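(* Let $\{G_i\}_{i\in I}$ be a collection of finite groups and let $P=\prod_{i\in I}G_i$ be the compact product group. Then $\mathrm{ZA}(P)$ is amenable if and only if all but finitely many of the groups $G_i$ are abelian.
   Context: For a compact group $G$, the Fourier algebra $\mathrm{A}(G)$ consists of the continuous functions $u$ with $\|u\|_{\mathrm A}=\sum_{\pi\in\widehat G}d_\pi\|\hat u(\pi)\|_1<\infty$, where $\hat u(\pi)=\int_G u(s)\bar\pi(s)\,ds$, $\widehat G$ is the set of equivalence classes of continuous irreducible representations, $d_\pi$ the dimension of $\pi$, and $\|\cdot\|_1$ is the trace norm; it is a Banach algebra under pointwise operations. The central Fourier algebra is $\mathrm{ZA}(G)=\{u\in \mathrm{A}(G): u(xyx^{-1})=u(y)\ \forall x,y\in G\}$. A Banach algebra $\mathcal{A}$ is amenable if every bounded derivation from $\mathcal{A}$ into any dual Banach $\mathcal{A}$-bimodule is inner; equivalently, if $\mathcal{A}$ has a bounded approximate diagonal. *)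

theory Defs
  imports
    "HOL-Probability.Probability"
    "HOL-Algebra.Algebra"
    "Jordan_Normal_Form.Schur_Decomposition"
begin

definition compact_group :: "('g, 'm) monoid_scheme \<Rightarrow> 'g topology \<Rightarrow> bool" where
  "compact_group G T \<longleftrightarrow>
     group G \<and> topspace T = carrier G \<and> compact_space T \<and> Hausdorff_space T \<and>
     continuous_map (prod_topology T T) T (\<lambda>(x, y). x \<otimes>\<^bsub>G\<^esub> y) \<and>
     continuous_map T T (\<lambda>x. inv\<^bsub>G\<^esub> x)"

text \<open>
  Haar measure is taken on the Baire sets, the \<open>\<sigma>\<close>-algebra generated by the continuous functions.
  On a compact group the invariant probability measure there is unique without any regularity
  condition, and it is the restriction of the Radon Haar measure on the Borel sets; only
  continuous functions are integrated below.
\<close>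

definition baire_algebra :: "'g topology \<Rightarrow> 'g measure" where
  "baire_algebra T =
     sigma (topspace T) {{x \<in> topspace T. f x > 0} | f :: 'g \<Rightarrow> real. continuous_map T euclidean f}"

definition is_haar_measure :: "('g, 'm) monoid_scheme \<Rightarrow> 'g topology \<Rightarrow> 'g measure \<Rightarrow> bool" where
  "is_haar_measure G T \<mu> \<longleftrightarrow>
     sets \<mu> = sets (baire_algebra T) \<and> prob_space \<mu> \<and>
     (\<forall>g \<in> carrier G. \<forall>E \<in> sets \<mu>.
        (\<lambda>x. g \<otimes>\<^bsub>G\<^esub> x) ` E \<in> sets \<mu> \<and> emeasure \<mu> ((\<lambda>x. g \<otimes>\<^bsub>G\<^esub> x) ` E) = emeasure \<mu> E)"

definition haar_measure :: "('g, 'm) monoid_scheme \<Rightarrow> 'g topology \<Rightarrow> 'g measure" where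
  "haar_measure G T = (THE \<mu>. is_haar_measure G T \<mu>)"

text \<open>
  Continuous irreducible representations of a compact group are finite-dimensional and
  unitarizable. As usual they are taken unitary, so that the trace norm of a Fourier coefficient
  depends only on the equivalence class.
\<close>

definition unitary_rep ::
    "('g, 'm) monoid_scheme \<Rightarrow> 'g topology \<Rightarrow> nat \<Rightarrow> ('g \<Rightarrow> complex mat) \<Rightarrow> bool" where
  "unitary_rep G T d \<pi> \<longleftrightarrow>
     (\<forall>x \<in> carrier G. \<pi> x \<in> carrier_mat d d \<and> mat_adjoint (\<pi> x) * \<pi> x = 1\<^sub>m d) \<and>
     (\<forall>x \<in> carrier G. \<forall>y \<in> carrier G. \<pi> (x \<otimes>\<^bsub>G\<^esub> y) = \<pi> x * \<pi> y) \<and>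
     (\<forall>j < d. \<forall>k < d. continuous_map T euclidean (\<lambda>x. \<pi> x $$ (j, k)))"

definition invariant_subspace ::
    "('g, 'm) monoid_scheme \<Rightarrow> nat \<Rightarrow> ('g \<Rightarrow> complex mat) \<Rightarrow> complex vec set \<Rightarrow> bool" where
  "invariant_subspace G d \<pi> W \<longleftrightarrow>
     W \<subseteq> carrier_vec d \<and> 0\<^sub>v d \<in> W \<and>
     (\<forall>v \<in> W. \<forall>w \<in> W. v + w \<in> W) \<and> (\<forall>c. \<forall>v \<in> W. c \<cdot>\<^sub>v v \<in> W) \<and>
     (\<forall>x \<in> carrier G. \<forall>v \<in> W. \<pi> x *\<^sub>v v \<in> W)"

definition irreps :: "('g, 'm) monoid_scheme \<Rightarrow> 'g topology \<Rightarrow> ('g \<Rightarrow> complex mat) set" where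
  "irreps G T =
     {\<pi>. \<exists>d > 0. unitary_rep G T d \<pi> \<and>
         (\<forall>W. invariant_subspace G d \<pi> W \<longrightarrow> W = {0\<^sub>v d} \<or> W = carrier_vec d)}"

definition rep_dim :: "('g, 'm) monoid_scheme \<Rightarrow> ('g \<Rightarrow> complex mat) \<Rightarrow> nat" where
  "rep_dim G \<pi> = dim_row (\<pi> \<one>\<^bsub>G\<^esub>)"

definition unitarily_equivalent ::
    "('g, 'm) monoid_scheme \<Rightarrow> ('g \<Rightarrow> complex mat) \<Rightarrow> ('g \<Rightarrow> complex mat) \<Rightarrow> bool" where
  "unitarily_equivalent G \<pi> \<rho> \<longleftrightarrow>
     rep_dim G \<pi> = rep_dim G \<rho> \<and>
     (\<exists>U \<in> carrier_mat (rep_dim G \<pi>) (rep_dim G \<pi>).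
        mat_adjoint U * U = 1\<^sub>m (rep_dim G \<pi>) \<and> (\<forall>x \<in> carrier G. \<rho> x * U = U * \<pi> x))"

definition dual_object :: "('g, 'm) monoid_scheme \<Rightarrow> 'g topology \<Rightarrow> ('g \<Rightarrow> complex mat) set set" where
  "dual_object G T =
     irreps G T // {(\<pi>, \<rho>). \<pi> \<in> irreps G T \<and> \<rho> \<in> irreps G T \<and> unitarily_equivalent G \<pi> \<rho>}"

text \<open>
  The sum of the singular values: these are the square roots of the eigenvalues of \<open>M\<^sup>* M\<close>, each
  counted with its multiplicity as a root of the characteristic polynomial.
\<close>

definition trace_norm :: "complex mat \<Rightarrow> real" where
  "trace_norm M =
     (\<Sum>z \<in> {z. poly (char_poly (mat_adjoint M * M)) z = 0}.
        real (Polynomial.order z (char_poly (mat_adjoint M * M))) * sqrt (Re z))"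

definition fourier_coeff ::
    "('g, 'm) monoid_scheme \<Rightarrow> 'g topology \<Rightarrow> ('g \<Rightarrow> complex) \<Rightarrow> ('g \<Rightarrow> complex mat) \<Rightarrow> complex mat" where
  "fourier_coeff G T u \<pi> =
     mat (rep_dim G \<pi>) (rep_dim G \<pi>)
       (\<lambda>(j, k). \<integral>s. u s * cnj (\<pi> s $$ (j, k)) \<partial>haar_measure G T)"

text \<open>The summand is constant on equivalence classes, so any representative may be chosen.\<close>

definition fourier_term ::
    "('g, 'm) monoid_scheme \<Rightarrow> 'g topology \<Rightarrow> ('g \<Rightarrow> complex) \<Rightarrow> ('g \<Rightarrow> complex mat) set \<Rightarrow> real" where
  "fourier_term G T u c =
     (let \<pi> = (SOME \<pi>. \<pi> \<in> c) in real (rep_dim G \<pi>) * trace_norm (fourier_coeff G T u \<pi>))"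

record 'v normed_alg = "(complex, 'v) module" +
  nrm :: "'v \<Rightarrow> real"

text \<open>
  A function on the group is represented by the function on the whole type that vanishes off the
  carrier, so that it is determined by its values on the group.
\<close>

definition fourier_algebra ::
    "('g, 'm) monoid_scheme \<Rightarrow> 'g topology \<Rightarrow> ('g \<Rightarrow> complex) normed_alg" where
  "fourier_algebra G T =
     \<lparr>carrier = {u. continuous_map T euclidean u \<and> (\<forall>x. x \<notin> carrier G \<longrightarrow> u x = 0) \<and>
                    fourier_term G T u summable_on dual_object G T},
      monoid.mult = (\<lambda>u v x. u x * v x),
      one = (\<lambda>x. if x \<in> carrier G then 1 else 0),
      ring.zero = (\<lambda>x. 0),
      ring.add = (\<lambda>u v x. u x + v x),
      module.smult = (\<lambda>c u x. c * u x),
      nrm = (\<lambda>u. \<Sum>\<^sub>\<infinity>c \<in> dual_object G T. fourier_term G T u c)\<rparr>"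

definition central_fourier_algebra ::
    "('g, 'm) monoid_scheme \<Rightarrow> 'g topology \<Rightarrow> ('g \<Rightarrow> complex) normed_alg" where
  "central_fourier_algebra G T =
     (fourier_algebra G T)
       \<lparr>carrier := {u \<in> carrier (fourier_algebra G T).
                     \<forall>x \<in> carrier G. \<forall>y \<in> carrier G. u (x \<otimes>\<^bsub>G\<^esub> y \<otimes>\<^bsub>G\<^esub> inv\<^bsub>G\<^esub> x) = u y}\<rparr>"

definition bounded_bilinear_forms :: "'v normed_alg \<Rightarrow> ('v \<Rightarrow> 'v \<Rightarrow> complex) set" where
  "bounded_bilinear_forms A =
     {B. (\<forall>a \<in> carrier A. \<forall>a' \<in> carrier A. \<forall>b \<in> carrier A.
             B (a \<oplus>\<^bsub>A\<^esub> a') b = B a b + B a' b \<and> B b (a \<oplus>\<^bsub>A\<^esub> a') = B b a + B b a') \<and>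
         (\<forall>c. \<forall>a \<in> carrier A. \<forall>b \<in> carrier A.
             B (c \<odot>\<^bsub>A\<^esub> a) b = c * B a b \<and> B a (c \<odot>\<^bsub>A\<^esub> b) = c * B a b) \<and>
         (\<exists>K. \<forall>a \<in> carrier A. \<forall>b \<in> carrier A. cmod (B a b) \<le> K * nrm A a * nrm A b)}"

text \<open>
  The completed projective tensor product \<open>A \<otimes> A\<close> consists of the sums \<open>\<Sum>n. a n \<otimes> b n\<close> of
  absolutely convergent series, and its norm is the infimum of \<open>\<Sum>n. \<parallel>a n\<parallel> * \<parallel>b n\<parallel>\<close> over all
  series with the given sum. Its dual is the space of bounded bilinear forms on \<open>A\<close>, so a tensor is
  encoded as the functional it induces on those forms (and by 0 elsewhere).
\<close>

type_synonym 'v tensor = "('v \<Rightarrow> 'v \<Rightarrow> complex) \<Rightarrow> complex"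

definition tensor_series ::
    "'v normed_alg \<Rightarrow> (nat \<Rightarrow> 'v) \<Rightarrow> (nat \<Rightarrow> 'v) \<Rightarrow> 'v tensor \<Rightarrow> bool" where
  "tensor_series A a b m \<longleftrightarrow>
     (\<forall>n. a n \<in> carrier A \<and> b n \<in> carrier A) \<and>
     summable (\<lambda>n. nrm A (a n) * nrm A (b n)) \<and>
     m = (\<lambda>B. if B \<in> bounded_bilinear_forms A then suminf (\<lambda>n. B (a n) (b n)) else 0)"

definition proj_tensor :: "'v normed_alg \<Rightarrow> 'v tensor set" where
  "proj_tensor A = {m. \<exists>a b. tensor_series A a b m}"

definition proj_norm :: "'v normed_alg \<Rightarrow> 'v tensor \<Rightarrow> real" where
  "proj_norm A m = Inf {suminf (\<lambda>n. nrm A (a n) * nrm A (b n)) | a b. tensor_series A a b m}"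

text \<open>The bimodule actions \<open>x \<cdot> (a \<otimes> b) = (x a) \<otimes> b\<close> and \<open>(a \<otimes> b) \<cdot> x = a \<otimes> (b x)\<close>.\<close>

definition tensor_lact :: "'v normed_alg \<Rightarrow> 'v \<Rightarrow> 'v tensor \<Rightarrow> 'v tensor" where
  "tensor_lact A x m =
     (\<lambda>B. if B \<in> bounded_bilinear_forms A then m (\<lambda>a b. B (x \<otimes>\<^bsub>A\<^esub> a) b) else 0)"

definition tensor_ract :: "'v normed_alg \<Rightarrow> 'v tensor \<Rightarrow> 'v \<Rightarrow> 'v tensor" where
  "tensor_ract A m x =
     (\<lambda>B. if B \<in> bounded_bilinear_forms A then m (\<lambda>a b. B a (b \<otimes>\<^bsub>A\<^esub> x)) else 0)"

text \<open>
  The multiplication map \<open>a \<otimes> b \<mapsto> a b\<close>. In a Banach algebra the limit exists and depends only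
  on the tensor, not on the series.
\<close>

definition tensor_mult :: "'v normed_alg \<Rightarrow> 'v tensor \<Rightarrow> 'v" where
  "tensor_mult A m =
     (THE v. v \<in> carrier A \<and>
        (\<exists>a b. tensor_series A a b m \<and>
          (\<lambda>n. nrm A ((\<Oplus>\<^bsub>A\<^esub>k \<in> {..<n}. a k \<otimes>\<^bsub>A\<^esub> b k) \<ominus>\<^bsub>A\<^esub> v)) \<longlonglongrightarrow> 0))"

text \<open>
  Nets are rendered as proper filters: a net gives its filter of tails, and conversely every proper
  filter on the tensors is the filter of tails of some net of tensors.
\<close>

definition bounded_approximate_diagonal :: "'v normed_alg \<Rightarrow> 'v tensor filter \<Rightarrow> bool" where
  "bounded_approximate_diagonal A F \<longleftrightarrow>
     F \<noteq> bot \<and>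
     (\<exists>C. \<forall>\<^sub>F m in F. m \<in> proj_tensor A \<and> proj_norm A m \<le> C) \<and>
     (\<forall>x \<in> carrier A.
        ((\<lambda>m. proj_norm A (\<lambda>B. tensor_lact A x m B - tensor_ract A m x B)) \<longlongrightarrow> 0) F \<and>
        ((\<lambda>m. nrm A (x \<otimes>\<^bsub>A\<^esub> tensor_mult A m \<ominus>\<^bsub>A\<^esub> x)) \<longlongrightarrow> 0) F)"

definition amenable :: "'v normed_alg \<Rightarrow> bool" where
  "amenable A \<longleftrightarrow> (\<exists>F. bounded_approximate_diagonal A F)"

abbreviation product_group_topology :: "'i set \<Rightarrow> ('i \<Rightarrow> ('a, 'm) monoid_scheme) \<Rightarrow> ('i \<Rightarrow> 'a) topology"
  where "product_group_topology I G \<equiv> product_topology (\<lambda>i. discrete_topology (carrier (G i))) I"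

lemma compact_group_product_group:
  assumes grp: "\<And>i. i \<in> I \<Longrightarrow> group (G i)" and fin: "\<And>i. i \<in> I \<Longrightarrow> finite (carrier (G i))"
  shows "compact_group (product_group I G) (product_group_topology I G)"
proof -
  let ?T = "product_group_topology I G"
  have top: "topspace ?T = carrier (product_group I G)"
    by simp
  have proj: "continuous_map ?T (discrete_topology (carrier (G i))) (\<lambda>x. x i)" if "i \<in> I" for i
    using that by (rule continuous_map_product_projection)
  have "continuous_map (prod_topology ?T ?T) ?T (\<lambda>(x, y). x \<otimes>\<^bsub>product_group I G\<^esub> y)"
  proof -
    have "continuous_map (prod_topology ?T ?T) (discrete_topology (carrier (G i)))
            (\<lambda>p. fst p i \<otimes>\<^bsub>G i\<^esub> snd p i)" if i: "i \<in> I" for i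
    proof -
      let ?D = "discrete_topology (carrier (G i))"
      have "continuous_map (prod_topology ?T ?T) (prod_topology ?D ?D) (\<lambda>p. (fst p i, snd p i))"
        using continuous_map_compose[OF continuous_map_fst proj[OF i], of ?T]
              continuous_map_compose[OF continuous_map_snd proj[OF i], of ?T]
        by (intro continuous_map_pairedI) (simp_all add: o_def)
      moreover have "continuous_map (prod_topology ?D ?D) ?D (\<lambda>p. fst p \<otimes>\<^bsub>G i\<^esub> snd p)"
        using grp[OF i] by (auto simp: prod_topology_discrete_topology[symmetric]
            intro!: group.is_monoid monoid.m_closed)
      ultimately show ?thesis
        using continuous_map_compose[of "prod_topology ?T ?T" "prod_topology ?D ?D"
            "\<lambda>p. (fst p i, snd p i)" ?D "\<lambda>p. fst p \<otimes>\<^bsub>G i\<^esub> snd p"]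
        by (simp add: o_def)
    qed
    then show ?thesis
      by (auto simp: continuous_map_componentwise case_prod_beta)
  qed
  moreover have "continuous_map ?T ?T (\<lambda>x. inv\<^bsub>product_group I G\<^esub> x)"
  proof -
    have "continuous_map ?T (discrete_topology (carrier (G i))) (\<lambda>x. inv\<^bsub>G i\<^esub> (x i))"
      if i: "i \<in> I" for i
    proof -
      have "continuous_map (discrete_topology (carrier (G i))) (discrete_topology (carrier (G i)))
              (\<lambda>a. inv\<^bsub>G i\<^esub> a)"
        using grp[OF i] by (auto intro: group.inv_closed)
      then show ?thesis
        using continuous_map_compose[OF proj[OF i], of "discrete_topology (carrier (G i))" "m_inv (G i)"]
        by (simp add: o_def)
    qed
    then have "continuous_map ?T ?T (\<lambda>x. \<lambda>i\<in>I. inv\<^bsub>G i\<^esub> (x i))"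
      by (auto simp: continuous_map_componentwise)
    then show ?thesis
      by (rule continuous_map_eq) (use grp in \<open>auto simp: inv_product_group\<close>)
  qed
  ultimately show ?thesis
    unfolding compact_group_def
    using grp fin by (auto simp: top compact_space_product_topology Hausdorff_space_product_topology
        compact_space_discrete_topology)
qed

end

theory Submission
  imports Defs "Jordan_Normal_Form.Spectral_Radius"
begin

text \<open>For a class function \<open>u = \<Sum>\<^sub>\<pi> a\<^sub>\<pi> \<chi>\<^sub>\<pi>\<close> the norm is \<open>\<Sum>\<^sub>\<pi> d\<^sub>\<pi> \<bar>a\<^sub>\<pi>\<bar>\<close>, so functionals
  are bounded through their values on the characters.

  Suppose infinitely many factors are non-abelian. For non-commuting \<open>a\<close>, \<open>g\<close> in such a factor put
  \<open>b = a\<^sup>-\<^sup>1\<close> and \<open>c = g b g\<^sup>-\<^sup>1\<close>. In the pairs \<open>(1, 1)\<close>, \<open>(a, a)\<close>, \<open>(b, c)\<close> the two entries are conjugate, in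
  \<open>(a b, a c)\<close> they are not. Summing over these pairs with signs \<open>+, +, +, -\<close> in each of \<open>n\<close> factors
  gives a functional with value \<open>3\<^sup>n\<close> on the limit of an approximate diagonal, whereas on products of
  characters it is bounded by \<open>(2 sqrt 2)\<^sup>n\<close>. So the diagonal has norm at least \<open>(3 / (2 sqrt 2))\<^sup>n\<close>
  for every \<open>n\<close>.

  If only finitely many factors are non-abelian, the sums \<open>\<Sum>\<^sub>C 1\<^sub>C \<otimes> 1\<^sub>C\<close> over the classes \<open>C\<close> of a finite
  subproduct form an approximate diagonal. The characters of the abelian part give them a second
  expansion, which shows that their norms are bounded by \<open>\<Sum>\<^sub>C \<parallel>1\<^sub>C\<parallel>\<^sup>2\<close>, where \<open>C\<close> runs only over the
  classes of the non-abelian part.\<close>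

section \<open>Complex matrices\<close>

unbundle no vec_syntax

text \<open>The combination \<open>1 + A + B - A * B\<close> is that of the CHSH inequality, and
  \<open>2 * sqrt 2\<close> is its Tsirelson bound. It holds for all unitary \<open>A\<close> and
  \<open>B\<close>, commuting or not, so it does not depend on the group. This uniformity is what
  counts: the non-abelian factors may be pairwise different, and their gaps are multiplied. The
  bound is proved for coefficients of Kronecker products of arbitrary representations of the whole
  product group, so its irreducible representations never have to be described through those of the
  factors.

  A bound on characters says something about the algebra only if a class function is determined by
  its Fourier coefficients. This part of the Peter-Weyl theorem is obtained from the finite
  subproducts: the regular representation of a subproduct has a multiple of a cylinder indicator as
  its character. Convolution with it therefore averages over a small neighbourhood and at the same
  time yields a finite combination of irreducible characters.\<close>

lemma dim_row_mat_adjoint [simp]: "dim_row (mat_adjoint A) = dim_col A"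
  and dim_col_mat_adjoint [simp]: "dim_col (mat_adjoint A) = dim_row A"
  by (simp_all add: mat_adjoint_def)

lemma mat_adjoint_carrier [simp]: "A \<in> carrier_mat n m \<Longrightarrow> mat_adjoint A \<in> carrier_mat m n"
  by (intro carrier_matI) (auto dest: carrier_matD)

lemma index_mat_adjoint [simp]:
  fixes A :: "complex mat"
  assumes "i < dim_col A" "j < dim_row A"
  shows "mat_adjoint A $$ (i, j) = cnj (A $$ (j, i))"
  using assms by (simp add: mat_adjoint_def mat_of_rows_def)

lemma mat_adjoint_adjoint [simp]: "mat_adjoint (mat_adjoint A) = (A :: complex mat)"
  by (rule eq_matI) auto

lemma mat_adjoint_one [simp]: "mat_adjoint (1\<^sub>m n) = (1\<^sub>m n :: complex mat)"
  by (rule eq_matI) auto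

lemma mat_adjoint_mult:
  fixes A B :: "complex mat"
  assumes "A \<in> carrier_mat n m" "B \<in> carrier_mat m p"
  shows "mat_adjoint (A * B) = mat_adjoint B * mat_adjoint A"
  using assms by (intro eq_matI) (auto simp: scalar_prod_def mult.commute)

lemma index_mult_mat_sum:
  assumes "A \<in> carrier_mat n m" "B \<in> carrier_mat m p" "i < n" "j < p"
  shows "(A * B) $$ (i, j) = (\<Sum>k<m. A $$ (i, k) * B $$ (k, j))"
  using assms by (simp add: scalar_prod_def lessThan_atLeast0)

lemma isometry_cancel:
  fixes V :: "complex mat"
  assumes "V \<in> carrier_mat d r" "mat_adjoint V * V = 1\<^sub>m r" "A \<in> carrier_mat r n"
  shows "mat_adjoint V * (V * A) = A"
  using assms assoc_mult_mat[of "mat_adjoint V" r d V r A n] by simp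

lemma isometry_cancel_vec:
  fixes V :: "complex mat"
  assumes "V \<in> carrier_mat d r" "mat_adjoint V * V = 1\<^sub>m r" "v \<in> carrier_vec r"
  shows "mat_adjoint V *\<^sub>v (V *\<^sub>v v) = v"
  using assms assoc_mult_mat_vec[of "mat_adjoint V" r d V r v] by simp

lemma unitary_right:
  fixes U :: "complex mat"
  assumes "U \<in> carrier_mat n n" "mat_adjoint U * U = 1\<^sub>m n"
  shows "U * mat_adjoint U = 1\<^sub>m n"
  using assms mat_mult_left_right_inverse mat_adjoint_carrier by blast

definition mtrace :: "complex mat \<Rightarrow> complex" where
  "mtrace A = (\<Sum>i<dim_row A. A $$ (i, i))"

lemma mtrace_comm:
  assumes "A \<in> carrier_mat n m" "B \<in> carrier_mat m n"
  shows "mtrace (A * B) = mtrace (B * A)"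
proof -
  have "mtrace (A * B) = (\<Sum>i<n. \<Sum>k<m. A $$ (i, k) * B $$ (k, i))"
    unfolding mtrace_def using assms by (auto intro!: sum.cong simp: index_mult_mat_sum[OF assms] simp del: index_mult_mat(1))
  also have "\<dots> = (\<Sum>k<m. \<Sum>i<n. B $$ (k, i) * A $$ (i, k))"
    by (subst sum.swap) (simp add: mult.commute)
  also have "\<dots> = mtrace (B * A)"
    unfolding mtrace_def using assms by (auto intro!: sum.cong simp: index_mult_mat_sum[OF assms(2,1)] simp del: index_mult_mat(1))
  finally show ?thesis .
qed

lemma mtrace_add:
  "A \<in> carrier_mat n n \<Longrightarrow> B \<in> carrier_mat n n \<Longrightarrow> mtrace (A + B) = mtrace A + mtrace B"
  by (simp add: mtrace_def sum.distrib)

lemma mtrace_smult: "A \<in> carrier_mat n n \<Longrightarrow> mtrace (c \<cdot>\<^sub>m A) = c * mtrace A"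
  by (simp add: mtrace_def sum_distrib_left)

lemma mtrace_one [simp]: "mtrace (1\<^sub>m n) = of_nat n"
  by (simp add: mtrace_def)

lemma mtrace_adjoint: "A \<in> carrier_mat n n \<Longrightarrow> mtrace (mat_adjoint A) = cnj (mtrace A)"
  by (simp add: mtrace_def)

lemma cmod_square_sum_adjoint:
  assumes "A \<in> carrier_mat n m" "j < m"
  shows "(mat_adjoint A * A) $$ (j, j) = complex_of_real (\<Sum>i<n. (cmod (A $$ (i, j)))\<^sup>2)"
proof -
  have "(mat_adjoint A * A) $$ (j, j) = (\<Sum>i<n. cnj (A $$ (i, j)) * A $$ (i, j))"
    using assms by (subst index_mult_mat_sum[of _ m n _ m]) auto
  also have "\<dots> = complex_of_real (\<Sum>i<n. (cmod (A $$ (i, j)))\<^sup>2)"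
    by (simp add: complex_norm_square mult.commute del: of_real_power)
  finally show ?thesis .
qed

text \<open>The trace of \<open>mat_adjoint A * A\<close> is the square of the Hilbert-Schmidt norm
  of \<open>A\<close>.\<close>

lemma mtrace_adjoint_self_eq_0:
  assumes "A \<in> carrier_mat n m" "mtrace (mat_adjoint A * A) = 0"
  shows "A = 0\<^sub>m n m"
proof -
  have "mtrace (mat_adjoint A * A) = complex_of_real (\<Sum>j<m. \<Sum>i<n. (cmod (A $$ (i, j)))\<^sup>2)"
    unfolding mtrace_def of_real_sum[where f = "\<lambda>j. \<Sum>i<n. (cmod (A $$ (i, j)))\<^sup>2"] using assms(1)
    by (intro sum.cong) (auto simp: cmod_square_sum_adjoint[OF assms(1)] simp del: index_mult_mat(1))
  then have "(\<Sum>j<m. \<Sum>i<n. (cmod (A $$ (i, j)))\<^sup>2) = 0"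
    unfolding assms(2) by (intro of_real_eq_0_iff[where 'a = complex, THEN iffD1] sym[of 0])
  then have "\<forall>j<m. \<forall>i<n. A $$ (i, j) = 0"
    by (simp add: sum_nonneg_eq_0_iff sum_nonneg)
  then show ?thesis using assms(1) by (intro eq_matI) auto
qed

lemma mtrace_adjoint_self_Re:
  assumes "A \<in> carrier_mat n m"
  shows "mtrace (mat_adjoint A * A) = complex_of_real (Re (mtrace (mat_adjoint A * A)))"
    "Re (mtrace (mat_adjoint A * A)) \<ge> 0"
proof -
  have *: "mtrace (mat_adjoint A * A) = complex_of_real (\<Sum>j<m. \<Sum>i<n. (cmod (A $$ (i, j)))\<^sup>2)"
    unfolding mtrace_def of_real_sum using assms(1)
    by (intro sum.cong) (auto simp: cmod_square_sum_adjoint[OF assms(1)] simp del: index_mult_mat(1))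
  show "mtrace (mat_adjoint A * A) = complex_of_real (Re (mtrace (mat_adjoint A * A)))"
    unfolding * by simp
  show "Re (mtrace (mat_adjoint A * A)) \<ge> 0"
    unfolding * by (simp add: sum_nonneg)
qed

text \<open>The only trace norm that has to be evaluated: by Schur's lemma the Fourier coefficients
  of class functions are scalar matrices. Here the characteristic polynomial of
  \<open>mat_adjoint M * M\<close> is a power of one linear factor.\<close>

lemma trace_norm_smult_one: "trace_norm (c \<cdot>\<^sub>m 1\<^sub>m d) = real d * cmod c"
proof -
  define a :: complex where "a = complex_of_real ((cmod c)\<^sup>2)"
  have eq: "mat_adjoint (c \<cdot>\<^sub>m 1\<^sub>m d) * (c \<cdot>\<^sub>m 1\<^sub>m d) = a \<cdot>\<^sub>m 1\<^sub>m d"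
  proof -
    have "mat_adjoint (c \<cdot>\<^sub>m 1\<^sub>m d) = cnj c \<cdot>\<^sub>m 1\<^sub>m d" by (rule eq_matI) auto
    then show ?thesis
      by (auto simp: a_def complex_norm_square mult_smult_assoc_mat[of _ d d _ d] mult.commute simp del: of_real_power intro!: eq_matI)
  qed
  have "char_poly (a \<cdot>\<^sub>m 1\<^sub>m d) = (\<Prod>x\<leftarrow>diag_mat (a \<cdot>\<^sub>m 1\<^sub>m d). [:- x, 1:])"
    by (rule char_poly_upper_triangular[of _ d]) auto
  also have "diag_mat (a \<cdot>\<^sub>m 1\<^sub>m d) = replicate d a"
    by (rule nth_equalityI) (auto simp: diag_mat_def)
  finally have cp: "char_poly (a \<cdot>\<^sub>m 1\<^sub>m d) = [:- a, 1:] ^ d" by simp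
  have "{z. poly ([:- a, 1:] ^ d) z = 0} = (if d = 0 then {} else {a})" by auto
  then have "trace_norm (c \<cdot>\<^sub>m 1\<^sub>m d) = real (Polynomial.order a ([:- a, 1:] ^ d)) * sqrt (Re a)"
    unfolding trace_norm_def eq cp by simp
  then show ?thesis unfolding order_power_n_n by (simp add: a_def)
qed

subsection \<open>Kronecker product\<close>

text \<open>An index pair \<open>(i, j)\<close> with \<open>j < m\<close> is coded as the number
  \<open>i * m + j\<close>; \<open>div\<close> and \<open>mod\<close> decode it.\<close>

definition kron :: "complex mat \<Rightarrow> complex mat \<Rightarrow> complex mat" where
  "kron A B = mat (dim_row A * dim_row B) (dim_col A * dim_col B)
     (\<lambda>(i, j). A $$ (i div dim_row B, j div dim_col B) * B $$ (i mod dim_row B, j mod dim_col B))"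

lemma sum_div_mod:
  fixes f :: "nat \<Rightarrow> nat \<Rightarrow> 'a :: comm_monoid_add"
  shows "(\<Sum>k<n * m. f (k div m) (k mod m)) = (\<Sum>i<n. \<Sum>j<m. f i j)"
proof -
  have "(\<Sum>k<n * m. f (k div m) (k mod m)) = (\<Sum>i<n. \<Sum>k=i*m..<i*m+m. f (k div m) (k mod m))"
    by (rule sum.nat_group[symmetric])
  also have "\<dots> = (\<Sum>i<n. \<Sum>j<m. f i j)"
  proof (rule sum.cong[OF refl])
    fix i
    have "(\<Sum>k=i*m..<i*m+m. f (k div m) (k mod m)) = (\<Sum>j=0..<m. f ((j + i*m) div m) ((j + i*m) mod m))"
      using sum.shift_bounds_nat_ivl[of "\<lambda>k. f (k div m) (k mod m)" 0 "i*m" m] by (simp add: add.commute)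
    also have "\<dots> = (\<Sum>j<m. f i j)"
      by (rule sum.cong) auto
    finally show "(\<Sum>k=i*m..<i*m+m. f (k div m) (k mod m)) = (\<Sum>j<m. f i j)" .
  qed
  finally show ?thesis .
qed

lemma div_mod_bounds: "(i::nat) < n * m \<Longrightarrow> i div m < n \<and> i mod m < m"
  by (metis less_mult_imp_div_less mod_less_divisor mult_0_right not_less_zero gr0I)

lemma kron_carrier [simp]:
  "A \<in> carrier_mat n n \<Longrightarrow> B \<in> carrier_mat m m \<Longrightarrow> kron A B \<in> carrier_mat (n * m) (n * m)"
  by (intro carrier_matI) (auto simp: kron_def dest: carrier_matD)

lemma kron_mult:
  assumes "A \<in> carrier_mat n n" "B \<in> carrier_mat m m" "C \<in> carrier_mat n n" "D \<in> carrier_mat m m"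
  shows "kron A B * kron C D = kron (A * C) (B * D)"
proof (rule eq_matI)
  show "dim_row (kron A B * kron C D) = dim_row (kron (A * C) (B * D))"
    "dim_col (kron A B * kron C D) = dim_col (kron (A * C) (B * D))"
    using assms by (simp_all add: kron_def)
  fix i j assume "i < dim_row (kron (A * C) (B * D))" "j < dim_col (kron (A * C) (B * D))"
  then have ij: "i < n * m" "j < n * m" using assms by (auto simp: kron_def)
  note b = div_mod_bounds[OF ij(1)] div_mod_bounds[OF ij(2)]
  have "(kron A B * kron C D) $$ (i, j) = (\<Sum>k<n * m. kron A B $$ (i, k) * kron C D $$ (k, j))"
    using assms ij by (intro index_mult_mat_sum[where p = "n * m"]) auto
  also have "\<dots> = (\<Sum>k<n * m. (A $$ (i div m, k div m) * C $$ (k div m, j div m)) *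
      (B $$ (i mod m, k mod m) * D $$ (k mod m, j mod m)))"
    using assms ij by (intro sum.cong) (auto simp: kron_def)
  also have "\<dots> = (\<Sum>k<n. A $$ (i div m, k) * C $$ (k, j div m)) * (\<Sum>l<m. B $$ (i mod m, l) * D $$ (l, j mod m))"
    by (subst sum_div_mod[where f = "\<lambda>k l. A $$ (i div m, k) * C $$ (k, j div m) * (B $$ (i mod m, l) * D $$ (l, j mod m))"])
       (simp add: sum_product)
  also have "\<dots> = (A * C) $$ (i div m, j div m) * (B * D) $$ (i mod m, j mod m)"
    using b index_mult_mat_sum[OF assms(1,3)] index_mult_mat_sum[OF assms(2,4)] by simp
  also have "\<dots> = kron (A * C) (B * D) $$ (i, j)"
    using assms ij by (simp add: kron_def)
  finally show "(kron A B * kron C D) $$ (i, j) = kron (A * C) (B * D) $$ (i, j)" .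
qed

lemma kron_one: "kron (1\<^sub>m n) (1\<^sub>m m) = 1\<^sub>m (n * m)"
proof (rule eq_matI)
  fix i j assume "i < dim_row (1\<^sub>m (n * m) :: complex mat)" "j < dim_col (1\<^sub>m (n * m) :: complex mat)"
  then have ij: "i < n * m" "j < n * m" by auto
  have "i = j \<longleftrightarrow> i div m = j div m \<and> i mod m = j mod m" by (metis div_mult_mod_eq)
  then show "kron (1\<^sub>m n) (1\<^sub>m m) $$ (i, j) = (1\<^sub>m (n * m) :: complex mat) $$ (i, j)"
    using ij div_mod_bounds[OF ij(1)] div_mod_bounds[OF ij(2)] by (auto simp: kron_def)
qed (auto simp: kron_def)

lemma kron_adjoint:
  assumes "A \<in> carrier_mat n n" "B \<in> carrier_mat m m"
  shows "mat_adjoint (kron A B) = kron (mat_adjoint A) (mat_adjoint B)"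
  using assms by (intro eq_matI) (auto simp: kron_def div_mod_bounds)

lemma mtrace_kron:
  assumes "A \<in> carrier_mat n n" "B \<in> carrier_mat m m"
  shows "mtrace (kron A B) = mtrace A * mtrace B"
proof -
  have "mtrace (kron A B) = (\<Sum>k<n * m. A $$ (k div m, k div m) * B $$ (k mod m, k mod m))"
    using assms by (auto simp: mtrace_def kron_def)
  also have "\<dots> = mtrace A * mtrace B"
    using assms by (subst sum_div_mod[where f = "\<lambda>i j. A $$ (i, i) * B $$ (j, j)"])
      (auto simp: mtrace_def sum_product)
  finally show ?thesis .
qed

subsection \<open>The Euclidean norm\<close>

definition vnorm :: "complex vec \<Rightarrow> real" where
  "vnorm v = L2_set (\<lambda>i. cmod (v $ i)) {..<dim_vec v}"

lemma vnorm_nonneg [simp]: "vnorm v \<ge> 0"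
  by (simp add: vnorm_def L2_set_nonneg)

lemma vnorm_square: "complex_of_real ((vnorm v)\<^sup>2) = v \<bullet>c v"
proof -
  have "complex_of_real ((vnorm v)\<^sup>2) = (\<Sum>i<dim_vec v. complex_of_real ((cmod (v $ i))\<^sup>2))"
    by (simp add: vnorm_def L2_set_def sum_nonneg)
  also have "\<dots> = v \<bullet>c v"
    by (simp add: scalar_prod_def lessThan_atLeast0 complex_norm_square del: of_real_power)
  finally show ?thesis .
qed

lemma vnorm_triangle:
  assumes "v \<in> carrier_vec n" "w \<in> carrier_vec n"
  shows "vnorm (v + w) \<le> vnorm v + vnorm w"
proof -
  have "vnorm (v + w) \<le> L2_set (\<lambda>i. cmod (v $ i) + cmod (w $ i)) {..<n}"
    unfolding vnorm_def using assms by (auto intro!: L2_set_mono norm_triangle_ineq)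
  also have "\<dots> \<le> L2_set (\<lambda>i. cmod (v $ i)) {..<n} + L2_set (\<lambda>i. cmod (w $ i)) {..<n}"
    by (rule L2_set_triangle_ineq)
  finally show ?thesis using assms by (simp add: vnorm_def)
qed

lemma vnorm_parallelogram:
  assumes "v \<in> carrier_vec n" "w \<in> carrier_vec n"
  shows "(vnorm (v + w))\<^sup>2 + (vnorm (v - w))\<^sup>2 = 2 * (vnorm v)\<^sup>2 + 2 * (vnorm w)\<^sup>2"
proof -
  have "(cmod (a + b))\<^sup>2 + (cmod (a - b))\<^sup>2 = 2 * (cmod a)\<^sup>2 + 2 * (cmod b)\<^sup>2" for a b
    unfolding cmod_power2 by (simp add: power2_eq_square algebra_simps)
  then have "(\<Sum>i<n. (cmod (v $ i + w $ i))\<^sup>2 + (cmod (v $ i - w $ i))\<^sup>2)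
      = (\<Sum>i<n. 2 * (cmod (v $ i))\<^sup>2 + 2 * (cmod (w $ i))\<^sup>2)" by simp
  then show ?thesis
    using assms by (simp add: vnorm_def L2_set_def sum_nonneg sum.distrib sum_distrib_left)
qed

lemma vnorm_component: "i < dim_vec v \<Longrightarrow> cmod (v $ i) \<le> vnorm v"
  unfolding vnorm_def using member_le_L2_set[of "{..<dim_vec v}" i "\<lambda>i. cmod (v $ i)"] by auto

lemma adjoint_scalar_prod:
  fixes A :: "complex mat"
  assumes "A \<in> carrier_mat n m" "v \<in> carrier_vec m" "w \<in> carrier_vec n"
  shows "(A *\<^sub>v v) \<bullet>c w = v \<bullet>c (mat_adjoint A *\<^sub>v w)"
proof -
  have "(A *\<^sub>v v) \<bullet>c w = (\<Sum>i<n. \<Sum>k<m. A $$ (i, k) * v $ k * cnj (w $ i))"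
    using assms
    by (auto simp: scalar_prod_def lessThan_atLeast0 sum_distrib_right)
  also have "\<dots> = (\<Sum>k<m. \<Sum>i<n. A $$ (i, k) * v $ k * cnj (w $ i))"
    by (rule sum.swap)
  also have "\<dots> = v \<bullet>c (mat_adjoint A *\<^sub>v w)"
    using assms
    by (auto simp: scalar_prod_def lessThan_atLeast0 sum_distrib_left ac_simps intro!: sum.cong)
  finally show ?thesis .
qed

lemma vnorm_unitary:
  assumes "A \<in> carrier_mat n n" "mat_adjoint A * A = 1\<^sub>m n" "v \<in> carrier_vec n"
  shows "vnorm (A *\<^sub>v v) = vnorm v"
proof -
  have "mat_adjoint A *\<^sub>v (A *\<^sub>v v) = v"
    by (rule isometry_cancel_vec[OF assms])
  then have "(A *\<^sub>v v) \<bullet>c (A *\<^sub>v v) = v \<bullet>c v"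
    using assms adjoint_scalar_prod[OF assms(1,3), of "A *\<^sub>v v"] by (metis mult_mat_vec_carrier)
  then have "(vnorm (A *\<^sub>v v))\<^sup>2 = (vnorm v)\<^sup>2"
    using vnorm_square by (metis of_real_eq_iff)
  then show ?thesis by simp
qed

text \<open>The operator norm behind the gap: \<open>(1 + A) v + (1 - A) B v\<close> is bounded by
  \<open>\<parallel>v + B v\<parallel> + \<parallel>v - B v\<parallel>\<close>, so the constant is \<open>2 \<surd>2\<close> rather than the trivial 4.\<close>

lemma vnorm_gap:
  assumes A: "A \<in> carrier_mat n n" "mat_adjoint A * A = 1\<^sub>m n"
    and B: "B \<in> carrier_mat n n" "mat_adjoint B * B = 1\<^sub>m n" and v: "v \<in> carrier_vec n"
  shows "vnorm (v + A *\<^sub>v v + B *\<^sub>v v - A *\<^sub>v (B *\<^sub>v v)) \<le> 2 * sqrt 2 * vnorm v"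
proof -
  define w where "w = B *\<^sub>v v"
  have w: "w \<in> carrier_vec n" "vnorm w = vnorm v"
    using assms by (auto simp: w_def vnorm_unitary)
  have "v + A *\<^sub>v v + w - A *\<^sub>v w = (v + w) + A *\<^sub>v (v - w)"
    using A v w by (subst mult_minus_distrib_mat_vec) (auto intro!: eq_vecI)
  then have "vnorm (v + A *\<^sub>v v + w - A *\<^sub>v w) \<le> vnorm (v + w) + vnorm (v - w)"
    using vnorm_triangle[of "v + w" n "A *\<^sub>v (v - w)"] vnorm_unitary[OF A, of "v - w"] A v w by simp
  \<comment> \<open>From \<open>2 * s * t \<le> s\<^sup>2 + t\<^sup>2\<close>; it puts the sum of
    norms into the form to which the parallelogram law applies.\<close>
  also have "\<dots> \<le> sqrt (2 * ((vnorm (v + w))\<^sup>2 + (vnorm (v - w))\<^sup>2))"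
    by (rule real_le_rsqrt) (use sum_squares_bound[of "vnorm (v + w)" "vnorm (v - w)"] in
      \<open>simp add: power2_sum\<close>)
  also have "\<dots> = sqrt (8 * (vnorm v)\<^sup>2)"
    using vnorm_parallelogram[OF v w(1)] w(2) by simp
  also have "\<dots> = 2 * sqrt 2 * vnorm v"
    by (simp add: real_sqrt_mult real_sqrt_unique[of "2 * sqrt 2"] power_mult_distrib)
  finally show ?thesis by (simp add: w_def)
qed

subsection \<open>Isometries onto subspaces\<close>

definition vec_subspace :: "nat \<Rightarrow> complex vec set \<Rightarrow> bool" where
  "vec_subspace d W \<longleftrightarrow> W \<subseteq> carrier_vec d \<and> 0\<^sub>v d \<in> W \<and>
     (\<forall>v \<in> W. \<forall>w \<in> W. v + w \<in> W) \<and> (\<forall>c. \<forall>v \<in> W. c \<cdot>\<^sub>v v \<in> W)"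

text \<open>\<open>V * mat_adjoint V\<close> is a projection, so its diagonal entries are at most 1
  and its trace is at most \<open>d\<close>; by cyclicity the trace equals \<open>r\<close>. This
  bounds the length of orthonormal lists without any theory of bases.\<close>

lemma isometry_dim_le:
  fixes V :: "complex mat"
  assumes V: "V \<in> carrier_mat d r" "mat_adjoint V * V = 1\<^sub>m r"
  shows "r \<le> d"
proof -
  define Q where "Q = V * mat_adjoint V"
  have Q: "Q \<in> carrier_mat d d" using V by (simp add: Q_def)
  have adj: "mat_adjoint Q = Q"
    using V by (simp add: Q_def mat_adjoint_mult[of _ d r _ d])
  have idem: "mat_adjoint Q * Q = Q"
    unfolding adj using V
    by (simp add: Q_def assoc_mult_mat[of V d r "mat_adjoint V" d "V * mat_adjoint V" d] isometry_cancel[OF V, of _ d])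
  have le: "Re (Q $$ (j, j)) \<le> 1" if j: "j < d" for j
  proof -
    have "Q $$ (j, j) = complex_of_real (\<Sum>i<d. (cmod (Q $$ (i, j)))\<^sup>2)"
      using cmod_square_sum_adjoint[OF Q j] idem by simp
    then have "Re (Q $$ (j, j)) = (\<Sum>i<d. (cmod (Q $$ (i, j)))\<^sup>2)" by simp
    also have "\<dots> \<ge> (cmod (Q $$ (j, j)))\<^sup>2"
      using j by (intro member_le_sum[of j "{..<d}" "\<lambda>i. (cmod (Q $$ (i, j)))\<^sup>2"]) auto
    finally have "(cmod (Q $$ (j, j)))\<^sup>2 \<le> Re (Q $$ (j, j))" .
    also have "\<dots> \<le> cmod (Q $$ (j, j))" by (rule complex_Re_le_cmod)
    finally have "cmod (Q $$ (j, j)) \<le> 1"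
      by (cases "Q $$ (j, j) = 0") (auto simp: power2_eq_square)
    then show ?thesis using complex_Re_le_cmod order_trans by blast
  qed
  have "of_nat r = mtrace (mat_adjoint V * V)" using V by simp
  also have "\<dots> = mtrace Q" unfolding Q_def using V by (intro mtrace_comm[of _ r d]) auto
  finally have "real r = Re (mtrace Q)" by (metis Re_complex_of_real of_real_of_nat_eq)
  also have "\<dots> \<le> (\<Sum>j<d. 1)"
    unfolding mtrace_def Re_sum carrier_matD(1)[OF Q] using le by (intro sum_mono) auto
  finally show ?thesis by simp
qed

lemma subspace_mult_mat_vec:
  assumes W: "vec_subspace d W" and V: "V \<in> carrier_mat d r" "\<And>j. j < r \<Longrightarrow> col V j \<in> W"
    and a: "a \<in> carrier_vec r"
  shows "V *\<^sub>v a \<in> W"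
proof -
  have "vec d (\<lambda>i. \<Sum>j<k. V $$ (i, j) * a $ j) \<in> W" if "k \<le> r" for k
    using that
  proof (induction k)
    case 0
    have "vec d (\<lambda>i. \<Sum>j<0. V $$ (i, j) * a $ j) = 0\<^sub>v d" by auto
    then show ?case using W by (metis vec_subspace_def)
  next
    case (Suc k)
    have "vec d (\<lambda>i. \<Sum>j<Suc k. V $$ (i, j) * a $ j)
        = vec d (\<lambda>i. \<Sum>j<k. V $$ (i, j) * a $ j) + (a $ k) \<cdot>\<^sub>v col V k"
      using V Suc.prems by (intro eq_vecI) auto
    moreover have "(a $ k) \<cdot>\<^sub>v col V k \<in> W" using W V Suc.prems by (auto simp: vec_subspace_def)
    moreover have "vec d (\<lambda>i. \<Sum>j<k. V $$ (i, j) * a $ j) \<in> W"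
      using Suc by simp
    ultimately show ?case using W unfolding vec_subspace_def by simp
  qed
  moreover have "V *\<^sub>v a = vec d (\<lambda>i. \<Sum>j<r. V $$ (i, j) * a $ j)"
    using V a by (intro eq_vecI) (auto simp: scalar_prod_def lessThan_atLeast0)
  ultimately show ?thesis by simp
qed

text \<open>The columns of \<open>V\<close> are a longest orthonormal list in \<open>W\<close>. If
  some \<open>w\<close> were not reproduced by the projection, its normalised residual would extend
  the list. Subspaces are replaced by isometries because an isometry turns an invariant subspace
  into a matrix representation of smaller size.\<close>

lemma ex_isometry_onto_subspace:
  assumes W: "vec_subspace d W"
  obtains r V where "V \<in> carrier_mat d r" "mat_adjoint V * V = 1\<^sub>m r"
    "\<And>a. a \<in> carrier_vec r \<Longrightarrow> V *\<^sub>v a \<in> W"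
    "\<And>w. w \<in> W \<Longrightarrow> V *\<^sub>v (mat_adjoint V *\<^sub>v w) = w"
proof -
  define ok where "ok vs \<longleftrightarrow> set vs \<subseteq> W \<and>
      (\<forall>i<length vs. \<forall>j<length vs. vs ! i \<bullet>c vs ! j = (if i = j then 1 else 0))" for vs :: "complex vec list"
  have WC: "W \<subseteq> carrier_vec d" using W by (simp add: vec_subspace_def)
  have gram: "mat_adjoint (mat_of_cols d vs) * mat_of_cols d vs = 1\<^sub>m (length vs)" if "ok vs" for vs
  proof (rule eq_matI)
    fix i j assume "i < dim_row (1\<^sub>m (length vs) :: complex mat)" "j < dim_col (1\<^sub>m (length vs) :: complex mat)"
    then have ij: "i < length vs" "j < length vs" by auto
    then have d: "vs ! i \<in> carrier_vec d" "vs ! j \<in> carrier_vec d"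
      using that WC unfolding ok_def by (meson nth_mem subsetD)+
    have "(mat_adjoint (mat_of_cols d vs) * mat_of_cols d vs) $$ (i, j) = vs ! j \<bullet>c vs ! i"
      using ij d by (auto simp: scalar_prod_def mat_of_cols_index mult.commute intro!: sum.cong)
    then show "(mat_adjoint (mat_of_cols d vs) * mat_of_cols d vs) $$ (i, j) = 1\<^sub>m (length vs) $$ (i, j)"
      using that ij unfolding ok_def by auto
  qed auto
  have bound: "length vs \<le> d" if "ok vs" for vs
    using isometry_dim_le[OF _ gram[OF that]] by auto
  have "ok []" by (simp add: ok_def)
  then obtain vs where vs: "ok vs" and max: "\<And>ws. ok ws \<Longrightarrow> length ws \<le> length vs"
    using ex_has_greatest_nat[of ok "[]" length "Suc d"] bound by (metis less_Suc_eq_le)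
  define V where "V = mat_of_cols d vs"
  let ?r = "length vs"
  have V: "V \<in> carrier_mat d ?r" "mat_adjoint V * V = 1\<^sub>m ?r"
    using gram[OF vs] by (simp_all add: V_def)
  have colV: "col V j = vs ! j" if "j < ?r" for j
    using that vs WC unfolding V_def ok_def by (intro col_mat_of_cols) (meson nth_mem subsetD)+
  have VW: "V *\<^sub>v a \<in> W" if "a \<in> carrier_vec ?r" for a
    using vs that by (intro subspace_mult_mat_vec[OF W V(1)]) (auto simp: colV ok_def)
  have "V *\<^sub>v (mat_adjoint V *\<^sub>v w) = w" if w: "w \<in> W" for w
  proof (rule ccontr)
    assume ne: "V *\<^sub>v (mat_adjoint V *\<^sub>v w) \<noteq> w"
    have wd: "w \<in> carrier_vec d" using w WC by auto
    define p where "p = V *\<^sub>v (mat_adjoint V *\<^sub>v w)"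
    have aw: "mat_adjoint V *\<^sub>v w \<in> carrier_vec ?r"
      using V wd by (meson mat_adjoint_carrier mult_mat_vec_carrier)
    have p: "p \<in> W" "p \<in> carrier_vec d"
      using VW[OF aw] WC by (auto simp: p_def)
    \<comment> \<open>The residual of the projection, written as a sum with a scalar multiple
      because these are the operations under which \<open>W\<close> is closed.\<close>
    define z where "z = w + (-1) \<cdot>\<^sub>v p"
    have z: "z \<in> W" "z \<in> carrier_vec d" using p w W wd by (auto simp: z_def vec_subspace_def)
    have "z \<noteq> 0\<^sub>v d"
    proof
      assume "z = 0\<^sub>v d"
      then have "z $ i = 0" if "i < d" for i using that by simp
      then have "w $ i = p $ i" if "i < d" for i using that wd p by (simp add: z_def)
      then have "p = w" using wd p by (intro eq_vecI) auto
      then show False using ne by (simp add: p_def)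
    qed
    have "mat_adjoint V *\<^sub>v p = mat_adjoint V *\<^sub>v w"
      unfolding p_def by (rule isometry_cancel_vec[OF V aw])
    then have az: "mat_adjoint V *\<^sub>v z = 0\<^sub>v ?r"
      unfolding z_def using V wd p aw
      by (subst mult_add_distrib_mat_vec[of _ ?r d]) (auto simp: mult_mat_vec[of _ ?r d])
    have orth: "vs ! j \<bullet>c z = 0" if j: "j < ?r" for j
    proof -
      have "(mat_adjoint V *\<^sub>v z) $ j = z \<bullet>c (vs ! j)"
        using V z j colV[OF j] by (auto simp: scalar_prod_def mult.commute intro!: sum.cong simp flip: colV)
      then have "z \<bullet>c (vs ! j) = 0" using az j by simp
      moreover have "vs ! j \<in> carrier_vec d"
        using vs j WC unfolding ok_def by (meson nth_mem subsetD)
      ultimately show ?thesis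
        using z by (metis complex_cnj_zero conjugate_complex_def conjugate_conjugate_sprod conjugate_vec_sprod_comm)
    qed
    define n where "n = vnorm z"
    have zz: "z \<bullet>c z = complex_of_real (n\<^sup>2)" unfolding n_def vnorm_square ..
    have n0: "n \<noteq> 0"
    proof
      assume "n = 0"
      then have "z \<bullet>c z = 0" using zz by simp
      then show False using z \<open>z \<noteq> 0\<^sub>v d\<close> by simp
    qed
    define e where "e = complex_of_real (1 / n) \<cdot>\<^sub>v z"
    have e: "e \<in> W" "e \<in> carrier_vec d" using z W by (auto simp: e_def vec_subspace_def)
    have ce: "conjugate e = complex_of_real (1 / n) \<cdot>\<^sub>v conjugate z"
      by (simp add: e_def conjugate_smult_vec)
    have ee: "e \<bullet>c e = 1"
      using z zz n0 unfolding ce by (simp add: e_def power2_eq_square)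
    have vsd: "vs ! j \<in> carrier_vec d" if "j < ?r" for j
      using vs that WC unfolding ok_def by (meson nth_mem subsetD)
    have oe: "vs ! j \<bullet>c e = 0" if "j < ?r" for j
      unfolding ce using orth[OF that] vsd[OF that] z by simp
    have eo: "e \<bullet>c vs ! j = 0" if j: "j < ?r" for j
    proof -
      show ?thesis
        using vsd[OF j] oe[OF j] e by (metis complex_cnj_zero conjugate_complex_def conjugate_conjugate_sprod conjugate_vec_sprod_comm)
    qed
    have "ok (vs @ [e])"
      using vs e ee oe eo unfolding ok_def by (auto simp: nth_append less_Suc_eq)
    then show False using max by fastforce
  qed
  then show ?thesis using that V VW by blast
qed

section \<open>Unitary representations\<close>

lemma mat_adjoint_zero [simp]: "mat_adjoint (0\<^sub>m n m) = (0\<^sub>m m n :: complex mat)"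
  by (rule eq_matI) auto

lemma mat_eq_vecI:
  fixes A B :: "complex mat"
  assumes "A \<in> carrier_mat n m" "B \<in> carrier_mat n m" "\<And>v. v \<in> carrier_vec m \<Longrightarrow> A *\<^sub>v v = B *\<^sub>v v"
  shows "A = B"
proof (rule eq_matI)
  fix i j assume ij: "i < dim_row B" "j < dim_col B"
  have "(A *\<^sub>v unit_vec m j) $ i = (B *\<^sub>v unit_vec m j) $ i" by (simp add: assms(3))
  then show "A $$ (i, j) = B $$ (i, j)" using assms(1,2) ij by simp
qed (use assms in auto)

lemma continuous_map_normed_mult:
  fixes f g :: "'a \<Rightarrow> 'b :: real_normed_algebra"
  assumes "continuous_map M euclidean f" "continuous_map M euclidean g"
  shows "continuous_map M euclidean (\<lambda>x. f x * g x)"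
proof -
  have "continuous_map M euclidean (\<lambda>x. (f x, g x))"
    using continuous_map_pairedI[OF assms] by simp
  moreover have "continuous_map euclidean euclidean (\<lambda>p :: 'b \<times> 'b. fst p * snd p)"
    by (auto intro!: continuous_intros)
  ultimately have "continuous_map M euclidean ((\<lambda>p. fst p * snd p) \<circ> (\<lambda>x. (f x, g x)))"
    by (rule continuous_map_compose)
  then show ?thesis by (simp add: o_def)
qed

locale compact_grp =
  fixes G :: "('g, 'm) monoid_scheme" (structure) and T :: "'g topology"
  assumes compact_group: "compact_group G T"
begin

section \<open>Compact groups and elementary properties of unitary representations\<close>

lemma group: "group G" and topspace_eq: "topspace T = carrier G" and compact_space: "compact_space T"
  using compact_group by (simp_all add: compact_group_def)

sublocale group G by (rule group)

lemma continuous_mult_right: "g \<in> carrier G \<Longrightarrow> continuous_map T T (\<lambda>x. x \<otimes> g)"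
  and continuous_mult_left: "g \<in> carrier G \<Longrightarrow> continuous_map T T (\<lambda>x. g \<otimes> x)"
proof -
  assume g: "g \<in> carrier G"
  have *: "continuous_map (prod_topology T T) T (\<lambda>(x, y). x \<otimes> y)"
    using compact_group by (simp add: compact_group_def)
  have "continuous_map T (prod_topology T T) (\<lambda>x. (x, g))" "continuous_map T (prod_topology T T) (\<lambda>x. (g, x))"
    using g by (simp_all add: continuous_map_pairwise o_def topspace_eq)
  from this[THEN continuous_map_compose[OF _ *]]
  show "continuous_map T T (\<lambda>x. x \<otimes> g)" "continuous_map T T (\<lambda>x. g \<otimes> x)"
    by (simp_all add: o_def)
qed

lemma continuous_inv: "continuous_map T T (\<lambda>x. inv x)"
  using compact_group by (simp add: compact_group_def)

lemma unitary_repD: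
  assumes "unitary_rep G T d \<pi>" "x \<in> carrier G"
  shows "\<pi> x \<in> carrier_mat d d" "mat_adjoint (\<pi> x) * \<pi> x = 1\<^sub>m d" "\<pi> x * mat_adjoint (\<pi> x) = 1\<^sub>m d"
    "y \<in> carrier G \<Longrightarrow> \<pi> (x \<otimes> y) = \<pi> x * \<pi> y"
  using assms by (auto simp: unitary_rep_def intro: unitary_right)

lemma unitary_rep_dims:
  assumes "unitary_rep G T d \<pi>" "x \<in> carrier G"
  shows "dim_row (\<pi> x) = d" "dim_col (\<pi> x) = d"
  using unitary_repD(1)[OF assms] by auto

lemma unitary_rep_continuous:
  "unitary_rep G T d \<pi> \<Longrightarrow> j < d \<Longrightarrow> k < d \<Longrightarrow> continuous_map T euclidean (\<lambda>x. \<pi> x $$ (j, k))"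
  by (simp add: unitary_rep_def)

lemma unitary_rep_one:
  assumes \<pi>: "unitary_rep G T d \<pi>" shows "\<pi> \<one> = 1\<^sub>m d"
proof -
  note u = unitary_repD[OF \<pi> one_closed]
  have "\<pi> \<one> * \<pi> \<one> = \<pi> \<one>" using u(4)[of \<one>] by simp
  then have "mat_adjoint (\<pi> \<one>) * (\<pi> \<one> * \<pi> \<one>) = mat_adjoint (\<pi> \<one>) * \<pi> \<one>" by simp
  then show ?thesis using isometry_cancel[OF u(1,2,1)] u(2) by simp
qed

lemma unitary_rep_inv:
  assumes \<pi>: "unitary_rep G T d \<pi>" and x: "x \<in> carrier G"
  shows "\<pi> (inv x) = mat_adjoint (\<pi> x)"
proof -
  note u = unitary_repD[OF \<pi> x]
  have "\<pi> x * \<pi> (inv x) = 1\<^sub>m d"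
    using u(4)[of "inv x"] x unitary_rep_one[OF \<pi>] by simp
  then have "mat_adjoint (\<pi> x) * (\<pi> x * \<pi> (inv x)) = mat_adjoint (\<pi> x)"
    using u by simp
  then show ?thesis using isometry_cancel[OF u(1,2), of "\<pi> (inv x)" d] unitary_repD(1)[OF \<pi>, of "inv x"] x by simp
qed

lemma rep_dim_eq: "unitary_rep G T d \<pi> \<Longrightarrow> rep_dim G \<pi> = d"
  using unitary_repD(1)[OF _ one_closed] by (auto simp: rep_dim_def)

lemma unitary_rep_entry_le:
  assumes \<pi>: "unitary_rep G T d \<pi>" and x: "x \<in> carrier G" and jk: "j < d" "k < d"
  shows "cmod (\<pi> x $$ (j, k)) \<le> 1"
proof -
  note u = unitary_repD[OF \<pi> x]
  have "1 = (\<Sum>i<d. (cmod (\<pi> x $$ (i, k)))\<^sup>2)"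
    using cmod_square_sum_adjoint[OF u(1) jk(2)] u(2) jk(2)
    by (metis index_one_mat(1) of_real_1 of_real_eq_iff)
  also have "\<dots> \<ge> (cmod (\<pi> x $$ (j, k)))\<^sup>2"
    using jk by (intro member_le_sum[of j "{..<d}" "\<lambda>i. (cmod (\<pi> x $$ (i, k)))\<^sup>2"]) auto
  finally show ?thesis by (metis abs_norm_cancel abs_square_le_1)
qed

subsection \<open>Characters\<close>

lemma character_one: "unitary_rep G T d \<pi> \<Longrightarrow> mtrace (\<pi> \<one>) = of_nat d"
  by (simp add: unitary_rep_one)

lemma character_inv:
  "unitary_rep G T d \<pi> \<Longrightarrow> x \<in> carrier G \<Longrightarrow> mtrace (\<pi> (inv x)) = cnj (mtrace (\<pi> x))"
  by (simp add: unitary_rep_inv mtrace_adjoint[OF unitary_repD(1)])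

lemma character_le: "unitary_rep G T d \<pi> \<Longrightarrow> x \<in> carrier G \<Longrightarrow> cmod (mtrace (\<pi> x)) \<le> d"
proof -
  assume *: "unitary_rep G T d \<pi>" "x \<in> carrier G"
  have "cmod (mtrace (\<pi> x)) \<le> (\<Sum>i<d. cmod (\<pi> x $$ (i, i)))"
    unfolding mtrace_def using unitary_repD(1)[OF *] by (auto intro: norm_sum)
  also have "\<dots> \<le> (\<Sum>i<d. 1)" using * by (intro sum_mono unitary_rep_entry_le) auto
  finally show ?thesis by simp
qed

lemma character_conj:
  assumes \<pi>: "unitary_rep G T d \<pi>" and xy: "x \<in> carrier G" "y \<in> carrier G"
  shows "mtrace (\<pi> (x \<otimes> y \<otimes> inv x)) = mtrace (\<pi> y)"
proof -
  have "mtrace (\<pi> (x \<otimes> y \<otimes> inv x)) = mtrace ((\<pi> x * \<pi> y) * \<pi> (inv x))"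
    using xy by (simp add: unitary_repD(4)[OF \<pi>])
  also have "\<dots> = mtrace (\<pi> (inv x) * (\<pi> x * \<pi> y))"
    using unitary_repD(1)[OF \<pi> xy(1)] unitary_repD(1)[OF \<pi> xy(2)] unitary_repD(1)[OF \<pi> inv_closed[OF xy(1)]]
    by (intro mtrace_comm[of _ d d]) auto
  also have "\<pi> (inv x) * (\<pi> x * \<pi> y) = \<pi> y"
    unfolding unitary_rep_inv[OF \<pi> xy(1)] using xy
    by (intro isometry_cancel[OF unitary_repD(1,2)[OF \<pi>] unitary_repD(1)[OF \<pi>]])
  finally show ?thesis .
qed

lemma continuous_character:
  assumes \<pi>: "unitary_rep G T d \<pi>"
  shows "continuous_map T euclidean (\<lambda>x. mtrace (\<pi> x))"
proof -
  have "continuous_map T euclidean (\<lambda>x. \<Sum>i<d. \<pi> x $$ (i, i))"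
    using \<pi> by (intro continuous_map_sum) (auto intro: unitary_rep_continuous)
  then show ?thesis
    by (rule continuous_map_eq) (simp add: mtrace_def topspace_eq unitary_rep_dims[OF \<pi>])
qed

subsection \<open>Kronecker products and conjugates\<close>

text \<open>The two arguments move independently, as in a representation of the square of the group.
  The test functionals translate them by different elements; \<open>kron_rep\<close> is the
  restriction to the diagonal.\<close>

lemma kron_rep_unitary:
  assumes "unitary_rep G T d \<pi>" "unitary_rep G T e \<rho>" "x \<in> carrier G" "y \<in> carrier G"
  shows "kron (\<pi> x) (\<rho> y) \<in> carrier_mat (d * e) (d * e)"
    "mat_adjoint (kron (\<pi> x) (\<rho> y)) * kron (\<pi> x) (\<rho> y) = 1\<^sub>m (d * e)"
    "x' \<in> carrier G \<Longrightarrow> y' \<in> carrier G \<Longrightarrow>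
      kron (\<pi> (x \<otimes> x')) (\<rho> (y \<otimes> y')) = kron (\<pi> x) (\<rho> y) * kron (\<pi> x') (\<rho> y')"
proof -
  note p = unitary_repD[OF assms(1,3)] and r = unitary_repD[OF assms(2,4)]
  show "kron (\<pi> x) (\<rho> y) \<in> carrier_mat (d * e) (d * e)" using p r by simp
  show "mat_adjoint (kron (\<pi> x) (\<rho> y)) * kron (\<pi> x) (\<rho> y) = 1\<^sub>m (d * e)"
    unfolding kron_adjoint[OF p(1) r(1)]
    by (subst kron_mult[of _ d _ e]) (use p r in \<open>auto simp: kron_one\<close>)
  assume xy': "x' \<in> carrier G" "y' \<in> carrier G"
  show "kron (\<pi> (x \<otimes> x')) (\<rho> (y \<otimes> y')) = kron (\<pi> x) (\<rho> y) * kron (\<pi> x') (\<rho> y')"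
    unfolding p(4)[OF xy'(1)] r(4)[OF xy'(2)]
    by (rule kron_mult[symmetric, OF p(1) r(1) unitary_repD(1)[OF assms(1) xy'(1)] unitary_repD(1)[OF assms(2) xy'(2)]])
qed

lemma kron_rep:
  assumes \<pi>: "unitary_rep G T d \<pi>" and \<rho>: "unitary_rep G T e \<rho>"
  shows "unitary_rep G T (d * e) (\<lambda>x. kron (\<pi> x) (\<rho> x))"
  unfolding unitary_rep_def
proof (intro conjI ballI allI impI)
  fix j k assume jk: "j < d * e" "k < d * e"
  have "continuous_map T euclidean (\<lambda>x. \<pi> x $$ (j div e, k div e) * \<rho> x $$ (j mod e, k mod e))"
    using div_mod_bounds[OF jk(1)] div_mod_bounds[OF jk(2)] \<pi> \<rho>
    by (intro continuous_map_normed_mult) (auto intro: unitary_rep_continuous)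
  then show "continuous_map T euclidean (\<lambda>x. kron (\<pi> x) (\<rho> x) $$ (j, k))"
    by (rule continuous_map_eq)
       (use jk in \<open>simp add: kron_def topspace_eq unitary_rep_dims[OF \<pi>] unitary_rep_dims[OF \<rho>]\<close>)
qed (use kron_rep_unitary[OF \<pi> \<rho>] in auto)

text \<open>Needed for the complex conjugates of the characters of the abelian part, which form the
  second tensor factors there.\<close>

lemma conjugate_rep:
  assumes \<pi>: "unitary_rep G T d \<pi>"
  shows "unitary_rep G T d (\<lambda>x. map_mat cnj (\<pi> x))"
  unfolding unitary_rep_def
proof (intro conjI ballI allI impI)
  have cnj_mult: "map_mat cnj (A * B) = map_mat cnj A * map_mat cnj B"
    if "A \<in> carrier_mat d d" "B \<in> carrier_mat d d" for A B
    using that by (intro eq_matI) (auto simp: scalar_prod_def)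
  fix x assume x: "x \<in> carrier G"
  note u = unitary_repD[OF \<pi> x]
  show "map_mat cnj (\<pi> x) \<in> carrier_mat d d" using u by simp
  have "mat_adjoint (map_mat cnj (\<pi> x)) = map_mat cnj (mat_adjoint (\<pi> x))"
    using u by (intro eq_matI) auto
  then have "mat_adjoint (map_mat cnj (\<pi> x)) * map_mat cnj (\<pi> x) = map_mat cnj (mat_adjoint (\<pi> x) * \<pi> x)"
    by (simp only: cnj_mult[OF mat_adjoint_carrier[OF u(1)] u(1)])
  then show "mat_adjoint (map_mat cnj (\<pi> x)) * map_mat cnj (\<pi> x) = 1\<^sub>m d"
    using u by (auto intro!: eq_matI)
  fix y assume y: "y \<in> carrier G"
  show "map_mat cnj (\<pi> (x \<otimes> y)) = map_mat cnj (\<pi> x) * map_mat cnj (\<pi> y)"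
    using u unitary_repD[OF \<pi> y] y by (simp add: cnj_mult)
next
  fix j k assume jk: "j < d" "k < d"
  have "continuous_map T euclidean (\<lambda>x. cnj (\<pi> x $$ (j, k)))"
    using continuous_map_compose[OF unitary_rep_continuous[OF \<pi> jk], of euclidean cnj]
    by (simp add: o_def continuous_on_cnj continuous_on_id)
  then show "continuous_map T euclidean (\<lambda>x. map_mat cnj (\<pi> x) $$ (j, k))"
    by (rule continuous_map_eq) (use jk in \<open>simp add: topspace_eq unitary_rep_dims[OF \<pi>]\<close>)
qed

lemma character_conjugate:
  "unitary_rep G T d \<pi> \<Longrightarrow> x \<in> carrier G \<Longrightarrow> mtrace (map_mat cnj (\<pi> x)) = cnj (mtrace (\<pi> x))"
  using unitary_repD(1)[of d \<pi> x] by (auto simp: mtrace_def)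

subsection \<open>Schur's lemma\<close>

lemma irrepsD:
  assumes "\<pi> \<in> irreps G T"
  shows "unitary_rep G T (rep_dim G \<pi>) \<pi>" "rep_dim G \<pi> > 0"
    "invariant_subspace G (rep_dim G \<pi>) \<pi> W \<Longrightarrow> W = {0\<^sub>v (rep_dim G \<pi>)} \<or> W = carrier_vec (rep_dim G \<pi>)"
  using assms rep_dim_eq unfolding irreps_def by blast+

text \<open>An eigenspace of \<open>A\<close> is invariant and nonzero, hence the whole
  space.\<close>

lemma schur_commute:
  assumes \<pi>: "\<pi> \<in> irreps G T" and A: "A \<in> carrier_mat (rep_dim G \<pi>) (rep_dim G \<pi>)"
    and comm: "\<And>x. x \<in> carrier G \<Longrightarrow> A * \<pi> x = \<pi> x * A"
  obtains c where "A = c \<cdot>\<^sub>m 1\<^sub>m (rep_dim G \<pi>)"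
proof -
  let ?d = "rep_dim G \<pi>"
  note u = unitary_repD[OF irrepsD(1)[OF \<pi>]]
  obtain c where "c \<in> spectrum A"
    using spectrum_non_empty[OF A] irrepsD(2)[OF \<pi>] by blast
  then obtain v0 where v0: "v0 \<in> carrier_vec ?d" "v0 \<noteq> 0\<^sub>v ?d" "A *\<^sub>v v0 = c \<cdot>\<^sub>v v0"
    using A by (auto simp: spectrum_def eigenvalue_def eigenvector_def)
  let ?W = "{v \<in> carrier_vec ?d. A *\<^sub>v v = c \<cdot>\<^sub>v v}"
  have "invariant_subspace G ?d \<pi> ?W"
    unfolding invariant_subspace_def
  proof (intro conjI ballI allI)
    fix v w assume "v \<in> ?W" "w \<in> ?W"
    then show "v + w \<in> ?W"
      using A by (auto simp: mult_add_distrib_mat_vec[OF A] smult_add_distrib_vec[of _ ?d])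
  next
    fix a and v :: "complex vec" assume "v \<in> ?W"
    then show "a \<cdot>\<^sub>v v \<in> ?W"
      using A by (auto simp: mult_mat_vec[OF A] smult_smult_assoc mult.commute)
  next
    fix x and v :: "complex vec" assume x: "x \<in> carrier G" and v: "v \<in> ?W"
    have "A *\<^sub>v (\<pi> x *\<^sub>v v) = (A * \<pi> x) *\<^sub>v v"
      using A u(1)[OF x] v by (intro assoc_mult_mat_vec[symmetric, of _ ?d ?d _ ?d]) auto
    also have "\<dots> = \<pi> x *\<^sub>v (A *\<^sub>v v)"
      unfolding comm[OF x] using A u(1)[OF x] v by (intro assoc_mult_mat_vec[of _ ?d ?d _ ?d]) auto
    also have "\<dots> = c \<cdot>\<^sub>v (\<pi> x *\<^sub>v v)"
      using v u(1)[OF x] by (simp add: mult_mat_vec[of _ ?d ?d])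
    finally show "\<pi> x *\<^sub>v v \<in> ?W" using u(1)[OF x] v by simp
  qed (use A in auto)
  then have "?W = carrier_vec ?d" using irrepsD(3)[OF \<pi>] v0 by blast
  then have "A *\<^sub>v v = c \<cdot>\<^sub>v v" if "v \<in> carrier_vec ?d" for v using that by blast
  then have "A = c \<cdot>\<^sub>m 1\<^sub>m ?d"
    by (intro mat_eq_vecI[OF A]) auto
  then show ?thesis by (rule that)
qed

text \<open>All \<open>\<pi> x\<close> are scalar by Schur's lemma, so the line through the first
  basis vector is invariant.\<close>

lemma irrep_commuting_dim:
  assumes \<pi>: "\<pi> \<in> irreps G T"
    and comm: "\<And>x y. x \<in> carrier G \<Longrightarrow> y \<in> carrier G \<Longrightarrow> \<pi> x * \<pi> y = \<pi> y * \<pi> x"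
  shows "rep_dim G \<pi> = 1"
proof -
  let ?d = "rep_dim G \<pi>"
  note u = unitary_repD[OF irrepsD(1)[OF \<pi>]]
  have d: "?d > 0" by (rule irrepsD(2)[OF \<pi>])
  define W :: "complex vec set" where "W = {v \<in> carrier_vec ?d. \<forall>i<?d. i \<noteq> 0 \<longrightarrow> v $ i = 0}"
  have "invariant_subspace G ?d \<pi> W"
    unfolding invariant_subspace_def W_def
  proof (intro conjI ballI allI)
    fix x and v :: "complex vec" assume x: "x \<in> carrier G" and v: "v \<in> {v \<in> carrier_vec ?d. \<forall>i<?d. i \<noteq> 0 \<longrightarrow> v $ i = 0}"
    obtain c where "\<pi> x = c \<cdot>\<^sub>m 1\<^sub>m ?d"
      using schur_commute[OF \<pi> u(1)[OF x]] comm[OF x] by metis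
    then have "\<pi> x *\<^sub>v v = c \<cdot>\<^sub>v v" using v by (auto intro!: eq_vecI)
    then show "\<pi> x *\<^sub>v v \<in> {v \<in> carrier_vec ?d. \<forall>i<?d. i \<noteq> 0 \<longrightarrow> v $ i = 0}" using v by auto
  qed auto
  moreover have "unit_vec ?d 0 \<in> W" by (auto simp: W_def)
  moreover have "unit_vec ?d 0 \<noteq> (0\<^sub>v ?d :: complex vec)"
    using d by (metis index_unit_vec(2) index_zero_vec(1) zero_neq_one)
  ultimately have W: "W = carrier_vec ?d" using irrepsD(3)[OF \<pi>] by blast
  show ?thesis
  proof (rule ccontr)
    assume "?d \<noteq> 1"
    then have 1: "1 < ?d" using d by simp
    have "unit_vec ?d 1 \<in> W" unfolding W by simp
    then have "unit_vec ?d 1 $ 1 = (0 :: complex)" using 1 by (auto simp: W_def)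
    then show False using 1 by simp
  qed
qed

text \<open>The intertwining relation at \<open>inv x\<close>, with adjoints taken on both
  sides.\<close>

lemma intertwiner_adjoint:
  assumes \<pi>: "unitary_rep G T d \<pi>" and \<rho>: "unitary_rep G T e \<rho>" and M: "M \<in> carrier_mat e d"
    and inter: "\<And>x. x \<in> carrier G \<Longrightarrow> \<rho> x * M = M * \<pi> x" and x: "x \<in> carrier G"
  shows "\<pi> x * mat_adjoint M = mat_adjoint M * \<rho> x"
proof -
  have "mat_adjoint (\<rho> (inv x) * M) = mat_adjoint (M * \<pi> (inv x))" using inter x by simp
  then have "mat_adjoint M * mat_adjoint (\<rho> (inv x)) = mat_adjoint (\<pi> (inv x)) * mat_adjoint M"
    using M x unitary_repD(1)[OF \<pi>, of "inv x"] unitary_repD(1)[OF \<rho>, of "inv x"]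
    by (simp add: mat_adjoint_mult[of _ e d _ d] mat_adjoint_mult[of _ e e _ d])
  then show ?thesis using x by (simp add: unitary_rep_inv[OF \<pi>] unitary_rep_inv[OF \<rho>])
qed

text \<open>Both products of \<open>M\<close> with its adjoint commute with an irreducible
  representation, so they are scalars \<open>a\<close> and \<open>b\<close>. Associativity gives
  \<open>a * M = b * M\<close>, hence \<open>a = b\<close>, and comparing traces gives equal
  dimensions. Equivalence is defined by a unitary intertwiner, so \<open>M\<close> still has to be
  rescaled.\<close>

lemma schur_intertwiner:
  assumes \<pi>: "\<pi> \<in> irreps G T" and \<rho>: "\<rho> \<in> irreps G T"
    and M: "M \<in> carrier_mat (rep_dim G \<rho>) (rep_dim G \<pi>)"
    and inter: "\<And>x. x \<in> carrier G \<Longrightarrow> \<rho> x * M = M * \<pi> x"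
  shows "M = 0\<^sub>m (rep_dim G \<rho>) (rep_dim G \<pi>) \<or> unitarily_equivalent G \<pi> \<rho>"
proof (cases "M = 0\<^sub>m (rep_dim G \<rho>) (rep_dim G \<pi>)")
  case False
  define d e N where "d = rep_dim G \<pi>" and "e = rep_dim G \<rho>" and "N = mat_adjoint M"
  note p = unitary_repD[OF irrepsD(1)[OF \<pi>], folded d_def]
    and r = unitary_repD[OF irrepsD(1)[OF \<rho>], folded e_def]
  have M: "M \<in> carrier_mat e d" and N: "N \<in> carrier_mat d e"
    using assms by (simp_all add: d_def e_def N_def)
  have adj: "\<pi> x * N = N * \<rho> x" if "x \<in> carrier G" for x
    unfolding N_def using intertwiner_adjoint[OF irrepsD(1)[OF \<pi>] irrepsD(1)[OF \<rho>]] assms that by blast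
  have "N * M * \<pi> x = \<pi> x * (N * M)" if x: "x \<in> carrier G" for x
  proof -
    have "N * M * \<pi> x = N * (\<rho> x * M)"
      unfolding inter[OF x] using M N p(1)[OF x] by (intro assoc_mult_mat)
    also have "\<dots> = (N * \<rho> x) * M"
      using M N r(1)[OF x] by (intro assoc_mult_mat[symmetric])
    also have "\<dots> = \<pi> x * (N * M)"
      unfolding adj[OF x, symmetric] using M N p(1)[OF x] by (intro assoc_mult_mat)
    finally show ?thesis .
  qed
  then obtain a where a: "N * M = a \<cdot>\<^sub>m 1\<^sub>m d"
    using schur_commute[OF \<pi>, of "N * M"] M N unfolding d_def by (metis mult_carrier_mat)
  have "M * N * \<rho> x = \<rho> x * (M * N)" if x: "x \<in> carrier G" for x
  proof -
    have "M * N * \<rho> x = M * (\<pi> x * N)"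
      unfolding adj[OF x] using M N r(1)[OF x] by (intro assoc_mult_mat)
    also have "\<dots> = (M * \<pi> x) * N"
      using M N p(1)[OF x] by (intro assoc_mult_mat[symmetric])
    also have "\<dots> = \<rho> x * (M * N)"
      unfolding inter[OF x, symmetric] using M N r(1)[OF x] by (intro assoc_mult_mat)
    finally show ?thesis .
  qed
  then obtain b where b: "M * N = b \<cdot>\<^sub>m 1\<^sub>m e"
    using schur_commute[OF \<rho>, of "M * N"] M N unfolding e_def by (metis mult_carrier_mat)
  have tr: "of_nat d * a = mtrace (N * M)" "of_nat e * b = mtrace (M * N)"
    unfolding a b by (simp_all add: mtrace_smult[of _ d] mtrace_smult[of _ e])
  have "M * (N * M) = M * N * M" using M N by simp
  then have "a \<cdot>\<^sub>m M = b \<cdot>\<^sub>m M"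
    unfolding a b mult_smult_distrib[OF M one_carrier_mat] mult_smult_assoc_mat[OF one_carrier_mat M]
    using M by simp
  moreover obtain i j where ij: "i < e" "j < d" "M $$ (i, j) \<noteq> 0"
    using False M unfolding d_def[symmetric] e_def[symmetric] by (metis carrier_matD eq_matI index_zero_mat)
  ultimately have ab: "a = b"
    using M by (metis carrier_matD index_smult_mat(1) mult_right_cancel)
  have ne: "mtrace (N * M) \<noteq> 0"
    using mtrace_adjoint_self_eq_0[OF M] False by (auto simp: N_def d_def e_def)
  then have "of_nat d = (of_nat e :: complex)"
    using tr ab mtrace_comm[OF M N] by (metis mult_eq_0_iff mult_right_cancel)
  then have de: "d = e" by simp
  \<comment> \<open>\<open>t\<close> is the scalar \<open>a\<close>, recovered from the trace in
    order to see that it is real and positive; dividing \<open>M\<close> by its square root makes it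
    unitary.\<close>
  define t where "t = Re (mtrace (N * M)) / d"
  have d0: "d > 0" using irrepsD(2)[OF \<pi>] by (simp add: d_def)
  have Re: "mtrace (N * M) = complex_of_real (Re (mtrace (N * M)))" "Re (mtrace (N * M)) \<ge> 0"
    using mtrace_adjoint_self_Re[OF M] by (simp_all add: N_def)
  have "a = mtrace (N * M) / of_nat d"
    unfolding tr(1)[symmetric] using d0 by simp
  also have "\<dots> = complex_of_real t"
    unfolding t_def of_real_divide Re(1)[symmetric] by simp
  finally have t1: "a = complex_of_real t" .
  have "Re (mtrace (N * M)) \<noteq> 0"
    using Re(1) ne by (metis of_real_0)
  then have t2: "t > 0" using Re(2) d0 by (simp add: t_def)
  define U where "U = complex_of_real (1 / sqrt t) \<cdot>\<^sub>m M"
  have U: "U \<in> carrier_mat d d" using M de by (simp add: U_def)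
  have "mat_adjoint U = complex_of_real (1 / sqrt t) \<cdot>\<^sub>m N"
    using M by (intro eq_matI) (auto simp: U_def N_def)
  then have "mat_adjoint U * U = complex_of_real (1 / sqrt t) \<cdot>\<^sub>m (complex_of_real (1 / sqrt t) \<cdot>\<^sub>m (N * M))"
    using M N by (simp add: U_def mult_smult_distrib[of N d e M d] mult_smult_assoc_mat[of N d e _ d])
  also have "\<dots> = 1\<^sub>m d"
    unfolding a t1 using t2 by (auto intro!: eq_matI simp flip: of_real_mult)
  finally have "mat_adjoint U * U = 1\<^sub>m d" .
  moreover have "\<rho> x * U = U * \<pi> x" if x: "x \<in> carrier G" for x
    using inter[OF x] M r(1)[OF x] p(1)[OF x]
    by (simp add: U_def mult_smult_distrib[of _ e e] mult_smult_assoc_mat[of _ e d])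
  ultimately show ?thesis
    unfolding unitarily_equivalent_def using U de by (auto simp: d_def e_def)
qed simp

lemma unitarily_equivalent_refl:
  assumes \<pi>: "\<pi> \<in> irreps G T" shows "unitarily_equivalent G \<pi> \<pi>"
  unfolding unitarily_equivalent_def
  using left_mult_one_mat[OF unitary_repD(1)[OF irrepsD(1)[OF \<pi>]]]
    right_mult_one_mat[OF unitary_repD(1)[OF irrepsD(1)[OF \<pi>]]]
  by (intro conjI bexI[of _ "1\<^sub>m (rep_dim G \<pi>)"]) auto

lemma unitarily_equivalent_sym:
  assumes \<pi>: "\<pi> \<in> irreps G T" and \<rho>: "\<rho> \<in> irreps G T" and eq: "unitarily_equivalent G \<pi> \<rho>"
  shows "unitarily_equivalent G \<rho> \<pi>"
proof -
  obtain U where U: "U \<in> carrier_mat (rep_dim G \<pi>) (rep_dim G \<pi>)"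
    "mat_adjoint U * U = 1\<^sub>m (rep_dim G \<pi>)" "\<And>x. x \<in> carrier G \<Longrightarrow> \<rho> x * U = U * \<pi> x"
    and d: "rep_dim G \<pi> = rep_dim G \<rho>"
    using eq unfolding unitarily_equivalent_def by blast
  have "\<pi> x * mat_adjoint U = mat_adjoint U * \<rho> x" if "x \<in> carrier G" for x
    using U that by (intro intertwiner_adjoint[OF irrepsD(1)[OF \<pi>] irrepsD(1)[OF \<rho>]]) (auto simp: d)
  then show ?thesis
    unfolding unitarily_equivalent_def using U unitary_right[OF U(1,2)] d
    by (intro conjI bexI[of _ "mat_adjoint U"]) auto
qed

lemma unitarily_equivalent_trans:
  assumes \<pi>: "\<pi> \<in> irreps G T" and \<rho>: "\<rho> \<in> irreps G T" and \<sigma>: "\<sigma> \<in> irreps G T"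
    and eq: "unitarily_equivalent G \<pi> \<rho>" "unitarily_equivalent G \<rho> \<sigma>"
  shows "unitarily_equivalent G \<pi> \<sigma>"
proof -
  define d where "d = rep_dim G \<pi>"
  obtain U where U: "U \<in> carrier_mat d d"
    "mat_adjoint U * U = 1\<^sub>m d" "\<And>x. x \<in> carrier G \<Longrightarrow> \<rho> x * U = U * \<pi> x" and d1: "rep_dim G \<rho> = d"
    using eq(1) unfolding unitarily_equivalent_def d_def by metis
  obtain V where V: "V \<in> carrier_mat d d"
    "mat_adjoint V * V = 1\<^sub>m d" "\<And>x. x \<in> carrier G \<Longrightarrow> \<sigma> x * V = V * \<rho> x" and d2: "rep_dim G \<sigma> = d"
    using eq(2) unfolding unitarily_equivalent_def d1 by metis
  note p = unitary_repD(1)[OF irrepsD(1)[OF \<pi>], folded d_def]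
    and r = unitary_repD(1)[OF irrepsD(1)[OF \<rho>], unfolded d1]
    and s = unitary_repD(1)[OF irrepsD(1)[OF \<sigma>], unfolded d2]
  have "\<sigma> x * (V * U) = (V * U) * \<pi> x" if x: "x \<in> carrier G" for x
  proof -
    have "\<sigma> x * (V * U) = (\<sigma> x * V) * U" using U V s[OF x] by simp
    also have "\<dots> = V * (\<rho> x * U)" unfolding V(3)[OF x] using U V r[OF x] by simp
    also have "\<dots> = (V * U) * \<pi> x" unfolding U(3)[OF x] using U V p[OF x] by simp
    finally show ?thesis .
  qed
  moreover have "mat_adjoint (V * U) * (V * U) = 1\<^sub>m d"
    using U V by (simp add: mat_adjoint_mult[of _ d d _ d] isometry_cancel[OF V(1,2), of _ d]
      assoc_mult_mat[of _ d d _ d _ d])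
  ultimately show ?thesis
    unfolding unitarily_equivalent_def d2 d_def[symmetric] using U V by (metis mult_carrier_mat)
qed

lemma unitarily_equivalent_character:
  assumes \<pi>: "\<pi> \<in> irreps G T" and \<rho>: "\<rho> \<in> irreps G T" and eq: "unitarily_equivalent G \<pi> \<rho>"
    and x: "x \<in> carrier G"
  shows "mtrace (\<pi> x) = mtrace (\<rho> x)"
proof -
  define d where "d = rep_dim G \<pi>"
  obtain U where U: "U \<in> carrier_mat d d"
    "mat_adjoint U * U = 1\<^sub>m d" "\<And>x. x \<in> carrier G \<Longrightarrow> \<rho> x * U = U * \<pi> x" and d1: "rep_dim G \<rho> = d"
    using eq(1) unfolding unitarily_equivalent_def d_def by metis
  note p = unitary_repD(1)[OF irrepsD(1)[OF \<pi>] x, folded d_def]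
    and r = unitary_repD(1)[OF irrepsD(1)[OF \<rho>] x, unfolded d1]
  have "mtrace (\<pi> x) = mtrace (mat_adjoint U * (U * \<pi> x))"
    by (subst isometry_cancel[OF U(1,2) p]) simp
  also have "\<dots> = mtrace (mat_adjoint U * (\<rho> x * U))" by (simp add: U(3)[OF x])
  also have "\<dots> = mtrace ((\<rho> x * U) * mat_adjoint U)"
    using U r by (intro mtrace_comm[of _ d d]) auto
  also have "(\<rho> x * U) * mat_adjoint U = \<rho> x"
    using assoc_mult_mat[OF r U(1) mat_adjoint_carrier[OF U(1)]] r unitary_right[OF U(1,2)] by simp
  finally show ?thesis .
qed

subsection \<open>Complete reducibility\<close>

text \<open>The pair \<open>(V, \<pi>)\<close> is a subrepresentation of \<open>\<rho>\<close>, embedded by the isometry \<open>V\<close>.\<close>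

definition embeds :: "nat \<Rightarrow> ('g \<Rightarrow> complex mat) \<Rightarrow> complex mat \<Rightarrow> ('g \<Rightarrow> complex mat) \<Rightarrow> bool" where
  "embeds d \<rho> V \<pi> \<longleftrightarrow> V \<in> carrier_mat d (rep_dim G \<pi>) \<and> mat_adjoint V * V = 1\<^sub>m (rep_dim G \<pi>) \<and>
     (\<forall>x \<in> carrier G. \<rho> x * V = V * \<pi> x)"

text \<open>The hypothesis \<open>inv\<close> says that the range of \<open>V\<close> is invariant,
  which makes the compression multiplicative. Unitarity then comes for free: the adjoint of the
  compression at \<open>x\<close> is the compression at \<open>inv x\<close>.\<close>

lemma compression_rep:
  assumes \<rho>: "unitary_rep G T d \<rho>" and V: "V \<in> carrier_mat d r" "mat_adjoint V * V = 1\<^sub>m r"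
    and inv: "\<And>x. x \<in> carrier G \<Longrightarrow> V * (mat_adjoint V * (\<rho> x * V)) = \<rho> x * V"
  shows "unitary_rep G T r (\<lambda>x. mat_adjoint V * (\<rho> x * V))" (is "unitary_rep G T r ?\<pi>")
  unfolding unitary_rep_def
proof (intro conjI ballI allI impI)
  note u = unitary_repD[OF \<rho>]
  have A: "mat_adjoint V \<in> carrier_mat r d" using V by simp
  have c: "?\<pi> x \<in> carrier_mat r r" if "x \<in> carrier G" for x
    using V A u(1)[OF that] by (meson mult_carrier_mat)
  have mult: "?\<pi> (x \<otimes> y) = ?\<pi> x * ?\<pi> y" if x: "x \<in> carrier G" and y: "y \<in> carrier G" for x y
  proof -
    have "?\<pi> x * ?\<pi> y = mat_adjoint V * (\<rho> x * (V * ?\<pi> y))"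
      using assoc_mult_mat[OF A mult_carrier_mat[OF u(1)[OF x] V(1)] c[OF y]]
        assoc_mult_mat[OF u(1)[OF x] V(1) c[OF y]] by simp
    also have "\<dots> = mat_adjoint V * (\<rho> x * (\<rho> y * V))" by (simp only: inv[OF y])
    also have "\<dots> = ?\<pi> (x \<otimes> y)"
      by (simp only: u(4)[OF x y] assoc_mult_mat[OF u(1)[OF x] u(1)[OF y] V(1)])
    finally show ?thesis by simp
  qed
  fix x assume x: "x \<in> carrier G"
  show "?\<pi> x \<in> carrier_mat r r" by (rule c[OF x])
  show "?\<pi> (x \<otimes> y) = ?\<pi> x * ?\<pi> y" if "y \<in> carrier G" for y by (rule mult[OF x that])
  have "mat_adjoint (?\<pi> x) = mat_adjoint (\<rho> x * V) * V"
    using V u(1)[OF x] by (simp add: mat_adjoint_mult[of _ r d _ r])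
  also have "\<dots> = mat_adjoint V * (mat_adjoint (\<rho> x) * V)"
    using V u(1)[OF x] by (simp add: mat_adjoint_mult[of _ d d _ r] assoc_mult_mat[of _ r d _ d _ r])
  also have "\<dots> = ?\<pi> (inv x)" using unitary_rep_inv[OF \<rho> x] by simp
  finally have "mat_adjoint (?\<pi> x) * ?\<pi> x = ?\<pi> (inv x \<otimes> x)"
    using mult[of "inv x" x] x by simp
  also have "\<dots> = 1\<^sub>m r" using x V by (simp add: unitary_rep_one[OF \<rho>])
  finally show "mat_adjoint (?\<pi> x) * ?\<pi> x = 1\<^sub>m r" .
next
  fix j k assume jk: "j < r" "k < r"
  have "continuous_map T euclidean (\<lambda>x. \<Sum>a<d. \<Sum>b<d. cnj (V $$ (a, j)) * (\<rho> x $$ (a, b) * V $$ (b, k)))"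
    using \<rho> by (intro continuous_map_sum continuous_map_normed_mult) (auto intro: unitary_rep_continuous)
  then show "continuous_map T euclidean (\<lambda>x. ?\<pi> x $$ (j, k))"
  proof (rule continuous_map_eq)
    fix x assume "x \<in> topspace T"
    then have x: "x \<in> carrier G" by (simp add: topspace_eq)
    show "(\<Sum>a<d. \<Sum>b<d. cnj (V $$ (a, j)) * (\<rho> x $$ (a, b) * V $$ (b, k))) = ?\<pi> x $$ (j, k)"
      using V jk unitary_repD(1)[OF \<rho> x]
      by (simp add: index_mult_mat_sum[of _ r d _ r] index_mult_mat_sum[of _ d d _ r] sum_distrib_left del: index_mult_mat(1))
  qed
qed

text \<open>Induction on the dimension, splitting off an invariant subspace and its orthogonal
  complement. The decomposition is recorded through its trace, which is all that characters need,
  and through the embeddings. The latter show later that each component of a regular representation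
  depends only on the coordinates on which that representation depends.\<close>

theorem complete_reducibility:
  assumes "unitary_rep G T d \<rho>"
  shows "\<exists>ps. (\<forall>(V, \<pi>) \<in> set ps. \<pi> \<in> irreps G T \<and> embeds d \<rho> V \<pi>) \<and>
    (\<forall>x \<in> carrier G. mtrace (\<rho> x) = (\<Sum>p\<leftarrow>ps. mtrace (snd p x)))"
  using assms
proof (induction d arbitrary: \<rho> rule: less_induct)
  case (less d)
  note \<rho> = less.prems
  note u = unitary_repD[OF \<rho>]
  consider "d = 0" | "\<rho> \<in> irreps G T" | W where "d > 0" "invariant_subspace G d \<rho> W" "W \<noteq> {0\<^sub>v d}" "W \<noteq> carrier_vec d"
    using \<rho> unfolding irreps_def by blast
  then show ?case
  proof cases
    case 1
    have "mtrace (\<rho> x) = 0" if "x \<in> carrier G" for x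
      using u(1)[OF that] 1 by (auto simp: mtrace_def)
    then show ?thesis by (intro exI[of _ "[]"]) auto
  next
    case 2
    have "embeds d \<rho> (1\<^sub>m d) \<rho>"
      using left_mult_one_mat[OF u(1)] right_mult_one_mat[OF u(1)] by (auto simp: embeds_def rep_dim_eq[OF \<rho>])
    then show ?thesis using 2 by (intro exI[of _ "[(1\<^sub>m d, \<rho>)]"]) auto
  next
    case (3 W)
    have W: "vec_subspace d W" and Winv: "\<And>x v. x \<in> carrier G \<Longrightarrow> v \<in> W \<Longrightarrow> \<rho> x *\<^sub>v v \<in> W"
      using 3 by (auto simp: invariant_subspace_def vec_subspace_def)
    obtain r V where V: "V \<in> carrier_mat d r" "mat_adjoint V * V = 1\<^sub>m r"
      and VW: "\<And>a. a \<in> carrier_vec r \<Longrightarrow> V *\<^sub>v a \<in> W"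
      and WV: "\<And>w. w \<in> W \<Longrightarrow> V *\<^sub>v (mat_adjoint V *\<^sub>v w) = w"
      by (rule ex_isometry_onto_subspace[OF W]) (rule that)
    have A: "mat_adjoint V \<in> carrier_mat r d" using V by simp
    \<comment> \<open>The orthogonal complement of \<open>W\<close>, as the kernel of the adjoint of
      the isometry onto \<open>W\<close>.\<close>
    define W' where "W' = {w \<in> carrier_vec d. mat_adjoint V *\<^sub>v w = 0\<^sub>v r}"
    have "vec_subspace d W'"
      unfolding vec_subspace_def W'_def using A V(1)
      by (auto simp: mult_add_distrib_mat_vec[OF A] mult_mat_vec[OF A] intro!: eq_vecI)
    note W' = this
    obtain s V' where V': "V' \<in> carrier_mat d s" "mat_adjoint V' * V' = 1\<^sub>m s"
      and VW': "\<And>a. a \<in> carrier_vec s \<Longrightarrow> V' *\<^sub>v a \<in> W'"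
      and WV': "\<And>w. w \<in> W' \<Longrightarrow> V' *\<^sub>v (mat_adjoint V' *\<^sub>v w) = w"
      by (rule ex_isometry_onto_subspace[OF W']) (rule that)
    have A': "mat_adjoint V' \<in> carrier_mat s d" using V' by simp
    have VV': "mat_adjoint V * V' = 0\<^sub>m r s"
    proof (rule mat_eq_vecI[of _ r s])
      fix v :: "complex vec" assume v: "v \<in> carrier_vec s"
      have "(mat_adjoint V * V') *\<^sub>v v = 0\<^sub>v r"
        using VW'[OF v] A V' v by (simp add: W'_def)
      then show "(mat_adjoint V * V') *\<^sub>v v = 0\<^sub>m r s *\<^sub>v v" using v by (auto intro!: eq_vecI)
    qed (use A V' in auto)
    have V'V: "mat_adjoint V' * V = 0\<^sub>m s r"
    proof -
      have "mat_adjoint (mat_adjoint V * V') = mat_adjoint V' * V"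
        using V V' by (subst mat_adjoint_mult[of _ r d _ s]) auto
      then show ?thesis unfolding VV' by simp
    qed
    have split: "V * mat_adjoint V + V' * mat_adjoint V' = 1\<^sub>m d"
    proof (rule mat_eq_vecI[of _ d d])
      fix v :: "complex vec" assume v: "v \<in> carrier_vec d"
      define a where "a = mat_adjoint V *\<^sub>v v"
      have a: "a \<in> carrier_vec r" using A v by (simp add: a_def)
      define w where "w = v - V *\<^sub>v a"
      have Va: "V *\<^sub>v a \<in> carrier_vec d" using V a by simp
      have w: "w \<in> carrier_vec d" using v Va by (simp add: w_def)
      have "mat_adjoint V *\<^sub>v w = a - mat_adjoint V *\<^sub>v (V *\<^sub>v a)"
        unfolding w_def a_def[symmetric] mult_minus_distrib_mat_vec[OF A v Va] ..
      also have "\<dots> = 0\<^sub>v r" unfolding isometry_cancel_vec[OF V a] using a by simp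
      finally have "w \<in> W'" using w by (simp add: W'_def)
      then have "V' *\<^sub>v (mat_adjoint V' *\<^sub>v w) = w" by (rule WV')
      moreover have "mat_adjoint V' *\<^sub>v w = mat_adjoint V' *\<^sub>v v"
      proof -
        have "mat_adjoint V' *\<^sub>v (V *\<^sub>v a) = (mat_adjoint V' * V) *\<^sub>v a"
          using A' V a by simp
        then have "mat_adjoint V' *\<^sub>v (V *\<^sub>v a) = 0\<^sub>v s" unfolding V'V using a by (auto intro!: eq_vecI)
        then show ?thesis
          unfolding w_def mult_minus_distrib_mat_vec[OF A' v Va] using A' v by (auto intro!: eq_vecI)
      qed
      ultimately have 1: "V' *\<^sub>v (mat_adjoint V' *\<^sub>v v) = w" by simp
      have "b + (v - b) = v" if "b \<in> carrier_vec d" for b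
        using that v by (auto intro!: eq_vecI)
      then have "V *\<^sub>v (mat_adjoint V *\<^sub>v v) + V' *\<^sub>v (mat_adjoint V' *\<^sub>v v) = v"
        unfolding 1 unfolding w_def a_def[symmetric] using Va by blast
      then show "(V * mat_adjoint V + V' * mat_adjoint V') *\<^sub>v v = 1\<^sub>m d *\<^sub>v v"
        using v add_mult_distrib_mat_vec[OF mult_carrier_mat[OF V(1) A] mult_carrier_mat[OF V'(1) A'] v]
          assoc_mult_mat_vec[OF V(1) A v] assoc_mult_mat_vec[OF V'(1) A' v] by simp
    qed (use V V' in auto)
    have \<rho>V_carrier: "\<rho> x * V \<in> carrier_mat d r" and \<rho>V'_carrier: "\<rho> x * V' \<in> carrier_mat d s"
      and comp_carrier: "mat_adjoint V * (\<rho> x * V) \<in> carrier_mat r r" if x: "x \<in> carrier G" for x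
      using V(1) V'(1) A u(1)[OF x] by (meson mult_carrier_mat)+
    have inv: "V * (mat_adjoint V * (\<rho> x * V)) = \<rho> x * V" if x: "x \<in> carrier G" for x
    proof (rule mat_eq_vecI[of _ d r])
      fix v :: "complex vec" assume v: "v \<in> carrier_vec r"
      have "\<rho> x *\<^sub>v (V *\<^sub>v v) \<in> W" by (rule Winv[OF x VW[OF v]])
      then show "(V * (mat_adjoint V * (\<rho> x * V))) *\<^sub>v v = (\<rho> x * V) *\<^sub>v v"
        using assoc_mult_mat_vec[OF V(1) comp_carrier[OF x] v] assoc_mult_mat_vec[OF A \<rho>V_carrier[OF x] v]
          assoc_mult_mat_vec[OF u(1)[OF x] V(1) v] WV by simp
    qed (use V(1) comp_carrier[OF x] \<rho>V_carrier[OF x] in auto)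
    have V'\<rho>V: "mat_adjoint V' * (\<rho> x * V) = 0\<^sub>m s r" if x: "x \<in> carrier G" for x
    proof -
      have "mat_adjoint V' * (\<rho> x * V) = mat_adjoint V' * (V * (mat_adjoint V * (\<rho> x * V)))"
        by (simp only: inv[OF x])
      also have "\<dots> = (mat_adjoint V' * V) * (mat_adjoint V * (\<rho> x * V))"
        by (rule assoc_mult_mat[OF A' V(1) comp_carrier[OF x], symmetric])
      also have "\<dots> = 0\<^sub>m s r" unfolding V'V by (rule left_mult_zero_mat[OF comp_carrier[OF x]])
      finally show ?thesis .
    qed
    \<comment> \<open>The complement is invariant because the off-diagonal block at \<open>x\<close>
      is the adjoint of the other one at \<open>inv x\<close>, which vanishes by invariance of
      \<open>W\<close>.\<close>
    have V\<rho>V': "mat_adjoint V * (\<rho> x * V') = 0\<^sub>m r s" if x: "x \<in> carrier G" for x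
    proof -
      have ix: "inv x \<in> carrier G" using x by simp
      have "mat_adjoint V * (\<rho> x * V') = mat_adjoint (mat_adjoint V' * (\<rho> (inv x) * V))"
        unfolding unitary_rep_inv[OF \<rho> x]
          mat_adjoint_mult[OF A' mult_carrier_mat[OF mat_adjoint_carrier[OF u(1)[OF x]] V(1)]]
          mat_adjoint_mult[OF mat_adjoint_carrier[OF u(1)[OF x]] V(1)]
        by (simp add: assoc_mult_mat[OF A u(1)[OF x] V'(1)])
      also have "\<dots> = 0\<^sub>m r s" unfolding V'\<rho>V[OF ix] by simp
      finally show ?thesis .
    qed
    have inv': "V' * (mat_adjoint V' * (\<rho> x * V')) = \<rho> x * V'" if x: "x \<in> carrier G" for x
    proof -
      note c = \<rho>V'_carrier[OF x]
      have "\<rho> x * V' = (V * mat_adjoint V + V' * mat_adjoint V') * (\<rho> x * V')"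
        unfolding split left_mult_one_mat[OF c] ..
      also have "\<dots> = V * mat_adjoint V * (\<rho> x * V') + V' * mat_adjoint V' * (\<rho> x * V')"
        by (rule add_mult_distrib_mat[OF mult_carrier_mat[OF V(1) A] mult_carrier_mat[OF V'(1) A'] c])
      also have "V * mat_adjoint V * (\<rho> x * V') = V * (mat_adjoint V * (\<rho> x * V'))"
        by (rule assoc_mult_mat[OF V(1) A c])
      also have "\<dots> = 0\<^sub>m d s" unfolding V\<rho>V'[OF x] using V by simp
      also have "V' * mat_adjoint V' * (\<rho> x * V') = V' * (mat_adjoint V' * (\<rho> x * V'))"
        by (rule assoc_mult_mat[OF V'(1) A' c])
      finally show ?thesis using left_add_zero_mat[OF mult_carrier_mat[OF V'(1) mult_carrier_mat[OF A' c]]] by simp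
    qed
    let ?\<pi> = "\<lambda>x. mat_adjoint V * (\<rho> x * V)" and ?\<pi>' = "\<lambda>x. mat_adjoint V' * (\<rho> x * V')"
    have \<pi>: "unitary_rep G T r ?\<pi>" by (rule compression_rep[OF \<rho> V inv])
    have \<pi>': "unitary_rep G T s ?\<pi>'" by (rule compression_rep[OF \<rho> V' inv'])
    have tr: "mtrace (\<rho> x) = mtrace (?\<pi> x) + mtrace (?\<pi>' x)" if x: "x \<in> carrier G" for x
    proof -
      have "mtrace (\<rho> x) = mtrace (\<rho> x * (V * mat_adjoint V + V' * mat_adjoint V'))"
        unfolding split right_mult_one_mat[OF u(1)[OF x]] ..
      also have "\<dots> = mtrace (\<rho> x * V * mat_adjoint V + \<rho> x * V' * mat_adjoint V')"
        unfolding mult_add_distrib_mat[OF u(1)[OF x] mult_carrier_mat[OF V(1) A] mult_carrier_mat[OF V'(1) A']]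
          assoc_mult_mat[OF u(1)[OF x] V(1) A] assoc_mult_mat[OF u(1)[OF x] V'(1) A'] ..
      also have "\<dots> = mtrace (\<rho> x * V * mat_adjoint V) + mtrace (\<rho> x * V' * mat_adjoint V')"
        by (rule mtrace_add[OF mult_carrier_mat[OF \<rho>V_carrier[OF x] A] mult_carrier_mat[OF \<rho>V'_carrier[OF x] A']])
      also have "mtrace (\<rho> x * V * mat_adjoint V) = mtrace (?\<pi> x)"
        by (rule mtrace_comm[OF \<rho>V_carrier[OF x] A])
      also have "mtrace (\<rho> x * V' * mat_adjoint V') = mtrace (?\<pi>' x)"
        by (rule mtrace_comm[OF \<rho>V'_carrier[OF x] A'])
      finally show ?thesis .
    qed
    \<comment> \<open>The dimensions are the traces at the identity.\<close>
    have rs: "d = r + s"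
    proof -
      have "complex_of_nat d = of_nat (r + s)"
        using tr[OF one_closed] character_one[OF \<rho>] character_one[OF \<pi>] character_one[OF \<pi>'] by simp
      then show ?thesis by (simp only: of_nat_eq_iff)
    qed
    have "r \<noteq> 0"
    proof
      assume r: "r = 0"
      have "w = 0\<^sub>v d" if "w \<in> W" for w
      proof -
        have "w \<in> carrier_vec d" using W that by (auto simp: vec_subspace_def)
        then have "mat_adjoint V *\<^sub>v w \<in> carrier_vec 0" using A r by simp
        then have "V *\<^sub>v (mat_adjoint V *\<^sub>v w) = 0\<^sub>v d"
          using V(1) r by (auto intro!: eq_vecI simp: scalar_prod_def)
        then show ?thesis using WV[OF that] by simp
      qed
      then show False using 3 W by (auto simp: vec_subspace_def)
    qed
    moreover have "s \<noteq> 0"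
    proof
      assume s: "s = 0"
      have "v \<in> W" if v: "v \<in> carrier_vec d" for v
      proof -
        have "V' * mat_adjoint V' = 0\<^sub>m d d" using V' s by (auto intro!: eq_matI simp: scalar_prod_def)
        then have "V * mat_adjoint V = 1\<^sub>m d" using split V by simp
        then have "V *\<^sub>v (mat_adjoint V *\<^sub>v v) = v" using V A v assoc_mult_mat_vec[OF V(1) A v] by simp
        then show ?thesis using VW[of "mat_adjoint V *\<^sub>v v"] A v by simp
      qed
      then show False using 3 W by (auto simp: vec_subspace_def)
    qed
    ultimately have lt: "r < d" "s < d" using rs by auto
    from less.IH[OF lt(1) \<pi>] obtain ps where ps: "\<forall>(U, \<sigma>) \<in> set ps. \<sigma> \<in> irreps G T \<and> embeds r ?\<pi> U \<sigma>"
      "\<forall>x \<in> carrier G. mtrace (?\<pi> x) = (\<Sum>p\<leftarrow>ps. mtrace (snd p x))" by blast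
    from less.IH[OF lt(2) \<pi>'] obtain qs where qs: "\<forall>(U, \<sigma>) \<in> set qs. \<sigma> \<in> irreps G T \<and> embeds s ?\<pi>' U \<sigma>"
      "\<forall>x \<in> carrier G. mtrace (?\<pi>' x) = (\<Sum>p\<leftarrow>qs. mtrace (snd p x))" by blast
    have comp: "embeds d \<rho> (V * U) \<sigma>"
      if V: "V \<in> carrier_mat d r" "mat_adjoint V * V = 1\<^sub>m r"
        and inv: "\<And>x. x \<in> carrier G \<Longrightarrow> V * (mat_adjoint V * (\<rho> x * V)) = \<rho> x * V"
        and U: "embeds r (\<lambda>x. mat_adjoint V * (\<rho> x * V)) U \<sigma>" and \<sigma>: "\<sigma> \<in> irreps G T" for r V U \<sigma>
    proof -
      let ?q = "rep_dim G \<sigma>"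
      have U': "U \<in> carrier_mat r ?q" "mat_adjoint U * U = 1\<^sub>m ?q"
        "\<And>x. x \<in> carrier G \<Longrightarrow> (mat_adjoint V * (\<rho> x * V)) * U = U * \<sigma> x"
        using U by (auto simp: embeds_def)
      have "mat_adjoint (V * U) * (V * U) = mat_adjoint U * (mat_adjoint V * (V * U))"
        unfolding mat_adjoint_mult[OF V(1) U'(1)]
        by (rule assoc_mult_mat[OF mat_adjoint_carrier[OF U'(1)] mat_adjoint_carrier[OF V(1)] mult_carrier_mat[OF V(1) U'(1)]])
      then have 1: "mat_adjoint (V * U) * (V * U) = 1\<^sub>m ?q"
        using isometry_cancel[OF V U'(1)] U' by simp
      have 2: "\<rho> x * (V * U) = (V * U) * \<sigma> x" if x: "x \<in> carrier G" for x
      proof -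
        have c: "mat_adjoint V * (\<rho> x * V) \<in> carrier_mat r r"
          using V(1) mat_adjoint_carrier[OF V(1)] u(1)[OF x] by (meson mult_carrier_mat)
        have "\<rho> x * (V * U) = (\<rho> x * V) * U" by (rule assoc_mult_mat[OF u(1)[OF x] V(1) U'(1), symmetric])
        also have "\<dots> = (V * (mat_adjoint V * (\<rho> x * V))) * U" by (simp only: inv[OF x])
        also have "\<dots> = V * ((mat_adjoint V * (\<rho> x * V)) * U)" by (rule assoc_mult_mat[OF V(1) c U'(1)])
        also have "\<dots> = V * (U * \<sigma> x)" by (simp only: U'(3)[OF x])
        also have "\<dots> = (V * U) * \<sigma> x"
          by (rule assoc_mult_mat[OF V(1) U'(1) unitary_repD(1)[OF irrepsD(1)[OF \<sigma>] x], symmetric])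
        finally show ?thesis .
      qed
      show ?thesis using 1 2 mult_carrier_mat[OF V(1) U'(1)] by (auto simp: embeds_def)
    qed
    let ?qs = "map (\<lambda>(U, \<sigma>). (V * U, \<sigma>)) ps @ map (\<lambda>(U, \<sigma>). (V' * U, \<sigma>)) qs"
    have "\<forall>(U, \<sigma>) \<in> set ?qs. \<sigma> \<in> irreps G T \<and> embeds d \<rho> U \<sigma>"
      using ps(1) qs(1) comp[OF V inv] comp[OF V' inv'] by fastforce
    moreover have "mtrace (\<rho> x) = (\<Sum>p\<leftarrow>?qs. mtrace (snd p x))" if x: "x \<in> carrier G" for x
      using ps(2) qs(2) x by (simp add: tr o_def case_prod_beta)
    ultimately show ?thesis by blast
  qed
qed

end

section \<open>Harmonic analysis of class functions\<close>

lemma continuous_map_cnj: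
  "continuous_map M euclidean f \<Longrightarrow> continuous_map M euclidean (\<lambda>x. cnj (f x))"
  using continuous_map_compose[of M euclidean f euclidean cnj]
  by (simp add: o_def continuous_on_cnj continuous_on_id)

lemma continuous_map_approx:
  fixes f :: "'a \<Rightarrow> complex"
  assumes "\<And>\<epsilon>. \<epsilon> > 0 \<Longrightarrow> \<exists>g. continuous_map M euclidean g \<and> (\<forall>x \<in> topspace M. cmod (g x - f x) \<le> \<epsilon>)"
  shows "continuous_map M euclidean f"
proof -
  obtain g where g: "\<And>n. continuous_map M euclidean (g n)"
    "\<And>n x. x \<in> topspace M \<Longrightarrow> cmod (g n x - f x) \<le> inverse (real (Suc n))"
    using assms[of "inverse (real (Suc _))"] by (metis inverse_positive_iff_positive of_nat_0_less_iff zero_less_Suc)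
  have "continuous_map M Met_TC.mtopology f"
  proof (rule Met_TC.continuous_map_uniform_limit)
    show "\<forall>\<^sub>F n in sequentially. continuous_map M Met_TC.mtopology (g n)"
      using g(1) by simp
    fix \<epsilon> :: real assume "\<epsilon> > 0"
    then have "\<forall>\<^sub>F n in sequentially. inverse (real (Suc n)) < \<epsilon>"
      using LIMSEQ_inverse_real_of_nat by (rule order_tendstoD(2)[rotated])
    then show "\<forall>\<^sub>F n in sequentially. \<forall>x\<in>topspace M. f x \<in> UNIV \<and> dist (g n x) (f x) < \<epsilon>"
      by eventually_elim (auto simp: dist_norm intro: le_less_trans[OF g(2)])
  qed simp
  then show ?thesis by simp
qed

text \<open>These are the facts about Haar measure that the analysis uses. They are assumed here so
  that it does not depend on how the definite description \<open>haar_measure\<close> is evaluated;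
  for products of finite groups they are proved from the product measure.\<close>

locale haar_grp = compact_grp +
  assumes prob_haar: "prob_space (haar_measure G T)"
    and space_haar: "space (haar_measure G T) = carrier G"
    and continuous_measurable:
      "\<And>f :: 'a \<Rightarrow> complex. continuous_map T euclidean f \<Longrightarrow> f \<in> borel_measurable (haar_measure G T)"
    and haar_left: "\<And>(f :: 'a \<Rightarrow> complex) g. continuous_map T euclidean f \<Longrightarrow> g \<in> carrier G \<Longrightarrow>
      (\<integral>x. f (g \<otimes> x) \<partial>haar_measure G T) = (\<integral>x. f x \<partial>haar_measure G T)"
    and haar_right: "\<And>(f :: 'a \<Rightarrow> complex) g. continuous_map T euclidean f \<Longrightarrow> g \<in> carrier G \<Longrightarrow>
      (\<integral>x. f (x \<otimes> g) \<partial>haar_measure G T) = (\<integral>x. f x \<partial>haar_measure G T)"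
begin

abbreviation haar where "haar \<equiv> haar_measure G T"

abbreviation cont :: "('a \<Rightarrow> complex) \<Rightarrow> bool" where "cont \<equiv> continuous_map T euclidean"

section \<open>Integration of continuous functions\<close>

lemma continuous_bounded:
  assumes "cont f" obtains B where "\<And>x. x \<in> carrier G \<Longrightarrow> cmod (f x) \<le> B"
proof -
  have "compactin euclidean (f ` topspace T)"
    using assms compact_space by (intro image_compactin[of T]) (auto simp: compact_space_def)
  then have "bounded (f ` carrier G)"
    by (simp add: topspace_eq compact_imp_bounded)
  then show ?thesis using that by (auto simp: bounded_iff)
qed

lemma integrable_continuous: "cont f \<Longrightarrow> integrable haar f"
proof -
  assume f: "cont f"
  interpret prob_space haar by (rule prob_haar)
  obtain B where "\<And>x. x \<in> carrier G \<Longrightarrow> cmod (f x) \<le> B" using continuous_bounded[OF f] by blast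
  then show "integrable haar f"
    by (intro integrable_const_bound[of _ B] continuous_measurable f AE_I2) (auto simp: space_haar)
qed

lemma integral_norm_le:
  assumes f: "cont f" and B: "\<And>x. x \<in> carrier G \<Longrightarrow> cmod (f x) \<le> B"
  shows "cmod (\<integral>x. f x \<partial>haar) \<le> B"
proof -
  interpret prob_space haar by (rule prob_haar)
  have "cmod (\<integral>x. f x \<partial>haar) \<le> (\<integral>x. cmod (f x) \<partial>haar)" by (rule integral_norm_bound)
  also have "\<dots> \<le> (\<integral>x. B \<partial>haar)"
    using B integrable_continuous[OF f] by (intro integral_mono) (auto simp: space_haar)
  also have "\<dots> = B" by (simp add: prob_space)
  finally show ?thesis .
qed

lemma integral_const [simp]: "(\<integral>x. c \<partial>haar) = (c :: complex)"
proof -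
  interpret prob_space haar by (rule prob_haar)
  show ?thesis by (simp add: prob_space)
qed

lemma integral_cong_carrier:
  fixes f g :: "'a \<Rightarrow> complex"
  shows "(\<And>x. x \<in> carrier G \<Longrightarrow> f x = g x) \<Longrightarrow> (\<integral>x. f x \<partial>haar) = (\<integral>x. g x \<partial>haar)"
  by (intro Bochner_Integration.integral_cong) (auto simp: space_haar)

lemma haar_conj:
  assumes f: "cont f" and g: "g \<in> carrier G"
  shows "(\<integral>x. f (g \<otimes> x \<otimes> inv g) \<partial>haar) = (\<integral>x. f x \<partial>haar)"
proof -
  have "cont (\<lambda>x. f (x \<otimes> inv g))"
    using continuous_map_compose[OF continuous_mult_right f, of "inv g"] g by (simp add: o_def)
  from haar_left[OF this g] haar_right[OF f, of "inv g"] g show ?thesis by simp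
qed

lemma cont_entry_cnj:
  "unitary_rep G T d \<pi> \<Longrightarrow> j < d \<Longrightarrow> k < d \<Longrightarrow> cont (\<lambda>x. cnj (\<pi> x $$ (j, k)))"
  by (intro continuous_map_cnj unitary_rep_continuous)

lemma cont_translate: "cont f \<Longrightarrow> g \<in> carrier G \<Longrightarrow> cont (\<lambda>x. f (g \<otimes> x))"
  using continuous_map_compose[OF continuous_mult_left, of g euclidean f] by (simp add: o_def)

subsection \<open>Orthogonality relations\<close>

text \<open>\<open>M\<close> is the average of \<open>\<rho> s * E * mat_adjoint (\<pi> s)\<close>
  for the matrix unit \<open>E\<close> at \<open>(j, k)\<close>; translating the integration
  variable by \<open>inv t\<close> moves \<open>\<rho> t\<close> across.\<close>

lemma average_intertwines:
  assumes \<pi>: "unitary_rep G T d \<pi>" and \<rho>: "unitary_rep G T e \<rho>" and jk: "j < e" "k < d"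
    and t: "t \<in> carrier G"
  defines "M \<equiv> mat e d (\<lambda>(a, b). \<integral>s. \<rho> s $$ (a, j) * cnj (\<pi> s $$ (b, k)) \<partial>haar)"
  shows "\<rho> t * M = M * \<pi> t"
proof (rule eq_matI)
  have M: "M \<in> carrier_mat e d" by (simp add: M_def)
  note c = unitary_rep_continuous[OF \<rho>] cont_entry_cnj[OF \<pi>]
  have int: "integrable haar (\<lambda>s. \<rho> s $$ (a, j) * cnj (\<pi> s $$ (b, k)))" if "a < e" "b < d" for a b
    using c that jk by (intro integrable_continuous continuous_map_normed_mult)
  show "dim_row (\<rho> t * M) = dim_row (M * \<pi> t)" "dim_col (\<rho> t * M) = dim_col (M * \<pi> t)"
    using M unitary_rep_dims[OF \<rho> t] unitary_rep_dims[OF \<pi> t] by auto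
  fix a b assume "a < dim_row (M * \<pi> t)" "b < dim_col (M * \<pi> t)"
  then have ab: "a < e" "b < d" using M unitary_rep_dims[OF \<pi> t] by auto
  have "(\<rho> t * M) $$ (a, b) = (\<Sum>i<e. \<rho> t $$ (a, i) * (\<integral>s. \<rho> s $$ (i, j) * cnj (\<pi> s $$ (b, k)) \<partial>haar))"
    using index_mult_mat_sum[OF unitary_repD(1)[OF \<rho> t] M ab] ab by (simp add: M_def)
  also have "\<dots> = (\<integral>s. (\<Sum>i<e. \<rho> t $$ (a, i) * (\<rho> s $$ (i, j) * cnj (\<pi> s $$ (b, k)))) \<partial>haar)"
    using int ab by (subst Bochner_Integration.integral_sum) auto
  also have "\<dots> = (\<integral>s. \<rho> (t \<otimes> s) $$ (a, j) * cnj (\<pi> s $$ (b, k)) \<partial>haar)"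
    using index_mult_mat_sum[OF unitary_repD(1)[OF \<rho> t] unitary_repD(1)[OF \<rho>] ab(1) jk(1)]
    by (intro integral_cong_carrier) (simp add: unitary_repD(4)[OF \<rho> t] sum_distrib_right mult.assoc)
  also have "\<dots> = (\<integral>s. \<rho> (t \<otimes> (inv t \<otimes> s)) $$ (a, j) * cnj (\<pi> (inv t \<otimes> s) $$ (b, k)) \<partial>haar)"
    using c ab jk t by (intro haar_left[symmetric] continuous_map_normed_mult cont_translate) auto
  also have "\<dots> = (\<integral>s. (\<Sum>i<d. \<pi> t $$ (i, b) * (\<rho> s $$ (a, j) * cnj (\<pi> s $$ (i, k)))) \<partial>haar)"
  proof (rule integral_cong_carrier)
    fix s assume s: "s \<in> carrier G"
    have it: "inv t \<in> carrier G" using t by simp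
    have "\<pi> (inv t \<otimes> s) $$ (b, k) = (\<Sum>i<d. cnj (\<pi> t $$ (i, b)) * \<pi> s $$ (i, k))"
      unfolding unitary_repD(4)[OF \<pi> it s] unitary_rep_inv[OF \<pi> t]
        index_mult_mat_sum[OF mat_adjoint_carrier[OF unitary_repD(1)[OF \<pi> t]] unitary_repD(1)[OF \<pi> s] ab(2) jk(2)]
      using ab unitary_rep_dims[OF \<pi> t] by simp
    moreover have "t \<otimes> (inv t \<otimes> s) = s" using t s by (simp add: m_assoc[symmetric])
    ultimately show "\<rho> (t \<otimes> (inv t \<otimes> s)) $$ (a, j) * cnj (\<pi> (inv t \<otimes> s) $$ (b, k))
        = (\<Sum>i<d. \<pi> t $$ (i, b) * (\<rho> s $$ (a, j) * cnj (\<pi> s $$ (i, k))))"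
      by (simp add: sum_distrib_left mult_ac)
  qed
  also have "\<dots> = (\<Sum>i<d. M $$ (a, i) * \<pi> t $$ (i, b))"
    using int ab by (subst Bochner_Integration.integral_sum) (auto simp: M_def mult.commute)
  also have "\<dots> = (M * \<pi> t) $$ (a, b)"
    using index_mult_mat_sum[OF M unitary_repD(1)[OF \<pi> t] ab] by simp
  finally show "(\<rho> t * M) $$ (a, b) = (M * \<pi> t) $$ (a, b)" .
qed

lemma character_inner:
  assumes \<pi>: "unitary_rep G T d \<pi>" and \<rho>: "unitary_rep G T e \<rho>"
  shows "(\<integral>s. mtrace (\<rho> s) * cnj (mtrace (\<pi> s)) \<partial>haar)
    = (\<Sum>j<e. \<Sum>k<d. \<integral>s. \<rho> s $$ (j, j) * cnj (\<pi> s $$ (k, k)) \<partial>haar)"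
proof -
  have "(\<integral>s. mtrace (\<rho> s) * cnj (mtrace (\<pi> s)) \<partial>haar)
      = (\<integral>s. (\<Sum>j<e. \<Sum>k<d. \<rho> s $$ (j, j) * cnj (\<pi> s $$ (k, k))) \<partial>haar)"
    by (intro integral_cong_carrier)
       (simp add: mtrace_def unitary_rep_dims[OF \<pi>] unitary_rep_dims[OF \<rho>] sum_product)
  also have "\<dots> = (\<Sum>j<e. \<integral>s. (\<Sum>k<d. \<rho> s $$ (j, j) * cnj (\<pi> s $$ (k, k))) \<partial>haar)"
    using unitary_rep_continuous[OF \<rho>] cont_entry_cnj[OF \<pi>]
    by (intro Bochner_Integration.integral_sum integrable_continuous continuous_map_sum continuous_map_normed_mult) auto
  also have "\<dots> = (\<Sum>j<e. \<Sum>k<d. \<integral>s. \<rho> s $$ (j, j) * cnj (\<pi> s $$ (k, k)) \<partial>haar)"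
    using unitary_rep_continuous[OF \<rho>] cont_entry_cnj[OF \<pi>]
    by (intro sum.cong refl Bochner_Integration.integral_sum integrable_continuous continuous_map_normed_mult) auto
  finally show ?thesis .
qed

lemma character_orthogonal:
  assumes \<pi>: "\<pi> \<in> irreps G T" and \<rho>: "\<rho> \<in> irreps G T" and ne: "\<not> unitarily_equivalent G \<pi> \<rho>"
  shows "(\<integral>s. mtrace (\<rho> s) * cnj (mtrace (\<pi> s)) \<partial>haar) = 0"
  unfolding character_inner[OF irrepsD(1)[OF \<pi>] irrepsD(1)[OF \<rho>]]
proof (intro sum.neutral ballI)
  let ?d = "rep_dim G \<pi>" and ?e = "rep_dim G \<rho>"
  fix j k assume "j \<in> {..<?e}" "k \<in> {..<?d}"
  then have jk: "j < ?e" "k < ?d" by auto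
  let ?M = "mat ?e ?d (\<lambda>(a, b). \<integral>s. \<rho> s $$ (a, j) * cnj (\<pi> s $$ (b, k)) \<partial>haar)"
  have "?M = 0\<^sub>m ?e ?d"
    using schur_intertwiner[OF \<pi> \<rho>, of ?M] average_intertwines[OF irrepsD(1)[OF \<pi>] irrepsD(1)[OF \<rho>] jk] ne
    by auto
  then have "?M $$ (j, k) = 0" using jk by simp
  then show "(\<integral>s. \<rho> s $$ (j, j) * cnj (\<pi> s $$ (k, k)) \<partial>haar) = 0" using jk by simp
qed

text \<open>The averaged matrix is a scalar \<open>c\<close>. Its trace is the \<open>(k, j)\<close>
  entry of \<open>mat_adjoint (\<pi> s) * \<pi> s\<close>, which is 1 or 0, so \<open>c\<close> is
  \<open>1 / d\<close> for \<open>j = k\<close> and 0 otherwise.\<close>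

lemma character_norm:
  assumes \<pi>: "\<pi> \<in> irreps G T"
  shows "(\<integral>s. mtrace (\<pi> s) * cnj (mtrace (\<pi> s)) \<partial>haar) = 1"
proof -
  let ?d = "rep_dim G \<pi>"
  note u = irrepsD(1)[OF \<pi>]
  have d: "?d > 0" by (rule irrepsD(2)[OF \<pi>])
  have *: "(\<integral>s. \<pi> s $$ (j, j) * cnj (\<pi> s $$ (k, k)) \<partial>haar) = (if j = k then 1 / of_nat ?d else 0)"
    if jk: "j < ?d" "k < ?d" for j k
  proof -
    define M where "M = mat ?d ?d (\<lambda>(a, b). \<integral>s. \<pi> s $$ (a, j) * cnj (\<pi> s $$ (b, k)) \<partial>haar)"
    have M: "M \<in> carrier_mat ?d ?d" by (simp add: M_def)
    have "M * \<pi> x = \<pi> x * M" if "x \<in> carrier G" for x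
      unfolding M_def using average_intertwines[OF u u jk that] by simp
    then obtain c where c: "M = c \<cdot>\<^sub>m 1\<^sub>m ?d" using schur_commute[OF \<pi> M] by blast
    have "of_nat ?d * c = mtrace M" unfolding c by (simp add: mtrace_smult[of _ ?d])
    also have "\<dots> = (\<Sum>a<?d. \<integral>s. \<pi> s $$ (a, j) * cnj (\<pi> s $$ (a, k)) \<partial>haar)"
      by (simp add: mtrace_def M_def)
    also have "\<dots> = (\<integral>s. (\<Sum>a<?d. \<pi> s $$ (a, j) * cnj (\<pi> s $$ (a, k))) \<partial>haar)"
      using unitary_rep_continuous[OF u] cont_entry_cnj[OF u] jk
      by (intro Bochner_Integration.integral_sum[symmetric] integrable_continuous continuous_map_normed_mult) auto
    also have "\<dots> = (\<integral>s. (if j = k then 1 else 0) \<partial>haar)"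
    proof (rule integral_cong_carrier)
      fix s assume s: "s \<in> carrier G"
      have "(mat_adjoint (\<pi> s) * \<pi> s) $$ (k, j) = (\<Sum>a<?d. cnj (\<pi> s $$ (a, k)) * \<pi> s $$ (a, j))"
        using index_mult_mat_sum[OF mat_adjoint_carrier[OF unitary_repD(1)[OF u s]] unitary_repD(1)[OF u s] jk(2,1)]
          jk unitary_rep_dims[OF u s] by simp
      then show "(\<Sum>a<?d. \<pi> s $$ (a, j) * cnj (\<pi> s $$ (a, k))) = (if j = k then 1 else 0)"
        unfolding unitary_repD(2)[OF u s] using jk by (auto simp: mult.commute)
    qed
    also have "\<dots> = (if j = k then 1 else 0)" by (rule integral_const)
    finally have "c = (if j = k then 1 / of_nat ?d else 0)" using d by (auto simp: field_simps)
    moreover have "(\<integral>s. \<pi> s $$ (j, j) * cnj (\<pi> s $$ (k, k)) \<partial>haar) = M $$ (j, k)" using jk by (simp add: M_def)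
    ultimately show ?thesis using jk by (simp add: c)
  qed
  have "(\<integral>s. mtrace (\<pi> s) * cnj (mtrace (\<pi> s)) \<partial>haar) = (\<Sum>j<?d. \<Sum>k<?d. if j = k then 1 / of_nat ?d else 0)"
    unfolding character_inner[OF u u] using * by (intro sum.cong refl) auto
  also have "\<dots> = 1" using d by (simp add: sum.delta)
  finally show ?thesis .
qed

subsection \<open>Fourier coefficients of class functions\<close>

definition class_fun :: "('a \<Rightarrow> complex) \<Rightarrow> bool" where
  "class_fun u \<longleftrightarrow> cont u \<and> (\<forall>x. x \<notin> carrier G \<longrightarrow> u x = 0) \<and>
     (\<forall>x \<in> carrier G. \<forall>y \<in> carrier G. u (x \<otimes> y \<otimes> inv x) = u y)"

lemma class_funD:
  assumes "class_fun u"
  shows "cont u" "x \<notin> carrier G \<Longrightarrow> u x = 0"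
    "x \<in> carrier G \<Longrightarrow> y \<in> carrier G \<Longrightarrow> u (x \<otimes> y \<otimes> inv x) = u y"
  using assms by (auto simp: class_fun_def)

text \<open>Conjugation invariance of \<open>u\<close> and of the measure make the coefficient
  commute with the representation. The argument runs with the conjugate matrix \<open>N\<close>, so
  that Schur's lemma is applied to \<open>\<pi>\<close> itself and not to its conjugate.\<close>

lemma fourier_coeff_class_fun:
  assumes u: "class_fun u" and \<pi>: "\<pi> \<in> irreps G T"
  shows "fourier_coeff G T u \<pi>
    = ((\<integral>s. u s * cnj (mtrace (\<pi> s)) \<partial>haar) / of_nat (rep_dim G \<pi>)) \<cdot>\<^sub>m 1\<^sub>m (rep_dim G \<pi>)"
proof -
  let ?d = "rep_dim G \<pi>"
  note r = irrepsD(1)[OF \<pi>]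
  define N where "N = mat ?d ?d (\<lambda>(j, k). \<integral>s. cnj (u s) * \<pi> s $$ (j, k) \<partial>haar)"
  have N: "N \<in> carrier_mat ?d ?d" by (simp add: N_def)
  have cu: "cont u" "cont (\<lambda>s. cnj (u s))" using class_funD(1)[OF u] by (auto intro: continuous_map_cnj)
  have int: "integrable haar (\<lambda>s. cnj (u s) * \<pi> s $$ (j, k))" if "j < ?d" "k < ?d" for j k
    using unitary_rep_continuous[OF r] cu that by (intro integrable_continuous continuous_map_normed_mult)
  have "N * \<pi> t = \<pi> t * N" if t: "t \<in> carrier G" for t
  proof (rule eq_matI)
    show "dim_row (N * \<pi> t) = dim_row (\<pi> t * N)" "dim_col (N * \<pi> t) = dim_col (\<pi> t * N)"
      using N unitary_rep_dims[OF r t] by auto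
    fix j k assume "j < dim_row (\<pi> t * N)" "k < dim_col (\<pi> t * N)"
    then have jk: "j < ?d" "k < ?d" using N unitary_rep_dims[OF r t] by auto
    have c1: "cont (\<lambda>s. cnj (u s) * \<pi> (t \<otimes> s) $$ (j, k))"
      using cu(2) cont_translate[OF unitary_rep_continuous[OF r jk] t] by (rule continuous_map_normed_mult)
    have "(N * \<pi> t) $$ (j, k) = (\<Sum>i<?d. (\<integral>s. cnj (u s) * \<pi> s $$ (j, i) \<partial>haar) * \<pi> t $$ (i, k))"
      using index_mult_mat_sum[OF N unitary_repD(1)[OF r t] jk] jk by (simp add: N_def)
    also have "\<dots> = (\<integral>s. (\<Sum>i<?d. cnj (u s) * \<pi> s $$ (j, i) * \<pi> t $$ (i, k)) \<partial>haar)"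
      using int jk by (subst Bochner_Integration.integral_sum) auto
    \<comment> \<open>Prepares the substitution of \<open>s\<close> by its conjugate
      \<open>inv t \<otimes> s \<otimes> t\<close>: \<open>u\<close> does not notice it, and it
      turns \<open>s \<otimes> t\<close> into \<open>t\<close> times the new variable.\<close>
    also have "\<dots> = (\<integral>s. cnj (u (inv t \<otimes> s \<otimes> inv (inv t))) * \<pi> (t \<otimes> (inv t \<otimes> s \<otimes> inv (inv t))) $$ (j, k) \<partial>haar)"
    proof (rule integral_cong_carrier)
      fix s assume s: "s \<in> carrier G"
      have "t \<otimes> (inv t \<otimes> s \<otimes> inv (inv t)) = s \<otimes> t" using s t by (simp add: m_assoc[symmetric])
      moreover have "u (inv t \<otimes> s \<otimes> inv (inv t)) = u s" using s t by (intro class_funD(3)[OF u]) auto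
      ultimately show "(\<Sum>i<?d. cnj (u s) * \<pi> s $$ (j, i) * \<pi> t $$ (i, k))
          = cnj (u (inv t \<otimes> s \<otimes> inv (inv t))) * \<pi> (t \<otimes> (inv t \<otimes> s \<otimes> inv (inv t))) $$ (j, k)"
        using index_mult_mat_sum[OF unitary_repD(1)[OF r s] unitary_repD(1)[OF r t] jk]
        by (simp add: unitary_repD(4)[OF r s t] sum_distrib_left mult.assoc)
    qed
    also have "\<dots> = (\<integral>s. cnj (u s) * \<pi> (t \<otimes> s) $$ (j, k) \<partial>haar)"
      using t by (intro haar_conj[OF c1]) auto
    also have "\<dots> = (\<integral>s. (\<Sum>i<?d. \<pi> t $$ (j, i) * (cnj (u s) * \<pi> s $$ (i, k))) \<partial>haar)"
      using index_mult_mat_sum[OF unitary_repD(1)[OF r t] unitary_repD(1)[OF r] jk]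
      by (intro integral_cong_carrier) (simp add: unitary_repD(4)[OF r t] sum_distrib_left mult_ac)
    also have "\<dots> = (\<Sum>i<?d. \<pi> t $$ (j, i) * N $$ (i, k))"
      using int jk by (subst Bochner_Integration.integral_sum) (auto simp: N_def)
    also have "\<dots> = (\<pi> t * N) $$ (j, k)" using index_mult_mat_sum[OF unitary_repD(1)[OF r t] N jk] by simp
    finally show "(N * \<pi> t) $$ (j, k) = (\<pi> t * N) $$ (j, k)" .
  qed
  then obtain c where c: "N = c \<cdot>\<^sub>m 1\<^sub>m ?d" using schur_commute[OF \<pi> N] by blast
  have ent: "(\<integral>s. u s * cnj (\<pi> s $$ (j, k)) \<partial>haar) = (if j = k then cnj c else 0)" if jk: "j < ?d" "k < ?d" for j k
  proof -
    have "(\<integral>s. u s * cnj (\<pi> s $$ (j, k)) \<partial>haar) = cnj (\<integral>s. cnj (u s) * \<pi> s $$ (j, k) \<partial>haar)"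
      using Bochner_Integration.integral_cnj[of haar "\<lambda>s. cnj (u s) * \<pi> s $$ (j, k)"] by (simp del: Bochner_Integration.integral_cnj)
    also have "\<dots> = cnj (N $$ (j, k))" using jk by (simp add: N_def)
    finally show ?thesis using jk by (simp add: c)
  qed
  have "(\<integral>s. u s * cnj (mtrace (\<pi> s)) \<partial>haar) = (\<integral>s. (\<Sum>j<?d. u s * cnj (\<pi> s $$ (j, j))) \<partial>haar)"
    by (intro integral_cong_carrier) (simp add: mtrace_def unitary_rep_dims[OF r] sum_distrib_left)
  also have "\<dots> = (\<Sum>j<?d. \<integral>s. u s * cnj (\<pi> s $$ (j, j)) \<partial>haar)"
    using cont_entry_cnj[OF r] cu
    by (intro Bochner_Integration.integral_sum integrable_continuous continuous_map_normed_mult) auto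
  also have "\<dots> = of_nat ?d * cnj c" using ent by simp
  finally have "cnj c = (\<integral>s. u s * cnj (mtrace (\<pi> s)) \<partial>haar) / of_nat ?d"
    using irrepsD(2)[OF \<pi>] by simp
  then show ?thesis
    unfolding fourier_coeff_def using ent by (intro eq_matI) auto
qed

text \<open>Convolution by a class function acts on each irreducible character as a scalar. This is
  what converts averages against a character into Fourier sums.\<close>

lemma convolve_character:
  assumes u: "class_fun u" and \<pi>: "\<pi> \<in> irreps G T" and x: "x \<in> carrier G"
  shows "(\<integral>z. u z * mtrace (\<pi> (inv z \<otimes> x)) \<partial>haar)
    = (\<integral>s. u s * cnj (mtrace (\<pi> s)) \<partial>haar) / of_nat (rep_dim G \<pi>) * mtrace (\<pi> x)"
proof -
  let ?d = "rep_dim G \<pi>"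
  note r = irrepsD(1)[OF \<pi>]
  let ?a = "(\<integral>s. u s * cnj (mtrace (\<pi> s)) \<partial>haar) / of_nat ?d"
  have ent: "(\<integral>s. u s * cnj (\<pi> s $$ (j, k)) \<partial>haar) = (if j = k then ?a else 0)" if jk: "j < ?d" "k < ?d" for j k
  proof -
    have "fourier_coeff G T u \<pi> $$ (j, k) = (\<integral>s. u s * cnj (\<pi> s $$ (j, k)) \<partial>haar)"
      using jk by (simp add: fourier_coeff_def)
    then show ?thesis unfolding fourier_coeff_class_fun[OF u \<pi>] using jk by auto
  qed
  have int: "integrable haar (\<lambda>s. u s * cnj (\<pi> s $$ (j, k)))" if "j < ?d" "k < ?d" for j k
    using cont_entry_cnj[OF r] class_funD(1)[OF u] that by (intro integrable_continuous continuous_map_normed_mult)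
  have "(\<integral>z. u z * mtrace (\<pi> (inv z \<otimes> x)) \<partial>haar)
      = (\<integral>z. (\<Sum>j<?d. \<Sum>k<?d. u z * cnj (\<pi> z $$ (k, j)) * \<pi> x $$ (k, j)) \<partial>haar)"
  proof (rule integral_cong_carrier)
    fix z assume z: "z \<in> carrier G"
    have iz: "inv z \<in> carrier G" using z by simp
    have "\<pi> (inv z \<otimes> x) $$ (j, j) = (\<Sum>k<?d. cnj (\<pi> z $$ (k, j)) * \<pi> x $$ (k, j))" if j: "j < ?d" for j
      unfolding unitary_repD(4)[OF r iz x] unitary_rep_inv[OF r z]
        index_mult_mat_sum[OF mat_adjoint_carrier[OF unitary_repD(1)[OF r z]] unitary_repD(1)[OF r x] j j]
      using j unitary_rep_dims[OF r z] by simp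
    then show "u z * mtrace (\<pi> (inv z \<otimes> x)) = (\<Sum>j<?d. \<Sum>k<?d. u z * cnj (\<pi> z $$ (k, j)) * \<pi> x $$ (k, j))"
      unfolding mtrace_def unitary_rep_dims(1)[OF r m_closed[OF iz x]]
      by (simp add: sum_distrib_left mult.assoc)
  qed
  also have "\<dots> = (\<Sum>j<?d. \<Sum>k<?d. (\<integral>z. u z * cnj (\<pi> z $$ (k, j)) \<partial>haar) * \<pi> x $$ (k, j))"
    using int by (subst Bochner_Integration.integral_sum) (auto simp: Bochner_Integration.integral_sum intro!: sum.cong Bochner_Integration.integrable_sum)
  also have "\<dots> = (\<Sum>j<?d. \<Sum>k<?d. if k = j then ?a * \<pi> x $$ (k, j) else 0)"
    using ent by (intro sum.cong refl) auto
  also have "\<dots> = ?a * mtrace (\<pi> x)"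
    by (simp add: sum.delta mtrace_def unitary_rep_dims[OF r x] sum_distrib_left)
  finally show ?thesis .
qed

subsection \<open>The dual object\<close>

abbreviation dual where "dual \<equiv> dual_object G T"

text \<open>The same choice of representative as in \<open>fourier_term\<close>, so that the two can
  be compared literally.\<close>

definition repr :: "('a \<Rightarrow> complex mat) set \<Rightarrow> 'a \<Rightarrow> complex mat" where
  "repr c = (SOME \<pi>. \<pi> \<in> c)"

definition cdim :: "('a \<Rightarrow> complex mat) set \<Rightarrow> nat" where
  "cdim c = rep_dim G (repr c)"

definition char_fun :: "('a \<Rightarrow> complex mat) \<Rightarrow> 'a \<Rightarrow> complex" where
  "char_fun \<pi> x = (if x \<in> carrier G then mtrace (\<pi> x) else 0)"

definition ch :: "('a \<Rightarrow> complex mat) set \<Rightarrow> 'a \<Rightarrow> complex" where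
  "ch c = char_fun (repr c)"

definition coef :: "('a \<Rightarrow> complex) \<Rightarrow> ('a \<Rightarrow> complex mat) set \<Rightarrow> complex" where
  "coef u c = (\<integral>s. u s * cnj (ch c s) \<partial>haar)"

lemma equiv_unitarily_equivalent:
  "equiv (irreps G T) {(\<pi>, \<rho>). \<pi> \<in> irreps G T \<and> \<rho> \<in> irreps G T \<and> unitarily_equivalent G \<pi> \<rho>}"
proof (rule equivI)
  show "refl_on (irreps G T) {(\<pi>, \<rho>). \<pi> \<in> irreps G T \<and> \<rho> \<in> irreps G T \<and> unitarily_equivalent G \<pi> \<rho>}"
    by (auto simp: refl_on_def unitarily_equivalent_refl)
  show "sym {(\<pi>, \<rho>). \<pi> \<in> irreps G T \<and> \<rho> \<in> irreps G T \<and> unitarily_equivalent G \<pi> \<rho>}"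
    by (auto simp: sym_def intro: unitarily_equivalent_sym)
  show "trans {(\<pi>, \<rho>). \<pi> \<in> irreps G T \<and> \<rho> \<in> irreps G T \<and> unitarily_equivalent G \<pi> \<rho>}"
    unfolding trans_def using unitarily_equivalent_trans by blast
qed auto

lemma repr_mem: "c \<in> dual \<Longrightarrow> repr c \<in> c"
proof -
  assume "c \<in> dual"
  then have "c \<noteq> {}" using in_quotient_imp_non_empty[OF equiv_unitarily_equivalent] by (simp add: dual_object_def)
  then show ?thesis unfolding repr_def by (simp add: some_in_eq)
qed

lemma repr_irreps: "c \<in> dual \<Longrightarrow> repr c \<in> irreps G T"
  using repr_mem in_quotient_imp_subset[OF equiv_unitarily_equivalent] unfolding dual_object_def by blast

lemma repr_inequivalent:
  assumes c: "c \<in> dual" "c' \<in> dual" and eq: "unitarily_equivalent G (repr c) (repr c')"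
  shows "c = c'"
  using quotient_eqI[OF equiv_unitarily_equivalent, of c c' "repr c" "repr c'"] c eq repr_mem repr_irreps
  by (auto simp: dual_object_def)

lemma dual_exists:
  assumes \<pi>: "\<pi> \<in> irreps G T"
  obtains c where "c \<in> dual" "unitarily_equivalent G \<pi> (repr c)"
proof -
  let ?R = "{(\<pi>, \<rho>). \<pi> \<in> irreps G T \<and> \<rho> \<in> irreps G T \<and> unitarily_equivalent G \<pi> \<rho>}"
  have c: "?R `` {\<pi>} \<in> dual" unfolding dual_object_def using \<pi> by (rule quotientI)
  from repr_mem[OF this] have "unitarily_equivalent G \<pi> (repr (?R `` {\<pi>}))" by blast
  with c show ?thesis by (rule that)
qed

lemma cdim_pos: "c \<in> dual \<Longrightarrow> cdim c > 0"
  and repr_rep: "c \<in> dual \<Longrightarrow> unitary_rep G T (cdim c) (repr c)"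
  using irrepsD(1,2)[OF repr_irreps] by (simp_all add: cdim_def)

lemma class_fun_char_fun: "unitary_rep G T d \<pi> \<Longrightarrow> class_fun (char_fun \<pi>)"
proof -
  assume \<pi>: "unitary_rep G T d \<pi>"
  have "cont (char_fun \<pi>)"
    using continuous_character[OF \<pi>] by (rule continuous_map_eq) (simp add: char_fun_def topspace_eq)
  then show ?thesis by (simp add: class_fun_def char_fun_def character_conj[OF \<pi>])
qed

lemma char_fun_le: "unitary_rep G T d \<pi> \<Longrightarrow> cmod (char_fun \<pi> x) \<le> d"
  by (simp add: char_fun_def character_le)

lemma char_fun_eq:
  "\<pi> \<in> irreps G T \<Longrightarrow> \<rho> \<in> irreps G T \<Longrightarrow> unitarily_equivalent G \<pi> \<rho> \<Longrightarrow> char_fun \<pi> = char_fun \<rho>"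
  by (rule ext) (simp add: char_fun_def unitarily_equivalent_character)

lemma class_fun_ch: "c \<in> dual \<Longrightarrow> class_fun (ch c)"
  unfolding ch_def by (rule class_fun_char_fun[OF repr_rep])

lemma ch_le: "c \<in> dual \<Longrightarrow> cmod (ch c x) \<le> cdim c"
  unfolding ch_def by (rule char_fun_le[OF repr_rep])

lemma irrep_char_fun:
  assumes "\<pi> \<in> irreps G T"
  obtains c where "c \<in> dual" "char_fun \<pi> = ch c" "cdim c = rep_dim G \<pi>"
proof -
  obtain c where c: "c \<in> dual" "unitarily_equivalent G \<pi> (repr c)" using dual_exists[OF assms] by blast
  have "char_fun \<pi> = ch c" unfolding ch_def by (rule char_fun_eq[OF assms repr_irreps[OF c(1)] c(2)])
  moreover have "cdim c = rep_dim G \<pi>" using c(2) by (simp add: cdim_def unitarily_equivalent_def)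
  ultimately show ?thesis using c(1) that by blast
qed

lemma coef_ch:
  assumes "c \<in> dual" "c' \<in> dual" shows "coef (ch c) c' = (if c = c' then 1 else 0)"
proof -
  have "coef (ch c) c' = (\<integral>s. mtrace (repr c s) * cnj (mtrace (repr c' s)) \<partial>haar)"
    unfolding coef_def by (intro integral_cong_carrier) (simp add: ch_def char_fun_def)
  also have "\<dots> = (if c = c' then 1 else 0)"
  proof (cases "c = c'")
    case True
    then show ?thesis using character_norm[OF repr_irreps[OF assms(1)]] by simp
  next
    case False
    then have "\<not> unitarily_equivalent G (repr c') (repr c)" using repr_inequivalent assms by metis
    then show ?thesis
      using character_orthogonal[OF repr_irreps[OF assms(2)] repr_irreps[OF assms(1)]] False by simp
  qed
  finally show ?thesis .
qed

lemma cont_coef: "cont u \<Longrightarrow> c \<in> dual \<Longrightarrow> cont (\<lambda>s. u s * cnj (ch c s))"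
  using class_funD(1)[OF class_fun_ch] by (intro continuous_map_normed_mult continuous_map_cnj)

lemma coef_add: "cont u \<Longrightarrow> cont v \<Longrightarrow> c \<in> dual \<Longrightarrow> coef (\<lambda>x. u x + v x) c = coef u c + coef v c"
  unfolding coef_def
  by (simp add: distrib_right Bochner_Integration.integral_add integrable_continuous cont_coef)

lemma coef_scale: "coef (\<lambda>x. a * u x) c = a * coef u c"
  unfolding coef_def by (simp add: mult.assoc)

lemma coef_sum:
  "(\<And>i. i \<in> S \<Longrightarrow> cont (u i)) \<Longrightarrow> c \<in> dual \<Longrightarrow> coef (\<lambda>x. \<Sum>i\<in>S. u i x) c = (\<Sum>i\<in>S. coef (u i) c)"
  unfolding coef_def sum_distrib_right
  by (intro Bochner_Integration.integral_sum integrable_continuous cont_coef)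

lemma coef_diff: "cont u \<Longrightarrow> cont v \<Longrightarrow> c \<in> dual \<Longrightarrow> coef (\<lambda>x. u x - v x) c = coef u c - coef v c"
  unfolding coef_def
  by (simp add: left_diff_distrib Bochner_Integration.integral_diff integrable_continuous cont_coef)

lemma coef_le:
  assumes "cont u" "c \<in> dual" "\<And>x. x \<in> carrier G \<Longrightarrow> cmod (u x) \<le> \<epsilon>"
  shows "cmod (coef u c) \<le> \<epsilon> * cdim c"
  unfolding coef_def
proof (rule integral_norm_le[OF cont_coef[OF assms(1,2)]])
  fix x assume x: "x \<in> carrier G"
  have "\<epsilon> \<ge> 0" using assms(3)[OF x] norm_ge_zero order_trans by blast
  then show "cmod (u x * cnj (ch c x)) \<le> \<epsilon> * cdim c"
    unfolding norm_mult complex_mod_cnj using assms(3)[OF x] ch_le[OF assms(2)] by (intro mult_mono) auto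
qed

text \<open>The coefficient is \<open>coef u c / cdim c\<close> times the identity; the trace norm
  of the identity cancels the denominator.\<close>

lemma fourier_term_class_fun:
  assumes u: "class_fun u" and c: "c \<in> dual"
  shows "fourier_term G T u c = cdim c * cmod (coef u c)"
proof -
  have "(\<integral>s. u s * cnj (mtrace (repr c s)) \<partial>haar) = coef u c"
    unfolding coef_def by (intro integral_cong_carrier) (simp add: ch_def char_fun_def)
  then have "fourier_coeff G T u (repr c) = (coef u c / of_nat (cdim c)) \<cdot>\<^sub>m 1\<^sub>m (cdim c)"
    using fourier_coeff_class_fun[OF u repr_irreps[OF c]] by (simp add: cdim_def)
  then have "trace_norm (fourier_coeff G T u (repr c)) = cmod (coef u c)"
    using cdim_pos[OF c] by (simp add: trace_norm_smult_one norm_divide)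
  then show ?thesis by (simp add: fourier_term_def Let_def repr_def[symmetric] cdim_def)
qed

end

section \<open>The central Fourier algebra\<close>

context haar_grp
begin

abbreviation ZA where "ZA \<equiv> central_fourier_algebra G T"

text \<open>Membership in the algebra together with a norm bound, expressed by finite sums only.
  Estimates thus need no separate summability argument; \<open>norm_le_iff\<close> translates
  back.\<close>

definition norm_le :: "('a \<Rightarrow> complex) \<Rightarrow> real \<Rightarrow> bool" where
  "norm_le u K \<longleftrightarrow> class_fun u \<and>
     (\<forall>F. finite F \<longrightarrow> F \<subseteq> dual \<longrightarrow> (\<Sum>c\<in>F. cdim c * cmod (coef u c)) \<le> K)"

lemma norm_leD:
  assumes "norm_le u K"
  shows "class_fun u" "cont u" "finite F \<Longrightarrow> F \<subseteq> dual \<Longrightarrow> (\<Sum>c\<in>F. cdim c * cmod (coef u c)) \<le> K"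
  using assms by (auto simp: norm_le_def class_fun_def)

lemma norm_le_nonneg: "norm_le u K \<Longrightarrow> K \<ge> 0"
  using norm_leD(3)[of u K "{}"] by simp

lemma norm_le_mono: "norm_le u K \<Longrightarrow> K \<le> L \<Longrightarrow> norm_le u L"
  unfolding norm_le_def by (meson order_trans)

lemma norm_le_add:
  assumes "norm_le u K" "norm_le v L"
  shows "norm_le (\<lambda>x. u x + v x) (K + L)"
  unfolding norm_le_def
proof (intro conjI allI impI)
  note u = norm_leD[OF assms(1)] and v = norm_leD[OF assms(2)]
  show "class_fun (\<lambda>x. u x + v x)"
    using u(1) v(1) by (auto simp: class_fun_def intro: continuous_map_add)
  fix F assume F: "finite F" "F \<subseteq> dual"
  have "(\<Sum>c\<in>F. cdim c * cmod (coef (\<lambda>x. u x + v x) c))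
      \<le> (\<Sum>c\<in>F. cdim c * cmod (coef u c) + cdim c * cmod (coef v c))"
  proof (rule sum_mono)
    fix c assume "c \<in> F"
    then have "coef (\<lambda>x. u x + v x) c = coef u c + coef v c" using F u v by (intro coef_add) auto
    then show "cdim c * cmod (coef (\<lambda>x. u x + v x) c) \<le> cdim c * cmod (coef u c) + cdim c * cmod (coef v c)"
      by (simp add: distrib_left[symmetric] mult_left_mono norm_triangle_ineq)
  qed
  also have "\<dots> \<le> K + L" using u(3)[OF F] v(3)[OF F] by (simp add: sum.distrib)
  finally show "(\<Sum>c\<in>F. cdim c * cmod (coef (\<lambda>x. u x + v x) c)) \<le> K + L" .
qed

lemma norm_le_scale:
  assumes "norm_le u K" shows "norm_le (\<lambda>x. a * u x) (cmod a * K)"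
  unfolding norm_le_def
proof (intro conjI allI impI)
  note u = norm_leD[OF assms]
  have "cont (\<lambda>x. a * u x)" using u(2) by (intro continuous_map_normed_mult) auto
  then show "class_fun (\<lambda>x. a * u x)" using u(1) by (auto simp: class_fun_def)
  fix F assume F: "finite F" "F \<subseteq> dual"
  have "(\<Sum>c\<in>F. cdim c * cmod (coef (\<lambda>x. a * u x) c)) = cmod a * (\<Sum>c\<in>F. cdim c * cmod (coef u c))"
    by (simp add: coef_scale norm_mult sum_distrib_left mult_ac)
  also have "\<dots> \<le> cmod a * K" using u(3)[OF F] by (intro mult_left_mono) auto
  finally show "(\<Sum>c\<in>F. cdim c * cmod (coef (\<lambda>x. a * u x) c)) \<le> cmod a * K" .
qed

lemma norm_le_zero: "norm_le (\<lambda>x. 0) 0"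
  by (simp add: norm_le_def class_fun_def coef_def)

lemma norm_le_diff: "norm_le u K \<Longrightarrow> norm_le v L \<Longrightarrow> norm_le (\<lambda>x. u x - v x) (K + L)"
  using norm_le_add[of u K "\<lambda>x. - 1 * v x" L] norm_le_scale[of v L "- 1"] by simp

lemma norm_le_sum:
  "finite S \<Longrightarrow> (\<And>i. i \<in> S \<Longrightarrow> norm_le (u i) (K i)) \<Longrightarrow> norm_le (\<lambda>x. \<Sum>i\<in>S. u i x) (\<Sum>i\<in>S. K i)"
proof (induction S rule: finite_induct)
  case (insert i S)
  then show ?case using norm_le_add[of "u i" "K i" "\<lambda>x. \<Sum>i\<in>S. u i x" "\<Sum>i\<in>S. K i"] by simp
qed (simp add: norm_le_zero)

text \<open>A closure property of Fatou type: each coefficient is continuous for uniform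
  convergence, and every condition in \<open>norm_le\<close> involves finitely many of them. The
  approximants need only be uniformly close and to obey the same bound \<open>K\<close>.\<close>

lemma norm_le_limit:
  assumes approx: "\<And>\<epsilon>. \<epsilon> > 0 \<Longrightarrow> \<exists>w. norm_le w K \<and> (\<forall>x \<in> carrier G. cmod (w x - u x) \<le> \<epsilon>)"
    and off: "\<And>x. x \<notin> carrier G \<Longrightarrow> u x = 0"
  shows "norm_le u K"
proof -
  have cu: "cont u"
  proof (rule continuous_map_approx)
    fix \<epsilon> :: real assume "\<epsilon> > 0"
    then show "\<exists>g. cont g \<and> (\<forall>x\<in>topspace T. cmod (g x - u x) \<le> \<epsilon>)"
      using approx norm_leD(2) unfolding topspace_eq by blast
  qed
  have conj: "u (x \<otimes> y \<otimes> inv x) = u y" if xy: "x \<in> carrier G" "y \<in> carrier G" for x y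
  proof (rule ccontr)
    assume ne: "u (x \<otimes> y \<otimes> inv x) \<noteq> u y"
    define \<epsilon> where "\<epsilon> = cmod (u (x \<otimes> y \<otimes> inv x) - u y) / 3"
    have "\<epsilon> > 0" using ne by (simp add: \<epsilon>_def)
    then obtain w where w: "norm_le w K" "\<And>x. x \<in> carrier G \<Longrightarrow> cmod (w x - u x) \<le> \<epsilon>"
      using approx by blast
    have eq: "w (x \<otimes> y \<otimes> inv x) = w y" using class_funD(3)[OF norm_leD(1)[OF w(1)]] xy by blast
    have "u (x \<otimes> y \<otimes> inv x) - u y = (w y - u y) - (w (x \<otimes> y \<otimes> inv x) - u (x \<otimes> y \<otimes> inv x))"
      using eq by simp
    then have "cmod (u (x \<otimes> y \<otimes> inv x) - u y)
        \<le> cmod (w y - u y) + cmod (w (x \<otimes> y \<otimes> inv x) - u (x \<otimes> y \<otimes> inv x))"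
      by (simp only: norm_triangle_ineq4)
    also have "\<dots> \<le> \<epsilon> + \<epsilon>" using xy by (intro add_mono w(2)) auto
    finally have "cmod (u (x \<otimes> y \<otimes> inv x) - u y) \<le> \<epsilon> + \<epsilon>" .
    then show False using \<open>\<epsilon> > 0\<close> by (simp add: \<epsilon>_def)
  qed
  have "(\<Sum>c\<in>F. cdim c * cmod (coef u c)) \<le> K" if F: "finite F" "F \<subseteq> dual" for F
  proof (rule field_le_epsilon)
    fix e :: real assume e: "e > 0"
    \<comment> \<open>An error \<open>e / D\<close> in the values costs \<open>e / D\<close> times
      the square of the dimension for each \<open>c\<close>; the summand 1 keeps \<open>D\<close>
      positive.\<close>
    define D where "D = 1 + (\<Sum>c\<in>F. real (cdim c) * real (cdim c))"
    have D: "D > 0" unfolding D_def by (intro add_pos_nonneg sum_nonneg) auto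
    obtain w where w: "norm_le w K" "\<And>x. x \<in> carrier G \<Longrightarrow> cmod (w x - u x) \<le> e / D"
      using approx[of "e / D"] e D by auto
    have "(\<Sum>c\<in>F. cdim c * cmod (coef u c)) \<le> (\<Sum>c\<in>F. cdim c * cmod (coef w c) + (e / D) * (cdim c * cdim c))"
    proof (rule sum_mono)
      fix c assume "c \<in> F"
      then have c: "c \<in> dual" using F by auto
      have "cont (\<lambda>x. w x - u x)" using norm_leD(2)[OF w(1)] cu by (rule continuous_map_diff)
      from coef_le[OF this c w(2)] have "cmod (coef w c - coef u c) \<le> e / D * cdim c"
        using coef_diff[OF norm_leD(2)[OF w(1)] cu c] by simp
      then have "cmod (coef u c) \<le> cmod (coef w c) + e / D * cdim c"
        using norm_triangle_ineq2[of "coef u c" "coef w c"] by (simp add: norm_minus_commute)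
      then have "cdim c * cmod (coef u c) \<le> cdim c * (cmod (coef w c) + e / D * cdim c)"
        by (intro mult_left_mono) auto
      then show "cdim c * cmod (coef u c) \<le> cdim c * cmod (coef w c) + (e / D) * (cdim c * cdim c)"
        by (simp add: algebra_simps)
    qed
    also have "\<dots> = (\<Sum>c\<in>F. cdim c * cmod (coef w c)) + (e / D) * (\<Sum>c\<in>F. real (cdim c) * real (cdim c))"
      by (simp add: sum.distrib sum_distrib_left)
    also have "\<dots> \<le> K + (e / D) * D"
      using norm_leD(3)[OF w(1) F] e D by (intro add_mono mult_left_mono) (auto simp: D_def)
    also have "\<dots> = K + e" using D by simp
    finally show "(\<Sum>c\<in>F. cdim c * cmod (coef u c)) \<le> K + e" .
  qed
  then show ?thesis using cu off conj by (simp add: norm_le_def class_fun_def)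
qed

lemma norm_le_ch:
  assumes c: "c \<in> dual" shows "norm_le (ch c) (cdim c)"
  unfolding norm_le_def
proof (intro conjI allI impI)
  show "class_fun (ch c)" by (rule class_fun_ch[OF c])
  fix F assume F: "finite F" "F \<subseteq> dual"
  have "(\<Sum>c'\<in>F. cdim c' * cmod (coef (ch c) c')) = (\<Sum>c'\<in>F. if c' = c then real (cdim c) else 0)"
  proof (intro sum.cong refl)
    fix c' assume "c' \<in> F"
    then have "c' \<in> dual" using F by auto
    then show "cdim c' * cmod (coef (ch c) c') = (if c' = c then real (cdim c) else 0)"
      using coef_ch[OF c, of c'] by simp
  qed
  also have "\<dots> \<le> cdim c" using F by (simp add: sum.delta)
  finally show "(\<Sum>c'\<in>F. cdim c' * cmod (coef (ch c) c')) \<le> cdim c" .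
qed

text \<open>The irreducible components have norms at most their dimensions, and these add up to
  \<open>d\<close> by evaluation at the identity.\<close>

lemma norm_le_char_fun:
  assumes \<pi>: "unitary_rep G T d \<pi>" shows "norm_le (char_fun \<pi>) d"
proof -
  obtain ps where ps: "\<forall>(V, \<sigma>) \<in> set ps. \<sigma> \<in> irreps G T \<and> embeds d \<pi> V \<sigma>"
    "\<forall>x \<in> carrier G. mtrace (\<pi> x) = (\<Sum>p\<leftarrow>ps. mtrace (snd p x))"
    using complete_reducibility[OF \<pi>] by blast
  have irr: "snd p \<in> irreps G T" if "p \<in> set ps" for p using ps(1) that by auto
  have "norm_le (\<lambda>x. \<Sum>p\<leftarrow>qs. char_fun (snd p) x) (\<Sum>p\<leftarrow>qs. real (rep_dim G (snd p)))"
    if "set qs \<subseteq> set ps" for qs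
    using that
  proof (induction qs)
    case (Cons q qs)
    obtain c where c: "c \<in> dual" "char_fun (snd q) = ch c" "cdim c = rep_dim G (snd q)"
      using irrep_char_fun[OF irr] Cons.prems by (metis list.set_intros(1) subsetD)
    show ?case using norm_le_add[OF norm_le_ch[OF c(1)] Cons.IH] Cons.prems c by simp
  qed (simp add: norm_le_zero)
  from this[of ps] have "norm_le (\<lambda>x. \<Sum>p\<leftarrow>ps. char_fun (snd p) x) (\<Sum>p\<leftarrow>ps. real (rep_dim G (snd p)))"
    by simp
  also have "(\<lambda>x. \<Sum>p\<leftarrow>ps. char_fun (snd p) x) = char_fun \<pi>"
    by (rule ext) (simp add: char_fun_def ps(2))
  also have "(\<Sum>p\<leftarrow>ps. real (rep_dim G (snd p))) = d"
  proof -
    have "complex_of_real (\<Sum>p\<leftarrow>qs. real (rep_dim G (snd p))) = (\<Sum>p\<leftarrow>qs. mtrace (snd p \<one>))"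
      if "set qs \<subseteq> set ps" for qs
      using that by (induction qs) (auto simp: character_one[OF irrepsD(1)[OF irr]])
    from this[of ps] have "complex_of_real (\<Sum>p\<leftarrow>ps. real (rep_dim G (snd p))) = of_nat d"
      using ps(2)[rule_format, OF one_closed] character_one[OF \<pi>] by simp
    then show ?thesis by (metis of_real_eq_iff of_real_of_nat_eq)
  qed
  finally show ?thesis .
qed

text \<open>The product is the character of the Kronecker product. This is the source of
  submultiplicativity, with no multiplicities of tensor products computed.\<close>

lemma norm_le_ch_mult:
  assumes "c \<in> dual" "c' \<in> dual"
  shows "norm_le (\<lambda>x. ch c x * ch c' x) (cdim c * cdim c')"
proof -
  note r = repr_rep[OF assms(1)] repr_rep[OF assms(2)]
  have "char_fun (\<lambda>x. kron (repr c x) (repr c' x)) = (\<lambda>x. ch c x * ch c' x)"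
    by (rule ext) (auto simp: char_fun_def ch_def mtrace_kron[OF unitary_repD(1)[OF r(1)] unitary_repD(1)[OF r(2)]])
  then show ?thesis using norm_le_char_fun[OF kron_rep[OF r]] by simp
qed

section \<open>Density of the finite character sums\<close>

lemma norm_le_tail:
  assumes u: "norm_le u K" and \<epsilon>: "\<epsilon> > 0"
  obtains F0 where "finite F0" "F0 \<subseteq> dual"
    "\<And>F. finite F \<Longrightarrow> F \<subseteq> dual \<Longrightarrow> F \<inter> F0 = {} \<Longrightarrow> (\<Sum>c\<in>F. cdim c * cmod (coef u c)) \<le> \<epsilon>"
proof -
  let ?S = "\<lambda>F. \<Sum>c\<in>F. cdim c * cmod (coef u c)"
  define B where "B = ?S ` {F. finite F \<and> F \<subseteq> dual}"
  have "B \<noteq> {}" unfolding B_def by blast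
  moreover have bdd: "bdd_above B"
    using norm_leD(3)[OF u] unfolding B_def by (auto intro!: bdd_aboveI[of _ K])
  ultimately obtain y where "y \<in> B" "Sup B - \<epsilon> < y"
    using \<epsilon> less_cSup_iff[of B "Sup B - \<epsilon>"] by auto
  then obtain F0 where F0: "finite F0" "F0 \<subseteq> dual" "Sup B - \<epsilon> < ?S F0" unfolding B_def by auto
  have "?S F \<le> \<epsilon>" if F: "finite F" "F \<subseteq> dual" "F \<inter> F0 = {}" for F
  proof -
    have "?S (F \<union> F0) \<le> Sup B" using F F0 by (intro cSup_upper bdd) (auto simp: B_def)
    then show ?thesis using F F0 by (simp add: sum.union_disjoint)
  qed
  with F0 show ?thesis using that by blast
qed

definition partial :: "('a \<Rightarrow> complex) \<Rightarrow> ('a \<Rightarrow> complex mat) set set \<Rightarrow> 'a \<Rightarrow> complex" where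
  "partial u F x = (\<Sum>c\<in>F. coef u c * ch c x)"

lemma partial_norm_le:
  assumes "finite F" "F \<subseteq> dual"
  shows "norm_le (partial u F) (\<Sum>c\<in>F. cdim c * cmod (coef u c))"
proof -
  have "norm_le (\<lambda>x. coef u c * ch c x) (cdim c * cmod (coef u c))" if "c \<in> F" for c
    using norm_le_scale[OF norm_le_ch, of c "coef u c"] assms that by (simp add: mult.commute subset_iff)
  from norm_le_sum[OF assms(1) this] show ?thesis unfolding partial_def[abs_def] .
qed

lemma coef_partial:
  assumes "finite F" "F \<subseteq> dual" "c \<in> dual"
  shows "coef (partial u F) c = (if c \<in> F then coef u c else 0)"
proof -
  have "coef (partial u F) c = (\<Sum>c'\<in>F. coef (\<lambda>x. coef u c' * ch c' x) c)"
    unfolding partial_def[abs_def] using assms class_funD(1)[OF class_fun_ch]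
    by (intro coef_sum continuous_map_normed_mult) auto
  also have "\<dots> = (\<Sum>c'\<in>F. if c' = c then coef u c else 0)"
  proof (intro sum.cong refl)
    fix c' assume "c' \<in> F"
    then have "c' \<in> dual" using assms by auto
    then show "coef (\<lambda>x. coef u c' * ch c' x) c = (if c' = c then coef u c else 0)"
      using coef_ch[OF _ assms(3), of c'] by (simp add: coef_scale)
  qed
  finally show ?thesis using assms by (simp add: sum.delta)
qed

lemma coef_ch_le: "c \<in> dual \<Longrightarrow> cmod (coef u c * ch c x) \<le> cdim c * cmod (coef u c)"
  using mult_right_mono[OF ch_le[of c x], of "cmod (coef u c)"] by (simp add: norm_mult mult.commute)

lemma partial_le:
  assumes "F \<subseteq> dual"
  shows "cmod (partial u F x) \<le> (\<Sum>c\<in>F. cdim c * cmod (coef u c))"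
  unfolding partial_def
proof (intro order_trans[OF norm_sum] sum_mono)
  fix c assume "c \<in> F"
  then show "cmod (coef u c * ch c x) \<le> cdim c * cmod (coef u c)"
    using assms by (intro coef_ch_le) auto
qed

lemma remainder_norm_le:
  assumes u: "class_fun u" and F: "finite F" "F \<subseteq> dual"
    and tail: "\<And>F'. finite F' \<Longrightarrow> F' \<subseteq> dual \<Longrightarrow> F' \<inter> F = {} \<Longrightarrow> (\<Sum>c\<in>F'. cdim c * cmod (coef u c)) \<le> \<epsilon>"
  shows "norm_le (\<lambda>x. u x - partial u F x) \<epsilon>"
  unfolding norm_le_def
proof (intro conjI allI impI)
  note p = norm_leD[OF partial_norm_le[OF F, of u]]
  show "class_fun (\<lambda>x. u x - partial u F x)"
    using u p(1) by (auto simp: class_fun_def intro: continuous_map_diff)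
  fix F' assume F': "finite F'" "F' \<subseteq> dual"
  have "(\<Sum>c\<in>F'. cdim c * cmod (coef (\<lambda>x. u x - partial u F x) c)) = (\<Sum>c\<in>F'. if c \<in> F then 0 else cdim c * cmod (coef u c))"
  proof (intro sum.cong refl)
    fix c assume "c \<in> F'"
    then have c: "c \<in> dual" using F' by auto
    show "cdim c * cmod (coef (\<lambda>x. u x - partial u F x) c) = (if c \<in> F then 0 else cdim c * cmod (coef u c))"
      using coef_diff[OF class_funD(1)[OF u] p(2) c] coef_partial[OF F c, of u] by simp
  qed
  also have "\<dots> = (\<Sum>c\<in>F' - F. cdim c * cmod (coef u c))"
    using F' by (intro sum.mono_neutral_cong_right) auto
  also have "\<dots> \<le> \<epsilon>" using F' by (intro tail) auto
  finally show "(\<Sum>c\<in>F'. cdim c * cmod (coef (\<lambda>x. u x - partial u F x) c)) \<le> \<epsilon>" .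
qed

lemma norm_le_approx:
  assumes u: "norm_le u K" and \<epsilon>: "\<epsilon> > 0"
  obtains F where "finite F" "F \<subseteq> dual" "norm_le (\<lambda>x. u x - partial u F x) \<epsilon>"
proof -
  obtain F where "finite F" "F \<subseteq> dual"
    "\<And>F'. finite F' \<Longrightarrow> F' \<subseteq> dual \<Longrightarrow> F' \<inter> F = {} \<Longrightarrow> (\<Sum>c\<in>F'. cdim c * cmod (coef u c)) \<le> \<epsilon>"
    by (rule norm_le_tail[OF u \<epsilon>]) (rule that)
  then show ?thesis using remainder_norm_le[OF norm_leD(1)[OF u]] that by blast
qed

text \<open>Expand into products of pairs of characters; the sum of their bounds factorises
  again.\<close>

lemma partial_mult_norm_le:
  assumes "finite F" "F \<subseteq> dual" "finite F'" "F' \<subseteq> dual"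
  shows "norm_le (\<lambda>x. partial u F x * partial v F' x)
    ((\<Sum>c\<in>F. cdim c * cmod (coef u c)) * (\<Sum>c\<in>F'. cdim c * cmod (coef v c)))"
proof -
  have "norm_le (\<lambda>x. \<Sum>c\<in>F. \<Sum>c'\<in>F'. coef u c * coef v c' * (ch c x * ch c' x))
      (\<Sum>c\<in>F. \<Sum>c'\<in>F'. cmod (coef u c * coef v c') * (cdim c * cdim c'))"
  proof (intro norm_le_sum assms)
    fix c c' assume "c \<in> F" "c' \<in> F'"
    then have "norm_le (\<lambda>x. ch c x * ch c' x) (cdim c * cdim c')"
      using assms by (intro norm_le_ch_mult) auto
    from norm_le_scale[OF this]
    show "norm_le (\<lambda>x. coef u c * coef v c' * (ch c x * ch c' x)) (cmod (coef u c * coef v c') * (cdim c * cdim c'))"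
      by simp
  qed
  also have "(\<lambda>x. \<Sum>c\<in>F. \<Sum>c'\<in>F'. coef u c * coef v c' * (ch c x * ch c' x)) = (\<lambda>x. partial u F x * partial v F' x)"
    by (rule ext) (simp add: partial_def sum_product mult_ac)
  also have "(\<Sum>c\<in>F. \<Sum>c'\<in>F'. cmod (coef u c * coef v c') * (cdim c * cdim c'))
      = (\<Sum>c\<in>F. cdim c * cmod (coef u c)) * (\<Sum>c\<in>F'. cdim c * cmod (coef v c))"
    by (simp add: sum_product norm_mult mult_ac)
  finally show ?thesis .
qed

section \<open>The operations and the norm of the algebra in pointwise form\<close>

lemma ZA_simps:
  "u \<in> carrier ZA \<longleftrightarrow> class_fun u \<and> fourier_term G T u summable_on dual"
  "u \<otimes>\<^bsub>ZA\<^esub> v = (\<lambda>x. u x * v x)" "u \<oplus>\<^bsub>ZA\<^esub> v = (\<lambda>x. u x + v x)" "\<zero>\<^bsub>ZA\<^esub> = (\<lambda>x. 0)"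
  "a \<odot>\<^bsub>ZA\<^esub> u = (\<lambda>x. a * u x)" "nrm ZA u = (\<Sum>\<^sub>\<infinity>c \<in> dual. fourier_term G T u c)"
  by (auto simp: central_fourier_algebra_def fourier_algebra_def class_fun_def)

lemma norm_le_iff: "norm_le u K \<longleftrightarrow> u \<in> carrier ZA \<and> nrm ZA u \<le> K"
proof (cases "class_fun u")
  case True
  have ft: "fourier_term G T u c = cdim c * cmod (coef u c)" if "c \<in> dual" for c
    by (rule fourier_term_class_fun[OF True that])
  have sum: "(\<Sum>c\<in>F. fourier_term G T u c) = (\<Sum>c\<in>F. cdim c * cmod (coef u c))" if "F \<subseteq> dual" for F
    using that ft by (intro sum.cong) auto
  have pos: "fourier_term G T u c \<ge> 0" if "c \<in> dual" for c using ft[OF that] by simp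
  show ?thesis
  proof
    assume K: "norm_le u K"
    have "fourier_term G T u summable_on dual"
      using norm_leD(3)[OF K] sum pos by (intro nonneg_bdd_above_summable_on bdd_aboveI[of _ K]) auto
    moreover from this have "nrm ZA u \<le> K"
      unfolding ZA_simps using norm_leD(3)[OF K] sum by (intro infsum_le_finite_sums) auto
    ultimately show "u \<in> carrier ZA \<and> nrm ZA u \<le> K" using True by (simp add: ZA_simps)
  next
    assume A: "u \<in> carrier ZA \<and> nrm ZA u \<le> K"
    have "(\<Sum>c\<in>F. cdim c * cmod (coef u c)) \<le> K" if F: "finite F" "F \<subseteq> dual" for F
    proof -
      have "(\<Sum>c\<in>F. fourier_term G T u c) \<le> infsum (fourier_term G T u) dual"
        using A F pos by (intro finite_sum_le_infsum) (auto simp: ZA_simps)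
      then show ?thesis using A sum[OF F(2)] by (simp add: ZA_simps)
    qed
    then show "norm_le u K" using True by (simp add: norm_le_def)
  qed
qed (auto simp: norm_le_def ZA_simps)

lemma norm_le_nrm: "u \<in> carrier ZA \<Longrightarrow> norm_le u (nrm ZA u)"
  by (simp add: norm_le_iff)

lemma nrm_nonneg: "u \<in> carrier ZA \<Longrightarrow> nrm ZA u \<ge> 0"
  using norm_le_nonneg norm_le_nrm by blast

lemma nrm_zero: "nrm ZA (\<lambda>x. 0) = 0"
  using norm_le_zero nrm_nonneg unfolding norm_le_iff by force

text \<open>Needed to evaluate the differences and finite sums of the record, which occur in the
  definition of an approximate diagonal and of \<open>tensor_mult\<close>.\<close>

lemma abelian_group_ZA: "abelian_group ZA"
proof (rule abelian_groupI)
  fix u v assume uv: "u \<in> carrier ZA" "v \<in> carrier ZA"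
  show "u \<oplus>\<^bsub>ZA\<^esub> v \<in> carrier ZA"
    using norm_le_add[OF norm_le_nrm[OF uv(1)] norm_le_nrm[OF uv(2)]] by (simp add: norm_le_iff ZA_simps(3))
  have "(\<lambda>x. - 1 * u x) \<in> carrier ZA" using norm_le_scale[OF norm_le_nrm[OF uv(1)], of "- 1"] norm_le_iff by blast
  then show "\<exists>w\<in>carrier ZA. w \<oplus>\<^bsub>ZA\<^esub> u = \<zero>\<^bsub>ZA\<^esub>"
    by (intro bexI[of _ "\<lambda>x. - 1 * u x"]) (auto simp: ZA_simps(3,4))
next
  show "\<zero>\<^bsub>ZA\<^esub> \<in> carrier ZA" using norm_le_zero by (simp add: norm_le_iff ZA_simps(4))
qed (auto simp: ZA_simps(3,4) add_ac)

lemma ZA_minus: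
  assumes "u \<in> carrier ZA" "v \<in> carrier ZA" shows "u \<ominus>\<^bsub>ZA\<^esub> v = (\<lambda>x. u x - v x)"
proof -
  interpret A: abelian_group ZA by (rule abelian_group_ZA)
  have "(\<lambda>x. - 1 * v x) \<in> carrier ZA" using norm_le_scale[OF norm_le_nrm[OF assms(2)], of "- 1"] norm_le_iff by blast
  then have "\<ominus>\<^bsub>ZA\<^esub> v = (\<lambda>x. - 1 * v x)"
    using assms(2) by (intro A.minus_equality) (auto simp: ZA_simps(3,4))
  then show ?thesis unfolding a_minus_def by (simp add: ZA_simps(3))
qed

lemma ZA_finsum:
  assumes "finite S" "\<And>i. i \<in> S \<Longrightarrow> u i \<in> carrier ZA"
  shows "(\<Oplus>\<^bsub>ZA\<^esub>i\<in>S. u i) = (\<lambda>x. \<Sum>i\<in>S. u i x)"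
proof -
  interpret A: abelian_group ZA by (rule abelian_group_ZA)
  show ?thesis using assms
    by (induction S rule: finite_induct) (auto simp: A.finsum_insert Pi_iff ZA_simps(3,4))
qed

end

text \<open>The assumption is the uniqueness part of the Peter-Weyl theorem for class functions. It
  is proved below for products of finite groups.\<close>

locale complete_haar_grp = haar_grp +
  assumes characters_complete: "\<And>u x. class_fun u \<Longrightarrow> (\<And>c. c \<in> dual \<Longrightarrow> coef u c = 0) \<Longrightarrow> u x = 0"
begin

text \<open>The Fourier series of \<open>w\<close> converges uniformly to some \<open>v\<close>,
  whose values are bounded by the sum of the terms. Its coefficients are those of \<open>w\<close>,
  so completeness gives \<open>v = w\<close>. Without it, finite sums of coefficients could not
  control values.\<close>

lemma norm_le_bound:
  assumes w: "norm_le w K" shows "cmod (w x) \<le> K"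
proof -
  define v where "v x = (\<Sum>\<^sub>\<infinity>c\<in>dual. coef w c * ch c x)" for x
  have lim: "((\<lambda>F. partial w F x) \<longlongrightarrow> v x) (finite_subsets_at_top dual)" for x
  proof -
    have "(\<lambda>c. cmod (coef w c * ch c x)) summable_on dual"
    proof (rule nonneg_bdd_above_summable_on)
      show "bdd_above (sum (\<lambda>c. cmod (coef w c * ch c x)) ` {F. F \<subseteq> dual \<and> finite F})"
      proof (rule bdd_aboveI2)
        fix F assume F: "F \<in> {F. F \<subseteq> dual \<and> finite F}"
        have "(\<Sum>c\<in>F. cmod (coef w c * ch c x)) \<le> (\<Sum>c\<in>F. cdim c * cmod (coef w c))"
        proof (rule sum_mono)
          fix c assume "c \<in> F"
          then show "cmod (coef w c * ch c x) \<le> cdim c * cmod (coef w c)"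
            using F by (intro coef_ch_le) auto
        qed
        then show "(\<Sum>c\<in>F. cmod (coef w c * ch c x)) \<le> K" using norm_leD(3)[OF w, of F] F by auto
      qed
    qed auto
    then have "(\<lambda>c. coef w c * ch c x) summable_on dual" by (rule abs_summable_summable)
    then show ?thesis unfolding v_def partial_def using has_sum_infsum unfolding has_sum_def by blast
  qed
  have close: "cmod (partial w F x - v x) \<le> \<epsilon>"
    if F: "finite F" "F \<subseteq> dual"
      and tail: "\<And>F'. finite F' \<Longrightarrow> F' \<subseteq> dual \<Longrightarrow> F' \<inter> F = {} \<Longrightarrow> (\<Sum>c\<in>F'. cdim c * cmod (coef w c)) \<le> \<epsilon>"
    for F \<epsilon> x
  proof -
    have "\<forall>\<^sub>F F' in finite_subsets_at_top dual. cmod (partial w F x - partial w F' x) \<le> \<epsilon>"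
      unfolding eventually_finite_subsets_at_top
    proof (intro exI[of _ F] conjI allI impI)
      fix F' assume F': "finite F' \<and> F \<subseteq> F' \<and> F' \<subseteq> dual"
      have "partial w F' x - partial w F x = partial w (F' - F) x"
        unfolding partial_def using F' by (simp add: sum_diff)
      then have "cmod (partial w F x - partial w F' x) \<le> (\<Sum>c\<in>F' - F. cdim c * cmod (coef w c))"
        using partial_le[of "F' - F" w x] F' by (auto simp: norm_minus_commute)
      also have "\<dots> \<le> \<epsilon>" using F' by (intro tail) auto
      finally show "cmod (partial w F x - partial w F' x) \<le> \<epsilon>" .
    qed (use F in auto)
    moreover have "((\<lambda>F'. cmod (partial w F x - partial w F' x)) \<longlongrightarrow> cmod (partial w F x - v x)) (finite_subsets_at_top dual)"
      by (intro tendsto_intros lim)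
    ultimately show ?thesis by (intro tendsto_upperbound) auto
  qed
  have v: "norm_le v K"
  proof (rule norm_le_limit)
    fix \<epsilon> :: real assume "\<epsilon> > 0"
    then obtain F where F: "finite F" "F \<subseteq> dual"
      "\<And>F'. finite F' \<Longrightarrow> F' \<subseteq> dual \<Longrightarrow> F' \<inter> F = {} \<Longrightarrow> (\<Sum>c\<in>F'. cdim c * cmod (coef w c)) \<le> \<epsilon>"
      by (rule norm_le_tail[OF w]) (rule that)
    have "norm_le (partial w F) K"
      using partial_norm_le[OF F(1,2)] norm_leD(3)[OF w F(1,2)] by (rule norm_le_mono)
    then show "\<exists>u. norm_le u K \<and> (\<forall>x\<in>carrier G. cmod (u x - v x) \<le> \<epsilon>)"
      using close[OF F] by blast
  next
    fix x assume "x \<notin> carrier G"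
    then show "v x = 0" by (simp add: v_def ch_def char_fun_def)
  qed
  have "coef (\<lambda>x. w x - v x) c = 0" if c: "c \<in> dual" for c
  proof -
    have "cmod (coef w c - coef v c) \<le> 0"
    proof (rule field_le_epsilon)
      fix e :: real assume e: "e > 0"
      then have e': "e / cdim c > 0" using cdim_pos[OF c] by simp
      obtain F where F: "finite F" "F \<subseteq> dual"
        "\<And>F'. finite F' \<Longrightarrow> F' \<subseteq> dual \<Longrightarrow> F' \<inter> F = {} \<Longrightarrow> (\<Sum>c\<in>F'. cdim c * cmod (coef w c)) \<le> e / cdim c"
        by (rule norm_le_tail[OF w e']) (rule that)
      \<comment> \<open>With \<open>c\<close> included, the partial sum has exactly the coefficient
        of \<open>w\<close> at \<open>c\<close>.\<close>
      have F': "finite (insert c F)" "insert c F \<subseteq> dual" using F c by auto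
      have p: "cont (partial w (insert c F))" using norm_leD(2)[OF partial_norm_le[OF F']] .
      have "cmod (partial w (insert c F) x - v x) \<le> e / cdim c" for x
        using F by (intro close F') auto
      then have "cmod (coef (\<lambda>x. partial w (insert c F) x - v x) c) \<le> e / cdim c * cdim c"
        using p norm_leD(2)[OF v] by (intro coef_le c continuous_map_diff) auto
      then show "cmod (coef w c - coef v c) \<le> 0 + e"
        using coef_diff[OF p norm_leD(2)[OF v] c] coef_partial[OF F' c, of w] cdim_pos[OF c] by simp
    qed
    then show ?thesis using coef_diff[OF norm_leD(2)[OF w] norm_leD(2)[OF v] c] by simp
  qed
  then have "w x - v x = 0"
    by (rule characters_complete[where u = "\<lambda>x. w x - v x", OF norm_leD(1)[OF norm_le_diff[OF w v]]])
  moreover have "cmod (v x) \<le> K"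
  proof (rule tendsto_upperbound[OF tendsto_norm[OF lim]])
    show "\<forall>\<^sub>F F in finite_subsets_at_top dual. cmod (partial w F x) \<le> K"
      using partial_le norm_leD(3)[OF w] by (intro eventually_finite_subsets_at_top_weakI) (meson order_trans)
  qed simp
  ultimately show ?thesis by simp
qed

text \<open>The bound holds for finite character sums and survives the uniform limit. The products
  converge uniformly because both factors and their approximants are bounded in the supremum
  norm.\<close>

lemma norm_le_mult:
  assumes u: "norm_le u K" and v: "norm_le v L"
  shows "norm_le (\<lambda>x. u x * v x) (K * L)"
proof (rule norm_le_limit)
  fix \<epsilon> :: real assume \<epsilon>: "\<epsilon> > 0"
  note K = norm_le_nonneg[OF u] and L = norm_le_nonneg[OF v]
  define \<delta> where "\<delta> = \<epsilon> / (K + L + 1)"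
  have \<delta>: "\<delta> > 0" using \<epsilon> K L by (simp add: \<delta>_def)
  obtain F where F: "finite F" "F \<subseteq> dual" "norm_le (\<lambda>x. u x - partial u F x) \<delta>"
    by (rule norm_le_approx[OF u \<delta>])
  obtain F' where F': "finite F'" "F' \<subseteq> dual" "norm_le (\<lambda>x. v x - partial v F' x) \<delta>"
    by (rule norm_le_approx[OF v \<delta>])
  have "(\<Sum>c\<in>F. cdim c * cmod (coef u c)) * (\<Sum>c\<in>F'. cdim c * cmod (coef v c)) \<le> K * L"
    using norm_leD(3)[OF u F(1,2)] norm_leD(3)[OF v F'(1,2)] K by (intro mult_mono sum_nonneg) auto
  with partial_mult_norm_le[OF F(1,2) F'(1,2)] have 1: "norm_le (\<lambda>x. partial u F x * partial v F' x) (K * L)"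
    by (rule norm_le_mono)
  have "cmod (partial u F x * partial v F' x - u x * v x) \<le> \<epsilon>" for x
  proof -
    have "partial u F x * partial v F' x - u x * v x
        = - ((u x - partial u F x) * partial v F' x + u x * (v x - partial v F' x))"
      by (simp add: algebra_simps)
    then have "cmod (partial u F x * partial v F' x - u x * v x)
        \<le> cmod (u x - partial u F x) * cmod (partial v F' x) + cmod (u x) * cmod (v x - partial v F' x)"
      by (simp only: norm_minus_cancel norm_mult[symmetric] norm_triangle_ineq)
    also have "\<dots> \<le> \<delta> * L + K * \<delta>"
      using norm_le_bound[OF F(3), of x] norm_le_bound[OF F'(3), of x] norm_le_bound[OF u, of x]
        order_trans[OF partial_le[OF F'(2)] norm_leD(3)[OF v F'(1,2)], of x] K \<delta>
      by (intro add_mono mult_mono) auto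
    also have "\<dots> \<le> \<delta> * (K + L + 1)" using \<delta> by (simp add: algebra_simps)
    also have "\<dots> = \<epsilon>" using K L by (simp add: \<delta>_def)
    finally show ?thesis .
  qed
  with 1 show "\<exists>w. norm_le w (K * L) \<and> (\<forall>x\<in>carrier G. cmod (w x - u x * v x) \<le> \<epsilon>)" by blast
qed (use class_funD(2)[OF norm_leD(1)[OF u]] in simp)

lemma norm_le_one: "norm_le (\<lambda>x. if x \<in> carrier G then 1 else 0) 1"
proof -
  have "unitary_rep G T 1 (\<lambda>x. 1\<^sub>m 1)" by (simp add: unitary_rep_def)
  from norm_le_char_fun[OF this] show ?thesis unfolding char_fun_def[abs_def] mtrace_one of_nat_1 of_nat_1 by simp
qed

text \<open>Completeness of the algebra, for absolutely convergent series and with an explicit bound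
  on the remainders. The finite blocks starting at \<open>n\<close> obey the bound and converge
  uniformly to the remainder.\<close>

lemma norm_le_series:
  assumes w: "\<And>n. norm_le (w n) (K n)" and K: "summable K"
  shows "summable (\<lambda>n. w n x)"
    "norm_le (\<lambda>x. (suminf (\<lambda>n. w n x)) - (\<Sum>k<n. w k x)) (suminf (\<lambda>k. K (k + n)))"
proof -
  have le: "cmod (w n x) \<le> K n" for n x by (rule norm_le_bound[OF w])
  have pos: "K n \<ge> 0" for n by (rule norm_le_nonneg[OF w])
  have abs: "summable (\<lambda>n. cmod (w n x))" for x using le by (intro summable_comparison_test'[OF K]) auto
  then have sm: "summable (\<lambda>n. w n x)" for x by (rule summable_norm_cancel)
  show "summable (\<lambda>n. w n x)" by (rule sm)
  have tail: "cmod ((suminf (\<lambda>n. w n x)) - (\<Sum>k<n. w k x)) \<le> (suminf (\<lambda>k. K (k + n)))" for x n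
  proof -
    have "(suminf (\<lambda>n. w n x)) - (\<Sum>k<n. w k x) = (suminf (\<lambda>k. w (k + n) x))"
      using suminf_minus_initial_segment[OF sm] by simp
    also have "cmod \<dots> \<le> (suminf (\<lambda>k. cmod (w (k + n) x)))"
      using abs by (intro summable_norm) (rule summable_ignore_initial_segment)
    also have "\<dots> \<le> (suminf (\<lambda>k. K (k + n)))"
      using abs K le by (intro suminf_le summable_ignore_initial_segment) auto
    finally show ?thesis .
  qed
  show "norm_le (\<lambda>x. (suminf (\<lambda>n. w n x)) - (\<Sum>k<n. w k x)) (suminf (\<lambda>k. K (k + n)))"
  proof (rule norm_le_limit)
    fix \<epsilon> :: real assume \<epsilon>: "\<epsilon> > 0"
    obtain N where N: "\<And>m. m \<ge> N \<Longrightarrow> norm (suminf (\<lambda>k. K (k + m))) < \<epsilon>"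
      using suminf_exist_split[OF \<epsilon> K] by auto
    define m where "m = max n N"
    have "norm_le (\<lambda>x. \<Sum>k\<in>{n..<m}. w k x) (\<Sum>k\<in>{n..<m}. K k)"
      by (rule norm_le_sum) (auto intro: w)
    moreover have "(\<Sum>k\<in>{n..<m}. K k) \<le> (suminf (\<lambda>k. K (k + n)))"
    proof -
      have "(\<Sum>k\<in>{n..<m}. K k) = (\<Sum>k\<in>{0..<m-n}. K (k + n))"
        using sum.shift_bounds_nat_ivl[of K 0 n "m - n"] by (simp add: m_def)
      also have "\<dots> \<le> (suminf (\<lambda>k. K (k + n)))"
        using K pos by (intro sum_le_suminf summable_ignore_initial_segment) auto
      finally show ?thesis .
    qed
    ultimately have 1: "norm_le (\<lambda>x. \<Sum>k\<in>{n..<m}. w k x) (suminf (\<lambda>k. K (k + n)))" by (rule norm_le_mono)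
    have "cmod ((\<Sum>k\<in>{n..<m}. w k x) - ((suminf (\<lambda>n. w n x)) - (\<Sum>k<n. w k x))) \<le> \<epsilon>" for x
    proof -
      have "(\<Sum>k<n. w k x) + (\<Sum>k\<in>{n..<m}. w k x) = (\<Sum>k<m. w k x)"
        by (simp add: m_def lessThan_atLeast0 sum.atLeastLessThan_concat)
      then have "(\<Sum>k\<in>{n..<m}. w k x) - ((suminf (\<lambda>n. w n x)) - (\<Sum>k<n. w k x)) = - ((suminf (\<lambda>n. w n x)) - (\<Sum>k<m. w k x))"
        by (simp add: algebra_simps)
      then have "cmod ((\<Sum>k\<in>{n..<m}. w k x) - ((suminf (\<lambda>n. w n x)) - (\<Sum>k<n. w k x))) \<le> (suminf (\<lambda>k. K (k + m)))"
        using tail[of x m] by (simp only: norm_minus_cancel)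
      also have "\<dots> \<le> \<epsilon>" using N[of m] by (simp add: m_def)
      finally show ?thesis .
    qed
    with 1 show "\<exists>u. norm_le u (suminf (\<lambda>k. K (k + n))) \<and>
        (\<forall>x\<in>carrier G. cmod (u x - ((suminf (\<lambda>n. w n x)) - (\<Sum>k<n. w k x))) \<le> \<epsilon>)" by blast
  qed (use class_funD(2)[OF norm_leD(1)[OF w]] in simp)
qed

subsection \<open>Tensors\<close>

text \<open>Point evaluation as a bilinear form. Through it a tensor \<open>m\<close> becomes the
  function \<open>m (ev2 x y)\<close> of two group elements.\<close>

definition ev2 :: "'a \<Rightarrow> 'a \<Rightarrow> ('a \<Rightarrow> complex) \<Rightarrow> ('a \<Rightarrow> complex) \<Rightarrow> complex" where
  "ev2 x y u v = u x * v y"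

lemma ZA_bound: "u \<in> carrier ZA \<Longrightarrow> cmod (u x) \<le> nrm ZA u"
  by (rule norm_le_bound[OF norm_le_nrm])

lemma ev2_bilinear: "ev2 x y \<in> bounded_bilinear_forms ZA"
  unfolding bounded_bilinear_forms_def
proof (intro CollectI conjI ballI allI exI[of _ 1])
  fix u v assume "u \<in> carrier ZA" "v \<in> carrier ZA"
  then show "cmod (ev2 x y u v) \<le> 1 * nrm ZA u * nrm ZA v"
    using ZA_bound[of u x] ZA_bound[of v y] nrm_nonneg by (simp add: ev2_def norm_mult mult_mono)
qed (auto simp: ev2_def ZA_simps(3,5) algebra_simps)

lemma tensor_seriesD:
  assumes "tensor_series ZA a b m"
  shows "a n \<in> carrier ZA" "b n \<in> carrier ZA" "summable (\<lambda>n. nrm ZA (a n) * nrm ZA (b n))"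
    "B \<in> bounded_bilinear_forms ZA \<Longrightarrow> m B = (suminf (\<lambda>n. B (a n) (b n)))"
  using assms by (auto simp: tensor_series_def)

lemma bilinear_summable:
  assumes m: "tensor_series ZA a b m"
    and K: "\<And>u v. u \<in> carrier ZA \<Longrightarrow> v \<in> carrier ZA \<Longrightarrow> cmod (B u v) \<le> K * nrm ZA u * nrm ZA v"
  shows "summable (\<lambda>n. B (a n) (b n))"
    "cmod (suminf (\<lambda>n. B (a n) (b n))) \<le> K * (suminf (\<lambda>n. nrm ZA (a n) * nrm ZA (b n)))"
proof -
  note t = tensor_seriesD[OF m]
  have s: "summable (\<lambda>n. K * (nrm ZA (a n) * nrm ZA (b n)))" using t(3) by (rule summable_mult)
  have le: "cmod (B (a n) (b n)) \<le> K * (nrm ZA (a n) * nrm ZA (b n))" for n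
    using K[OF t(1,2)] by (simp add: mult.assoc)
  have abs: "summable (\<lambda>n. cmod (B (a n) (b n)))" using le by (intro summable_comparison_test'[OF s]) auto
  then show "summable (\<lambda>n. B (a n) (b n))" by (rule summable_norm_cancel)
  have "cmod (suminf (\<lambda>n. B (a n) (b n))) \<le> (suminf (\<lambda>n. cmod (B (a n) (b n))))" by (rule summable_norm[OF abs])
  also have "\<dots> \<le> (suminf (\<lambda>n. K * (nrm ZA (a n) * nrm ZA (b n))))" by (rule suminf_le[OF le abs s])
  also have "\<dots> = K * (suminf (\<lambda>n. nrm ZA (a n) * nrm ZA (b n)))" by (rule suminf_mult[OF t(3)])
  finally show "cmod (suminf (\<lambda>n. B (a n) (b n))) \<le> K * (suminf (\<lambda>n. nrm ZA (a n) * nrm ZA (b n)))" .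
qed

text \<open>Duality between tensors and forms; the slack \<open>e / (K + 1)\<close> in the infimum
  also covers \<open>K = 0\<close>.\<close>

lemma proj_norm_bound:
  assumes m: "m \<in> proj_tensor ZA" and B: "B \<in> bounded_bilinear_forms ZA" and K0: "K \<ge> 0"
    and K: "\<And>u v. u \<in> carrier ZA \<Longrightarrow> v \<in> carrier ZA \<Longrightarrow> cmod (B u v) \<le> K * nrm ZA u * nrm ZA v"
  shows "cmod (m B) \<le> K * proj_norm ZA m"
proof (rule field_le_epsilon)
  fix e :: real assume e: "e > 0"
  define N where "N = {suminf (\<lambda>n. nrm ZA (a n) * nrm ZA (b n)) | a b. tensor_series ZA a b m}"
  have "N \<noteq> {}" using m by (auto simp: N_def proj_tensor_def)
  moreover have "Inf N < Inf N + e / (K + 1)" using e K0 by simp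
  ultimately obtain s where "s \<in> N" "s < Inf N + e / (K + 1)" by (meson cInf_lessD)
  then obtain a b where ab: "tensor_series ZA a b m"
    "(suminf (\<lambda>n. nrm ZA (a n) * nrm ZA (b n))) < proj_norm ZA m + e / (K + 1)"
    unfolding N_def proj_norm_def by auto
  have "cmod (m B) \<le> K * (suminf (\<lambda>n. nrm ZA (a n) * nrm ZA (b n)))"
    using bilinear_summable(2)[OF ab(1) K] tensor_seriesD(4)[OF ab(1) B] by simp
  also have "\<dots> \<le> K * (proj_norm ZA m + e / (K + 1))" using ab(2) K0 by (intro mult_left_mono) auto
  also have "\<dots> \<le> K * proj_norm ZA m + e"
    using K0 e by (simp add: field_simps)
  finally show "cmod (m B) \<le> K * proj_norm ZA m + e" .
qed

lemma proj_norm_le: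
  assumes m: "tensor_series ZA a b m"
  shows "0 \<le> proj_norm ZA m" "proj_norm ZA m \<le> (suminf (\<lambda>n. nrm ZA (a n) * nrm ZA (b n)))"
proof -
  have pos: "0 \<le> (suminf (\<lambda>n. nrm ZA (a n) * nrm ZA (b n)))" if "tensor_series ZA a b m" for a b
    using tensor_seriesD[OF that] nrm_nonneg by (intro suminf_nonneg) auto
  show "0 \<le> proj_norm ZA m" unfolding proj_norm_def using m pos by (intro cInf_greatest) auto
  show "proj_norm ZA m \<le> (suminf (\<lambda>n. nrm ZA (a n) * nrm ZA (b n)))"
    unfolding proj_norm_def using m pos by (intro cInf_lower bdd_belowI[of _ 0]) auto
qed

text \<open>Multiplication is restriction to the diagonal. A norm limit is also a pointwise limit,
  which shows uniqueness, and the remainder bound of \<open>norm_le_series\<close> shows existence,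
  so the definite description is well defined.\<close>

lemma tensor_mult_eq:
  assumes m: "m \<in> proj_tensor ZA"
  shows "tensor_mult ZA m \<in> carrier ZA" "tensor_mult ZA m = (\<lambda>x. m (ev2 x x))"
proof -
  let ?P = "\<lambda>v. v \<in> carrier ZA \<and> (\<exists>a b. tensor_series ZA a b m \<and>
          (\<lambda>n. nrm ZA ((\<Oplus>\<^bsub>ZA\<^esub>k \<in> {..<n}. a k \<otimes>\<^bsub>ZA\<^esub> b k) \<ominus>\<^bsub>ZA\<^esub> v)) \<longlonglongrightarrow> 0)"
  have prod: "norm_le (\<lambda>x. a k x * b k x) (nrm ZA (a k) * nrm ZA (b k))" if "tensor_series ZA a b m" for a b k
    using tensor_seriesD[OF that] by (intro norm_le_mult norm_le_nrm)
  have fs: "(\<Oplus>\<^bsub>ZA\<^esub>k \<in> {..<n}. a k \<otimes>\<^bsub>ZA\<^esub> b k) = (\<lambda>x. \<Sum>k<n. a k x * b k x)"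
    "(\<lambda>x. \<Sum>k<n. a k x * b k x) \<in> carrier ZA" if "tensor_series ZA a b m" for a b n
  proof -
    show "(\<Oplus>\<^bsub>ZA\<^esub>k \<in> {..<n}. a k \<otimes>\<^bsub>ZA\<^esub> b k) = (\<lambda>x. \<Sum>k<n. a k x * b k x)"
      unfolding ZA_simps(2) using prod[OF that] by (intro ZA_finsum) (auto simp: norm_le_iff)
    show "(\<lambda>x. \<Sum>k<n. a k x * b k x) \<in> carrier ZA"
      using norm_le_sum[of "{..<n}" "\<lambda>k x. a k x * b k x", OF _ prod[OF that]] by (simp add: norm_le_iff)
  qed
  have uniq: "v = (\<lambda>x. m (ev2 x x))" if v: "?P v" for v
  proof
    fix x
    obtain a b where ab: "tensor_series ZA a b m" and vc: "v \<in> carrier ZA"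
      and lim: "(\<lambda>n. nrm ZA ((\<Oplus>\<^bsub>ZA\<^esub>k \<in> {..<n}. a k \<otimes>\<^bsub>ZA\<^esub> b k) \<ominus>\<^bsub>ZA\<^esub> v)) \<longlonglongrightarrow> 0" using v by blast
    have "(\<lambda>n. (\<Sum>k<n. a k x * b k x) - v x) \<longlonglongrightarrow> 0"
    proof (rule Lim_null_comparison[OF always_eventually lim], rule allI)
      fix n
      have "(\<Oplus>\<^bsub>ZA\<^esub>k \<in> {..<n}. a k \<otimes>\<^bsub>ZA\<^esub> b k) \<ominus>\<^bsub>ZA\<^esub> v = (\<lambda>x. (\<Sum>k<n. a k x * b k x) - v x)"
        unfolding fs(1)[OF ab] using fs(2)[OF ab] vc by (rule ZA_minus)
      moreover have "(\<lambda>x. (\<Sum>k<n. a k x * b k x) - v x) \<in> carrier ZA"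
        using norm_le_diff[OF norm_le_nrm[OF fs(2)[OF ab]] norm_le_nrm[OF vc]] by (simp add: norm_le_iff)
      ultimately show "cmod ((\<Sum>k<n. a k x * b k x) - v x) \<le> nrm ZA ((\<Oplus>\<^bsub>ZA\<^esub>k \<in> {..<n}. a k \<otimes>\<^bsub>ZA\<^esub> b k) \<ominus>\<^bsub>ZA\<^esub> v)"
        using ZA_bound[of "\<lambda>x. (\<Sum>k<n. a k x * b k x) - v x" x] by (simp only:)
    qed
    then have "(\<lambda>n. a n x * b n x) sums v x" unfolding sums_def by (subst Lim_null)
    then show "v x = m (ev2 x x)"
      unfolding tensor_seriesD(4)[OF ab ev2_bilinear] ev2_def by (rule sums_unique)
  qed
  obtain a b where ab: "tensor_series ZA a b m" using m by (auto simp: proj_tensor_def)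
  let ?w = "\<lambda>k x. a k x * b k x" and ?K = "\<lambda>k. nrm ZA (a k) * nrm ZA (b k)"
  define v where "v = (\<lambda>x. suminf (\<lambda>k. ?w k x))"
  note ser = norm_le_series(2)[of ?w ?K, OF prod[OF ab] tensor_seriesD(3)[OF ab]]
  have vc: "v \<in> carrier ZA" using ser[of 0] by (simp add: v_def norm_le_iff)
  have "(\<lambda>n. nrm ZA ((\<Oplus>\<^bsub>ZA\<^esub>k \<in> {..<n}. a k \<otimes>\<^bsub>ZA\<^esub> b k) \<ominus>\<^bsub>ZA\<^esub> v)) \<longlonglongrightarrow> 0"
  proof (rule Lim_null_comparison[OF always_eventually], rule allI)
    fix n
    have eq: "(\<Oplus>\<^bsub>ZA\<^esub>k \<in> {..<n}. a k \<otimes>\<^bsub>ZA\<^esub> b k) \<ominus>\<^bsub>ZA\<^esub> v = (\<lambda>x. (\<Sum>k<n. ?w k x) - v x)"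
      unfolding fs(1)[OF ab] using fs(2)[OF ab] vc by (rule ZA_minus)
    have "norm_le (\<lambda>x. (\<Sum>k<n. ?w k x) - v x) (suminf (\<lambda>k. ?K (k + n)))"
      using norm_le_scale[OF ser[of n], of "- 1"] by (simp add: v_def)
    then show "norm (nrm ZA ((\<Oplus>\<^bsub>ZA\<^esub>k \<in> {..<n}. a k \<otimes>\<^bsub>ZA\<^esub> b k) \<ominus>\<^bsub>ZA\<^esub> v)) \<le> (suminf (\<lambda>k. ?K (k + n)))"
      unfolding eq using nrm_nonneg by (auto simp: norm_le_iff)
  next
    show "(\<lambda>n. suminf (\<lambda>k. ?K (k + n))) \<longlonglongrightarrow> 0" by (rule suminf_exist_split2[OF tensor_seriesD(3)[OF ab]])
  qed
  then have P: "?P v" using vc ab by blast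
  have "tensor_mult ZA m = v"
    unfolding tensor_mult_def by (rule the_equality) (use P uniq in auto)
  then show "tensor_mult ZA m \<in> carrier ZA" "tensor_mult ZA m = (\<lambda>x. m (ev2 x x))"
    using vc uniq[OF P] by auto
qed

end

section \<open>Products of finite groups\<close>

locale finite_product_grp =
  fixes I :: "'i set" and G :: "'i \<Rightarrow> ('a, 'm) monoid_scheme"
  assumes grp: "\<And>i. i \<in> I \<Longrightarrow> group (G i)" and fin: "\<And>i. i \<in> I \<Longrightarrow> finite (carrier (G i))"
begin

abbreviation P where "P \<equiv> product_group I G"
abbreviation T where "T \<equiv> product_group_topology I G"
abbreviation C where "C i \<equiv> carrier (G i)"

sublocale compact_grp P T
  by unfold_locales (rule compact_group_product_group[OF grp fin])

section \<open>Coordinates, cylinders and functions of finitely many coordinates\<close>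

lemma mem_P: "x \<in> carrier P \<longleftrightarrow> x \<in> (\<Pi>\<^sub>E i\<in>I. C i)"
  by simp

lemma P_component: "x \<in> carrier P \<Longrightarrow> i \<in> I \<Longrightarrow> x i \<in> C i"
  by auto

lemma one_C: "i \<in> I \<Longrightarrow> \<one>\<^bsub>G i\<^esub> \<in> C i"
  using grp group.is_monoid monoid.one_closed by blast

lemma mult_component: "i \<in> I \<Longrightarrow> (x \<otimes>\<^bsub>P\<^esub> y) i = x i \<otimes>\<^bsub>G i\<^esub> y i"
  and one_component: "i \<in> I \<Longrightarrow> \<one>\<^bsub>P\<^esub> i = \<one>\<^bsub>G i\<^esub>"
  by simp_all

lemma inv_component: "x \<in> carrier P \<Longrightarrow> i \<in> I \<Longrightarrow> (inv\<^bsub>P\<^esub> x) i = inv\<^bsub>G i\<^esub> (x i)"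
  using grp by (simp add: inv_product_group)

definition agree :: "'i set \<Rightarrow> ('i \<Rightarrow> 'a) \<Rightarrow> ('i \<Rightarrow> 'a) \<Rightarrow> bool" where
  "agree J x y \<longleftrightarrow> (\<forall>j\<in>J. x j = y j)"

definition cyl :: "'i set \<Rightarrow> ('i \<Rightarrow> 'a) \<Rightarrow> ('i \<Rightarrow> 'a) set" where
  "cyl J x = {z \<in> carrier P. agree J z x}"

lemma cyl_eq_PiE:
  assumes x: "x \<in> carrier P" and J: "J \<subseteq> I"
  shows "cyl J x = (\<Pi>\<^sub>E i\<in>I. if i \<in> J then {x i} else C i)"
proof (rule Set.set_eqI)
  fix z
  have "(\<forall>i\<in>I. z i \<in> C i) \<and> (\<forall>j\<in>J. z j = x j) \<longleftrightarrow> (\<forall>i\<in>I. z i \<in> (if i \<in> J then {x i} else C i))"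
    using J P_component[OF x] by (auto split: if_splits)
  then show "z \<in> cyl J x \<longleftrightarrow> z \<in> (\<Pi>\<^sub>E i\<in>I. if i \<in> J then {x i} else C i)"
    unfolding cyl_def agree_def mem_P mem_Collect_eq PiE_iff by blast
qed

lemma openin_cyl:
  assumes "finite J" "J \<subseteq> I" "x \<in> carrier P" shows "openin T (cyl J x)"
proof -
  have "finite {i \<in> I. (if i \<in> J then {x i} else C i) \<noteq> C i}"
    by (rule finite_subset[OF _ assms(1)]) auto
  then show ?thesis
    unfolding cyl_eq_PiE[OF assms(3,2)] using assms P_component[OF assms(3)]
    by (intro openin_PiE_gen[THEN iffD2] disjI2) auto
qed

lemma open_contains_cyl:
  assumes "openin T U" "x \<in> U"
  obtains J where "finite J" "J \<subseteq> I" "cyl J x \<subseteq> U"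
proof -
  obtain V where V: "finite {i \<in> I. V i \<noteq> C i}" "x \<in> Pi\<^sub>E I V" "Pi\<^sub>E I V \<subseteq> U"
    using assms unfolding openin_product_topology_alt by auto
  let ?J = "{i \<in> I. V i \<noteq> C i}"
  have "cyl ?J x \<subseteq> Pi\<^sub>E I V"
  proof
    fix z assume "z \<in> cyl ?J x"
    then have z: "z \<in> carrier P" "\<And>i. i \<in> ?J \<Longrightarrow> z i = x i" by (auto simp: cyl_def agree_def)
    have "z i \<in> V i" if "i \<in> I" for i
      using z(2)[of i] PiE_mem[OF V(2) that] P_component[OF z(1) that] that by (cases "V i = C i") auto
    moreover have "z \<in> extensional I" using z(1) unfolding mem_P PiE_iff by blast
    ultimately show "z \<in> Pi\<^sub>E I V" unfolding PiE_iff by blast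
  qed
  then show ?thesis using V that[of ?J] by auto
qed

definition depends_on :: "'i set \<Rightarrow> (('i \<Rightarrow> 'a) \<Rightarrow> 'b) \<Rightarrow> bool" where
  "depends_on J f \<longleftrightarrow> (\<forall>x\<in>carrier P. \<forall>y\<in>carrier P. agree J x y \<longrightarrow> f x = f y)"

lemma depends_onD: "depends_on J f \<Longrightarrow> x \<in> carrier P \<Longrightarrow> y \<in> carrier P \<Longrightarrow> agree J x y \<Longrightarrow> f x = f y"
  unfolding depends_on_def by blast

lemma agree_mono: "agree J x y \<Longrightarrow> K \<subseteq> J \<Longrightarrow> agree K x y"
  by (auto simp: agree_def)

lemma depends_on_mono: "depends_on J f \<Longrightarrow> J \<subseteq> K \<Longrightarrow> depends_on K f"
  unfolding depends_on_def using agree_mono by blast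

lemma continuous_depends_on:
  fixes f :: "('i \<Rightarrow> 'a) \<Rightarrow> 'b :: topological_space"
  assumes "depends_on J f" "finite J" "J \<subseteq> I"
  shows "continuous_map T euclidean f"
proof -
  have "openin T {x \<in> topspace T. f x \<in> U}" if "open U" for U
  proof (subst openin_subopen, intro ballI)
    fix x assume x: "x \<in> {x \<in> topspace T. f x \<in> U}"
    then have xP: "x \<in> carrier P" using topspace_eq by auto
    show "\<exists>V. openin T V \<and> x \<in> V \<and> V \<subseteq> {x \<in> topspace T. f x \<in> U}"
    proof (intro exI[of _ "cyl J x"] conjI subsetI)
      show "openin T (cyl J x)" using assms xP by (intro openin_cyl)
      show "x \<in> cyl J x" using xP by (simp add: cyl_def agree_def)
      fix z assume "z \<in> cyl J x"
      then have z: "z \<in> carrier P" "agree J z x" by (auto simp: cyl_def)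
      then have "f z = f x" using depends_onD[OF assms(1) _ xP] by blast
      then show "z \<in> {x \<in> topspace T. f x \<in> U}" using z x topspace_eq by auto
    qed
  qed
  then show ?thesis by (simp add: continuous_map_def)
qed

subsection \<open>Haar measure\<close>

abbreviation M where "M i \<equiv> uniform_count_measure (C i)"
abbreviation \<mu> where "\<mu> \<equiv> PiM I M"

lemma space_M [simp]: "space (M i) = C i" and sets_M [simp]: "sets (M i) = Pow (C i)"
  by (simp_all add: space_uniform_count_measure sets_uniform_count_measure)

lemma prob_M: "i \<in> I \<Longrightarrow> prob_space (M i)"
  using fin one_C by (intro prob_space_uniform_count_measure) auto

lemma prob_\<mu>: "prob_space \<mu>"
  by (rule prob_space_PiM[OF prob_M])

lemma space_\<mu>: "space \<mu> = carrier P"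
  by (simp add: space_PiM)

lemma mem_prod_emb:
  "J \<subseteq> I \<Longrightarrow> z \<in> prod_emb I M J (Pi\<^sub>E J A) \<longleftrightarrow> z \<in> carrier P \<and> (\<forall>j\<in>J. z j \<in> A j)"
  by (auto simp: prod_emb_def restrict_PiE_iff)

lemma cyl_measurable:
  assumes "finite J" "J \<subseteq> I" "x \<in> carrier P" shows "cyl J x \<in> sets \<mu>"
proof -
  have "cyl J x = prod_emb I M J (\<Pi>\<^sub>E j\<in>J. {x j})"
    using mem_prod_emb[OF assms(2), of _ "\<lambda>j. {x j}"] unfolding cyl_def agree_def by blast
  also have "\<dots> \<in> sets \<mu>"
    using assms P_component[OF assms(3)] by (intro sets_PiM_I) auto
  finally show ?thesis .
qed

lemma finite_cylinders:
  assumes "finite J" "J \<subseteq> I" shows "finite (cyl J ` carrier P)"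
proof -
  have "finite (\<Pi>\<^sub>E j\<in>J. C j)" using assms fin by (intro finite_PiE) auto
  moreover have "cyl J ` carrier P \<subseteq> (\<lambda>y. {z \<in> carrier P. agree J z y}) ` (\<Pi>\<^sub>E j\<in>J. C j)"
  proof
    fix S assume "S \<in> cyl J ` carrier P"
    then obtain x where x: "x \<in> carrier P" "S = cyl J x" by auto
    then have "S = {z \<in> carrier P. agree J z (restrict x J)}" by (auto simp: cyl_def agree_def)
    moreover have "restrict x J \<in> (\<Pi>\<^sub>E j\<in>J. C j)" using assms P_component[OF x(1)] by auto
    ultimately show "S \<in> (\<lambda>y. {z \<in> carrier P. agree J z y}) ` (\<Pi>\<^sub>E j\<in>J. C j)" by blast
  qed
  ultimately show ?thesis by (meson finite_imageI finite_subset)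
qed

text \<open>For uncountable \<open>I\<close> an open set may fail to lie in the product algebra, so
  continuity has to be used: the sets where \<open>f\<close> is at least \<open>1 / Suc n\<close>
  are compact, and each is covered by finitely many cylinders on which \<open>f\<close> is
  positive.\<close>

lemma positive_set_measurable:
  fixes f :: "('i \<Rightarrow> 'a) \<Rightarrow> real"
  assumes f: "continuous_map T euclidean f"
  shows "{x \<in> topspace T. f x > 0} \<in> sets \<mu>"
proof -
  let ?U = "{x \<in> topspace T. f x > 0}"
  have U: "openin T ?U"
    using openin_continuous_map_preimage[OF f, of "{0<..}"] by simp
  have "\<exists>W \<in> sets \<mu>. {x \<in> topspace T. f x \<ge> 1 / Suc n} \<subseteq> W \<and> W \<subseteq> ?U" for n
  proof -
    let ?K = "{x \<in> topspace T. f x \<ge> 1 / Suc n}"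
    have "closedin T ?K"
      using closedin_continuous_map_preimage[OF f, of "{1 / Suc n..}"] by simp
    then have K: "compactin T ?K" using compact_space by (rule closedin_compact_space[rotated])
    define \<C> where "\<C> = {cyl J x | J x. finite J \<and> J \<subseteq> I \<and> x \<in> carrier P \<and> cyl J x \<subseteq> ?U}"
    have "\<exists>\<F>. finite \<F> \<and> \<F> \<subseteq> \<C> \<and> ?K \<subseteq> \<Union>\<F>"
    proof (rule compactinD[OF K])
      show "openin T S" if "S \<in> \<C>" for S using that openin_cyl by (auto simp: \<C>_def)
      show "?K \<subseteq> \<Union>\<C>"
      proof
        fix x assume "x \<in> ?K"
        then have x: "x \<in> ?U" by (auto intro: less_le_trans[of 0 "1 / Suc n"])
        obtain J where J: "finite J" "J \<subseteq> I" "cyl J x \<subseteq> ?U" by (rule open_contains_cyl[OF U x]) (rule that)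
        have xP: "x \<in> carrier P" using x topspace_eq by auto
        have "x \<in> cyl J x" using xP by (simp add: cyl_def agree_def)
        then show "x \<in> \<Union>\<C>" using J xP unfolding \<C>_def by blast
      qed
    qed
    then obtain \<F> where \<F>: "finite \<F>" "\<F> \<subseteq> \<C>" "?K \<subseteq> \<Union>\<F>" by blast
    have "\<Union>\<F> \<in> sets \<mu>" using \<F> cyl_measurable by (intro sets.finite_Union) (auto simp: \<C>_def)
    moreover have "\<Union>\<F> \<subseteq> ?U" using \<F>(2) unfolding \<C>_def by blast
    ultimately show ?thesis using \<F>(3) by blast
  qed
  then have "\<forall>n. \<exists>W. W \<in> sets \<mu> \<and> {x \<in> topspace T. f x \<ge> 1 / Suc n} \<subseteq> W \<and> W \<subseteq> ?U" by blast
  from choice[OF this]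
  obtain W where W': "\<forall>n. W n \<in> sets \<mu> \<and> {x \<in> topspace T. f x \<ge> 1 / Suc n} \<subseteq> W n \<and> W n \<subseteq> ?U" ..
  then have W: "\<And>n. W n \<in> sets \<mu>" "\<And>n. {x \<in> topspace T. f x \<ge> 1 / Suc n} \<subseteq> W n" "\<And>n. W n \<subseteq> ?U"
    by blast+
  have "?U = (\<Union>n. W n)"
  proof (intro equalityI subsetI)
    fix x assume x: "x \<in> ?U"
    then obtain n where "1 / Suc n < f x" using nat_approx_posE[of "f x"] by auto
    then show "x \<in> (\<Union>n. W n)" using W(2)[of n] x by auto
  qed (use W(3) in blast)
  then show ?thesis using W(1) by auto
qed

text \<open>One inclusion is \<open>positive_set_measurable\<close>; for the other, the indicator of
  a condition on a single coordinate is continuous.\<close>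

lemma sets_baire: "sets (baire_algebra T) = sets \<mu>"
proof -
  let ?R = "{{x \<in> topspace T. f x > 0} | f :: ('i \<Rightarrow> 'a) \<Rightarrow> real. continuous_map T euclidean f}"
  have R: "?R \<subseteq> Pow (topspace T)" by auto
  have 1: "sets (baire_algebra T) = sigma_sets (topspace T) ?R"
    unfolding baire_algebra_def by (rule sets_measure_of[OF R])
  have sp: "topspace T = space \<mu>" using space_\<mu> topspace_eq by simp
  have "sigma_sets (topspace T) ?R \<subseteq> sets \<mu>"
    unfolding sp using positive_set_measurable sp by (intro sets.sigma_sets_subset) auto
  moreover have "sets \<mu> \<subseteq> sigma_sets (topspace T) ?R"
    unfolding sets_PiM_single
  proof (rule sigma_sets_subseteq[THEN subset_trans])
    show "{{f \<in> \<Pi>\<^sub>E i\<in>I. space (M i). f i \<in> A} |i A. i \<in> I \<and> A \<in> sets (M i)} \<subseteq> ?R"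
    proof (intro subsetI, elim CollectE exE conjE)
      fix S i A assume S: "S = {f \<in> \<Pi>\<^sub>E i\<in>I. space (M i). f i \<in> A}" and i: "i \<in> I" and A: "A \<in> sets (M i)"
      let ?f = "\<lambda>x. if x i \<in> A then 1 else 0 :: real"
      have "depends_on {i} ?f" by (auto simp: depends_on_def agree_def)
      then have "continuous_map T euclidean ?f" using i by (intro continuous_depends_on) auto
      moreover have "S = {x \<in> topspace T. ?f x > 0}" unfolding S by auto
      ultimately show "S \<in> ?R" by (intro CollectI exI[of _ ?f] conjI)
    qed
  qed simp
  ultimately show ?thesis using 1 by blast
qed

text \<open>A bijection of a finite set preserves its uniform measure, hence the measure of all
  boxes. Left and right translations are both of this kind.\<close>

lemma component_bijection_preserves_\<mu>:
  assumes h: "\<And>i. i \<in> I \<Longrightarrow> bij_betw (h i) (C i) (C i)"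
  defines "\<psi> \<equiv> \<lambda>x. \<lambda>i\<in>I. h i (x i)"
  shows "\<psi> \<in> measurable \<mu> \<mu>" "distr \<mu> \<mu> \<psi> = \<mu>"
proof -
  have hm: "h i \<in> measurable (M i) (M i)" if "i \<in> I" for i
    using h[OF that] by (auto simp: measurable_def bij_betw_def)
  show meas: "\<psi> \<in> measurable \<mu> \<mu>"
    unfolding \<psi>_def using hm by (intro measurable_restrict measurable_compose[OF measurable_component_singleton])
  interpret prob_space \<mu> by (rule prob_\<mu>)
  show "distr \<mu> \<mu> \<psi> = \<mu>"
  proof (rule measure_eqI_PiM_infinite)
    fix A J assume J: "finite J" "J \<subseteq> I" and A: "\<And>i. i \<in> J \<Longrightarrow> A i \<in> sets (M i)"
    let ?B = "\<lambda>i. h i -` A i \<inter> C i"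
    have "\<psi> -` prod_emb I M J (Pi\<^sub>E J A) \<inter> space \<mu> = prod_emb I M J (Pi\<^sub>E J ?B)"
    proof (rule Set.set_eqI)
      fix x
      have \<psi>P: "\<psi> x \<in> carrier P" if "x \<in> carrier P"
        using that h by (auto simp: \<psi>_def PiE_iff bij_betw_def)
      have "\<psi> x j = h j (x j)" if "j \<in> J" for j using that J by (auto simp: \<psi>_def)
      then have "x \<in> \<psi> -` prod_emb I M J (Pi\<^sub>E J A) \<inter> space \<mu>
          \<longleftrightarrow> x \<in> carrier P \<and> (\<forall>j\<in>J. h j (x j) \<in> A j)"
        unfolding Int_iff vimage_eq mem_prod_emb[OF J(2)] space_\<mu> using \<psi>P by auto
      also have "\<dots> \<longleftrightarrow> x \<in> prod_emb I M J (Pi\<^sub>E J ?B)"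
        unfolding mem_prod_emb[OF J(2)] using P_component J by blast
      finally show "x \<in> \<psi> -` prod_emb I M J (Pi\<^sub>E J A) \<inter> space \<mu> \<longleftrightarrow> x \<in> prod_emb I M J (Pi\<^sub>E J ?B)" .
    qed
    then have "emeasure (distr \<mu> \<mu> \<psi>) (prod_emb I M J (Pi\<^sub>E J A)) = emeasure \<mu> (prod_emb I M J (Pi\<^sub>E J ?B))"
      using J A meas by (subst emeasure_distr) (auto intro!: sets_PiM_I)
    also have "\<dots> = (\<Prod>i\<in>J. emeasure (M i) (?B i))"
      using J by (intro emeasure_PiM_emb prob_M) auto
    also have "\<dots> = (\<Prod>i\<in>J. emeasure (M i) (A i))"
    proof (intro prod.cong refl)
      fix i assume "i \<in> J"
      then have i: "i \<in> I" "A i \<subseteq> C i" using J A by auto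
      have inj: "inj_on (h i) (C i)" and im: "h i ` C i = C i" using h[OF i(1)] by (auto simp: bij_betw_def)
      have "h i ` ?B i = A i \<inter> h i ` C i" by auto
      also have "\<dots> = A i" unfolding im using i(2) by auto
      finally have "card (A i) = card (h i ` ?B i)" by simp
      also have "\<dots> = card (?B i)" by (rule card_image[OF inj_on_subset[OF inj]]) auto
      finally have "card (?B i) = card (A i)" by simp
      then show "emeasure (M i) (?B i) = emeasure (M i) (A i)"
        using i fin by (simp add: emeasure_uniform_count_measure)
    qed
    also have "\<dots> = emeasure \<mu> (prod_emb I M J (Pi\<^sub>E J A))"
      using J A by (intro emeasure_PiM_emb[symmetric] prob_M) auto
    finally show "emeasure (distr \<mu> \<mu> \<psi>) (prod_emb I M J (Pi\<^sub>E J A)) = emeasure \<mu> (prod_emb I M J (Pi\<^sub>E J A))" .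
  next
    interpret D: prob_space "distr \<mu> \<mu> \<psi>" by (rule prob_space_distr[OF meas])
    show "finite_measure (distr \<mu> \<mu> \<psi>)" by unfold_locales
  qed simp_all
qed

lemma bij_mult_left: "i \<in> I \<Longrightarrow> a \<in> C i \<Longrightarrow> bij_betw (\<lambda>b. a \<otimes>\<^bsub>G i\<^esub> b) (C i) (C i)"
  and bij_mult_right: "i \<in> I \<Longrightarrow> a \<in> C i \<Longrightarrow> bij_betw (\<lambda>b. b \<otimes>\<^bsub>G i\<^esub> a) (C i) (C i)"
proof -
  assume i: "i \<in> I" and a: "a \<in> C i"
  interpret Gi: group "G i" by (rule grp[OF i])
  show "bij_betw (\<lambda>b. a \<otimes>\<^bsub>G i\<^esub> b) (C i) (C i)"
    by (rule bij_betw_byWitness[where f' = "\<lambda>b. inv\<^bsub>G i\<^esub> a \<otimes>\<^bsub>G i\<^esub> b"]) (use a in \<open>auto simp: Gi.m_assoc[symmetric]\<close>)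
  show "bij_betw (\<lambda>b. b \<otimes>\<^bsub>G i\<^esub> a) (C i) (C i)"
    by (rule bij_betw_byWitness[where f' = "\<lambda>b. b \<otimes>\<^bsub>G i\<^esub> inv\<^bsub>G i\<^esub> a"]) (use a in \<open>auto simp: Gi.m_assoc\<close>)
qed

lemma translate_\<mu>:
  assumes g: "g \<in> carrier P"
  shows "(\<lambda>x. g \<otimes>\<^bsub>P\<^esub> x) \<in> measurable \<mu> \<mu>" "distr \<mu> \<mu> (\<lambda>x. g \<otimes>\<^bsub>P\<^esub> x) = \<mu>"
    "(\<lambda>x. x \<otimes>\<^bsub>P\<^esub> g) \<in> measurable \<mu> \<mu>" "distr \<mu> \<mu> (\<lambda>x. x \<otimes>\<^bsub>P\<^esub> g) = \<mu>"
  using component_bijection_preserves_\<mu>[of "\<lambda>i b. g i \<otimes>\<^bsub>G i\<^esub> b"] component_bijection_preserves_\<mu>[of "\<lambda>i b. b \<otimes>\<^bsub>G i\<^esub> g i"]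
    bij_mult_left bij_mult_right P_component[OF g] by (simp_all add: mult_product_group)

lemma haar_\<mu>: "is_haar_measure P T \<mu>"
  unfolding is_haar_measure_def
proof (intro conjI ballI)
  show "sets \<mu> = sets (baire_algebra T)" by (rule sets_baire[symmetric])
  show "prob_space \<mu>" by (rule prob_\<mu>)
  fix g E assume g: "g \<in> carrier P" and E: "E \<in> sets \<mu>"
  let ?\<psi> = "\<lambda>x. inv\<^bsub>P\<^esub> g \<otimes>\<^bsub>P\<^esub> x"
  have g': "inv\<^bsub>P\<^esub> g \<in> carrier P" using g by (rule inv_closed)
  have EP: "E \<subseteq> carrier P" using sets.sets_into_space[OF E] space_\<mu> by simp
  have im: "(\<lambda>x. g \<otimes>\<^bsub>P\<^esub> x) ` E = ?\<psi> -` E \<inter> space \<mu>"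
  proof (intro equalityI subsetI)
    fix y assume "y \<in> (\<lambda>x. g \<otimes>\<^bsub>P\<^esub> x) ` E"
    then obtain x where x: "x \<in> E" "y = g \<otimes>\<^bsub>P\<^esub> x" by blast
    then have xP: "x \<in> carrier P" using EP by blast
    have "?\<psi> y = x" unfolding x(2) using g xP by (metis inv_closed l_inv l_one m_assoc)
    then show "y \<in> ?\<psi> -` E \<inter> space \<mu>"
      unfolding space_\<mu> Int_iff vimage_eq x(2) using x(1) m_closed[OF g xP] by (simp only: simp_thms)
  next
    fix y assume "y \<in> ?\<psi> -` E \<inter> space \<mu>"
    then have y: "?\<psi> y \<in> E" "y \<in> carrier P" by (simp_all only: Int_iff vimage_eq space_\<mu>)
    then have "y = g \<otimes>\<^bsub>P\<^esub> ?\<psi> y" using g by (metis inv_closed r_inv l_one m_assoc)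
    then show "y \<in> (\<lambda>x. g \<otimes>\<^bsub>P\<^esub> x) ` E" using y(1) by (rule image_eqI)
  qed
  show "(\<lambda>x. g \<otimes>\<^bsub>P\<^esub> x) ` E \<in> sets \<mu>" unfolding im by (rule measurable_sets[OF translate_\<mu>(1)[OF g'] E])
  have "emeasure \<mu> ((\<lambda>x. g \<otimes>\<^bsub>P\<^esub> x) ` E) = emeasure (distr \<mu> \<mu> ?\<psi>) E"
    unfolding im by (rule emeasure_distr[OF translate_\<mu>(1)[OF g'] E, symmetric])
  then show "emeasure \<mu> ((\<lambda>x. g \<otimes>\<^bsub>P\<^esub> x) ` E) = emeasure \<mu> E" by (simp only: translate_\<mu>(2)[OF g'])
qed

text \<open>Translation by \<open>x\<close> carries the cylinder at the identity onto the one at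
  \<open>x\<close>.\<close>

lemma haar_cyl:
  assumes \<nu>: "is_haar_measure P T \<nu>" and J: "finite J" "J \<subseteq> I" and x: "x \<in> carrier P"
  shows "emeasure \<nu> (cyl J x) = emeasure \<nu> (cyl J \<one>\<^bsub>P\<^esub>)" "cyl J x \<in> sets \<nu>"
proof -
  have sets: "sets \<nu> = sets \<mu>" using \<nu> sets_baire by (simp add: is_haar_measure_def)
  show "cyl J x \<in> sets \<nu>" unfolding sets by (rule cyl_measurable[OF J x])
  have im: "(\<lambda>z. x \<otimes>\<^bsub>P\<^esub> z) ` cyl J \<one>\<^bsub>P\<^esub> = cyl J x"
  proof (intro equalityI subsetI)
    fix y assume "y \<in> (\<lambda>z. x \<otimes>\<^bsub>P\<^esub> z) ` cyl J \<one>\<^bsub>P\<^esub>"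
    then obtain z where z: "z \<in> carrier P" "agree J z \<one>\<^bsub>P\<^esub>" "y = x \<otimes>\<^bsub>P\<^esub> z" by (auto simp: cyl_def)
    have "y j = x j" if "j \<in> J" for j
    proof -
      interpret Gj: group "G j" using grp J that by auto
      have "j \<in> I" using J that by auto
      then show ?thesis using z that P_component[OF x] by (auto simp: agree_def mult_component one_component)
    qed
    moreover have "y \<in> carrier P" unfolding z(3) by (rule m_closed[OF x z(1)])
    ultimately show "y \<in> cyl J x" unfolding cyl_def agree_def by blast
  next
    fix y assume "y \<in> cyl J x"
    then have y: "y \<in> carrier P" "agree J y x" by (auto simp: cyl_def)
    have ix: "inv\<^bsub>P\<^esub> x \<in> carrier P" using x by (rule inv_closed)
    have eq: "y = x \<otimes>\<^bsub>P\<^esub> (inv\<^bsub>P\<^esub> x \<otimes>\<^bsub>P\<^esub> y)" using x y by (metis inv_closed r_inv l_one m_assoc)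
    have "(inv\<^bsub>P\<^esub> x \<otimes>\<^bsub>P\<^esub> y) j = \<one>\<^bsub>P\<^esub> j" if "j \<in> J" for j
    proof -
      interpret Gj: group "G j" using grp J that by auto
      have j: "j \<in> I" using J that by auto
      have "y j = x j" using y that by (simp add: agree_def)
      then show ?thesis using P_component[OF x j] by (simp only: mult_component[OF j] inv_component[OF x j] one_component[OF j] Gj.l_inv)
    qed
    then have "inv\<^bsub>P\<^esub> x \<otimes>\<^bsub>P\<^esub> y \<in> cyl J \<one>\<^bsub>P\<^esub>"
      unfolding cyl_def agree_def using m_closed[OF ix y(1)] by blast
    with eq show "y \<in> (\<lambda>z. x \<otimes>\<^bsub>P\<^esub> z) ` cyl J \<one>\<^bsub>P\<^esub>" by (rule image_eqI)
  qed
  have "cyl J \<one>\<^bsub>P\<^esub> \<in> sets \<nu>" unfolding sets by (rule cyl_measurable[OF J one_closed])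
  then have "emeasure \<nu> ((\<lambda>z. x \<otimes>\<^bsub>P\<^esub> z) ` cyl J \<one>\<^bsub>P\<^esub>) = emeasure \<nu> (cyl J \<one>\<^bsub>P\<^esub>)"
    using \<nu> x unfolding is_haar_measure_def by (simp only:)
  then show "emeasure \<nu> (cyl J x) = emeasure \<nu> (cyl J \<one>\<^bsub>P\<^esub>)" unfolding im .
qed

lemma haar_box:
  assumes \<nu>: "is_haar_measure P T \<nu>" and J: "finite J" "J \<subseteq> I" and A: "\<And>j. j \<in> J \<Longrightarrow> A j \<subseteq> C j"
  shows "emeasure \<nu> (prod_emb I M J (Pi\<^sub>E J A)) = of_nat (card (Pi\<^sub>E J A)) * emeasure \<nu> (cyl J \<one>\<^bsub>P\<^esub>)"
proof -
  define e where "e y = (\<lambda>i\<in>I. if i \<in> J then y i else \<one>\<^bsub>G i\<^esub>)" for y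
  have eP: "e y \<in> carrier P" if "y \<in> Pi\<^sub>E J A" for y
    unfolding mem_P e_def using subsetD[OF A PiE_mem[OF that]] one_C by auto
  have eJ: "e y j = y j" if "j \<in> J" for y j using that J by (auto simp: e_def)
  have finA: "finite (Pi\<^sub>E J A)" using J by (intro finite_PiE finite_subset[OF A] fin) auto
  have "prod_emb I M J (Pi\<^sub>E J A) = (\<Union>y\<in>Pi\<^sub>E J A. cyl J (e y))"
  proof (intro equalityI subsetI)
    fix z assume "z \<in> prod_emb I M J (Pi\<^sub>E J A)"
    then have z: "z \<in> carrier P" "restrict z J \<in> Pi\<^sub>E J A"
      unfolding mem_prod_emb[OF J(2)] restrict_PiE_iff by blast+
    then have "z \<in> cyl J (e (restrict z J))" unfolding cyl_def agree_def by (simp add: eJ)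
    then show "z \<in> (\<Union>y\<in>Pi\<^sub>E J A. cyl J (e y))" using z by blast
  next
    fix z assume "z \<in> (\<Union>y\<in>Pi\<^sub>E J A. cyl J (e y))"
    then obtain y where y: "y \<in> Pi\<^sub>E J A" "z \<in> carrier P" "\<forall>j\<in>J. z j = y j"
      by (auto simp: cyl_def agree_def eJ)
    then show "z \<in> prod_emb I M J (Pi\<^sub>E J A)" unfolding mem_prod_emb[OF J(2)] by auto
  qed
  also have "emeasure \<nu> \<dots> = (\<Sum>y\<in>Pi\<^sub>E J A. emeasure \<nu> (cyl J (e y)))"
  proof (rule sum_emeasure[symmetric])
    show "(\<lambda>y. cyl J (e y)) ` Pi\<^sub>E J A \<subseteq> sets \<nu>" using haar_cyl(2)[OF \<nu> J] eP by blast
    show "disjoint_family_on (\<lambda>y. cyl J (e y)) (Pi\<^sub>E J A)"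
    proof (unfold disjoint_family_on_def, intro ballI impI)
      fix y y' assume y: "y \<in> Pi\<^sub>E J A" "y' \<in> Pi\<^sub>E J A" "y \<noteq> y'"
      then obtain j where "j \<in> J" "y j \<noteq> y' j" by (metis PiE_ext)
      then show "cyl J (e y) \<inter> cyl J (e y') = {}" using eJ by (auto simp: cyl_def agree_def)
    qed
  qed (rule finA)
  also have "\<dots> = (\<Sum>y\<in>Pi\<^sub>E J A. emeasure \<nu> (cyl J \<one>\<^bsub>P\<^esub>))"
    by (rule sum.cong[OF refl]) (rule haar_cyl(1)[OF \<nu> J eP])
  finally show ?thesis by simp
qed

definition box_card :: "'i set \<Rightarrow> nat" where "box_card J = card (\<Pi>\<^sub>E j\<in>J. C j)"

lemma box_card_pos: "finite J \<Longrightarrow> J \<subseteq> I \<Longrightarrow> box_card J > 0"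
proof -
  assume J: "finite J" "J \<subseteq> I"
  have "(\<Pi>\<^sub>E j\<in>J. C j) \<noteq> {}"
    using J one_C by (auto simp: PiE_eq_empty_iff)
  then show ?thesis unfolding box_card_def using J fin by (simp add: card_gt_0_iff finite_PiE subset_iff)
qed

lemma haar_cyl_box_card:
  assumes \<nu>: "is_haar_measure P T \<nu>" and J: "finite J" "J \<subseteq> I"
  shows "of_nat (box_card J) * emeasure \<nu> (cyl J \<one>\<^bsub>P\<^esub>) = 1"
proof -
  interpret prob_space \<nu> using \<nu> by (simp add: is_haar_measure_def)
  have sets: "sets \<nu> = sets \<mu>" using \<nu> sets_baire by (simp add: is_haar_measure_def)
  have "prod_emb I M J (\<Pi>\<^sub>E j\<in>J. C j) = space \<nu>"
    unfolding sets_eq_imp_space_eq[OF sets] space_\<mu>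
    using mem_prod_emb[OF J(2), of _ C] P_component J(2) by blast
  then have "1 = emeasure \<nu> (prod_emb I M J (\<Pi>\<^sub>E j\<in>J. C j))" using emeasure_space_1 by simp
  also have "\<dots> = of_nat (box_card J) * emeasure \<nu> (cyl J \<one>\<^bsub>P\<^esub>)"
    unfolding box_card_def by (rule haar_box[OF \<nu> J]) simp
  finally show ?thesis by simp
qed

text \<open>The \<open>box_card J\<close> cylinders over \<open>J\<close> partition the group and
  have equal measure, so this measure is forced. Every box is a finite disjoint union of cylinders,
  and the boxes determine the measure.\<close>

lemma haar_unique:
  assumes \<nu>: "is_haar_measure P T \<nu>" shows "\<nu> = \<mu>"
proof (rule measure_eqI_PiM_infinite)
  interpret prob_space \<nu> using \<nu> by (simp add: is_haar_measure_def)
  show "sets \<nu> = sets \<mu>" using \<nu> sets_baire by (simp add: is_haar_measure_def)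
  show "finite_measure \<nu>" by unfold_locales
  fix A J assume J: "finite J" "J \<subseteq> I" and A: "\<And>i. i \<in> J \<Longrightarrow> A i \<in> sets (M i)"
  let ?n = "of_nat (box_card J) :: ennreal"
  have A': "\<And>i. i \<in> J \<Longrightarrow> A i \<subseteq> C i" using A by simp
  have n: "?n \<noteq> 0" "?n \<noteq> \<top>" using box_card_pos[OF J] by auto
  have "emeasure \<nu> (cyl J \<one>\<^bsub>P\<^esub>) = emeasure \<mu> (cyl J \<one>\<^bsub>P\<^esub>)"
    using haar_cyl_box_card[OF \<nu> J] haar_cyl_box_card[OF haar_\<mu> J] n by (metis ennreal_mult_cancel_left)
  then show "emeasure \<nu> (prod_emb I M J (Pi\<^sub>E J A)) = emeasure \<mu> (prod_emb I M J (Pi\<^sub>E J A))"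
    by (simp only: haar_box[OF \<nu> J A'] haar_box[OF haar_\<mu> J A'])
qed simp

lemma haar_eq: "haar_measure P T = \<mu>"
  unfolding haar_measure_def using haar_\<mu> haar_unique by (rule the_equality)

lemma measurable_continuous:
  fixes f :: "('i \<Rightarrow> 'a) \<Rightarrow> complex"
  assumes f: "continuous_map T euclidean f" shows "f \<in> borel_measurable \<mu>"
proof -
  have "h \<in> borel_measurable \<mu>" if h: "continuous_map T euclidean h" for h :: "('i \<Rightarrow> 'a) \<Rightarrow> real"
    unfolding borel_measurable_iff_greater
  proof
    fix a
    have "continuous_map T euclidean (\<lambda>x. h x - a)" using h by (intro continuous_map_diff) auto
    from positive_set_measurable[OF this] have "{x \<in> carrier P. 0 < h x - a} \<in> sets \<mu>"
      unfolding topspace_eq .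
    then show "{w \<in> space \<mu>. a < h w} \<in> sets \<mu>" by (simp only: space_\<mu> diff_gt_0_iff_gt)
  qed
  moreover have "continuous_map T euclidean (\<lambda>x. Re (f x))" "continuous_map T euclidean (\<lambda>x. Im (f x))"
    using continuous_map_compose[OF f, of euclidean Re] continuous_map_compose[OF f, of euclidean Im]
    by (simp_all add: o_def continuous_on_Re continuous_on_Im continuous_on_id)
  ultimately show ?thesis unfolding borel_measurable_complex_iff by blast
qed

sublocale haar_grp P T
proof (intro haar_grp.intro haar_grp_axioms.intro, goal_cases)
  case 1
  show ?case by (rule compact_grp_axioms)
next
  case 2
  show ?case unfolding haar_eq by (rule prob_\<mu>)
next
  case 3
  show ?case unfolding haar_eq by (rule space_\<mu>)
next
  case (4 f)
  then show ?case unfolding haar_eq by (rule measurable_continuous)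
next
  case (5 f g)
  then show ?case
    unfolding haar_eq using integral_distr[OF translate_\<mu>(1)[OF 5(2)] measurable_continuous[OF 5(1)]]
    by (simp only: translate_\<mu>(2)[OF 5(2)])
next
  case (6 f g)
  then show ?case
    unfolding haar_eq using integral_distr[OF translate_\<mu>(3)[OF 6(2)] measurable_continuous[OF 6(1)]]
    by (simp only: translate_\<mu>(4)[OF 6(2)])
qed

end

context finite_product_grp
begin

subsection \<open>Regular representations of the finite subproducts\<close>

definition enum :: "'i set \<Rightarrow> nat \<Rightarrow> 'i \<Rightarrow> 'a" where
  "enum J = (SOME h. bij_betw h {..<box_card J} (\<Pi>\<^sub>E j\<in>J. C j))"

text \<open>Left translation by \<open>x\<close> on the finite subproduct, transported to indices
  through \<open>enum\<close>.\<close>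

definition perm :: "'i set \<Rightarrow> ('i \<Rightarrow> 'a) \<Rightarrow> nat \<Rightarrow> nat" where
  "perm J x b = inv_into {..<box_card J} (enum J) (\<lambda>j\<in>J. x j \<otimes>\<^bsub>G j\<^esub> enum J b j)"

text \<open>The left regular representation of the subproduct over \<open>J\<close>, pulled back to
  the whole group.\<close>

definition regular :: "'i set \<Rightarrow> ('i \<Rightarrow> 'a) \<Rightarrow> complex mat" where
  "regular J x = mat (box_card J) (box_card J) (\<lambda>(a, b). if a = perm J x b then 1 else 0)"

context
  fixes J assumes J: "finite J" "J \<subseteq> I"
begin

lemma enum_bij: "bij_betw (enum J) {..<box_card J} (\<Pi>\<^sub>E j\<in>J. C j)"
proof -
  have "finite (\<Pi>\<^sub>E j\<in>J. C j)" using J fin by (intro finite_PiE) auto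
  then have "\<exists>h. bij_betw h {..<box_card J} (\<Pi>\<^sub>E j\<in>J. C j)"
    using ex_bij_betw_nat_finite[of "\<Pi>\<^sub>E j\<in>J. C j"] by (simp add: box_card_def lessThan_atLeast0)
  then show ?thesis unfolding enum_def by (rule someI_ex)
qed

lemma enum_mem: "b < box_card J \<Longrightarrow> enum J b \<in> (\<Pi>\<^sub>E j\<in>J. C j)"
  using enum_bij by (auto simp: bij_betw_def)

lemma enum_inj: "a < box_card J \<Longrightarrow> b < box_card J \<Longrightarrow> enum J a = enum J b \<longleftrightarrow> a = b"
  using enum_bij by (auto simp: bij_betw_def inj_on_def)

lemma perm_props:
  assumes x: "x \<in> carrier P" and b: "b < box_card J"
  shows "perm J x b < box_card J" "enum J (perm J x b) = (\<lambda>j\<in>J. x j \<otimes>\<^bsub>G j\<^esub> enum J b j)"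
proof -
  have "(\<lambda>j\<in>J. x j \<otimes>\<^bsub>G j\<^esub> enum J b j) \<in> (\<Pi>\<^sub>E j\<in>J. C j)"
  proof (intro restrict_PiE_iff[THEN iffD2] ballI)
    fix j assume j: "j \<in> J"
    interpret Gj: group "G j" using grp J j by auto
    show "x j \<otimes>\<^bsub>G j\<^esub> enum J b j \<in> C j"
      using P_component[OF x] PiE_mem[OF enum_mem[OF b] j] j J by (intro Gj.m_closed) auto
  qed
  then have im: "(\<lambda>j\<in>J. x j \<otimes>\<^bsub>G j\<^esub> enum J b j) \<in> enum J ` {..<box_card J}"
    using enum_bij by (simp add: bij_betw_def)
  show "perm J x b < box_card J" unfolding perm_def using inv_into_into[OF im] by simp
  show "enum J (perm J x b) = (\<lambda>j\<in>J. x j \<otimes>\<^bsub>G j\<^esub> enum J b j)" unfolding perm_def by (rule f_inv_into_f[OF im])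
qed

lemma perm_eqI:
  "x \<in> carrier P \<Longrightarrow> b < box_card J \<Longrightarrow> a < box_card J \<Longrightarrow>
    (\<And>j. j \<in> J \<Longrightarrow> enum J a j = x j \<otimes>\<^bsub>G j\<^esub> enum J b j) \<Longrightarrow> perm J x b = a"
  using perm_props[of x b] enum_mem[of a] enum_inj[of "perm J x b" a]
  by (metis (no_types, lifting) PiE_restrict restrict_ext)

lemma perm_mult:
  assumes x: "x \<in> carrier P" and y: "y \<in> carrier P" and b: "b < box_card J"
  shows "perm J (x \<otimes>\<^bsub>P\<^esub> y) b = perm J x (perm J y b)"
proof (rule perm_eqI[OF m_closed[OF x y] b])
  note y' = perm_props[OF y b]
  note x' = perm_props[OF x y'(1)]
  show "perm J x (perm J y b) < box_card J" by (rule x')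
  fix j assume j: "j \<in> J"
  interpret Gj: group "G j" using grp J j by auto
  have jI: "j \<in> I" using j J by auto
  show "enum J (perm J x (perm J y b)) j = (x \<otimes>\<^bsub>P\<^esub> y) j \<otimes>\<^bsub>G j\<^esub> enum J b j"
    unfolding x'(2) y'(2) mult_component[OF jI]
    using j P_component[OF x jI] P_component[OF y jI] PiE_mem[OF enum_mem[OF b] j] by (simp add: Gj.m_assoc)
qed

text \<open>Left translations act freely, so a single fixed index forces the coordinates in
  \<open>J\<close> to be trivial. Hence the character of the regular representation is concentrated
  on a cylinder.\<close>

lemma perm_fixed:
  assumes x: "x \<in> carrier P" and b: "b < box_card J"
  shows "perm J x b = b \<longleftrightarrow> agree J x \<one>\<^bsub>P\<^esub>"
proof -
  have iff: "x j \<otimes>\<^bsub>G j\<^esub> enum J b j = enum J b j \<longleftrightarrow> x j = \<one>\<^bsub>P\<^esub> j" if j: "j \<in> J" for j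
  proof -
    interpret Gj: group "G j" using grp J j by auto
    have jI: "j \<in> I" using j J by auto
    show ?thesis
      unfolding one_component[OF jI] using P_component[OF x jI] PiE_mem[OF enum_mem[OF b] j] by simp
  qed
  show ?thesis
  proof
    assume "perm J x b = b"
    then have eq: "(\<lambda>j\<in>J. x j \<otimes>\<^bsub>G j\<^esub> enum J b j) = enum J b" using perm_props(2)[OF x b] by simp
    have "x j \<otimes>\<^bsub>G j\<^esub> enum J b j = enum J b j" if "j \<in> J" for j
      using fun_cong[OF eq, of j] that by (simp only: restrict_apply if_True)
    then show "agree J x \<one>\<^bsub>P\<^esub>" unfolding agree_def using iff by blast
  next
    assume "agree J x \<one>\<^bsub>P\<^esub>"
    then have "x j \<otimes>\<^bsub>G j\<^esub> enum J b j = enum J b j" if "j \<in> J" for j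
      using iff[OF that] that unfolding agree_def by blast
    then show "perm J x b = b" by (intro perm_eqI[OF x b b] sym[of "_ \<otimes>\<^bsub>G _\<^esub> _"])
  qed
qed

lemma perm_inj:
  assumes x: "x \<in> carrier P" and ab: "a < box_card J" "b < box_card J"
  shows "perm J x a = perm J x b \<longleftrightarrow> a = b"
proof
  have ix: "inv\<^bsub>P\<^esub> x \<in> carrier P" by (rule inv_closed[OF x])
  have "agree J (inv\<^bsub>P\<^esub> x \<otimes>\<^bsub>P\<^esub> x) \<one>\<^bsub>P\<^esub>" unfolding l_inv[OF x] agree_def by blast
  then have *: "perm J (inv\<^bsub>P\<^esub> x) (perm J x c) = c" if "c < box_card J" for c
    using perm_fixed[OF m_closed[OF ix x] that] perm_mult[OF ix x that] by metis
  assume "perm J x a = perm J x b"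
  then show "a = b" using *[OF ab(1)] *[OF ab(2)] by metis
qed simp

lemma perm_agree: "agree J x y \<Longrightarrow> perm J x b = perm J y b"
  unfolding perm_def agree_def by (rule arg_cong[of _ _ "inv_into {..<box_card J} (enum J)"]) (simp cong: restrict_cong)

lemma regular_rep: "unitary_rep P T (box_card J) (regular J)"
  unfolding unitary_rep_def
proof (intro conjI ballI allI impI)
  let ?N = "box_card J"
  have R: "regular J x \<in> carrier_mat ?N ?N" for x by (simp add: regular_def)
  fix x assume x: "x \<in> carrier P"
  show "regular J x \<in> carrier_mat ?N ?N" by (rule R)
  show "mat_adjoint (regular J x) * regular J x = 1\<^sub>m ?N"
  proof (rule eq_matI)
    fix a b assume "a < dim_row (1\<^sub>m ?N :: complex mat)" "b < dim_col (1\<^sub>m ?N :: complex mat)"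
    then have ab: "a < ?N" "b < ?N" by auto
    have "(mat_adjoint (regular J x) * regular J x) $$ (a, b)
        = (\<Sum>c<?N. if c = perm J x a then (if perm J x a = perm J x b then 1 else 0) else 0)"
      unfolding index_mult_mat_sum[OF mat_adjoint_carrier[OF R] R ab]
      using ab R by (intro sum.cong) (auto simp: regular_def)
    also have "\<dots> = 1\<^sub>m ?N $$ (a, b)"
      using perm_props(1)[OF x ab(1)] perm_inj[OF x ab] ab by simp
    finally show "(mat_adjoint (regular J x) * regular J x) $$ (a, b) = 1\<^sub>m ?N $$ (a, b)" .
  qed (simp_all add: regular_def)
  fix y assume y: "y \<in> carrier P"
  show "regular J (x \<otimes>\<^bsub>P\<^esub> y) = regular J x * regular J y"
  proof (rule eq_matI)
    fix a b assume "a < dim_row (regular J x * regular J y)" "b < dim_col (regular J x * regular J y)"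
    then have ab: "a < ?N" "b < ?N" by (auto simp: regular_def)
    have "(regular J x * regular J y) $$ (a, b)
        = (\<Sum>c<?N. if c = perm J y b then (if a = perm J x (perm J y b) then 1 else 0) else 0)"
      unfolding index_mult_mat_sum[OF R R ab] using ab by (intro sum.cong) (auto simp: regular_def)
    also have "\<dots> = (if a = perm J x (perm J y b) then 1 else 0)"
      using perm_props(1)[OF y ab(2)] by simp
    also have "\<dots> = regular J (x \<otimes>\<^bsub>P\<^esub> y) $$ (a, b)"
      unfolding regular_def perm_mult[OF x y ab(2), symmetric] using ab by simp
    finally show "regular J (x \<otimes>\<^bsub>P\<^esub> y) $$ (a, b) = (regular J x * regular J y) $$ (a, b)" by simp
  qed (simp_all add: regular_def)
next
  fix a b assume "a < box_card J" "b < box_card J"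
  have "depends_on J (\<lambda>x. regular J x $$ (a, b))"
    unfolding depends_on_def
  proof (intro ballI impI)
    fix x y assume "agree J x y"
    then have "perm J x = perm J y" by (intro ext perm_agree)
    then show "regular J x $$ (a, b) = regular J y $$ (a, b)" by (simp only: regular_def)
  qed
  then show "cont (\<lambda>x. regular J x $$ (a, b))" using J by (rule continuous_depends_on)
qed

lemma regular_trace:
  assumes x: "x \<in> carrier P"
  shows "mtrace (regular J x) = (if agree J x \<one>\<^bsub>P\<^esub> then of_nat (box_card J) else 0)"
proof -
  have "mtrace (regular J x) = (\<Sum>b<box_card J. if perm J x b = b then 1 else 0)"
    unfolding mtrace_def by (intro sum.cong) (auto simp: regular_def)
  also have "\<dots> = (\<Sum>b<box_card J. if agree J x \<one>\<^bsub>P\<^esub> then 1 else 0)"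
    using perm_fixed[OF x] by (intro sum.cong) auto
  finally show ?thesis by simp
qed

section \<open>Averaging over cylinders\<close>

lemma agree_inv_mult:
  assumes z: "z \<in> carrier P" and x: "x \<in> carrier P"
  shows "agree J (inv\<^bsub>P\<^esub> z \<otimes>\<^bsub>P\<^esub> x) \<one>\<^bsub>P\<^esub> \<longleftrightarrow> agree J z x"
proof -
  have "(inv\<^bsub>P\<^esub> z \<otimes>\<^bsub>P\<^esub> x) j = \<one>\<^bsub>P\<^esub> j \<longleftrightarrow> z j = x j" if j: "j \<in> J" for j
  proof -
    interpret Gj: group "G j" using grp J j by auto
    have jI: "j \<in> I" using j J by auto
    have c: "z j \<in> C j" "x j \<in> C j" using P_component[OF z jI] P_component[OF x jI] by auto
    show ?thesis
      unfolding mult_component[OF jI] inv_component[OF z jI] one_component[OF jI]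
      using c Gj.inv_solve_left'[of "\<one>\<^bsub>G j\<^esub>" "z j" "x j"] by auto
  qed
  then show ?thesis unfolding agree_def by blast
qed

text \<open>The indicator of the cylinder at \<open>x\<close>, scaled to have integral 1. It equals
  the character of the regular representation at \<open>inv z\<close> times \<open>x\<close>, see
  \<open>kernel_eq\<close>.\<close>

definition kernel :: "('i \<Rightarrow> 'a) \<Rightarrow> ('i \<Rightarrow> 'a) \<Rightarrow> real" where
  "kernel x z = (if agree J z x then real (box_card J) else 0)"

lemma kernel_eq:
  "z \<in> carrier P \<Longrightarrow> x \<in> carrier P \<Longrightarrow> mtrace (regular J (inv\<^bsub>P\<^esub> z \<otimes>\<^bsub>P\<^esub> x)) = complex_of_real (kernel x z)"
  using regular_trace[OF m_closed[OF inv_closed]] agree_inv_mult by (simp only: kernel_def if_distrib of_real_of_nat_eq of_real_0)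

lemma kernel_integral:
  assumes x: "x \<in> carrier P"
  shows "integrable haar (kernel x)" "(\<integral>z. kernel x z \<partial>haar) = 1"
proof -
  interpret prob_space haar by (rule prob_haar)
  have m: "cyl J x \<in> sets haar" unfolding haar_eq by (rule cyl_measurable[OF J x])
  have k: "kernel x z = real (box_card J) * indicator (cyl J x) z" if "z \<in> space haar" for z
    using that unfolding space_haar by (simp add: kernel_def cyl_def indicator_def)
  have "integrable haar (\<lambda>z. real (box_card J) * indicator (cyl J x) z)"
    using m by (intro integrable_mult_right) (simp add: emeasure_eq_measure)
  then show "integrable haar (kernel x)"
    by (subst Bochner_Integration.integrable_cong[OF refl k])
  have "of_nat (box_card J) * emeasure haar (cyl J x) = 1"
    unfolding haar_eq using haar_cyl_box_card[OF haar_\<mu> J] haar_cyl(1)[OF haar_\<mu> J x] by simp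
  then have "real (box_card J) * measure haar (cyl J x) = 1"
    unfolding emeasure_eq_measure by (simp add: ennreal_of_nat_eq_real_of_nat flip: ennreal_mult' ennreal_1)
  moreover have "cyl J x \<inter> space haar = cyl J x" using sets.sets_into_space[OF m] by blast
  ultimately show "(\<integral>z. kernel x z \<partial>haar) = 1"
    by (subst Bochner_Integration.integral_cong[OF refl k]) auto
qed

text \<open>The conditional expectation onto the functions of the coordinates in
  \<open>J\<close>.\<close>

definition local_average :: "(('i \<Rightarrow> 'a) \<Rightarrow> complex) \<Rightarrow> ('i \<Rightarrow> 'a) \<Rightarrow> complex" where
  "local_average u x = (\<integral>z. u z * kernel x z \<partial>haar)"

lemma cont_kernel: "cont (\<lambda>z. complex_of_real (kernel x z))"
proof (rule continuous_depends_on[OF _ J])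
  show "depends_on J (\<lambda>z. complex_of_real (kernel x z))"
    unfolding depends_on_def kernel_def agree_def by simp
qed

lemma local_average_close:
  assumes u: "cont u" and x: "x \<in> carrier P" and \<epsilon>: "\<And>z. z \<in> cyl J x \<Longrightarrow> cmod (u z - u x) \<le> \<epsilon>"
  shows "cmod (local_average u x - u x) \<le> \<epsilon>"
proof -
  have int: "integrable haar (\<lambda>z. u z * kernel x z)"
    using u cont_kernel by (intro integrable_continuous continuous_map_normed_mult)
  have int': "integrable haar (\<lambda>z. u x * kernel x z)"
    using cont_kernel by (intro integrable_continuous continuous_map_normed_mult) auto
  have "(\<integral>z. u x * kernel x z \<partial>haar) = u x"
    using kernel_integral(2)[OF x] by simp
  then have "local_average u x - u x = (\<integral>z. u z * kernel x z - u x * kernel x z \<partial>haar)"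
    unfolding local_average_def using int int' by (simp add: Bochner_Integration.integral_diff)
  also have "cmod \<dots> \<le> (\<integral>z. cmod (u z * kernel x z - u x * kernel x z) \<partial>haar)"
    by (rule integral_norm_bound)
  also have "\<dots> \<le> (\<integral>z. \<epsilon> * kernel x z \<partial>haar)"
  proof (rule integral_mono)
    show "integrable haar (\<lambda>z. cmod (u z * kernel x z - u x * kernel x z))" using int int' by auto
    show "integrable haar (\<lambda>z. \<epsilon> * kernel x z)" using kernel_integral(1)[OF x] by auto
    fix z assume "z \<in> space haar"
    then have z: "z \<in> carrier P" by (simp only: space_haar)
    show "cmod (u z * kernel x z - u x * kernel x z) \<le> \<epsilon> * kernel x z"
    proof (cases "agree J z x")
      case True
      then have "cmod (u z - u x) \<le> \<epsilon>" using \<epsilon> z unfolding cyl_def by blast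
      then have "cmod (u z - u x) * real (box_card J) \<le> \<epsilon> * real (box_card J)" by (intro mult_right_mono) auto
      moreover have "cmod (u z * kernel x z - u x * kernel x z) = cmod (u z - u x) * real (box_card J)"
        using True unfolding left_diff_distrib[symmetric] norm_mult by (simp add: kernel_def)
      ultimately show ?thesis using True by (simp add: kernel_def)
    qed (simp add: kernel_def)
  qed
  also have "\<dots> = \<epsilon>" using kernel_integral(2)[OF x] by simp
  finally show ?thesis .
qed

text \<open>The case of error 0 in \<open>local_average_close\<close>.\<close>

lemma local_average_fixed:
  assumes u: "depends_on J u" and x: "x \<in> carrier P"
  shows "local_average u x = u x"
proof -
  have "cmod (local_average u x - u x) \<le> 0"
  proof (rule local_average_close[OF continuous_depends_on[OF u J] x])
    fix z assume "z \<in> cyl J x"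
    then show "cmod (u z - u x) \<le> 0" using depends_onD[OF u _ x] by (simp add: cyl_def)
  qed
  then show ?thesis by simp
qed

lemma local_average_depends: "depends_on J (local_average u)"
  unfolding depends_on_def local_average_def kernel_def agree_def
  by (intro ballI impI Bochner_Integration.integral_cong) auto

text \<open>Decompose the regular representation: the kernel becomes a sum of irreducible
  characters, and convolution with each of them is a scalar multiple of it. The family
  \<open>c\<close> may repeat, since irreducible components occur with multiplicity.\<close>

lemma local_average_expand:
  assumes u: "class_fun u"
  obtains n :: nat and c where "\<And>k. k < n \<Longrightarrow> c k \<in> dual"
    "\<And>x. x \<in> carrier P \<Longrightarrow> local_average u x = (\<Sum>k<n. coef u (c k) / cdim (c k) * ch (c k) x)"
proof -
  obtain ps where ps: "\<forall>(V, \<sigma>) \<in> set ps. \<sigma> \<in> irreps P T \<and> embeds (box_card J) (regular J) V \<sigma>"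
    "\<forall>x \<in> carrier P. mtrace (regular J x) = (\<Sum>p\<leftarrow>ps. mtrace (snd p x))"
    using complete_reducibility[OF regular_rep] by blast
  define n where "n = length ps"
  define \<sigma> where "\<sigma> k = snd (ps ! k)" for k
  have irr: "\<sigma> k \<in> irreps P T" if "k < n" for k
    using ps(1) nth_mem[of k ps] that unfolding n_def \<sigma>_def by (cases "ps ! k") auto
  have tr: "mtrace (regular J x) = (\<Sum>k<n. mtrace (\<sigma> k x))" if "x \<in> carrier P" for x
    using ps(2)[rule_format, OF that] by (simp add: sum_list_sum_nth n_def \<sigma>_def lessThan_atLeast0)
  have "\<exists>c. c \<in> dual \<and> char_fun (\<sigma> k) = ch c \<and> cdim c = rep_dim P (\<sigma> k)" if "k < n" for k
    using irrep_char_fun[OF irr[OF that]] by metis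
  then have "\<forall>k. \<exists>c. k < n \<longrightarrow> c \<in> dual \<and> char_fun (\<sigma> k) = ch c \<and> cdim c = rep_dim P (\<sigma> k)" by blast
  from choice[OF this] obtain c where
    c': "\<forall>k. k < n \<longrightarrow> c k \<in> dual \<and> char_fun (\<sigma> k) = ch (c k) \<and> cdim (c k) = rep_dim P (\<sigma> k)" ..
  then have c: "\<And>k. k < n \<Longrightarrow> c k \<in> dual" "\<And>k. k < n \<Longrightarrow> char_fun (\<sigma> k) = ch (c k)"
    "\<And>k. k < n \<Longrightarrow> cdim (c k) = rep_dim P (\<sigma> k)" by blast+
  have chv: "mtrace (\<sigma> k x) = ch (c k) x" if "k < n" "x \<in> carrier P" for k x
    using fun_cong[OF c(2)[OF that(1)], of x] that(2) unfolding char_fun_def by (simp only: if_True)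
  have "local_average u x = (\<Sum>k<n. coef u (c k) / cdim (c k) * ch (c k) x)" if x: "x \<in> carrier P" for x
  proof -
    have "local_average u x = (\<integral>z. (\<Sum>k<n. u z * mtrace (\<sigma> k (inv\<^bsub>P\<^esub> z \<otimes>\<^bsub>P\<^esub> x))) \<partial>haar)"
      unfolding local_average_def
    proof (rule integral_cong_carrier)
      fix z assume z: "z \<in> carrier P"
      show "u z * kernel x z = (\<Sum>k<n. u z * mtrace (\<sigma> k (inv\<^bsub>P\<^esub> z \<otimes>\<^bsub>P\<^esub> x)))"
        unfolding kernel_eq[OF z x, symmetric] tr[OF m_closed[OF inv_closed[OF z] x]] sum_distrib_left ..
    qed
    also have "\<dots> = (\<Sum>k<n. \<integral>z. u z * mtrace (\<sigma> k (inv\<^bsub>P\<^esub> z \<otimes>\<^bsub>P\<^esub> x)) \<partial>haar)"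
    proof (rule Bochner_Integration.integral_sum, rule integrable_continuous, rule continuous_map_normed_mult)
      fix k assume "k \<in> {..<n}"
      then have k: "k < n" by simp
      show "cont u" by (rule class_funD(1)[OF u])
      have 1: "continuous_map T T (\<lambda>z. inv\<^bsub>P\<^esub> z \<otimes>\<^bsub>P\<^esub> x)"
        using continuous_map_compose[OF continuous_inv continuous_mult_right[OF x]] by (simp only: o_def)
      show "cont (\<lambda>z. mtrace (\<sigma> k (inv\<^bsub>P\<^esub> z \<otimes>\<^bsub>P\<^esub> x)))"
        using continuous_map_compose[OF 1 continuous_character[OF irrepsD(1)[OF irr[OF k]]]] by (simp only: o_def)
    qed
    also have "\<dots> = (\<Sum>k<n. coef u (c k) / cdim (c k) * ch (c k) x)"
    proof (rule sum.cong[OF refl])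
      fix k assume "k \<in> {..<n}"
      then have k: "k < n" by simp
      have "(\<integral>s. u s * cnj (mtrace (\<sigma> k s)) \<partial>haar) = coef u (c k)"
        unfolding coef_def by (rule integral_cong_carrier) (simp only: chv[OF k])
      then show "(\<integral>z. u z * mtrace (\<sigma> k (inv\<^bsub>P\<^esub> z \<otimes>\<^bsub>P\<^esub> x)) \<partial>haar) = coef u (c k) / cdim (c k) * ch (c k) x"
        unfolding convolve_character[OF u irr[OF k] x] c(3)[OF k, symmetric] chv[OF k x] by simp
    qed
    finally show ?thesis .
  qed
  with c(1) show ?thesis by (rule that)
qed

end

section \<open>Completeness of the characters and local class functions\<close>

lemma ex_cyl_close:
  assumes u: "cont u" and x: "x \<in> carrier P" and \<epsilon>: "\<epsilon> > 0"
  obtains J where "finite J" "J \<subseteq> I" "\<And>z. z \<in> cyl J x \<Longrightarrow> cmod (u z - u x) \<le> \<epsilon>"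
proof -
  let ?U = "{z \<in> topspace T. u z \<in> ball (u x) \<epsilon>}"
  have "openin T ?U" using openin_continuous_map_preimage[OF u, of "ball (u x) \<epsilon>"] by simp
  moreover have "x \<in> ?U" using x \<epsilon> topspace_eq by simp
  ultimately obtain J where "finite J" "J \<subseteq> I" "cyl J x \<subseteq> ?U" by (rule open_contains_cyl) (rule that)
  then show ?thesis using that[of J] by (auto simp: dist_norm norm_minus_commute less_imp_le subset_iff)
qed

text \<open>If all coefficients of \<open>u\<close> vanish, then so do all its local averages; by
  continuity these approximate \<open>u\<close> at every point.\<close>

sublocale complete_haar_grp P T
proof (intro complete_haar_grp.intro complete_haar_grp_axioms.intro)
  show "haar_grp P T" by (rule haar_grp_axioms)
  fix u x assume u: "class_fun u" and 0: "\<And>c. c \<in> dual \<Longrightarrow> coef u c = 0"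
  show "u x = 0"
  proof (cases "x \<in> carrier P")
    case True
    have "cmod (u x) \<le> 0"
    proof (rule field_le_epsilon)
      fix e :: real assume "e > 0"
      then obtain J where J: "finite J" "J \<subseteq> I" "\<And>z. z \<in> cyl J x \<Longrightarrow> cmod (u z - u x) \<le> e"
        by (rule ex_cyl_close[OF class_funD(1)[OF u] True]) (rule that)
      obtain n :: nat and c where c: "\<And>k. k < n \<Longrightarrow> c k \<in> dual"
        "\<And>x. x \<in> carrier P \<Longrightarrow> local_average J u x = (\<Sum>k<n. coef u (c k) / cdim (c k) * ch (c k) x)"
        by (rule local_average_expand[OF J(1,2) u]) (rule that)
      have "local_average J u x = 0" unfolding c(2)[OF True] using 0[OF c(1)] by (intro sum.neutral) auto
      then show "cmod (u x) \<le> 0 + e"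
        using local_average_close[OF J(1,2) class_funD(1)[OF u] True J(3)] by simp
    qed
    then show ?thesis by simp
  qed (rule class_funD(2)[OF u])
qed

text \<open>Such a function is its own local average, hence a finite combination of characters. No
  particular bound is needed, only membership in the algebra.\<close>

lemma local_class_fun_norm_le:
  assumes J: "finite J" "J \<subseteq> I" and u: "class_fun u" "depends_on J u"
  obtains K where "norm_le u K"
proof -
  obtain n :: nat and c where c: "\<And>k. k < n \<Longrightarrow> c k \<in> dual"
    "\<And>x. x \<in> carrier P \<Longrightarrow> local_average J u x = (\<Sum>k<n. coef u (c k) / cdim (c k) * ch (c k) x)"
    by (rule local_average_expand[OF J u(1)]) (rule that)
  have "norm_le (\<lambda>x. coef u (c k) / cdim (c k) * ch (c k) x) (cmod (coef u (c k) / cdim (c k)) * cdim (c k))"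
    if "k < n" for k by (rule norm_le_scale[OF norm_le_ch[OF c(1)[OF that]]])
  then have "norm_le (\<lambda>x. \<Sum>k<n. coef u (c k) / cdim (c k) * ch (c k) x)
      (\<Sum>k<n. cmod (coef u (c k) / cdim (c k)) * cdim (c k))"
    by (intro norm_le_sum) auto
  moreover have "(\<lambda>x. \<Sum>k<n. coef u (c k) / cdim (c k) * ch (c k) x) = u"
  proof
    fix x
    show "(\<Sum>k<n. coef u (c k) / cdim (c k) * ch (c k) x) = u x"
    proof (cases "x \<in> carrier P")
      case True
      then show ?thesis using c(2)[OF True] local_average_fixed[OF J u(2) True] by simp
    next
      case False
      then show ?thesis using class_funD(2)[OF u(1) False] class_funD(2)[OF class_fun_ch[OF c(1)] False] by simp
    qed
  qed
  ultimately show ?thesis using that by simp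
qed

text \<open>Averaging over \<open>J\<close> multiplies an irreducible character by a scalar
  \<open>l\<close>. On a small cylinder at the identity the character stays close to its value
  there, the dimension, so the average there is nonzero and so is \<open>l\<close>. Thus the
  character is a multiple of a function of the coordinates in \<open>J\<close>.\<close>

lemma ch_depends_on_finite:
  assumes c: "c \<in> dual"
  obtains J where "finite J" "J \<subseteq> I" "depends_on J (ch c)"
proof -
  have d: "real (cdim c) / 2 > 0" using cdim_pos[OF c] by simp
  obtain J where J: "finite J" "J \<subseteq> I" "\<And>z. z \<in> cyl J \<one>\<^bsub>P\<^esub> \<Longrightarrow> cmod (ch c z - ch c \<one>\<^bsub>P\<^esub>) \<le> real (cdim c) / 2"
    by (rule ex_cyl_close[OF class_funD(1)[OF class_fun_ch[OF c]] one_closed d]) (rule that)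
  obtain n :: nat and c' where c': "\<And>k. k < n \<Longrightarrow> c' k \<in> dual"
    "\<And>x. x \<in> carrier P \<Longrightarrow> local_average J (ch c) x = (\<Sum>k<n. coef (ch c) (c' k) / cdim (c' k) * ch (c' k) x)"
    by (rule local_average_expand[OF J(1,2) class_fun_ch[OF c]]) (rule that)
  \<comment> \<open>Orthogonality removes all terms but those with \<open>c' k = c\<close>;
    \<open>l\<close> is their number divided by the dimension.\<close>
  define l where "l = (\<Sum>k<n. if c = c' k then 1 / complex_of_nat (cdim c) else 0)"
  have l: "local_average J (ch c) x = l * ch c x" if "x \<in> carrier P" for x
    unfolding c'(2)[OF that] l_def sum_distrib_right using coef_ch[OF c c'(1)] by (intro sum.cong) auto
  have "cmod (local_average J (ch c) \<one>\<^bsub>P\<^esub> - ch c \<one>\<^bsub>P\<^esub>) \<le> real (cdim c) / 2"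
    by (rule local_average_close[OF J(1,2) class_funD(1)[OF class_fun_ch[OF c]] one_closed J(3)])
  moreover have "ch c \<one>\<^bsub>P\<^esub> = of_nat (cdim c)"
    unfolding ch_def char_fun_def using character_one[OF repr_rep[OF c]] one_closed by (simp only: if_True)
  ultimately have "l \<noteq> 0" using d l[OF one_closed] by auto
  have "depends_on J (ch c)"
    unfolding depends_on_def
  proof (intro ballI impI)
    fix x y assume xy: "x \<in> carrier P" "y \<in> carrier P" "agree J x y"
    have "l * ch c x = l * ch c y"
      unfolding l[OF xy(1), symmetric] l[OF xy(2), symmetric]
      by (rule depends_onD[OF local_average_depends[OF J(1,2)] xy])
    then show "ch c x = ch c y" using \<open>l \<noteq> 0\<close> by simp
  qed
  then show ?thesis using J that by blast
qed

end

section \<open>Infinitely many non-abelian factors\<close>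

lemma complex_sums_if:
  fixes f g :: "nat \<Rightarrow> complex"
  assumes "g sums x" "f sums y"
  shows "(\<lambda>n. if even n then f (n div 2) else g ((n - 1) div 2)) sums (x + y)"
  using assms sums_if[of "\<lambda>n. Re (g n)" "Re x" "\<lambda>n. Re (f n)" "Re y"]
    sums_if[of "\<lambda>n. Im (g n)" "Im x" "\<lambda>n. Im (f n)" "Im y"]
  by (simp add: sums_complex_iff if_distrib)

context complete_haar_grp
begin

section \<open>Commutators of an element with a tensor\<close>

definition commutator :: "('a \<Rightarrow> complex) \<Rightarrow> ('a \<Rightarrow> complex) tensor \<Rightarrow> ('a \<Rightarrow> complex) tensor" where
  "commutator u m = (\<lambda>B. tensor_lact ZA u m B - tensor_ract ZA m u B)"

lemma ZA_mult_closed: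
  assumes "u \<in> carrier ZA" "v \<in> carrier ZA"
  shows "(\<lambda>x. u x * v x) \<in> carrier ZA" "nrm ZA (\<lambda>x. u x * v x) \<le> nrm ZA u * nrm ZA v"
  using norm_le_mult[OF norm_le_nrm[OF assms(1)] norm_le_nrm[OF assms(2)]] by (auto simp: norm_le_iff)

lemma bounded_bilinearE:
  assumes "B \<in> bounded_bilinear_forms ZA"
  obtains K where "\<And>v w. v \<in> carrier ZA \<Longrightarrow> w \<in> carrier ZA \<Longrightarrow> cmod (B v w) \<le> K * nrm ZA v * nrm ZA w"
proof -
  have "\<exists>K. \<forall>v\<in>carrier ZA. \<forall>w\<in>carrier ZA. cmod (B v w) \<le> K * nrm ZA v * nrm ZA w"
    using assms unfolding bounded_bilinear_forms_def by simp
  then obtain K where "\<forall>v\<in>carrier ZA. \<forall>w\<in>carrier ZA. cmod (B v w) \<le> K * nrm ZA v * nrm ZA w" ..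
  then show ?thesis by (intro that[of K]) blast
qed

text \<open>A tensor is 0 on functions that are not bounded bilinear forms, so evaluating the module
  actions requires that the shifted forms are again bounded.\<close>

lemma bilinear_mult:
  assumes B: "B \<in> bounded_bilinear_forms ZA" and u: "u \<in> carrier ZA"
  shows "(\<lambda>v w. B (\<lambda>x. u x * v x) w) \<in> bounded_bilinear_forms ZA"
    "(\<lambda>v w. B v (\<lambda>x. w x * u x)) \<in> bounded_bilinear_forms ZA"
proof -
  have add: "B (\<lambda>x. v x + v' x) w = B v w + B v' w" "B w (\<lambda>x. v x + v' x) = B w v + B w v'"
    if "v \<in> carrier ZA" "v' \<in> carrier ZA" "w \<in> carrier ZA" for v v' w
    using B that unfolding bounded_bilinear_forms_def ZA_simps(3) by auto
  have scale: "B (\<lambda>x. a * v x) w = a * B v w" "B v (\<lambda>x. a * w x) = a * B v w"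
    if "v \<in> carrier ZA" "w \<in> carrier ZA" for v w a
    using B that unfolding bounded_bilinear_forms_def ZA_simps(5) by auto
  obtain K where K: "\<And>v w. v \<in> carrier ZA \<Longrightarrow> w \<in> carrier ZA \<Longrightarrow> cmod (B v w) \<le> K * nrm ZA v * nrm ZA w"
    by (rule bounded_bilinearE[OF B]) (rule that)
  have K': "cmod (B v w) \<le> \<bar>K\<bar> * nrm ZA v * nrm ZA w" if "v \<in> carrier ZA" "w \<in> carrier ZA" for v w
    using K[OF that] nrm_nonneg that by (meson abs_ge_self mult_right_mono order_trans)
  note cl = ZA_mult_closed(1)[OF u] ZA_mult_closed(1)[OF _ u]
  have bd: "cmod (B (\<lambda>x. u x * v x) w) \<le> (\<bar>K\<bar> * nrm ZA u) * nrm ZA v * nrm ZA w"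
    "cmod (B v (\<lambda>x. w x * u x)) \<le> (\<bar>K\<bar> * nrm ZA u) * nrm ZA v * nrm ZA w"
    if v: "v \<in> carrier ZA" and w: "w \<in> carrier ZA" for v w
  proof -
    have "cmod (B (\<lambda>x. u x * v x) w) \<le> \<bar>K\<bar> * nrm ZA (\<lambda>x. u x * v x) * nrm ZA w" by (rule K'[OF cl(1)[OF v] w])
    also have "\<dots> \<le> \<bar>K\<bar> * (nrm ZA u * nrm ZA v) * nrm ZA w"
      using ZA_mult_closed(2)[OF u v] nrm_nonneg[OF w] by (intro mult_right_mono mult_left_mono) auto
    finally show "cmod (B (\<lambda>x. u x * v x) w) \<le> (\<bar>K\<bar> * nrm ZA u) * nrm ZA v * nrm ZA w" by (simp add: mult.assoc)
    have "cmod (B v (\<lambda>x. w x * u x)) \<le> \<bar>K\<bar> * nrm ZA v * nrm ZA (\<lambda>x. w x * u x)" by (rule K'[OF v cl(2)[OF w]])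
    also have "\<dots> \<le> \<bar>K\<bar> * nrm ZA v * (nrm ZA w * nrm ZA u)"
      using ZA_mult_closed(2)[OF w u] nrm_nonneg[OF v] by (intro mult_left_mono) auto
    finally show "cmod (B v (\<lambda>x. w x * u x)) \<le> (\<bar>K\<bar> * nrm ZA u) * nrm ZA v * nrm ZA w" by (simp add: mult_ac)
  qed
  have 1: "(\<lambda>x. u x * (v x + v' x)) = (\<lambda>x. u x * v x + u x * v' x)"
    "(\<lambda>x. (v x + v' x) * u x) = (\<lambda>x. v x * u x + v' x * u x)"
    "(\<lambda>x. u x * (a * v x)) = (\<lambda>x. a * (u x * v x))" "(\<lambda>x. a * v x * u x) = (\<lambda>x. a * (v x * u x))" for v v' a
    by (auto simp: algebra_simps)
  show "(\<lambda>v w. B (\<lambda>x. u x * v x) w) \<in> bounded_bilinear_forms ZA"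
    unfolding bounded_bilinear_forms_def ZA_simps(3,5)
    using bd(1) by (intro CollectI conjI ballI allI exI[of _ "\<bar>K\<bar> * nrm ZA u"])
      (simp_all only: 1 add scale cl)
  show "(\<lambda>v w. B v (\<lambda>x. w x * u x)) \<in> bounded_bilinear_forms ZA"
    unfolding bounded_bilinear_forms_def ZA_simps(3,5)
    using bd(2) by (intro CollectI conjI ballI allI exI[of _ "\<bar>K\<bar> * nrm ZA u"])
      (simp_all only: 1 add scale cl)
qed

text \<open>Interleave the two series: even terms come from the left action, odd ones from the right
  action with the sign absorbed into the first factor. Each half contributes \<open>nrm ZA u\<close>
  times the original sum.\<close>

lemma commutator_series:
  assumes m: "tensor_series ZA a b m" and u: "u \<in> carrier ZA"
  obtains a' b' where "tensor_series ZA a' b' (commutator u m)"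
    "suminf (\<lambda>n. nrm ZA (a' n) * nrm ZA (b' n)) \<le> 2 * nrm ZA u * suminf (\<lambda>n. nrm ZA (a n) * nrm ZA (b n))"
proof -
  note t = tensor_seriesD[OF m]
  define a' where "a' n = (if even n then (\<lambda>x. u x * a (n div 2) x) else (\<lambda>x. - 1 * a ((n - 1) div 2) x))" for n
  define b' where "b' n = (if even n then b (n div 2) else (\<lambda>x. b ((n - 1) div 2) x * u x))" for n
  let ?s = "\<lambda>n. nrm ZA (a n) * nrm ZA (b n)" and ?K = "nrm ZA u"
  have neg: "(\<lambda>x. - 1 * v x) \<in> carrier ZA" "nrm ZA (\<lambda>x. - 1 * v x) \<le> nrm ZA v" if "v \<in> carrier ZA" for v
    using norm_le_scale[OF norm_le_nrm[OF that], of "- 1"] by (auto simp: norm_le_iff)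
  have cl: "a' n \<in> carrier ZA" "b' n \<in> carrier ZA" for n
    using ZA_mult_closed(1)[OF u t(1)] ZA_mult_closed(1)[OF t(2) u] neg(1)[OF t(1)] t(2) by (simp_all add: a'_def b'_def)
  let ?g = "\<lambda>n. if even n then ?K * ?s (n div 2) else ?K * ?s ((n - 1) div 2)"
  have g: "?g sums (?K * suminf ?s + ?K * suminf ?s)"
    using t(3) by (intro sums_if sums_mult summable_sums)
  have le: "nrm ZA (a' n) * nrm ZA (b' n) \<le> ?g n" for n
  proof (cases "even n")
    case True
    then show ?thesis
      using mult_right_mono[OF ZA_mult_closed(2)[OF u t(1)] nrm_nonneg[OF t(2)]] by (simp add: a'_def b'_def mult.assoc)
  next
    case False
    then show ?thesis
      using mult_mono[OF neg(2)[OF t(1)] ZA_mult_closed(2)[OF t(2) u] nrm_nonneg[OF t(1)] nrm_nonneg[OF ZA_mult_closed(1)[OF t(2) u]]]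
      by (simp add: a'_def b'_def mult_ac)
  qed
  have pos: "nrm ZA (a' n) * nrm ZA (b' n) \<ge> 0" for n using nrm_nonneg cl by simp
  have sm: "summable (\<lambda>n. nrm ZA (a' n) * nrm ZA (b' n))"
    using pos le by (intro summable_comparison_test'[OF sums_summable[OF g]]) auto
  have "suminf (\<lambda>n. nrm ZA (a' n) * nrm ZA (b' n)) \<le> suminf ?g" by (rule suminf_le[OF le sm sums_summable[OF g]])
  also have "\<dots> = 2 * ?K * suminf ?s" using sums_unique[OF g] by simp
  finally have 1: "suminf (\<lambda>n. nrm ZA (a' n) * nrm ZA (b' n)) \<le> 2 * ?K * suminf ?s" .
  have eq: "commutator u m B = suminf (\<lambda>n. B (a' n) (b' n))" if B: "B \<in> bounded_bilinear_forms ZA" for B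
  proof -
    note BB = bilinear_mult[OF B u]
    have sm1: "summable (\<lambda>n. B' (a n) (b n))" if "B' \<in> bounded_bilinear_forms ZA" for B'
    proof -
      obtain K where "\<And>v w. v \<in> carrier ZA \<Longrightarrow> w \<in> carrier ZA \<Longrightarrow> cmod (B' v w) \<le> K * nrm ZA v * nrm ZA w"
        by (rule bounded_bilinearE[OF \<open>B' \<in> bounded_bilinear_forms ZA\<close>]) (rule that)
      then show ?thesis by (rule bilinear_summable(1)[OF m])
    qed
    have s1: "(\<lambda>n. B (\<lambda>x. u x * a n x) (b n)) sums tensor_lact ZA u m B"
      using summable_sums[OF sm1[OF BB(1)]] t(4)[OF BB(1)] B by (simp add: tensor_lact_def ZA_simps(2))
    have s2: "(\<lambda>n. B (a n) (\<lambda>x. b n x * u x)) sums tensor_ract ZA m u B"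
      using summable_sums[OF sm1[OF BB(2)]] t(4)[OF BB(2)] B by (simp add: tensor_ract_def ZA_simps(2))
    have neg_eq: "B (\<lambda>x. - 1 * a n x) (\<lambda>x. b n x * u x) = - B (a n) (\<lambda>x. b n x * u x)" for n
    proof -
      have "B (\<lambda>x. - 1 * a n x) (\<lambda>x. b n x * u x) = - 1 * B (a n) (\<lambda>x. b n x * u x)"
        using B t(1) ZA_mult_closed(1)[OF t(2) u] unfolding bounded_bilinear_forms_def ZA_simps(5) by blast
      then show ?thesis by simp
    qed
    have "(\<lambda>n. if even n then B (\<lambda>x. u x * a (n div 2) x) (b (n div 2))
          else - B (a ((n - 1) div 2)) (\<lambda>x. b ((n - 1) div 2) x * u x)) sums (- tensor_ract ZA m u B + tensor_lact ZA u m B)"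
      by (rule complex_sums_if[OF sums_minus[OF s2] s1])
    also have "(\<lambda>n. if even n then B (\<lambda>x. u x * a (n div 2) x) (b (n div 2))
          else - B (a ((n - 1) div 2)) (\<lambda>x. b ((n - 1) div 2) x * u x)) = (\<lambda>n. B (a' n) (b' n))"
      unfolding a'_def b'_def neg_eq[symmetric] by (rule ext) simp
    finally show ?thesis by (simp add: commutator_def sums_iff)
  qed
  have "commutator u m = (\<lambda>B. if B \<in> bounded_bilinear_forms ZA then suminf (\<lambda>n. B (a' n) (b' n)) else 0)"
    using eq by (auto simp: commutator_def tensor_lact_def tensor_ract_def)
  then have "tensor_series ZA a' b' (commutator u m)" using cl sm by (simp add: tensor_series_def)
  then show ?thesis using 1 by (rule that)
qed

text \<open>Hence an approximate diagonal must tend to 0 at every pair of points that the algebra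
  separates.\<close>

lemma commutator_ev2:
  assumes m: "m \<in> proj_tensor ZA" and u: "u \<in> carrier ZA"
  shows "commutator u m (ev2 x y) = (u x - u y) * m (ev2 x y)"
proof -
  obtain a b where ab: "tensor_series ZA a b m" using m by (auto simp: proj_tensor_def)
  note t = tensor_seriesD[OF ab]
  note BB = bilinear_mult[OF ev2_bilinear u, of x y]
  have sm: "summable (\<lambda>n. a n x * b n y)"
    using bilinear_summable(1)[OF ab, of "ev2 x y" 1] ZA_bound nrm_nonneg
    by (simp add: ev2_def norm_mult mult_mono)
  have "tensor_lact ZA u m (ev2 x y) = m (\<lambda>v w. ev2 x y (\<lambda>z. u z * v z) w)"
    by (simp add: tensor_lact_def ZA_simps(2) ev2_bilinear)
  also have "\<dots> = suminf (\<lambda>n. u x * (a n x * b n y))"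
    unfolding t(4)[OF BB(1)] by (simp add: ev2_def mult.assoc)
  also have "\<dots> = u x * m (ev2 x y)" unfolding t(4)[OF ev2_bilinear] ev2_def by (rule suminf_mult[OF sm])
  finally have 1: "tensor_lact ZA u m (ev2 x y) = u x * m (ev2 x y)" .
  have "tensor_ract ZA m u (ev2 x y) = m (\<lambda>v w. ev2 x y v (\<lambda>z. w z * u z))"
    by (simp add: tensor_ract_def ZA_simps(2) ev2_bilinear)
  also have "\<dots> = suminf (\<lambda>n. u y * (a n x * b n y))"
    unfolding t(4)[OF BB(2)] by (simp add: ev2_def mult_ac)
  also have "\<dots> = u y * m (ev2 x y)" unfolding t(4)[OF ev2_bilinear] ev2_def by (rule suminf_mult[OF sm])
  finally show ?thesis using 1 by (simp add: commutator_def left_diff_distrib)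
qed

subsection \<open>The test functionals\<close>

text \<open>With \<open>R\<close> denoting right translation on pairs, this is the operator
  \<open>1 + A + B - A * B\<close> for \<open>A = R (p, p)\<close> and \<open>B = R (p', q)\<close>.
  Its value is again a function of two variables, so that such operators can be iterated.\<close>

definition theta :: "'a \<times> 'a \<times> 'a \<Rightarrow> ('a \<Rightarrow> 'a \<Rightarrow> complex) \<Rightarrow> 'a \<Rightarrow> 'a \<Rightarrow> complex" where
  "theta = (\<lambda>(p, p', q) F x y. F x y + F (x \<otimes> p) (y \<otimes> p) + F (x \<otimes> p') (y \<otimes> q) - F (x \<otimes> (p \<otimes> p')) (y \<otimes> (p \<otimes> q)))"

text \<open>The head of the list acts on \<open>F\<close> first.\<close>

primrec lam :: "('a \<times> 'a \<times> 'a) list \<Rightarrow> ('a \<Rightarrow> 'a \<Rightarrow> complex) \<Rightarrow> 'a \<Rightarrow> 'a \<Rightarrow> complex" where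
  "lam [] F = F" | "lam (t # ts) F = lam ts (theta t F)"

abbreviation triples where "triples \<equiv> carrier G \<times> carrier G \<times> carrier G"

lemma lam_cong:
  assumes "set ts \<subseteq> triples" "\<And>x y. x \<in> carrier G \<Longrightarrow> y \<in> carrier G \<Longrightarrow> F x y = F' x y"
    and "x \<in> carrier G" "y \<in> carrier G"
  shows "lam ts F x y = lam ts F' x y"
  using assms(1,2)
proof (induction ts arbitrary: F F')
  case Nil
  then show ?case using assms by simp
next
  case (Cons t ts)
  have "theta t F x y = theta t F' x y" if "x \<in> carrier G" "y \<in> carrier G" for x y
    using Cons.prems that by (cases t) (auto simp: theta_def)
  moreover have "set ts \<subseteq> triples" using Cons.prems(1) by simp
  ultimately show ?case unfolding lam.simps by (intro Cons.IH)
qed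

lemma theta_linear:
  "theta t (\<lambda>x y. a * F x y + b * F' x y) x y = a * theta t F x y + b * theta t F' x y"
  by (cases t) (simp add: theta_def algebra_simps)

lemma lam_linear: "lam ts (\<lambda>x y. a * F x y + b * F' x y) x y = a * lam ts F x y + b * lam ts F' x y"
proof (induction ts arbitrary: F F')
  case (Cons t ts)
  have "theta t (\<lambda>x y. a * F x y + b * F' x y) = (\<lambda>x y. a * theta t F x y + b * theta t F' x y)"
    by (intro ext theta_linear)
  then show ?case using Cons.IH by simp
qed simp

lemma lam_zero: "lam ts (\<lambda>x y. 0) x y = 0"
  using lam_linear[of ts 0 "\<lambda>x y. 0" 0 "\<lambda>x y. 0" x y] by simp

lemma lam_sum: "finite S \<Longrightarrow> lam ts (\<lambda>x y. \<Sum>i\<in>S. a i * F i x y) x y = (\<Sum>i\<in>S. a i * lam ts (F i) x y)"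
proof (induction S rule: finite_induct)
  case (insert i S)
  then show ?case using lam_linear[of ts "a i" "F i" 1 "\<lambda>x y. \<Sum>i\<in>S. a i * F i x y"] by simp
qed (simp add: lam_zero)

text \<open>The trivial estimate by the number of terms. It serves only to control the error of an
  approximation, where the growth in \<open>length ts\<close> is harmless.\<close>

lemma lam_bound:
  assumes "set ts \<subseteq> triples" "\<And>x y. x \<in> carrier G \<Longrightarrow> y \<in> carrier G \<Longrightarrow> cmod (F x y) \<le> K"
    and "x \<in> carrier G" "y \<in> carrier G"
  shows "cmod (lam ts F x y) \<le> 4 ^ length ts * K"
  using assms(1,2)
proof (induction ts arbitrary: F K)
  case Nil
  then show ?case using assms by simp
next
  case (Cons t ts)
  have tri: "cmod (a + b + c - d) \<le> cmod a + cmod b + cmod c + cmod d" for a b c d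
    by (meson add_mono norm_triangle_ineq norm_triangle_ineq4 order_refl order_trans)
  have "cmod (theta t F x y) \<le> 4 * K" if xy: "x \<in> carrier G" "y \<in> carrier G" for x y
  proof (cases t)
    case (fields p p' q)
    then have c: "p \<in> carrier G" "p' \<in> carrier G" "q \<in> carrier G" using Cons.prems by auto
    have "cmod (theta t F x y) \<le> cmod (F x y) + cmod (F (x \<otimes> p) (y \<otimes> p)) + cmod (F (x \<otimes> p') (y \<otimes> q))
        + cmod (F (x \<otimes> (p \<otimes> p')) (y \<otimes> (p \<otimes> q)))"
      unfolding fields theta_def prod.case by (rule tri)
    also have "\<dots> \<le> K + K + K + K" using c xy by (intro add_mono Cons.prems(2)) auto
    finally show ?thesis by simp
  qed
  moreover have "set ts \<subseteq> triples" using Cons.prems(1) by simp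
  ultimately have "cmod (lam ts (theta t F) x y) \<le> 4 ^ length ts * (4 * K)" by (intro Cons.IH)
  then show ?case by (simp add: mult_ac)
qed

lemma lam_tendsto:
  assumes "set ts \<subseteq> triples"
    "\<And>x y. x \<in> carrier G \<Longrightarrow> y \<in> carrier G \<Longrightarrow> ((\<lambda>m. F m x y) \<longlongrightarrow> S x y) L"
    and "x \<in> carrier G" "y \<in> carrier G"
  shows "((\<lambda>m. lam ts (F m) x y) \<longlongrightarrow> lam ts S x y) L"
  using assms(1,2)
proof (induction ts arbitrary: F S)
  case Nil
  then show ?case using assms by simp
next
  case (Cons t ts)
  have "((\<lambda>m. theta t (F m) x y) \<longlongrightarrow> theta t S x y) L" if "x \<in> carrier G" "y \<in> carrier G" for x y
    using Cons.prems that by (cases t) (auto simp: theta_def intro!: tendsto_intros)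
  moreover have "set ts \<subseteq> triples" using Cons.prems(1) by simp
  ultimately show ?case unfolding lam.simps by (intro Cons.IH)
qed

text \<open>Right translation of a coefficient with fixed row \<open>k\<close> only changes the
  vector, so \<open>theta\<close> keeps this family of functions and replaces \<open>v\<close> by
  \<open>v + A v + B v - A B v\<close>. Each step costs the factor from \<open>vnorm_gap\<close>,
  which is why coefficients are followed here rather than traces.\<close>

lemma lam_kron:
  assumes \<pi>: "unitary_rep G T d \<pi>" and \<rho>: "unitary_rep G T e \<rho>" and ts: "set ts \<subseteq> triples"
    and v: "v \<in> carrier_vec (d * e)" and k: "k < d * e"
  shows "\<exists>w \<in> carrier_vec (d * e). vnorm w \<le> (2 * sqrt 2) ^ length ts * vnorm v \<and>
    (\<forall>x\<in>carrier G. \<forall>y\<in>carrier G. lam ts (\<lambda>x y. (kron (\<pi> x) (\<rho> y) *\<^sub>v v) $ k) x y = (kron (\<pi> x) (\<rho> y) *\<^sub>v w) $ k)"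
  using ts v
proof (induction ts arbitrary: v)
  case Nil
  then show ?case by (intro bexI[of _ v]) auto
next
  case (Cons t ts)
  obtain p p' q where t: "t = (p, p', q)" by (cases t)
  have c: "p \<in> carrier G" "p' \<in> carrier G" "q \<in> carrier G" using Cons.prems t by auto
  note K = kron_rep_unitary[OF \<pi> \<rho>]
  define A where "A = kron (\<pi> p) (\<rho> p)"
  define B where "B = kron (\<pi> p') (\<rho> q)"
  have A: "A \<in> carrier_mat (d * e) (d * e)" "mat_adjoint A * A = 1\<^sub>m (d * e)"
    and B: "B \<in> carrier_mat (d * e) (d * e)" "mat_adjoint B * B = 1\<^sub>m (d * e)"
    using K c by (simp_all add: A_def B_def)
  note v = Cons.prems(2)
  define w where "w = v + A *\<^sub>v v + B *\<^sub>v v - A *\<^sub>v (B *\<^sub>v v)"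
  have Av: "A *\<^sub>v v \<in> carrier_vec (d * e)" and Bv: "B *\<^sub>v v \<in> carrier_vec (d * e)"
    and ABv: "A *\<^sub>v (B *\<^sub>v v) \<in> carrier_vec (d * e)" using A(1) B(1) v by simp_all
  have w: "w \<in> carrier_vec (d * e)" using v Av Bv ABv by (simp add: w_def)
  have wn: "vnorm w \<le> 2 * sqrt 2 * vnorm v" unfolding w_def by (rule vnorm_gap[OF A B v])
  have th: "theta t (\<lambda>x y. (kron (\<pi> x) (\<rho> y) *\<^sub>v v) $ k) x y = (kron (\<pi> x) (\<rho> y) *\<^sub>v w) $ k"
    if xy: "x \<in> carrier G" "y \<in> carrier G" for x y
  proof -
    define R where "R = kron (\<pi> x) (\<rho> y)"
    have R: "R \<in> carrier_mat (d * e) (d * e)" using K xy by (simp add: R_def)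
    have 1: "kron (\<pi> (x \<otimes> p)) (\<rho> (y \<otimes> p)) *\<^sub>v v = R *\<^sub>v (A *\<^sub>v v)"
      unfolding K(3)[OF xy c(1) c(1)] R_def[symmetric] A_def[symmetric] by (rule assoc_mult_mat_vec[OF R A(1) v])
    have 2: "kron (\<pi> (x \<otimes> p')) (\<rho> (y \<otimes> q)) *\<^sub>v v = R *\<^sub>v (B *\<^sub>v v)"
      unfolding K(3)[OF xy c(2,3)] R_def[symmetric] B_def[symmetric] by (rule assoc_mult_mat_vec[OF R B(1) v])
    have 3: "kron (\<pi> (x \<otimes> (p \<otimes> p'))) (\<rho> (y \<otimes> (p \<otimes> q))) *\<^sub>v v = R *\<^sub>v (A *\<^sub>v (B *\<^sub>v v))"
      unfolding K(3)[OF xy m_closed[OF c(1,2)] m_closed[OF c(1,3)]] K(3)[OF c(1,1,2,3)]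
        R_def[symmetric] A_def[symmetric] B_def[symmetric]
        assoc_mult_mat_vec[OF R mult_carrier_mat[OF A(1) B(1)] v] assoc_mult_mat_vec[OF A(1) B(1) v] ..
    have "R *\<^sub>v w = R *\<^sub>v v + R *\<^sub>v (A *\<^sub>v v) + R *\<^sub>v (B *\<^sub>v v) - R *\<^sub>v (A *\<^sub>v (B *\<^sub>v v))"
      unfolding w_def
      by (simp only: mult_minus_distrib_mat_vec[OF R add_carrier_vec[OF add_carrier_vec[OF v Av] Bv] ABv]
          mult_add_distrib_mat_vec[OF R add_carrier_vec[OF v Av] Bv] mult_add_distrib_mat_vec[OF R v Av])
    then show ?thesis
      unfolding t theta_def prod.case 1 2 3 R_def[symmetric] using R k by simp
  qed
  obtain w' where w': "w' \<in> carrier_vec (d * e)" "vnorm w' \<le> (2 * sqrt 2) ^ length ts * vnorm w"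
    "\<forall>x\<in>carrier G. \<forall>y\<in>carrier G. lam ts (\<lambda>x y. (kron (\<pi> x) (\<rho> y) *\<^sub>v w) $ k) x y = (kron (\<pi> x) (\<rho> y) *\<^sub>v w') $ k"
    using Cons.IH[OF _ w] Cons.prems(1) by auto
  have "vnorm w' \<le> (2 * sqrt 2) ^ length ts * (2 * sqrt 2 * vnorm v)"
    by (rule order_trans[OF w'(2) mult_left_mono[OF wn]]) simp
  moreover have "lam (t # ts) (\<lambda>x y. (kron (\<pi> x) (\<rho> y) *\<^sub>v v) $ k) x y = (kron (\<pi> x) (\<rho> y) *\<^sub>v w') $ k"
    if xy: "x \<in> carrier G" "y \<in> carrier G" for x y
  proof -
    have "lam ts (theta t (\<lambda>x y. (kron (\<pi> x) (\<rho> y) *\<^sub>v v) $ k)) x y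
        = lam ts (\<lambda>x y. (kron (\<pi> x) (\<rho> y) *\<^sub>v w) $ k) x y"
      using Cons.prems(1) th xy by (intro lam_cong) auto
    then show ?thesis using w'(3) xy by simp
  qed
  ultimately show ?case using w'(1) by (intro bexI[of _ w']) (auto simp: mult_ac)
qed

text \<open>The product of the two characters is the trace of the Kronecker product, a sum of
  \<open>cdim c * cdim c'\<close> coefficients with unit vectors. At the identity a coefficient is
  one coordinate of its vector.\<close>

lemma lam_ch:
  assumes c: "c \<in> dual" "c' \<in> dual" and ts: "set ts \<subseteq> triples"
  shows "cmod (lam ts (\<lambda>x y. ch c x * ch c' y) \<one> \<one>) \<le> (2 * sqrt 2) ^ length ts * (cdim c * cdim c')"
proof -
  let ?d = "cdim c" and ?e = "cdim c'" and ?K = "\<lambda>x y. kron (repr c x) (repr c' y)"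
  note r = repr_rep[OF c(1)] repr_rep[OF c(2)]
  have "ch c x * ch c' y = (\<Sum>k<?d * ?e. 1 * (?K x y *\<^sub>v unit_vec (?d * ?e) k) $ k)"
    if xy: "x \<in> carrier G" "y \<in> carrier G" for x y
  proof -
    have K: "?K x y \<in> carrier_mat (?d * ?e) (?d * ?e)" using kron_rep_unitary(1)[OF r xy] .
    have "ch c x * ch c' y = mtrace (?K x y)"
      using xy by (simp add: ch_def char_fun_def mtrace_kron[OF unitary_repD(1)[OF r(1)] unitary_repD(1)[OF r(2)]])
    also have "\<dots> = (\<Sum>k<?d * ?e. 1 * (?K x y *\<^sub>v unit_vec (?d * ?e) k) $ k)"
      unfolding mtrace_def using K by (intro sum.cong) auto
    finally show ?thesis .
  qed
  then have "lam ts (\<lambda>x y. ch c x * ch c' y) \<one> \<one>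
      = lam ts (\<lambda>x y. \<Sum>k<?d * ?e. 1 * (?K x y *\<^sub>v unit_vec (?d * ?e) k) $ k) \<one> \<one>"
    by (intro lam_cong[OF ts]) auto
  also have "\<dots> = (\<Sum>k<?d * ?e. 1 * lam ts (\<lambda>x y. (?K x y *\<^sub>v unit_vec (?d * ?e) k) $ k) \<one> \<one>)"
    by (rule lam_sum) simp
  also have "cmod \<dots> \<le> (\<Sum>k<?d * ?e. (2 * sqrt 2) ^ length ts)"
  proof (intro sum_norm_le)
    fix k assume "k \<in> {..<?d * ?e}"
    then have k: "k < ?d * ?e" by simp
    obtain w where w: "w \<in> carrier_vec (?d * ?e)"
      "vnorm w \<le> (2 * sqrt 2) ^ length ts * vnorm (unit_vec (?d * ?e) k)"
      "\<forall>x\<in>carrier G. \<forall>y\<in>carrier G. lam ts (\<lambda>x y. (?K x y *\<^sub>v unit_vec (?d * ?e) k) $ k) x y = (?K x y *\<^sub>v w) $ k"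
      using lam_kron[OF r ts _ k, of "unit_vec (?d * ?e) k"] by auto
    have "vnorm (unit_vec (?d * ?e) k) = 1"
    proof -
      have "(\<Sum>i<?d * ?e. (cmod (unit_vec (?d * ?e) k $ i))\<^sup>2) = (\<Sum>i<?d * ?e. if i = k then 1 else 0)"
        using k by (intro sum.cong) auto
      then show ?thesis using k by (simp add: vnorm_def L2_set_def)
    qed
    moreover have "?K \<one> \<one> = 1\<^sub>m (?d * ?e)"
      by (simp add: unitary_rep_one[OF r(1)] unitary_rep_one[OF r(2)] kron_one)
    ultimately show "cmod (1 * lam ts (\<lambda>x y. (?K x y *\<^sub>v unit_vec (?d * ?e) k) $ k) \<one> \<one>) \<le> (2 * sqrt 2) ^ length ts"
      using w vnorm_component[of k w] k by (simp add: w(3))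
  qed
  also have "\<dots> = (2 * sqrt 2) ^ length ts * (?d * ?e)" by simp
  finally show ?thesis by simp
qed

definition test_form :: "('a \<times> 'a \<times> 'a) list \<Rightarrow> ('a \<Rightarrow> complex) \<Rightarrow> ('a \<Rightarrow> complex) \<Rightarrow> complex" where
  "test_form ts u v = lam ts (\<lambda>x y. u x * v y) \<one> \<one>"

text \<open>From products of characters to the algebra by bilinearity. Finite sums obey the bound
  exactly, and the remainders are small in the supremum norm.\<close>

lemma test_form_bound:
  assumes ts: "set ts \<subseteq> triples" and u: "norm_le u K" and v: "norm_le v L"
  shows "cmod (test_form ts u v) \<le> (2 * sqrt 2) ^ length ts * K * L"
proof (rule field_le_epsilon)
  fix e :: real assume e: "e > 0"
  let ?n = "length ts"
  note K = norm_le_nonneg[OF u] and L = norm_le_nonneg[OF v]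
  \<comment> \<open>At most \<open>4 ^ n\<close> point values enter, each with an error of at most
    \<open>\<delta> * (K + L + 1)\<close>.\<close>
  define D where "D = 4 ^ ?n * (K + L + 1)"
  have D: "D > 0" using K L by (simp add: D_def)
  define \<delta> where "\<delta> = e / D"
  have \<delta>: "\<delta> > 0" using e D by (simp add: \<delta>_def)
  obtain F where F: "finite F" "F \<subseteq> dual" "norm_le (\<lambda>x. u x - partial u F x) \<delta>"
    by (rule norm_le_approx[OF u \<delta>])
  obtain F' where F': "finite F'" "F' \<subseteq> dual" "norm_le (\<lambda>x. v x - partial v F' x) \<delta>"
    by (rule norm_le_approx[OF v \<delta>])
  have "cmod (u x * v y - partial u F x * partial v F' y) \<le> \<delta> * (K + L + 1)" for x y
  proof -
    have "u x * v y - partial u F x * partial v F' y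
        = (u x - partial u F x) * partial v F' y + u x * (v y - partial v F' y)"
      by (simp add: algebra_simps)
    then have "cmod (u x * v y - partial u F x * partial v F' y)
        \<le> cmod (u x - partial u F x) * cmod (partial v F' y) + cmod (u x) * cmod (v y - partial v F' y)"
      by (simp only: norm_mult[symmetric] norm_triangle_ineq)
    also have "\<dots> \<le> \<delta> * L + K * \<delta>"
      using norm_le_bound[OF F(3), of x] norm_le_bound[OF F'(3), of y] norm_le_bound[OF u, of x]
        order_trans[OF partial_le[OF F'(2)] norm_leD(3)[OF v F'(1,2)], of y] K \<delta>
      by (intro add_mono mult_mono) auto
    also have "\<dots> \<le> \<delta> * (K + L + 1)" using \<delta> by (simp add: algebra_simps)
    finally show ?thesis .
  qed
  then have "cmod (lam ts (\<lambda>x y. 1 * (u x * v y) + - 1 * (partial u F x * partial v F' y)) \<one> \<one>) \<le> 4 ^ ?n * (\<delta> * (K + L + 1))"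
    by (intro lam_bound[OF ts]) auto
  also have "\<dots> = \<delta> * D" unfolding D_def by (simp only: mult_ac)
  also have "\<dots> = e" using D by (simp add: \<delta>_def)
  finally have 1: "cmod (test_form ts u v - test_form ts (partial u F) (partial v F')) \<le> e"
    unfolding lam_linear test_form_def by simp
  have "test_form ts (partial u F) (partial v F')
      = lam ts (\<lambda>x y. \<Sum>i\<in>F \<times> F'. (coef u (fst i) * coef v (snd i)) * (ch (fst i) x * ch (snd i) y)) \<one> \<one>"
    unfolding test_form_def partial_def sum_product sum.cartesian_product by (simp add: case_prod_beta mult_ac)
  also have "\<dots> = (\<Sum>i\<in>F \<times> F'. (coef u (fst i) * coef v (snd i)) * lam ts (\<lambda>x y. ch (fst i) x * ch (snd i) y) \<one> \<one>)"
    using F F' by (intro lam_sum) auto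
  also have "cmod \<dots> \<le> (\<Sum>i\<in>F \<times> F'. (2 * sqrt 2) ^ ?n * ((cdim (fst i) * cmod (coef u (fst i))) * (cdim (snd i) * cmod (coef v (snd i)))))"
  proof (intro sum_norm_le)
    fix i assume "i \<in> F \<times> F'"
    then have "fst i \<in> dual" "snd i \<in> dual" using F F' by auto
    from mult_left_mono[OF lam_ch[OF this ts], of "cmod (coef u (fst i) * coef v (snd i))"]
    show "cmod (coef u (fst i) * coef v (snd i) * lam ts (\<lambda>x y. ch (fst i) x * ch (snd i) y) \<one> \<one>)
        \<le> (2 * sqrt 2) ^ ?n * ((cdim (fst i) * cmod (coef u (fst i))) * (cdim (snd i) * cmod (coef v (snd i))))"
      by (simp add: norm_mult mult_ac)
  qed
  also have "\<dots> = (2 * sqrt 2) ^ ?n * (\<Sum>i\<in>F \<times> F'. (cdim (fst i) * cmod (coef u (fst i))) * (cdim (snd i) * cmod (coef v (snd i))))"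
    by (rule sum_distrib_left[symmetric])
  also have "(\<Sum>i\<in>F \<times> F'. (cdim (fst i) * cmod (coef u (fst i))) * (cdim (snd i) * cmod (coef v (snd i))))
      = (\<Sum>c\<in>F. cdim c * cmod (coef u c)) * (\<Sum>c\<in>F'. cdim c * cmod (coef v c))"
    unfolding sum_product sum.cartesian_product by (simp only: case_prod_unfold)
  also have "(2 * sqrt 2) ^ ?n * \<dots> \<le> (2 * sqrt 2) ^ ?n * (K * L)"
    using norm_leD(3)[OF u F(1,2)] norm_leD(3)[OF v F'(1,2)] K by (intro mult_left_mono mult_mono sum_nonneg) auto
  finally have 2: "cmod (test_form ts (partial u F) (partial v F')) \<le> (2 * sqrt 2) ^ ?n * (K * L)" .
  show "cmod (test_form ts u v) \<le> (2 * sqrt 2) ^ ?n * K * L + e"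
    using norm_triangle_sub[of "test_form ts u v" "test_form ts (partial u F) (partial v F')"] 1 2 by (simp add: mult.assoc)
qed

lemma test_form_bilinear:
  assumes ts: "set ts \<subseteq> triples" shows "test_form ts \<in> bounded_bilinear_forms ZA"
  unfolding bounded_bilinear_forms_def ZA_simps(3,5)
proof (intro CollectI conjI ballI allI exI[of _ "(2 * sqrt 2) ^ length ts"])
  fix u v w a
  show "test_form ts (\<lambda>x. u x + v x) w = test_form ts u w + test_form ts v w"
    using lam_linear[of ts 1 "\<lambda>x y. u x * w y" 1 "\<lambda>x y. v x * w y" \<one> \<one>] by (simp add: test_form_def algebra_simps)
  show "test_form ts w (\<lambda>x. u x + v x) = test_form ts w u + test_form ts w v"
    using lam_linear[of ts 1 "\<lambda>x y. w x * u y" 1 "\<lambda>x y. w x * v y" \<one> \<one>] by (simp add: test_form_def algebra_simps)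
  show "test_form ts (\<lambda>x. a * u x) w = a * test_form ts u w"
    using lam_linear[of ts a "\<lambda>x y. u x * w y" 0 "\<lambda>x y. 0" \<one> \<one>] by (simp add: test_form_def algebra_simps)
  show "test_form ts w (\<lambda>x. a * u x) = a * test_form ts w u"
    using lam_linear[of ts a "\<lambda>x y. w x * u y" 0 "\<lambda>x y. 0" \<one> \<one>] by (simp add: test_form_def algebra_simps)
next
  fix u v assume "u \<in> carrier ZA" "v \<in> carrier ZA"
  then show "cmod (test_form ts u v) \<le> (2 * sqrt 2) ^ length ts * nrm ZA u * nrm ZA v"
    by (intro test_form_bound[OF ts] norm_le_nrm)
qed

text \<open>The form is a finite combination of point evaluations, so its value on a tensor can be
  read off from the values \<open>m (ev2 x y)\<close>; their limits are known, while the norm bound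
  comes from the form.\<close>

lemma tensor_test_form:
  assumes m: "m \<in> proj_tensor ZA" and ts: "set ts \<subseteq> triples"
  shows "m (test_form ts) = lam ts (\<lambda>x y. m (ev2 x y)) \<one> \<one>"
    "cmod (m (test_form ts)) \<le> (2 * sqrt 2) ^ length ts * proj_norm ZA m"
proof -
  obtain a b where ab: "tensor_series ZA a b m" using m by (auto simp: proj_tensor_def)
  note t = tensor_seriesD[OF ab]
  have bd: "cmod (test_form ts u v) \<le> (2 * sqrt 2) ^ length ts * nrm ZA u * nrm ZA v"
    if "u \<in> carrier ZA" "v \<in> carrier ZA" for u v
    using that by (intro test_form_bound[OF ts] norm_le_nrm)
  show "cmod (m (test_form ts)) \<le> (2 * sqrt 2) ^ length ts * proj_norm ZA m"
    by (rule proj_norm_bound[OF m test_form_bilinear[OF ts] _ bd]) auto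
  have ev: "(\<lambda>n. a n x * b n y) sums m (ev2 x y)" for x y
    using bilinear_summable(1)[OF ab, of "ev2 x y" 1] ZA_bound nrm_nonneg t(4)[OF ev2_bilinear]
    by (simp add: ev2_def norm_mult mult_mono sums_iff)
  have "(\<lambda>n. lam ts (\<lambda>x y. \<Sum>k<n. 1 * (a k x * b k y)) \<one> \<one>) \<longlonglongrightarrow> lam ts (\<lambda>x y. m (ev2 x y)) \<one> \<one>"
    using ev unfolding sums_def by (intro lam_tendsto[OF ts]) auto
  then have "(\<lambda>n. \<Sum>k<n. test_form ts (a k) (b k)) \<longlonglongrightarrow> lam ts (\<lambda>x y. m (ev2 x y)) \<one> \<one>"
    by (subst (asm) lam_sum) (simp_all add: test_form_def)
  then have "(\<lambda>n. test_form ts (a n) (b n)) sums lam ts (\<lambda>x y. m (ev2 x y)) \<one> \<one>" by (simp add: sums_def)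
  then show "m (test_form ts) = lam ts (\<lambda>x y. m (ev2 x y)) \<one> \<one>"
    unfolding t(4)[OF test_form_bilinear[OF ts]] by (simp add: sums_iff)
qed

text \<open>For separated points divide \<open>commutator_ev2\<close> by the nonzero difference. For
  conjugate points class functions do not distinguish \<open>y\<close> from \<open>x\<close>, so the
  value is that of \<open>tensor_mult\<close> at \<open>x\<close>, which tends to 1 by testing with
  the unit. The truth value \<open>same\<close> stands for conjugacy, decided by the caller.\<close>

lemma approximate_diagonal_limit:
  assumes L: "bounded_approximate_diagonal ZA L" and x: "x \<in> carrier G" and y: "y \<in> carrier G"
    and sep: "\<not> same \<Longrightarrow> \<exists>u \<in> carrier ZA. u x \<noteq> u y"
    and conjugate: "same \<Longrightarrow> \<exists>g \<in> carrier G. y = g \<otimes> x \<otimes> inv g"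
  shows "((\<lambda>m. m (ev2 x y)) \<longlongrightarrow> (if same then 1 else 0)) L"
proof -
  have pt: "\<forall>\<^sub>F m in L. m \<in> proj_tensor ZA"
    using L unfolding bounded_approximate_diagonal_def by (auto elim: eventually_mono)
  have lims: "((\<lambda>m. proj_norm ZA (commutator u m)) \<longlongrightarrow> 0) L"
    "((\<lambda>m. nrm ZA (u \<otimes>\<^bsub>ZA\<^esub> tensor_mult ZA m \<ominus>\<^bsub>ZA\<^esub> u)) \<longlongrightarrow> 0) L" if "u \<in> carrier ZA" for u
    using L that unfolding bounded_approximate_diagonal_def commutator_def by auto
  show ?thesis
  proof (cases same)
    case False
    then obtain u where u: "u \<in> carrier ZA" "u x \<noteq> u y" using sep by blast
    have "((\<lambda>m. (u x - u y) * m (ev2 x y)) \<longlongrightarrow> 0) L"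
    proof (rule Lim_null_comparison[OF _ lims(1)[OF u(1)]])
      show "\<forall>\<^sub>F m in L. norm ((u x - u y) * m (ev2 x y)) \<le> proj_norm ZA (commutator u m)"
        using pt
      proof eventually_elim
        case (elim m)
        obtain a b where ab: "tensor_series ZA a b m" using elim by (auto simp: proj_tensor_def)
        obtain a' b' where "tensor_series ZA a' b' (commutator u m)"
          by (rule commutator_series[OF ab u(1)])
        then have "commutator u m \<in> proj_tensor ZA" by (auto simp: proj_tensor_def)
        from proj_norm_bound[OF this ev2_bilinear, of 1 x y] show ?case
          using ZA_bound nrm_nonneg by (simp add: commutator_ev2[OF elim u(1)] ev2_def norm_mult mult_mono)
      qed
    qed
    from tendsto_mult[OF tendsto_const[of "inverse (u x - u y)"] this]
    have "((\<lambda>m. inverse (u x - u y) * ((u x - u y) * m (ev2 x y))) \<longlongrightarrow> 0) L" by simp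
    then show ?thesis using u(2) False by (simp add: mult.assoc[symmetric])
  next
    case True
    then obtain g where g: "g \<in> carrier G" "y = g \<otimes> x \<otimes> inv g" using conjugate by blast
    let ?one = "\<lambda>x. if x \<in> carrier G then 1 else 0 :: complex"
    have one: "?one \<in> carrier ZA" using norm_le_one by (simp add: norm_le_iff)
    have "((\<lambda>m. m (ev2 x y) - 1) \<longlongrightarrow> 0) L"
    proof (rule Lim_null_comparison[OF _ lims(2)[OF one]])
      show "\<forall>\<^sub>F m in L. norm (m (ev2 x y) - 1) \<le> nrm ZA (?one \<otimes>\<^bsub>ZA\<^esub> tensor_mult ZA m \<ominus>\<^bsub>ZA\<^esub> ?one)"
        using pt
      proof eventually_elim
        case (elim m)
        obtain a b where ab: "tensor_series ZA a b m" using elim by (auto simp: proj_tensor_def)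
        note tm = tensor_mult_eq[OF elim]
        have p: "(\<lambda>z. ?one z * tensor_mult ZA m z) \<in> carrier ZA" by (rule ZA_mult_closed(1)[OF one tm(1)])
        have eq: "?one \<otimes>\<^bsub>ZA\<^esub> tensor_mult ZA m \<ominus>\<^bsub>ZA\<^esub> ?one = (\<lambda>z. ?one z * tensor_mult ZA m z - ?one z)"
          unfolding ZA_simps(2) by (rule ZA_minus[OF p one])
        have "(\<lambda>z. ?one z * tensor_mult ZA m z - ?one z) \<in> carrier ZA"
          using norm_le_diff[OF norm_le_nrm[OF p] norm_le_nrm[OF one]] by (simp add: norm_le_iff)
        from ZA_bound[OF this, of x] have "cmod (m (ev2 x x) - 1) \<le> nrm ZA (?one \<otimes>\<^bsub>ZA\<^esub> tensor_mult ZA m \<ominus>\<^bsub>ZA\<^esub> ?one)"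
          unfolding eq using x tm(2) by simp
        moreover have "m (ev2 x y) = m (ev2 x x)"
        proof -
          have "b n y = b n x" for n
            unfolding g(2) using class_funD(3)[OF norm_leD(1)[OF norm_le_nrm[OF tensor_seriesD(2)[OF ab]]] g(1) x] .
          then show ?thesis unfolding tensor_seriesD(4)[OF ab ev2_bilinear] ev2_def by simp
        qed
        ultimately show ?case by simp
      qed
    qed
    from tendsto_add[OF this tendsto_const[of 1]] show ?thesis using True by simp
  qed
qed

end

context finite_product_grp
begin

subsection \<open>Conjugacy classes\<close>

definition conj_at :: "'i \<Rightarrow> 'a \<Rightarrow> 'a \<Rightarrow> bool" where
  "conj_at i a b \<longleftrightarrow> (\<exists>g\<in>C i. b = g \<otimes>\<^bsub>G i\<^esub> a \<otimes>\<^bsub>G i\<^esub> inv\<^bsub>G i\<^esub> g)"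

definition conj_on :: "'i set \<Rightarrow> ('i \<Rightarrow> 'a) \<Rightarrow> ('i \<Rightarrow> 'a) \<Rightarrow> bool" where
  "conj_on J x y \<longleftrightarrow> (\<forall>j\<in>J. conj_at j (x j) (y j))"

definition class_ind :: "'i set \<Rightarrow> ('i \<Rightarrow> 'a) \<Rightarrow> ('i \<Rightarrow> 'a) \<Rightarrow> complex" where
  "class_ind J t z = (if z \<in> carrier P \<and> conj_on J t z then 1 else 0)"

lemma conj_at_refl: "i \<in> I \<Longrightarrow> a \<in> C i \<Longrightarrow> conj_at i a a"
proof -
  assume i: "i \<in> I" and a: "a \<in> C i"
  interpret Gi: group "G i" by (rule grp[OF i])
  show ?thesis unfolding conj_at_def using a by (intro bexI[of _ "\<one>\<^bsub>G i\<^esub>"]) auto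
qed

lemma conj_at_sym:
  assumes i: "i \<in> I" and a: "a \<in> C i" and ab: "conj_at i a b" shows "conj_at i b a"
proof -
  interpret Gi: group "G i" by (rule grp[OF i])
  obtain g where g: "g \<in> C i" "b = g \<otimes>\<^bsub>G i\<^esub> a \<otimes>\<^bsub>G i\<^esub> inv\<^bsub>G i\<^esub> g" using ab by (auto simp: conj_at_def)
  have "inv\<^bsub>G i\<^esub> g \<otimes>\<^bsub>G i\<^esub> b \<otimes>\<^bsub>G i\<^esub> inv\<^bsub>G i\<^esub> (inv\<^bsub>G i\<^esub> g) = a"
    unfolding g(2) using g(1) a by (simp add: Gi.m_assoc) (simp add: Gi.m_assoc[symmetric])
  then show ?thesis unfolding conj_at_def using g(1) by (intro bexI[of _ "inv\<^bsub>G i\<^esub> g"]) auto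
qed

lemma conj_at_trans:
  assumes i: "i \<in> I" and a: "a \<in> C i" and ab: "conj_at i a b" and bc: "conj_at i b c" shows "conj_at i a c"
proof -
  interpret Gi: group "G i" by (rule grp[OF i])
  obtain g where g: "g \<in> C i" "b = g \<otimes>\<^bsub>G i\<^esub> a \<otimes>\<^bsub>G i\<^esub> inv\<^bsub>G i\<^esub> g" using ab by (auto simp: conj_at_def)
  obtain h where h: "h \<in> C i" "c = h \<otimes>\<^bsub>G i\<^esub> b \<otimes>\<^bsub>G i\<^esub> inv\<^bsub>G i\<^esub> h" using bc by (auto simp: conj_at_def)
  have "c = (h \<otimes>\<^bsub>G i\<^esub> g) \<otimes>\<^bsub>G i\<^esub> a \<otimes>\<^bsub>G i\<^esub> inv\<^bsub>G i\<^esub> (h \<otimes>\<^bsub>G i\<^esub> g)"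
    unfolding h(2) g(2) using g(1) h(1) a by (simp add: Gi.m_assoc Gi.inv_mult_group)
  then show ?thesis unfolding conj_at_def using g(1) h(1) by (intro bexI[of _ "h \<otimes>\<^bsub>G i\<^esub> g"]) auto
qed

lemma conj_on_refl: "J \<subseteq> I \<Longrightarrow> x \<in> carrier P \<Longrightarrow> conj_on J x x"
  unfolding conj_on_def using conj_at_refl P_component by blast

lemma conj_on_sym: "J \<subseteq> I \<Longrightarrow> x \<in> carrier P \<Longrightarrow> conj_on J x y \<Longrightarrow> conj_on J y x"
  unfolding conj_on_def using conj_at_sym P_component by blast

lemma conj_on_trans: "J \<subseteq> I \<Longrightarrow> x \<in> carrier P \<Longrightarrow> conj_on J x y \<Longrightarrow> conj_on J y z \<Longrightarrow> conj_on J x z"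
  unfolding conj_on_def using conj_at_trans P_component by blast

lemma conjugate_component:
  "g \<in> carrier P \<Longrightarrow> j \<in> I \<Longrightarrow> (g \<otimes>\<^bsub>P\<^esub> x \<otimes>\<^bsub>P\<^esub> inv\<^bsub>P\<^esub> g) j = g j \<otimes>\<^bsub>G j\<^esub> x j \<otimes>\<^bsub>G j\<^esub> inv\<^bsub>G j\<^esub> (g j)"
  by (simp only: mult_component inv_component)

lemma conj_on_conjugate:
  "J \<subseteq> I \<Longrightarrow> g \<in> carrier P \<Longrightarrow> conj_on J x (g \<otimes>\<^bsub>P\<^esub> x \<otimes>\<^bsub>P\<^esub> inv\<^bsub>P\<^esub> g)"
  unfolding conj_on_def conj_at_def using conjugate_component P_component by blast

text \<open>Choose a conjugating element in each coordinate of \<open>J\<close> and the identity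
  elsewhere.\<close>

lemma conj_on_lift:
  assumes J: "J \<subseteq> I" and xy: "conj_on J x y"
  obtains g where "g \<in> carrier P" "agree J (g \<otimes>\<^bsub>P\<^esub> x \<otimes>\<^bsub>P\<^esub> inv\<^bsub>P\<^esub> g) y"
proof -
  have "\<forall>j. \<exists>g. j \<in> J \<longrightarrow> g \<in> C j \<and> y j = g \<otimes>\<^bsub>G j\<^esub> x j \<otimes>\<^bsub>G j\<^esub> inv\<^bsub>G j\<^esub> g"
    using xy unfolding conj_on_def conj_at_def by blast
  from choice[OF this] obtain g where
    g: "\<forall>j. j \<in> J \<longrightarrow> g j \<in> C j \<and> y j = g j \<otimes>\<^bsub>G j\<^esub> x j \<otimes>\<^bsub>G j\<^esub> inv\<^bsub>G j\<^esub> (g j)" ..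
  define h where "h = (\<lambda>i\<in>I. if i \<in> J then g i else \<one>\<^bsub>G i\<^esub>)"
  have h: "h \<in> carrier P" unfolding mem_P h_def using g one_C by auto
  have "(h \<otimes>\<^bsub>P\<^esub> x \<otimes>\<^bsub>P\<^esub> inv\<^bsub>P\<^esub> h) j = y j" if "j \<in> J" for j
  proof -
    have "j \<in> I" "h j = g j" using that J by (auto simp: h_def)
    then show ?thesis using g that conjugate_component[OF h, of j x] by (simp only:)
  qed
  then show ?thesis using that[OF h] unfolding agree_def by blast
qed

lemma class_ind_depends: "depends_on J (class_ind J t)"
  unfolding depends_on_def class_ind_def conj_on_def agree_def by (intro ballI impI) (simp only: cong: ball_cong)

lemma class_ind_class_fun:
  assumes J: "finite J" "J \<subseteq> I" and t: "t \<in> carrier P" shows "class_fun (class_ind J t)"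
  unfolding class_fun_def
proof (intro conjI ballI allI impI)
  show "cont (class_ind J t)" by (rule continuous_depends_on[OF class_ind_depends J])
  show "class_ind J t x = 0" if "x \<notin> carrier P" for x unfolding class_ind_def using that by (simp only: simp_thms if_False)
  fix g y assume g: "g \<in> carrier P" and y: "y \<in> carrier P"
  have gy: "g \<otimes>\<^bsub>P\<^esub> y \<otimes>\<^bsub>P\<^esub> inv\<^bsub>P\<^esub> g \<in> carrier P" by (intro m_closed inv_closed g y)
  note c = conj_on_conjugate[OF J(2) g, of y]
  have "conj_on J t (g \<otimes>\<^bsub>P\<^esub> y \<otimes>\<^bsub>P\<^esub> inv\<^bsub>P\<^esub> g) \<longleftrightarrow> conj_on J t y"
    using conj_on_trans[OF J(2) t _ c] conj_on_trans[OF J(2) t _ conj_on_sym[OF J(2) y c]] by blast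
  then show "class_ind J t (g \<otimes>\<^bsub>P\<^esub> y \<otimes>\<^bsub>P\<^esub> inv\<^bsub>P\<^esub> g) = class_ind J t y"
    unfolding class_ind_def using gy y by (simp only: simp_thms)
qed

lemma class_ind_ZA:
  assumes "finite J" "J \<subseteq> I" "t \<in> carrier P" shows "class_ind J t \<in> carrier ZA"
proof -
  obtain K where "norm_le (class_ind J t) K"
    by (rule local_class_fun_norm_le[OF assms(1,2) class_ind_class_fun[OF assms] class_ind_depends])
  then show ?thesis by (simp only: norm_le_iff)
qed

lemma class_ind_self: "J \<subseteq> I \<Longrightarrow> t \<in> carrier P \<Longrightarrow> class_ind J t t = 1"
  unfolding class_ind_def using conj_on_refl by (simp only: simp_thms if_True)

text \<open>Non-conjugate elements already differ in the class of a single coordinate, whose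
  indicator lies in the algebra.\<close>

lemma separate_classes:
  assumes x: "x \<in> carrier P" and y: "y \<in> carrier P" and ne: "\<not> conj_on I x y"
  shows "\<exists>u \<in> carrier ZA. u x \<noteq> u y"
proof -
  obtain i where i: "i \<in> I" "\<not> conj_at i (x i) (y i)" using ne unfolding conj_on_def by blast
  have "class_ind {i} x x = 1" by (rule class_ind_self) (use i x in blast)+
  moreover have "class_ind {i} x y = 0" unfolding class_ind_def conj_on_def using i by simp
  moreover have "class_ind {i} x \<in> carrier ZA" by (rule class_ind_ZA) (use i x in blast)+
  ultimately show ?thesis by (intro bexI[of _ "class_ind {i} x"]) simp
qed

lemma conj_on_all:
  assumes x: "x \<in> carrier P" and y: "y \<in> carrier P" and c: "conj_on I x y"
  shows "\<exists>g \<in> carrier P. y = g \<otimes>\<^bsub>P\<^esub> x \<otimes>\<^bsub>P\<^esub> inv\<^bsub>P\<^esub> g"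
proof -
  obtain g where g: "g \<in> carrier P" "agree I (g \<otimes>\<^bsub>P\<^esub> x \<otimes>\<^bsub>P\<^esub> inv\<^bsub>P\<^esub> g) y"
    by (rule conj_on_lift[OF order_refl c]) (rule that)
  have "g \<otimes>\<^bsub>P\<^esub> x \<otimes>\<^bsub>P\<^esub> inv\<^bsub>P\<^esub> g \<in> carrier P" by (intro m_closed inv_closed g(1) x)
  then have "g \<otimes>\<^bsub>P\<^esub> x \<otimes>\<^bsub>P\<^esub> inv\<^bsub>P\<^esub> g = y"
    using y g(2) unfolding mem_P agree_def by (intro PiE_ext) blast+
  then show ?thesis using g(1) by blast
qed

subsection \<open>Non-amenability\<close>

abbreviation nonabelian where "nonabelian \<equiv> {i \<in> I. \<not> comm_group (G i)}"

definition single :: "'i \<Rightarrow> 'a \<Rightarrow> 'i \<Rightarrow> 'a" where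
  "single i a = (\<lambda>k\<in>I. if k = i then a else \<one>\<^bsub>G k\<^esub>)"

lemma single_P: "a \<in> C i \<Longrightarrow> single i a \<in> carrier P"
  unfolding mem_P single_def using one_C by auto

lemma mult_single:
  assumes "x \<in> carrier P" "k \<in> I" "a \<in> C i"
  shows "(x \<otimes>\<^bsub>P\<^esub> single i a) k = (if k = i then x k \<otimes>\<^bsub>G k\<^esub> a else x k)"
proof -
  interpret Gk: group "G k" by (rule grp[OF assms(2)])
  show ?thesis using assms(2) P_component[OF assms(1,2)] unfolding mult_component[OF assms(2)] by (simp add: single_def)
qed

lemma single_mult: "single i a \<otimes>\<^bsub>P\<^esub> single i b = single i (a \<otimes>\<^bsub>G i\<^esub> b)"
proof
  fix k
  show "(single i a \<otimes>\<^bsub>P\<^esub> single i b) k = single i (a \<otimes>\<^bsub>G i\<^esub> b) k"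
  proof (cases "k \<in> I")
    case True
    interpret Gk: group "G k" by (rule grp[OF True])
    show ?thesis using True by (simp add: single_def)
  qed (simp add: single_def)
qed

text \<open>The inequality says that the two elements do not commute, in the form in which it is
  used: the first times a conjugate of its inverse is not the identity.\<close>

definition witness :: "'i \<Rightarrow> 'a \<times> 'a" where
  "witness i = (SOME p. fst p \<in> C i \<and> snd p \<in> C i \<and>
     fst p \<otimes>\<^bsub>G i\<^esub> (snd p \<otimes>\<^bsub>G i\<^esub> inv\<^bsub>G i\<^esub> (fst p) \<otimes>\<^bsub>G i\<^esub> inv\<^bsub>G i\<^esub> (snd p)) \<noteq> \<one>\<^bsub>G i\<^esub>)"

lemma witness:
  assumes i: "i \<in> nonabelian"
  shows "fst (witness i) \<in> C i" "snd (witness i) \<in> C i"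
    "fst (witness i) \<otimes>\<^bsub>G i\<^esub> (snd (witness i) \<otimes>\<^bsub>G i\<^esub> inv\<^bsub>G i\<^esub> (fst (witness i)) \<otimes>\<^bsub>G i\<^esub> inv\<^bsub>G i\<^esub> (snd (witness i))) \<noteq> \<one>\<^bsub>G i\<^esub>"
proof -
  interpret Gi: group "G i" using grp i by auto
  obtain a b where ab: "a \<in> C i" "b \<in> C i" "a \<otimes>\<^bsub>G i\<^esub> b \<noteq> b \<otimes>\<^bsub>G i\<^esub> a"
    using i Gi.group_comm_groupI by blast
  have "a \<otimes>\<^bsub>G i\<^esub> (b \<otimes>\<^bsub>G i\<^esub> inv\<^bsub>G i\<^esub> a \<otimes>\<^bsub>G i\<^esub> inv\<^bsub>G i\<^esub> b) \<noteq> \<one>\<^bsub>G i\<^esub>"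
  proof
    assume "a \<otimes>\<^bsub>G i\<^esub> (b \<otimes>\<^bsub>G i\<^esub> inv\<^bsub>G i\<^esub> a \<otimes>\<^bsub>G i\<^esub> inv\<^bsub>G i\<^esub> b) = \<one>\<^bsub>G i\<^esub>"
    then have "(a \<otimes>\<^bsub>G i\<^esub> b) \<otimes>\<^bsub>G i\<^esub> inv\<^bsub>G i\<^esub> (b \<otimes>\<^bsub>G i\<^esub> a) = \<one>\<^bsub>G i\<^esub>"
      using ab by (simp add: Gi.m_assoc Gi.inv_mult_group)
    then have "a \<otimes>\<^bsub>G i\<^esub> b = b \<otimes>\<^bsub>G i\<^esub> a"
      using ab Gi.inv_equality[of "a \<otimes>\<^bsub>G i\<^esub> b" "inv\<^bsub>G i\<^esub> (b \<otimes>\<^bsub>G i\<^esub> a)"] by simp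
    then show False using ab(3) by simp
  qed
  then have "\<exists>p. fst p \<in> C i \<and> snd p \<in> C i \<and>
     fst p \<otimes>\<^bsub>G i\<^esub> (snd p \<otimes>\<^bsub>G i\<^esub> inv\<^bsub>G i\<^esub> (fst p) \<otimes>\<^bsub>G i\<^esub> inv\<^bsub>G i\<^esub> (snd p)) \<noteq> \<one>\<^bsub>G i\<^esub>"
    using ab by (intro exI[of _ "(a, b)"]) simp
  from someI_ex[OF this] show "fst (witness i) \<in> C i" "snd (witness i) \<in> C i"
    "fst (witness i) \<otimes>\<^bsub>G i\<^esub> (snd (witness i) \<otimes>\<^bsub>G i\<^esub> inv\<^bsub>G i\<^esub> (fst (witness i)) \<otimes>\<^bsub>G i\<^esub> inv\<^bsub>G i\<^esub> (snd (witness i))) \<noteq> \<one>\<^bsub>G i\<^esub>"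
    unfolding witness_def[symmetric] by blast+
qed

definition triple :: "'i \<Rightarrow> ('i \<Rightarrow> 'a) \<times> ('i \<Rightarrow> 'a) \<times> ('i \<Rightarrow> 'a)" where
  "triple i = (let x = fst (witness i); g = snd (witness i) in
     (single i x, single i (inv\<^bsub>G i\<^esub> x), single i (g \<otimes>\<^bsub>G i\<^esub> inv\<^bsub>G i\<^esub> x \<otimes>\<^bsub>G i\<^esub> inv\<^bsub>G i\<^esub> g)))"

lemma triple_mem: "i \<in> nonabelian \<Longrightarrow> triple i \<in> triples"
proof -
  assume i: "i \<in> nonabelian"
  interpret Gi: group "G i" using grp i by auto
  show ?thesis unfolding triple_def Let_def using witness[OF i] by (intro SigmaI single_P Gi.m_closed Gi.inv_closed)
qed

definition diag :: "('i \<Rightarrow> 'a) \<Rightarrow> ('i \<Rightarrow> 'a) \<Rightarrow> complex" where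
  "diag x y = (if conj_on I x y then 1 else 0)"

text \<open>Of the four points visited by \<open>theta\<close>, the first three stay in the relation of being conjugate
  and the last one, which carries the negative sign, leaves it; hence the factor 3.\<close>

lemma theta_diag:
  assumes i: "i \<in> nonabelian" and x: "x \<in> carrier P" and y: "y \<in> carrier P"
    and 1: "x i = \<one>\<^bsub>G i\<^esub>" "y i = \<one>\<^bsub>G i\<^esub>"
  shows "theta (triple i) diag x y = 3 * diag x y"
proof -
  have iI: "i \<in> I" using i by simp
  interpret Gi: group "G i" by (rule grp[OF iI])
  define a where "a = fst (witness i)"
  define g where "g = snd (witness i)"
  define b where "b = inv\<^bsub>G i\<^esub> a"
  define c where "c = g \<otimes>\<^bsub>G i\<^esub> b \<otimes>\<^bsub>G i\<^esub> inv\<^bsub>G i\<^esub> g"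
  have ag: "a \<in> C i" "g \<in> C i" "a \<otimes>\<^bsub>G i\<^esub> c \<noteq> \<one>\<^bsub>G i\<^esub>" using witness[OF i] by (simp_all add: a_def g_def b_def c_def)
  have bc: "b \<in> C i" "c \<in> C i" using ag by (simp_all add: b_def c_def)
  have ac: "a \<otimes>\<^bsub>G i\<^esub> c \<in> C i" using ag bc by simp
  have t: "triple i = (single i a, single i b, single i c)" by (simp add: triple_def Let_def a_def g_def b_def c_def)
  \<comment> \<open>Both points are trivial at \<open>i\<close>, so the multiplication replaces the
    \<open>i\<close>-th coordinates by \<open>p\<close> and \<open>q\<close>; the remaining
    coordinates decide \<open>diag x y\<close>.\<close>
  have D: "diag (x \<otimes>\<^bsub>P\<^esub> single i p) (y \<otimes>\<^bsub>P\<^esub> single i q) = (if conj_at i p q then diag x y else 0)"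
    if p: "p \<in> C i" and q: "q \<in> C i" for p q
  proof -
    have xi: "(x \<otimes>\<^bsub>P\<^esub> single i p) k = (if k = i then p else x k)" if "k \<in> I" for k
      using mult_single[OF x that p] 1 p by auto
    have yi: "(y \<otimes>\<^bsub>P\<^esub> single i q) k = (if k = i then q else y k)" if "k \<in> I" for k
      using mult_single[OF y that q] 1 q by auto
    have one_i: "conj_at i (x i) (y i)" unfolding 1 by (rule conj_at_refl[OF iI Gi.one_closed])
    have "conj_on I (x \<otimes>\<^bsub>P\<^esub> single i p) (y \<otimes>\<^bsub>P\<^esub> single i q) \<longleftrightarrow> conj_at i p q \<and> conj_on I x y"
    proof
      assume c: "conj_on I (x \<otimes>\<^bsub>P\<^esub> single i p) (y \<otimes>\<^bsub>P\<^esub> single i q)"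
      then have k: "conj_at k (if k = i then p else x k) (if k = i then q else y k)" if "k \<in> I" for k
        unfolding xi[OF that, symmetric] yi[OF that, symmetric] using c that by (simp only: conj_on_def)
      have "conj_at i p q" using k[OF iI] by (simp only: simp_thms if_True)
      moreover have "conj_at k (x k) (y k)" if "k \<in> I" for k
        using k[OF that] one_i by (cases "k = i") auto
      ultimately show "conj_at i p q \<and> conj_on I x y" unfolding conj_on_def by blast
    next
      assume c: "conj_at i p q \<and> conj_on I x y"
      show "conj_on I (x \<otimes>\<^bsub>P\<^esub> single i p) (y \<otimes>\<^bsub>P\<^esub> single i q)"
        unfolding conj_on_def
      proof
        fix k assume k: "k \<in> I"
        show "conj_at k ((x \<otimes>\<^bsub>P\<^esub> single i p) k) ((y \<otimes>\<^bsub>P\<^esub> single i q) k)"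
          unfolding xi[OF k] yi[OF k] using c k by (auto simp: conj_on_def)
      qed
    qed
    then show ?thesis unfolding diag_def by (simp only: split: if_split) blast
  qed
  have "conj_at i a a" by (rule conj_at_refl[OF iI ag(1)])
  moreover have "conj_at i b c" unfolding conj_at_def c_def using ag by blast
  moreover have "\<not> conj_at i (a \<otimes>\<^bsub>G i\<^esub> b) (a \<otimes>\<^bsub>G i\<^esub> c)"
  proof
    have ab: "a \<otimes>\<^bsub>G i\<^esub> b = \<one>\<^bsub>G i\<^esub>" using ag by (simp add: b_def)
    assume "conj_at i (a \<otimes>\<^bsub>G i\<^esub> b) (a \<otimes>\<^bsub>G i\<^esub> c)"
    then obtain h where "h \<in> C i" "a \<otimes>\<^bsub>G i\<^esub> c = h \<otimes>\<^bsub>G i\<^esub> \<one>\<^bsub>G i\<^esub> \<otimes>\<^bsub>G i\<^esub> inv\<^bsub>G i\<^esub> h"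
      unfolding conj_at_def ab by blast
    then show False using ag(3) by simp
  qed
  ultimately show ?thesis
    unfolding t theta_def prod.case single_mult D[OF ag(1,1)] D[OF bc] D[OF Gi.m_closed[OF ag(1) bc(1)] ac] by simp
qed

text \<open>Each \<open>theta_diag\<close> needs points that are trivial in its own coordinate, so
  \<open>F\<close> is required to be a multiple of \<open>diag\<close> only at pairs trivial on
  \<open>J0\<close>. Processing a triple adds its coordinate to \<open>J0\<close> and multiplies the
  constant by 3; distinctness keeps the later triples away from \<open>J0\<close>.\<close>

lemma lam_diag:
  assumes "distinct is" "set is \<subseteq> nonabelian" "J0 \<inter> set is = {}"
    and "\<And>x y. x \<in> carrier P \<Longrightarrow> y \<in> carrier P \<Longrightarrow> agree J0 x \<one>\<^bsub>P\<^esub> \<Longrightarrow> agree J0 y \<one>\<^bsub>P\<^esub> \<Longrightarrow> F x y = c * diag x y"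
  shows "lam (map triple is) F \<one>\<^bsub>P\<^esub> \<one>\<^bsub>P\<^esub> = c * 3 ^ length is * diag \<one>\<^bsub>P\<^esub> \<one>\<^bsub>P\<^esub>"
  using assms
proof (induction "is" arbitrary: J0 F c)
  case Nil
  have "F \<one>\<^bsub>P\<^esub> \<one>\<^bsub>P\<^esub> = c * diag \<one>\<^bsub>P\<^esub> \<one>\<^bsub>P\<^esub>"
    by (rule Nil.prems(4)[OF one_closed one_closed]) (unfold agree_def, blast+)
  then show ?case by (simp only: list.map lam.simps list.size power_0 mult_1_right)
next
  case (Cons i js)
  have i: "i \<in> nonabelian" and iI: "i \<in> I" and iJ: "i \<notin> J0" using Cons.prems by auto
  obtain p p' q where t: "triple i = (p, p', q)" by (cases "triple i")
  have pP: "p \<in> carrier P" "p' \<in> carrier P" "q \<in> carrier P" using triple_mem[OF i] unfolding t by blast+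
  have off: "r k = \<one>\<^bsub>P\<^esub> k" if r: "r \<in> {p, p', q}" and k: "k \<noteq> i" for r k
    using t r k unfolding triple_def Let_def by (auto simp: single_def)
  have keep: "agree J0 (x \<otimes>\<^bsub>P\<^esub> r) \<one>\<^bsub>P\<^esub>"
    if x: "agree J0 x \<one>\<^bsub>P\<^esub>" and r: "\<And>k. k \<noteq> i \<Longrightarrow> r k = \<one>\<^bsub>P\<^esub> k" for x r
    unfolding agree_def
  proof
    fix k assume k: "k \<in> J0"
    then have ki: "k \<noteq> i" using iJ by auto
    have xk: "x k = \<one>\<^bsub>P\<^esub> k" using x k by (simp only: agree_def)
    show "(x \<otimes>\<^bsub>P\<^esub> r) k = \<one>\<^bsub>P\<^esub> k"
    proof (cases "k \<in> I")
      case True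
      interpret Gk: group "G k" by (rule grp[OF True])
      show ?thesis unfolding mult_component[OF True] xk r[OF ki] one_component[OF True] by simp
    qed simp
  qed
  have off2: "(r \<otimes>\<^bsub>P\<^esub> s) k = \<one>\<^bsub>P\<^esub> k" if "r \<in> {p, p', q}" "s \<in> {p, p', q}" "k \<noteq> i" for r s k
  proof (cases "k \<in> I")
    case True
    interpret Gk: group "G k" by (rule grp[OF True])
    show ?thesis unfolding mult_component[OF True] off[OF that(1,3)] off[OF that(2,3)] one_component[OF True] by simp
  qed simp
  \<comment> \<open>All four points differ from \<open>(x, y)\<close> at most in coordinate
    \<open>i\<close>, which is not in \<open>J0\<close>, so the hypothesis on \<open>F\<close>
    applies to each of them.\<close>
  have th: "theta (triple i) F x y = (c * 3) * diag x y"
    if xy: "x \<in> carrier P" "y \<in> carrier P" and a: "agree (insert i J0) x \<one>\<^bsub>P\<^esub>" "agree (insert i J0) y \<one>\<^bsub>P\<^esub>" for x y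
  proof -
    have a0: "agree J0 x \<one>\<^bsub>P\<^esub>" "agree J0 y \<one>\<^bsub>P\<^esub>" using a by (auto simp: agree_def)
    have e: "x i = \<one>\<^bsub>G i\<^esub>" "y i = \<one>\<^bsub>G i\<^esub>" using a iI by (auto simp: agree_def)
    have F_eq: "F (x \<otimes>\<^bsub>P\<^esub> r) (y \<otimes>\<^bsub>P\<^esub> s) = c * diag (x \<otimes>\<^bsub>P\<^esub> r) (y \<otimes>\<^bsub>P\<^esub> s)"
      if "r \<in> carrier P" "s \<in> carrier P" "\<And>k. k \<noteq> i \<Longrightarrow> r k = \<one>\<^bsub>P\<^esub> k" "\<And>k. k \<noteq> i \<Longrightarrow> s k = \<one>\<^bsub>P\<^esub> k" for r s
      by (rule Cons.prems(4)[OF m_closed[OF xy(1) that(1)] m_closed[OF xy(2) that(2)]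
            keep[OF a0(1) that(3)] keep[OF a0(2) that(4)]])
    have o: "\<And>k. k \<noteq> i \<Longrightarrow> p k = \<one>\<^bsub>P\<^esub> k" "\<And>k. k \<noteq> i \<Longrightarrow> p' k = \<one>\<^bsub>P\<^esub> k" "\<And>k. k \<noteq> i \<Longrightarrow> q k = \<one>\<^bsub>P\<^esub> k"
      "\<And>k. k \<noteq> i \<Longrightarrow> (p \<otimes>\<^bsub>P\<^esub> p') k = \<one>\<^bsub>P\<^esub> k" "\<And>k. k \<noteq> i \<Longrightarrow> (p \<otimes>\<^bsub>P\<^esub> q) k = \<one>\<^bsub>P\<^esub> k"
      using off off2 by blast+
    have f1: "F (x \<otimes>\<^bsub>P\<^esub> p) (y \<otimes>\<^bsub>P\<^esub> p) = c * diag (x \<otimes>\<^bsub>P\<^esub> p) (y \<otimes>\<^bsub>P\<^esub> p)"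
      by (rule F_eq[OF pP(1) pP(1)]) (rule o(1), assumption)+
    have f2: "F (x \<otimes>\<^bsub>P\<^esub> p') (y \<otimes>\<^bsub>P\<^esub> q) = c * diag (x \<otimes>\<^bsub>P\<^esub> p') (y \<otimes>\<^bsub>P\<^esub> q)"
      by (rule F_eq[OF pP(2) pP(3)]) (rule o(2) o(3), assumption)+
    have f3: "F (x \<otimes>\<^bsub>P\<^esub> (p \<otimes>\<^bsub>P\<^esub> p')) (y \<otimes>\<^bsub>P\<^esub> (p \<otimes>\<^bsub>P\<^esub> q)) = c * diag (x \<otimes>\<^bsub>P\<^esub> (p \<otimes>\<^bsub>P\<^esub> p')) (y \<otimes>\<^bsub>P\<^esub> (p \<otimes>\<^bsub>P\<^esub> q))"
      by (rule F_eq[OF m_closed[OF pP(1,2)] m_closed[OF pP(1,3)]]) (rule o(4) o(5), assumption)+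
    have "theta (triple i) F x y = c * theta (triple i) diag x y"
      unfolding t theta_def prod.case f1 f2 f3 Cons.prems(4)[OF xy a0] by (simp only: distrib_left right_diff_distrib)
    then show ?thesis unfolding theta_diag[OF i xy e] by simp
  qed
  have d: "distinct js" "set js \<subseteq> nonabelian" "insert i J0 \<inter> set js = {}"
    using Cons.prems(1,2,3) by auto
  have "lam (map triple js) (theta (triple i) F) \<one>\<^bsub>P\<^esub> \<one>\<^bsub>P\<^esub> = c * 3 * 3 ^ length js * diag \<one>\<^bsub>P\<^esub> \<one>\<^bsub>P\<^esub>"
    by (rule Cons.IH[OF d]) (rule th)
  then show ?case by (simp only: list.map lam.simps list.size power_Suc mult.assoc add_Suc_right add_0_right)
qed

theorem not_amenable:
  assumes inf: "infinite nonabelian" shows "\<not> amenable ZA"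
proof
  assume "amenable ZA"
  then obtain L where L: "bounded_approximate_diagonal ZA L" unfolding amenable_def ..
  then obtain K where nb: "L \<noteq> bot" and K: "\<forall>\<^sub>F m in L. m \<in> proj_tensor ZA \<and> proj_norm ZA m \<le> K"
    unfolding bounded_approximate_diagonal_def by blast
  have lim: "((\<lambda>m. m (ev2 x y)) \<longlongrightarrow> diag x y) L" if "x \<in> carrier P" "y \<in> carrier P" for x y
    unfolding diag_def using that
    by (intro approximate_diagonal_limit[OF L] separate_classes conj_on_all)
  \<comment> \<open>The bound \<open>K\<close> of the approximate diagonal is fixed before
    \<open>n\<close>, and infinitely many non-abelian factors allow every \<open>n\<close>.\<close>
  have main: "3 ^ n \<le> (2 * sqrt 2) ^ n * K" for n
  proof -
    obtain S where S: "S \<subseteq> nonabelian" "finite S" "card S = n" using infinite_arbitrarily_large[OF inf] by blast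
    obtain js where js: "set js = S" "distinct js" using finite_distinct_list[OF S(2)] by blast
    have len: "length js = n" using distinct_card[OF js(2)] js(1) S(3) by simp
    let ?ts = "map triple js"
    have ts: "set ?ts \<subseteq> triples" unfolding set_map using triple_mem S(1) js(1) by blast
    have "lam ?ts diag \<one>\<^bsub>P\<^esub> \<one>\<^bsub>P\<^esub> = 1 * 3 ^ length js * diag \<one>\<^bsub>P\<^esub> \<one>\<^bsub>P\<^esub>"
      by (rule lam_diag[of js "{}"]) (use js S in auto)
    moreover have "diag \<one>\<^bsub>P\<^esub> \<one>\<^bsub>P\<^esub> = 1"
      unfolding diag_def using conj_on_refl[OF order_refl one_closed] by (simp only: if_True)
    ultimately have val: "lam ?ts diag \<one>\<^bsub>P\<^esub> \<one>\<^bsub>P\<^esub> = 3 ^ n" by (simp only: len mult_1 mult_1_right)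
    have "((\<lambda>m. lam ?ts (\<lambda>x y. m (ev2 x y)) \<one>\<^bsub>P\<^esub> \<one>\<^bsub>P\<^esub>) \<longlongrightarrow> 3 ^ n) L"
      unfolding val[symmetric] by (rule lam_tendsto[OF ts lim one_closed one_closed])
    then have "((\<lambda>m. cmod (lam ?ts (\<lambda>x y. m (ev2 x y)) \<one>\<^bsub>P\<^esub> \<one>\<^bsub>P\<^esub>)) \<longlongrightarrow> cmod (3 ^ n)) L"
      by (rule tendsto_norm)
    moreover have "\<forall>\<^sub>F m in L. cmod (lam ?ts (\<lambda>x y. m (ev2 x y)) \<one>\<^bsub>P\<^esub> \<one>\<^bsub>P\<^esub>) \<le> (2 * sqrt 2) ^ n * K"
      using K
    proof eventually_elim
      case (elim m)
      have "cmod (lam ?ts (\<lambda>x y. m (ev2 x y)) \<one>\<^bsub>P\<^esub> \<one>\<^bsub>P\<^esub>) \<le> (2 * sqrt 2) ^ n * proj_norm ZA m"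
        using tensor_test_form[OF conjunct1[OF elim] ts] by (simp only: length_map len)
      also have "\<dots> \<le> (2 * sqrt 2) ^ n * K" using elim by (intro mult_left_mono) auto
      finally show ?case .
    qed
    ultimately have "cmod (3 ^ n) \<le> (2 * sqrt 2) ^ n * K" using nb by (rule tendsto_upperbound)
    then show ?thesis by (simp add: norm_power)
  qed
  \<comment> \<open>After squaring this is 8 < 9.\<close>
  have "2 * sqrt 2 < (3 :: real)"
    by (rule power2_less_imp_less) (simp_all add: power_mult_distrib)
  then have "1 < 3 / (2 * sqrt 2)" by simp
  then obtain n where "K < (3 / (2 * sqrt 2)) ^ n" using real_arch_pow by blast
  then have "(2 * sqrt 2) ^ n * K < 3 ^ n"
    by (simp only: power_divide) (simp add: field_simps)
  then show False using main[of n] by simp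
qed

end

section \<open>Finitely many non-abelian factors\<close>

context complete_haar_grp
begin

section \<open>Bilinear forms on finite sums, and finite tensors\<close>

lemma bilinear_add:
  assumes B: "B \<in> bounded_bilinear_forms ZA" and "v \<in> carrier ZA" "v' \<in> carrier ZA" "w \<in> carrier ZA"
  shows "B (\<lambda>x. v x + v' x) w = B v w + B v' w" "B w (\<lambda>x. v x + v' x) = B w v + B w v'"
  using assms unfolding bounded_bilinear_forms_def ZA_simps(3) by auto

lemma bilinear_scale:
  assumes B: "B \<in> bounded_bilinear_forms ZA" and "v \<in> carrier ZA" "w \<in> carrier ZA"
  shows "B (\<lambda>x. a * v x) w = a * B v w" "B w (\<lambda>x. a * v x) = a * B w v"
  using assms unfolding bounded_bilinear_forms_def ZA_simps(5) by auto

lemma bilinear_scale_sum: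
  assumes B: "B \<in> bounded_bilinear_forms ZA" and S: "finite S" and f: "\<And>i. i \<in> S \<Longrightarrow> f i \<in> carrier ZA"
    and w: "w \<in> carrier ZA"
  shows "(\<lambda>x. \<Sum>i\<in>S. a i * f i x) \<in> carrier ZA"
    "B (\<lambda>x. \<Sum>i\<in>S. a i * f i x) w = (\<Sum>i\<in>S. a i * B (f i) w)"
    "B w (\<lambda>x. \<Sum>i\<in>S. a i * f i x) = (\<Sum>i\<in>S. a i * B w (f i))"
proof -
  have add: "B (\<lambda>x. v x + v' x) w = B v w + B v' w" "B w (\<lambda>x. v x + v' x) = B w v + B w v'"
    if "v \<in> carrier ZA" "v' \<in> carrier ZA" for v v'
    by (rule bilinear_add[OF B that w])+
  have scale: "B (\<lambda>x. a * v x) w = a * B v w" "B w (\<lambda>x. a * v x) = a * B w v" if "v \<in> carrier ZA" for v a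
    by (rule bilinear_scale[OF B that w])+
  have sc: "(\<lambda>x. a * v x) \<in> carrier ZA" if "v \<in> carrier ZA" for v a
    using norm_le_scale[OF norm_le_nrm[OF that]] by (simp only: norm_le_iff)
  have ad: "(\<lambda>x. v x + v' x) \<in> carrier ZA" if "v \<in> carrier ZA" "v' \<in> carrier ZA" for v v'
    using norm_le_add[OF norm_le_nrm[OF that(1)] norm_le_nrm[OF that(2)]] by (simp only: norm_le_iff)
  have zero: "(\<lambda>x. 0) \<in> carrier ZA" using norm_le_zero by (simp only: norm_le_iff)
  have "(\<lambda>x. \<Sum>i\<in>S. a i * f i x) \<in> carrier ZA \<and> B (\<lambda>x. \<Sum>i\<in>S. a i * f i x) w = (\<Sum>i\<in>S. a i * B (f i) w)
    \<and> B w (\<lambda>x. \<Sum>i\<in>S. a i * f i x) = (\<Sum>i\<in>S. a i * B w (f i))"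
    using S f
  proof (induction S rule: finite_induct)
    case empty
    then show ?case using zero scale[OF zero, of 0] by simp
  next
    case (insert i S)
    have i: "f i \<in> carrier ZA" and IH: "(\<lambda>x. \<Sum>i\<in>S. a i * f i x) \<in> carrier ZA"
      "B (\<lambda>x. \<Sum>i\<in>S. a i * f i x) w = (\<Sum>i\<in>S. a i * B (f i) w)"
      "B w (\<lambda>x. \<Sum>i\<in>S. a i * f i x) = (\<Sum>i\<in>S. a i * B w (f i))" using insert by auto
    show ?case
      unfolding sum.insert[OF insert(1,2)] add[OF sc[OF i] IH(1)] scale[OF i] IH(2,3)
      using ad[OF sc[OF i] IH(1)] by blast
  qed
  then show "(\<lambda>x. \<Sum>i\<in>S. a i * f i x) \<in> carrier ZA"
    "B (\<lambda>x. \<Sum>i\<in>S. a i * f i x) w = (\<Sum>i\<in>S. a i * B (f i) w)"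
    "B w (\<lambda>x. \<Sum>i\<in>S. a i * f i x) = (\<Sum>i\<in>S. a i * B w (f i))" by blast+
qed

definition finite_tensor :: "'s set \<Rightarrow> ('s \<Rightarrow> 'a \<Rightarrow> complex) \<Rightarrow> ('s \<Rightarrow> 'a \<Rightarrow> complex) \<Rightarrow> ('a \<Rightarrow> complex) tensor" where
  "finite_tensor S f g = (\<lambda>B. if B \<in> bounded_bilinear_forms ZA then (\<Sum>s\<in>S. B (f s) (g s)) else 0)"

text \<open>Enumerate \<open>S\<close> and pad with zeros, which contribute neither to a bilinear
  form nor to the norm sum.\<close>

lemma finite_tensor_series:
  assumes S: "finite S" and f: "\<And>s. s \<in> S \<Longrightarrow> f s \<in> carrier ZA" and g: "\<And>s. s \<in> S \<Longrightarrow> g s \<in> carrier ZA"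
  obtains a b where "tensor_series ZA a b (finite_tensor S f g)"
    "suminf (\<lambda>n. nrm ZA (a n) * nrm ZA (b n)) = (\<Sum>s\<in>S. nrm ZA (f s) * nrm ZA (g s))"
proof -
  obtain h where h: "bij_betw h {..<card S} S"
    using ex_bij_betw_nat_finite[OF S] by (auto simp: lessThan_atLeast0)
  have hS: "h n \<in> S" if "n < card S" for n using h that by (auto simp: bij_betw_def)
  have zero: "(\<lambda>x. 0) \<in> carrier ZA" using norm_le_zero by (simp only: norm_le_iff)
  define a where "a n = (if n < card S then f (h n) else (\<lambda>x. 0))" for n
  define b where "b n = (if n < card S then g (h n) else (\<lambda>x. 0))" for n
  have ab: "a n \<in> carrier ZA" "b n \<in> carrier ZA" for n using hS f g zero by (auto simp: a_def b_def)
  \<comment> \<open>Used twice: for the product of the norms and for an arbitrary bounded bilinear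
    form.\<close>
  have fin: "(\<lambda>n. F (a n) (b n)) sums (\<Sum>s\<in>S. F (f s) (g s))" if "F (\<lambda>x. 0) (\<lambda>x. 0) = 0"
    for F :: "_ \<Rightarrow> _ \<Rightarrow> 'z :: real_normed_vector"
  proof -
    have "(\<lambda>n. F (a n) (b n)) sums (\<Sum>n<card S. F (a n) (b n))"
      by (rule sums_finite) (auto simp: a_def b_def that)
    also have "(\<Sum>n<card S. F (a n) (b n)) = (\<Sum>n<card S. F (f (h n)) (g (h n)))"
      by (intro sum.cong) (auto simp: a_def b_def)
    also have "\<dots> = (\<Sum>s\<in>S. F (f s) (g s))" by (rule sum.reindex_bij_betw[OF h])
    finally show ?thesis .
  qed
  note n = fin[of "\<lambda>u v. nrm ZA u * nrm ZA v", unfolded nrm_zero, simplified]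
  have "suminf (\<lambda>n. B (a n) (b n)) = (\<Sum>s\<in>S. B (f s) (g s))" if B: "B \<in> bounded_bilinear_forms ZA" for B
  proof -
    have "B (\<lambda>x. 0) (\<lambda>x. 0) = 0" using bilinear_scale(1)[OF B zero zero, of 0] by simp
    from fin[of B, OF this] show ?thesis by (simp only: sums_iff)
  qed
  then have "finite_tensor S f g = (\<lambda>B. if B \<in> bounded_bilinear_forms ZA then suminf (\<lambda>n. B (a n) (b n)) else 0)"
    by (auto simp: finite_tensor_def)
  then have "tensor_series ZA a b (finite_tensor S f g)"
    using ab sums_summable[OF n] by (simp add: tensor_series_def)
  then show ?thesis using sums_unique[OF n] by (intro that) simp_all
qed

end

context finite_product_grp
begin

section \<open>Class indicators of a finite subproduct and their diagonal tensor\<close>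

definition conj_classes :: "'i set \<Rightarrow> (('i \<Rightarrow> 'a) \<Rightarrow> complex) set" where
  "conj_classes J = class_ind J ` carrier P"

definition pt :: "(('i \<Rightarrow> 'a) \<Rightarrow> complex) \<Rightarrow> 'i \<Rightarrow> 'a" where
  "pt D = (SOME x. x \<in> carrier P \<and> D x = 1)"

definition class_diagonal :: "'i set \<Rightarrow> (('i \<Rightarrow> 'a) \<Rightarrow> complex) tensor" where
  "class_diagonal J = finite_tensor (conj_classes J) (\<lambda>D. D) (\<lambda>D. D)"

lemma finite_classes:
  assumes J: "finite J" "J \<subseteq> I" shows "finite (conj_classes J)"
proof -
  have "conj_classes J \<subseteq> (\<lambda>S. class_ind J (SOME x. x \<in> S)) ` (cyl J ` carrier P)"
  proof
    fix D assume "D \<in> conj_classes J"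
    then obtain t where t: "t \<in> carrier P" "D = class_ind J t" by (auto simp only: conj_classes_def)
    have "t \<in> cyl J t" using t(1) unfolding cyl_def agree_def by blast
    then have "(SOME x. x \<in> cyl J t) \<in> cyl J t" by (rule someI[where P = "\<lambda>x. x \<in> cyl J t"])
    then have "agree J (SOME x. x \<in> cyl J t) t" unfolding cyl_def by blast
    then have "class_ind J (SOME x. x \<in> cyl J t) = D"
      unfolding t(2) by (intro ext) (simp only: class_ind_def conj_on_def agree_def cong: ball_cong)
    then show "D \<in> (\<lambda>S. class_ind J (SOME x. x \<in> S)) ` (cyl J ` carrier P)" using t(1) by blast
  qed
  then show ?thesis using finite_cylinders[OF J] by (meson finite_imageI finite_subset)
qed

lemma class_ind_cases: "class_ind J t x = 0 \<or> class_ind J t x = 1"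
  unfolding class_ind_def by (simp only: split: if_split) blast

lemma class_ind_one: "class_ind J t x = 1 \<longleftrightarrow> x \<in> carrier P \<and> conj_on J t x"
  unfolding class_ind_def by (simp only: split: if_split) simp

text \<open>Classes are represented by their indicator functions, so equality of classes becomes
  equality of functions and any member determines its class.\<close>

lemma class_ind_eq:
  assumes J: "J \<subseteq> I" and t: "t \<in> carrier P" and s: "s \<in> carrier P"
  shows "class_ind J t = class_ind J s \<longleftrightarrow> conj_on J t s"
proof
  assume "class_ind J t = class_ind J s"
  then have "class_ind J t s = 1" using class_ind_self[OF J s] by simp
  then show "conj_on J t s" by (simp only: class_ind_one)
next
  assume ts: "conj_on J t s"
  have "conj_on J t x \<longleftrightarrow> conj_on J s x" for x
    using conj_on_trans[OF J t ts] conj_on_trans[OF J s conj_on_sym[OF J t ts]] by blast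
  then show "class_ind J t = class_ind J s" by (intro ext) (simp only: class_ind_def)
qed

context
  fixes J assumes J: "finite J" "J \<subseteq> I"
begin

lemma pt:
  assumes D: "D \<in> conj_classes J" shows "pt D \<in> carrier P" "D = class_ind J (pt D)"
proof -
  obtain t where t: "t \<in> carrier P" "D = class_ind J t" using D by (auto simp only: conj_classes_def)
  have "\<exists>x. x \<in> carrier P \<and> D x = 1" using t class_ind_self[OF J(2) t(1)] by blast
  from someI_ex[OF this] have p: "pt D \<in> carrier P" "D (pt D) = 1" unfolding pt_def[symmetric] by blast+
  show "pt D \<in> carrier P" by (rule p(1))
  have "conj_on J t (pt D)" using p(2) unfolding t(2) by (simp only: class_ind_one)
  then show "D = class_ind J (pt D)" using class_ind_eq[OF J(2) t(1) p(1)] t(2) by simp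
qed

lemma classes_ZA: "D \<in> conj_classes J \<Longrightarrow> D \<in> carrier ZA"
  unfolding conj_classes_def using class_ind_ZA[OF J] by blast

lemma class_fun_const:
  assumes u: "class_fun u" "depends_on J u" and x: "x \<in> carrier P" and y: "y \<in> carrier P" and xy: "conj_on J x y"
  shows "u y = u x"
proof -
  obtain g where g: "g \<in> carrier P" "agree J (g \<otimes>\<^bsub>P\<^esub> x \<otimes>\<^bsub>P\<^esub> inv\<^bsub>P\<^esub> g) y"
    by (rule conj_on_lift[OF J(2) xy]) (rule that)
  have gx: "g \<otimes>\<^bsub>P\<^esub> x \<otimes>\<^bsub>P\<^esub> inv\<^bsub>P\<^esub> g \<in> carrier P" by (intro m_closed inv_closed g(1) x)
  show ?thesis using depends_onD[OF u(2) gx y g(2)] class_funD(3)[OF u(1) g(1) x] by simp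
qed

lemma class_fun_mult_class:
  assumes u: "class_fun u" "depends_on J u" and D: "D \<in> conj_classes J"
  shows "(\<lambda>x. u x * D x) = (\<lambda>x. u (pt D) * D x)"
proof
  fix x
  note p = pt[OF D]
  show "u x * D x = u (pt D) * D x"
  proof (cases "D x = 0")
    case False
    then have "class_ind J (pt D) x = 1" using class_ind_cases[of J "pt D" x] p(2) by metis
    then have "x \<in> carrier P" "conj_on J (pt D) x" by (simp_all only: class_ind_one)
    then show ?thesis using class_fun_const[OF u p(1)] by simp
  qed simp
qed

text \<open>The indicators form a partition of unity: at \<open>x\<close> only the class of
  \<open>x\<close> contributes.\<close>

lemma class_sum:
  assumes x: "x \<in> carrier P" shows "(\<Sum>D\<in>conj_classes J. a D * D x) = a (class_ind J x)"
proof -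
  have mem: "class_ind J x \<in> conj_classes J" unfolding conj_classes_def using x by blast
  have "(\<Sum>D\<in>conj_classes J. a D * D x) = (\<Sum>D\<in>conj_classes J. if D = class_ind J x then a (class_ind J x) else 0)"
  proof (rule sum.cong[OF refl])
    fix D assume D: "D \<in> conj_classes J"
    note p = pt[OF D]
    show "a D * D x = (if D = class_ind J x then a (class_ind J x) else 0)"
    proof (cases "D = class_ind J x")
      case True
      then show ?thesis using class_ind_self[OF J(2) x] by simp
    next
      case False
      then have "\<not> conj_on J (pt D) x" using class_ind_eq[OF J(2) p(1) x] p(2) by metis
      then have "D x = 0" using class_ind_cases[of J "pt D" x] class_ind_one[of J "pt D" x] p(2) by metis
      then show ?thesis using False by simp
    qed
  qed
  then show ?thesis using finite_classes[OF J] mem by simp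
qed

lemma class_fun_expand:
  assumes u: "class_fun u" "depends_on J u"
  shows "u = (\<lambda>x. \<Sum>D\<in>conj_classes J. u (pt D) * D x)"
proof
  fix x
  show "u x = (\<Sum>D\<in>conj_classes J. u (pt D) * D x)"
  proof (cases "x \<in> carrier P")
    case True
    have mem: "class_ind J x \<in> conj_classes J" unfolding conj_classes_def using True by blast
    have "conj_on J x (pt (class_ind J x))"
      using pt[OF mem] class_ind_eq[OF J(2) True pt(1)[OF mem]] by metis
    then have "u (pt (class_ind J x)) = u x" by (rule class_fun_const[OF u True pt(1)[OF mem]])
    then show ?thesis using class_sum[OF True, of "\<lambda>D. u (pt D)"] by simp
  next
    case False
    have "D x = 0" if "D \<in> conj_classes J" for D
      using class_funD(2)[OF norm_leD(1)[OF norm_le_nrm[OF classes_ZA[OF that]]] False] .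
    then show ?thesis using class_funD(2)[OF u(1) False] by simp
  qed
qed

text \<open>Class functions of the coordinates in \<open>J\<close> are combinations of finitely many
  indicators. This allows two expansions of a tensor to be compared through their coefficients at
  pairs of classes.\<close>

lemma bilinear_expand:
  assumes B: "B \<in> bounded_bilinear_forms ZA" and u: "class_fun u" "depends_on J u" and v: "class_fun v" "depends_on J v"
  shows "B u v = (\<Sum>D\<in>conj_classes J. \<Sum>E\<in>conj_classes J. u (pt D) * v (pt E) * B D E)"
proof -
  note fc = finite_classes[OF J]
  have vZ: "v \<in> carrier ZA"
  proof (rule ssubst[OF class_fun_expand[OF v], of "\<lambda>z. z \<in> carrier ZA"])
    have zero: "(\<lambda>x. 0) \<in> carrier ZA" using norm_le_zero by (simp only: norm_le_iff)
    show "(\<lambda>x. \<Sum>D\<in>conj_classes J. v (pt D) * D x) \<in> carrier ZA"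
      by (rule bilinear_scale_sum(1)[OF B fc _ zero]) (rule classes_ZA)
  qed
  have "B u v = B (\<lambda>x. \<Sum>D\<in>conj_classes J. u (pt D) * D x) v"
    by (rule arg_cong[OF class_fun_expand[OF u], of "\<lambda>z. B z v"])
  also have "\<dots> = (\<Sum>D\<in>conj_classes J. u (pt D) * B D v)" by (rule bilinear_scale_sum(2)[OF B fc classes_ZA vZ])
  also have "\<dots> = (\<Sum>D\<in>conj_classes J. u (pt D) * (\<Sum>E\<in>conj_classes J. v (pt E) * B D E))"
  proof (rule sum.cong[OF refl])
    fix D assume D: "D \<in> conj_classes J"
    have "B D v = B D (\<lambda>x. \<Sum>E\<in>conj_classes J. v (pt E) * E x)"
      by (rule arg_cong[OF class_fun_expand[OF v], of "B D"])
    also have "\<dots> = (\<Sum>E\<in>conj_classes J. v (pt E) * B D E)" by (rule bilinear_scale_sum(3)[OF B fc classes_ZA classes_ZA[OF D]])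
    finally show "u (pt D) * B D v = u (pt D) * (\<Sum>E\<in>conj_classes J. v (pt E) * B D E)" by simp
  qed
  finally show ?thesis by (simp add: sum_distrib_left mult.assoc)
qed

text \<open>Hence the diagonal is mapped exactly to the unit under multiplication, for every
  \<open>J\<close>.\<close>

lemma class_diagonal_ev2:
  "class_diagonal J (ev2 x x) = (if x \<in> carrier P then 1 else 0)"
proof (cases "x \<in> carrier P")
  case True
  have "class_diagonal J (ev2 x x) = (\<Sum>D\<in>conj_classes J. D x * D x)"
    by (simp add: class_diagonal_def finite_tensor_def ev2_bilinear ev2_def)
  also have "\<dots> = class_ind J x x" using class_sum[OF True, of "\<lambda>D. D x"] .
  finally show ?thesis using class_ind_self[OF J(2) True] True by simp
next
  case False
  have "D x = 0" if "D \<in> conj_classes J" for D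
    using class_funD(2)[OF norm_leD(1)[OF norm_le_nrm[OF classes_ZA[OF that]]] False] .
  then show ?thesis using False by (simp add: class_diagonal_def finite_tensor_def ev2_bilinear ev2_def)
qed

text \<open>A class function of the coordinates in \<open>J\<close> commutes exactly with the diagonal, so only the
  remainder \<open>u - y\<close> contributes.\<close>

lemma commutator_class_diagonal:
  assumes u: "u \<in> carrier ZA" and y: "y \<in> carrier ZA" "depends_on J y"
  shows "commutator u (class_diagonal J) = commutator (\<lambda>x. u x - y x) (class_diagonal J)"
proof
  fix B
  show "commutator u (class_diagonal J) B = commutator (\<lambda>x. u x - y x) (class_diagonal J) B"
  proof (cases "B \<in> bounded_bilinear_forms ZA")
    case True
    define w where "w = (\<lambda>x. u x - y x)"
    have w: "w \<in> carrier ZA"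
      using norm_le_diff[OF norm_le_nrm[OF u] norm_le_nrm[OF y(1)]] unfolding w_def by (simp only: norm_le_iff)
    have cf: "class_fun y" using norm_leD(1)[OF norm_le_nrm[OF y(1)]] .
    have com: "commutator v (class_diagonal J) B = (\<Sum>D\<in>conj_classes J. B (\<lambda>x. v x * D x) D - B D (\<lambda>x. D x * v x))"
      if v: "v \<in> carrier ZA" for v
      using bilinear_mult[OF True v] True
      by (simp add: commutator_def tensor_lact_def tensor_ract_def class_diagonal_def finite_tensor_def ZA_simps(2) sum_subtractf)
    have "B (\<lambda>x. u x * D x) D - B D (\<lambda>x. D x * u x) = B (\<lambda>x. w x * D x) D - B D (\<lambda>x. D x * w x)"
      if D: "D \<in> conj_classes J" for D
    proof -
      have Z: "D \<in> carrier ZA" by (rule classes_ZA[OF D])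
      have m: "(\<lambda>x. w x * D x) \<in> carrier ZA" "(\<lambda>x. y x * D x) \<in> carrier ZA"
        "(\<lambda>x. D x * w x) \<in> carrier ZA" "(\<lambda>x. D x * y x) \<in> carrier ZA"
        using ZA_mult_closed(1) Z w y(1) by blast+
      have "B (\<lambda>x. w x * D x + y x * D x) D = B (\<lambda>x. w x * D x) D + B (\<lambda>x. y x * D x) D"
        "B D (\<lambda>x. D x * w x + D x * y x) = B D (\<lambda>x. D x * w x) + B D (\<lambda>x. D x * y x)"
        by (rule bilinear_add[OF True m(1,2) Z], rule bilinear_add[OF True m(3,4) Z])
      moreover have "(\<lambda>x. w x * D x + y x * D x) = (\<lambda>x. u x * D x)" "(\<lambda>x. D x * w x + D x * y x) = (\<lambda>x. D x * u x)"
        by (auto simp: w_def algebra_simps)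
      moreover have "B (\<lambda>x. y x * D x) D = B D (\<lambda>x. D x * y x)"
      proof -
        have e: "(\<lambda>x. y x * D x) = (\<lambda>x. y (pt D) * D x)" by (rule class_fun_mult_class[OF cf y(2) D])
        have "B (\<lambda>x. y (pt D) * D x) D = y (pt D) * B D D" "B D (\<lambda>x. y (pt D) * D x) = y (pt D) * B D D"
          by (rule bilinear_scale[OF True Z Z])+
        then show ?thesis using e by (simp add: mult.commute[of "D _"])
      qed
      ultimately show ?thesis by simp
    qed
    then show ?thesis unfolding com[OF u] w_def[symmetric] com[OF w] by (rule sum.cong[OF refl])
  qed (simp add: commutator_def tensor_lact_def tensor_ract_def)
qed

end

subsection \<open>Characters of the abelian part\<close>

text \<open>The \<open>\<chi> k\<close> are the components of the regular representation, all of
  dimension 1, so there are \<open>box_card J\<close> of them. Their sum at \<open>inv y\<close>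
  times \<open>x\<close> is the character of the regular representation, which gives the
  orthogonality relation without classifying the characters of a finite abelian group.\<close>

lemma abelian_characters:
  assumes J: "finite J" "J \<subseteq> I" and ab: "\<And>j. j \<in> J \<Longrightarrow> comm_group (G j)"
  obtains \<chi> where "\<And>k. k < box_card J \<Longrightarrow> norm_le (\<chi> k) 1" "\<And>k. k < box_card J \<Longrightarrow> norm_le (\<lambda>x. cnj (\<chi> k x)) 1"
    "\<And>k. k < box_card J \<Longrightarrow> depends_on J (\<chi> k)"
    "\<And>x y. x \<in> carrier P \<Longrightarrow> y \<in> carrier P \<Longrightarrow>
      (\<Sum>k<box_card J. \<chi> k x * cnj (\<chi> k y)) = (if agree J x y then of_nat (box_card J) else 0)"
proof -
  let ?N = "box_card J"
  note r = unitary_repD[OF regular_rep[OF J]]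
  obtain ps where ps: "\<forall>(V, \<sigma>) \<in> set ps. \<sigma> \<in> irreps P T \<and> embeds ?N (regular J) V \<sigma>"
    "\<forall>x \<in> carrier P. mtrace (regular J x) = (\<Sum>p\<leftarrow>ps. mtrace (snd p x))"
    using complete_reducibility[OF regular_rep[OF J]] by blast
  define \<sigma> where "\<sigma> k = snd (ps ! k)" for k
  define V where "V k = fst (ps ! k)" for k
  have irr: "\<sigma> k \<in> irreps P T" and emb: "embeds ?N (regular J) (V k) (\<sigma> k)" if "k < length ps" for k
    using ps(1) nth_mem[OF that] unfolding \<sigma>_def V_def by (cases "ps ! k"; auto)+
  have tr: "mtrace (regular J x) = (\<Sum>k<length ps. mtrace (\<sigma> k x))" if "x \<in> carrier P" for x
    using ps(2)[rule_format, OF that] by (simp add: sum_list_sum_nth \<sigma>_def lessThan_atLeast0)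
  have \<sigma>_eq: "\<sigma> k x = mat_adjoint (V k) * (regular J x * V k)" if k: "k < length ps" and x: "x \<in> carrier P" for k x
  proof -
    have E: "V k \<in> carrier_mat ?N (rep_dim P (\<sigma> k))" "mat_adjoint (V k) * V k = 1\<^sub>m (rep_dim P (\<sigma> k))"
      "regular J x * V k = V k * \<sigma> k x" using emb[OF k] x unfolding embeds_def by blast+
    show ?thesis unfolding E(3) using isometry_cancel[OF E(1,2) unitary_repD(1)[OF irrepsD(1)[OF irr[OF k]] x]] by simp
  qed
  have reg_agree: "regular J x = regular J y" if "agree J x y" for x y
    unfolding regular_def using perm_agree[OF J that] by simp
  have comm: "agree J (x \<otimes>\<^bsub>P\<^esub> y) (y \<otimes>\<^bsub>P\<^esub> x)" if x: "x \<in> carrier P" and y: "y \<in> carrier P" for x y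
    unfolding agree_def
  proof
    fix j assume j: "j \<in> J"
    then have jI: "j \<in> I" using J by auto
    interpret Gj: comm_group "G j" by (rule ab[OF j])
    show "(x \<otimes>\<^bsub>P\<^esub> y) j = (y \<otimes>\<^bsub>P\<^esub> x) j"
      unfolding mult_component[OF jI] by (rule Gj.m_comm[OF P_component[OF x jI] P_component[OF y jI]])
  qed
  \<comment> \<open>The whole group need not be abelian. The component is a compression of
    \<open>regular J\<close>, so it sees only coordinates in \<open>J\<close>, where the factors
    commute.\<close>
  have dim: "rep_dim P (\<sigma> k) = 1" if k: "k < length ps" for k
  proof (rule irrep_commuting_dim[OF irr[OF k]])
    fix x y assume xy: "x \<in> carrier P" "y \<in> carrier P"
    note s = unitary_repD(4)[OF irrepsD(1)[OF irr[OF k]]]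
    have "\<sigma> k (x \<otimes>\<^bsub>P\<^esub> y) = \<sigma> k (y \<otimes>\<^bsub>P\<^esub> x)"
      unfolding \<sigma>_eq[OF k m_closed[OF xy]] \<sigma>_eq[OF k m_closed[OF xy(2,1)]] reg_agree[OF comm[OF xy]] ..
    then show "\<sigma> k x * \<sigma> k y = \<sigma> k y * \<sigma> k x" unfolding s[OF xy] s[OF xy(2,1)] .
  qed
  have rep: "unitary_rep P T 1 (\<sigma> k)" if "k < length ps" for k using irrepsD(1)[OF irr[OF that]] dim[OF that] by simp
  have len: "length ps = ?N"
  proof -
    have "complex_of_nat ?N = (\<Sum>k<length ps. mtrace (\<sigma> k \<one>\<^bsub>P\<^esub>))"
      using tr[OF one_closed] character_one[OF regular_rep[OF J]] by (simp only:)
    also have "\<dots> = (\<Sum>k<length ps. 1)" by (rule sum.cong[OF refl]) (use character_one[OF rep] in simp)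
    finally have "complex_of_nat ?N = of_nat (length ps)" by simp
    then show ?thesis by (simp only: of_nat_eq_iff)
  qed
  define \<chi> where "\<chi> k = char_fun (\<sigma> k)" for k
  have \<chi>_eq: "\<chi> k x = mtrace (\<sigma> k x)" if "x \<in> carrier P" for k x using that unfolding \<chi>_def char_fun_def by (simp only: if_True)
  show ?thesis
  proof (rule that[of \<chi>])
    fix k assume "k < ?N"
    then have k: "k < length ps" by (simp only: len)
    show "norm_le (\<chi> k) 1" unfolding \<chi>_def using norm_le_char_fun[OF rep[OF k]] by simp
    have "(\<lambda>x. cnj (\<chi> k x)) = char_fun (\<lambda>x. map_mat cnj (\<sigma> k x))"
    proof
      fix x
      show "cnj (\<chi> k x) = char_fun (\<lambda>x. map_mat cnj (\<sigma> k x)) x"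
        unfolding \<chi>_def char_fun_def using character_conjugate[OF rep[OF k], of x] by (cases "x \<in> carrier P") (simp_all only: if_True if_False complex_cnj_zero)
    qed
    then show "norm_le (\<lambda>x. cnj (\<chi> k x)) 1" using norm_le_char_fun[OF conjugate_rep[OF rep[OF k]]] by simp
    show "depends_on J (\<chi> k)"
      unfolding depends_on_def
    proof (intro ballI impI)
      fix x y assume x: "x \<in> carrier P" and y: "y \<in> carrier P" and a: "agree J x y"
      show "\<chi> k x = \<chi> k y" unfolding \<chi>_eq[OF x] \<chi>_eq[OF y] \<sigma>_eq[OF k x] \<sigma>_eq[OF k y] reg_agree[OF a] ..
    qed
  next
    fix x y assume x: "x \<in> carrier P" and y: "y \<in> carrier P"
    have iy: "inv\<^bsub>P\<^esub> y \<in> carrier P" by (rule inv_closed[OF y])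
    have "(\<Sum>k<?N. \<chi> k x * cnj (\<chi> k y)) = (\<Sum>k<length ps. mtrace (\<sigma> k (inv\<^bsub>P\<^esub> y \<otimes>\<^bsub>P\<^esub> x)))"
      unfolding len
    proof (rule sum.cong[OF refl])
      fix k assume "k \<in> {..<?N}"
      then have k: "k < length ps" by (simp add: len)
      note d = unitary_repD[OF rep[OF k]]
      have m1: "mtrace M = M $$ (0, 0)" if "M \<in> carrier_mat 1 1" for M using that by (simp add: mtrace_def)
      have "mtrace (\<sigma> k (inv\<^bsub>P\<^esub> y \<otimes>\<^bsub>P\<^esub> x)) = mtrace (\<sigma> k (inv\<^bsub>P\<^esub> y)) * mtrace (\<sigma> k x)"
        unfolding d(4)[OF iy x] m1[OF mult_carrier_mat[OF d(1)[OF iy] d(1)[OF x]]] m1[OF d(1)[OF iy]] m1[OF d(1)[OF x]]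
        by (subst index_mult_mat_sum[OF d(1)[OF iy] d(1)[OF x]]) simp_all
      also have "\<dots> = cnj (\<chi> k y) * \<chi> k x" unfolding character_inv[OF rep[OF k] y] \<chi>_eq[OF x] \<chi>_eq[OF y] ..
      finally show "\<chi> k x * cnj (\<chi> k y) = mtrace (\<sigma> k (inv\<^bsub>P\<^esub> y \<otimes>\<^bsub>P\<^esub> x))" by (simp add: mult.commute)
    qed
    also have "\<dots> = complex_of_real (kernel J x y)"
      unfolding tr[OF m_closed[OF iy x], symmetric] by (rule kernel_eq[OF J y x])
    also have "\<dots> = (if agree J x y then of_nat ?N else 0)"
      unfolding kernel_def[OF J] by (auto simp: agree_def)
    finally show "(\<Sum>k<?N. \<chi> k x * cnj (\<chi> k y)) = (if agree J x y then of_nat ?N else 0)" .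
  qed
qed

lemma conj_on_abelian:
  assumes J: "J \<subseteq> I" and ab: "\<And>j. j \<in> J \<Longrightarrow> comm_group (G j)" and x: "x \<in> carrier P" and y: "y \<in> carrier P"
  shows "conj_on J x y \<longleftrightarrow> agree J x y"
proof -
  have "conj_at j (x j) (y j) \<longleftrightarrow> x j = y j" if j: "j \<in> J" for j
  proof -
    have jI: "j \<in> I" using j J by auto
    interpret Gj: comm_group "G j" by (rule ab[OF j])
    have c: "x j \<in> C j" by (rule P_component[OF x jI])
    have "g \<otimes>\<^bsub>G j\<^esub> x j \<otimes>\<^bsub>G j\<^esub> inv\<^bsub>G j\<^esub> g = x j" if g: "g \<in> C j" for g
      using c g by (simp add: Gj.m_comm[OF g c] Gj.m_assoc)
    then have "conj_at j (x j) (y j) \<longleftrightarrow> (\<exists>g\<in>C j. y j = x j)" unfolding conj_at_def by auto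
    then show ?thesis using Gj.one_closed by auto
  qed
  then show ?thesis unfolding conj_on_def agree_def by blast
qed

text \<open>A class over \<open>N \<union> S\<close> is a class over \<open>N\<close> together with
  a point over \<open>S\<close>. The diagonal of the points over \<open>S\<close> is the average of
  the tensors formed by a character and its conjugate, each of projective norm at most 1. So the
  bound does not grow with \<open>S\<close>, unlike what the definition by class indicators
  suggests.\<close>

lemma class_diagonal_series:
  assumes N: "finite N" "N \<subseteq> I" and S: "finite S" "S \<subseteq> I" and ab: "\<And>j. j \<in> S \<Longrightarrow> comm_group (G j)"
  obtains a b where "tensor_series ZA a b (class_diagonal (N \<union> S))"
    "suminf (\<lambda>n. nrm ZA (a n) * nrm ZA (b n)) \<le> (\<Sum>D\<in>conj_classes N. nrm ZA D * nrm ZA D)"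
proof -
  let ?n = "box_card S" and ?J = "N \<union> S"
  have J: "finite ?J" "?J \<subseteq> I" using N S by auto
  have n: "?n > 0" by (rule box_card_pos[OF S])
  obtain \<chi> where \<chi>: "\<And>k. k < ?n \<Longrightarrow> norm_le (\<chi> k) 1" "\<And>k. k < ?n \<Longrightarrow> norm_le (\<lambda>x. cnj (\<chi> k x)) 1"
    "\<And>k. k < ?n \<Longrightarrow> depends_on S (\<chi> k)"
    "\<And>x y. x \<in> carrier P \<Longrightarrow> y \<in> carrier P \<Longrightarrow>
      (\<Sum>k<?n. \<chi> k x * cnj (\<chi> k y)) = (if agree S x y then of_nat ?n else 0)"
    by (rule abelian_characters[OF S ab]) (assumption, rule that)
  let ?S = "conj_classes N \<times> {..<?n}"
  \<comment> \<open>The weight of the average is put into the first factor only.\<close>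
  define f where "f = (\<lambda>(D, k) x. complex_of_real (1 / ?n) * (D x * \<chi> k x))"
  define g where "g = (\<lambda>(D, k) x. D x * cnj (\<chi> k x))"
  have fS: "finite ?S" using finite_classes[OF N] by simp
  have fg: "norm_le (f (D, k)) (1 / ?n * nrm ZA D)" "norm_le (g (D, k)) (nrm ZA D)"
    if D: "D \<in> conj_classes N" and k: "k < ?n" for D k
  proof -
    have d: "norm_le D (nrm ZA D)" by (rule norm_le_nrm[OF classes_ZA[OF N D]])
    show "norm_le (f (D, k)) (1 / ?n * nrm ZA D)"
      using norm_le_scale[OF norm_le_mult[OF d \<chi>(1)[OF k]], of "complex_of_real (1 / ?n)"] by (simp add: f_def norm_divide)
    show "norm_le (g (D, k)) (nrm ZA D)" using norm_le_mult[OF d \<chi>(2)[OF k]] by (simp add: g_def)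
  qed
  have dep: "depends_on ?J (f (D, k))" "depends_on ?J (g (D, k))" if D: "D \<in> conj_classes N" and k: "k < ?n" for D k
  proof -
    obtain t where t: "D = class_ind N t" using D unfolding conj_classes_def by blast
    have "depends_on ?J D" unfolding t using class_ind_depends by (rule depends_on_mono) simp
    moreover have "depends_on ?J (\<chi> k)" using \<chi>(3)[OF k] by (rule depends_on_mono) simp
    ultimately show "depends_on ?J (f (D, k))" "depends_on ?J (g (D, k))"
      unfolding depends_on_def f_def g_def prod.case by metis+
  qed
  have ZA: "f s \<in> carrier ZA" "g s \<in> carrier ZA" if "s \<in> ?S" for s using fg that by (auto simp: norm_le_iff)
  obtain a b where ab': "tensor_series ZA a b (finite_tensor ?S f g)"
    "suminf (\<lambda>n. nrm ZA (a n) * nrm ZA (b n)) = (\<Sum>s\<in>?S. nrm ZA (f s) * nrm ZA (g s))"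
    by (rule finite_tensor_series[OF fS ZA]) (assumption, assumption, rule that)
  have "(\<Sum>s\<in>?S. nrm ZA (f s) * nrm ZA (g s)) \<le> (\<Sum>s\<in>?S. (1 / ?n) * (nrm ZA (fst s) * nrm ZA (fst s)))"
  proof (rule sum_mono)
    fix s assume "s \<in> ?S"
    then obtain D k where s: "s = (D, k)" "D \<in> conj_classes N" "k < ?n" by auto
    have "nrm ZA (f s) * nrm ZA (g s) \<le> (1 / ?n * nrm ZA D) * nrm ZA D"
      using fg[OF s(2,3)] nrm_nonneg[OF classes_ZA[OF N s(2)]] nrm_nonneg unfolding s(1) norm_le_iff
      by (intro mult_mono) auto
    then show "nrm ZA (f s) * nrm ZA (g s) \<le> (1 / ?n) * (nrm ZA (fst s) * nrm ZA (fst s))" using s(1) by simp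
  qed
  also have "\<dots> = (\<Sum>D\<in>conj_classes N. \<Sum>k<?n. (1 / ?n) * (nrm ZA D * nrm ZA D))"
    unfolding sum.cartesian_product by (simp only: case_prod_unfold)
  also have "\<dots> = (\<Sum>D\<in>conj_classes N. nrm ZA D * nrm ZA D)" using n by simp
  finally have le: "(\<Sum>s\<in>?S. nrm ZA (f s) * nrm ZA (g s)) \<le> (\<Sum>D\<in>conj_classes N. nrm ZA D * nrm ZA D)" .
  have "finite_tensor ?S f g B = class_diagonal ?J B" for B
  proof (cases "B \<in> bounded_bilinear_forms ZA")
    case True
    have "finite_tensor ?S f g B = (\<Sum>s\<in>?S. \<Sum>D\<in>conj_classes ?J. \<Sum>E\<in>conj_classes ?J. f s (pt D) * g s (pt E) * B D E)"
      unfolding finite_tensor_def using True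
    proof (simp only: if_True, intro sum.cong refl)
      fix s assume "s \<in> ?S"
      then obtain D k where s: "s = (D, k)" "D \<in> conj_classes N" "k < ?n" by auto
      show "B (f s) (g s) = (\<Sum>D\<in>conj_classes ?J. \<Sum>E\<in>conj_classes ?J. f s (pt D) * g s (pt E) * B D E)"
        unfolding s(1) by (rule bilinear_expand[OF J True norm_leD(1)[OF fg(1)[OF s(2,3)]] dep(1)[OF s(2,3)]
          norm_leD(1)[OF fg(2)[OF s(2,3)]] dep(2)[OF s(2,3)]])
    qed
    also have "\<dots> = (\<Sum>D\<in>conj_classes ?J. \<Sum>E\<in>conj_classes ?J. \<Sum>s\<in>?S. f s (pt D) * g s (pt E) * B D E)"
      by (subst sum.swap, rule sum.cong[OF refl], rule sum.swap)
    \<comment> \<open>The coefficient at a pair \<open>D\<close>, \<open>E\<close> factorises into a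
      sum over classes of \<open>N\<close>, which tests conjugacy there, and a sum over characters,
      which tests equality on \<open>S\<close>.\<close>
    also have "\<dots> = (\<Sum>D\<in>conj_classes ?J. \<Sum>E\<in>conj_classes ?J. if E = D then B D D else 0)"
    proof (intro sum.cong refl)
      fix D E assume D: "D \<in> conj_classes ?J" and E: "E \<in> conj_classes ?J"
      note d = pt[OF J D] and e = pt[OF J E]
      have "(\<Sum>s\<in>?S. f s (pt D) * g s (pt E)) = (\<Sum>F\<in>conj_classes N. \<Sum>k<?n. (F (pt D) * F (pt E)) * (\<chi> k (pt D) * cnj (\<chi> k (pt E)) / ?n))"
        unfolding sum.cartesian_product f_def g_def by (intro sum.cong refl) (auto simp: field_simps)
      also have "\<dots> = (\<Sum>F\<in>conj_classes N. F (pt E) * F (pt D)) * ((\<Sum>k<?n. \<chi> k (pt D) * cnj (\<chi> k (pt E))) / ?n)"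
        by (simp only: sum_divide_distrib sum_product mult_ac)
      also have "(\<Sum>F\<in>conj_classes N. F (pt E) * F (pt D)) = class_ind N (pt D) (pt E)"
        using class_sum[OF N d(1), of "\<lambda>F. F (pt E)"] .
      also have "(\<Sum>k<?n. \<chi> k (pt D) * cnj (\<chi> k (pt E))) / ?n = (if agree S (pt D) (pt E) then 1 else 0)"
        using \<chi>(4)[OF d(1) e(1)] n by simp
      also have "class_ind N (pt D) (pt E) * (if agree S (pt D) (pt E) then 1 else 0) = (if E = D then 1 else 0)"
      proof -
        have cs: "conj_on S (pt D) (pt E) \<longleftrightarrow> agree S (pt D) (pt E)" by (rule conj_on_abelian[OF S(2) ab d(1) e(1)])
        have "E = D \<longleftrightarrow> conj_on ?J (pt D) (pt E)" using class_ind_eq[OF J(2) d(1) e(1)] d(2) e(2) by metis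
        also have "\<dots> \<longleftrightarrow> conj_on N (pt D) (pt E) \<and> agree S (pt D) (pt E)"
          using cs unfolding conj_on_def ball_Un by (simp only: )
        finally show ?thesis unfolding class_ind_def using e(1) by (simp only: simp_thms split: if_split) simp
      qed
      finally have "(\<Sum>s\<in>?S. f s (pt D) * g s (pt E)) = (if E = D then 1 else 0)" .
      then show "(\<Sum>s\<in>?S. f s (pt D) * g s (pt E) * B D E) = (if E = D then B D D else 0)"
        unfolding sum_distrib_right[symmetric] by simp
    qed
    also have "\<dots> = (\<Sum>D\<in>conj_classes ?J. B D D)"
      using finite_classes[OF J] by simp
    finally show ?thesis using True by (simp add: class_diagonal_def finite_tensor_def)
  qed (simp add: class_diagonal_def finite_tensor_def)
  then have "finite_tensor ?S f g = class_diagonal ?J" by (rule ext)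
  then show ?thesis using ab' le by (intro that[of a b]) simp_all
qed

text \<open>The net runs over the finite sets of abelian indices. Multiplication gives the unit
  exactly. An element close to a finite character sum, which depends on finitely many coordinates,
  has a small commutator once these coordinates are included.\<close>

theorem amenable_ZA:
  assumes fin_na: "finite nonabelian" shows "amenable ZA"
proof -
  let ?N = nonabelian and ?F = "finite_subsets_at_top (I - nonabelian)"
  let ?m = "\<lambda>S. class_diagonal (?N \<union> S)"
  define K where "K = (\<Sum>D\<in>conj_classes ?N. nrm ZA D * nrm ZA D)"
  have N: "finite ?N" "?N \<subseteq> I" using fin_na by auto
  have ser: "\<exists>a b. tensor_series ZA a b (?m S) \<and> suminf (\<lambda>n. nrm ZA (a n) * nrm ZA (b n)) \<le> K"
    if S: "finite S" "S \<subseteq> I - ?N" for S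
  proof -
    have S': "S \<subseteq> I" and ab: "\<And>j. j \<in> S \<Longrightarrow> comm_group (G j)" using S by auto
    show ?thesis unfolding K_def by (rule class_diagonal_series[OF N S(1) S' ab]) (assumption, blast)
  qed
  have K0: "K \<ge> 0" unfolding K_def using nrm_nonneg classes_ZA[OF N] by (intro sum_nonneg) simp
  have pt: "?m S \<in> proj_tensor ZA" and pn: "proj_norm ZA (?m S) \<le> K" if S: "finite S" "S \<subseteq> I - ?N" for S
    using ser[OF S] proj_norm_le(2) unfolding proj_tensor_def by (blast intro: order_trans)+
  have com: "((\<lambda>S. proj_norm ZA (commutator u (?m S))) \<longlongrightarrow> 0) ?F" if u: "u \<in> carrier ZA" for u
  proof (rule tendstoI)
    fix e :: real assume e: "e > 0"
    \<comment> \<open>The commutator with the remainder is at most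
      \<open>2 * \<epsilon> * K\<close>; the added 1 makes the estimate strict and covers
      \<open>K = 0\<close>.\<close>
    define \<epsilon> where "\<epsilon> = e / (2 * K + 1)"
    have \<epsilon>: "\<epsilon> > 0" using e K0 by (simp add: \<epsilon>_def)
    obtain F where F: "finite F" "F \<subseteq> dual" "norm_le (\<lambda>x. u x - partial u F x) \<epsilon>"
      by (rule norm_le_approx[OF norm_le_nrm[OF u] \<epsilon>])
    have "\<forall>c. \<exists>J. c \<in> F \<longrightarrow> finite J \<and> J \<subseteq> I \<and> depends_on J (ch c)"
    proof
      fix c
      show "\<exists>J. c \<in> F \<longrightarrow> finite J \<and> J \<subseteq> I \<and> depends_on J (ch c)"
      proof (cases "c \<in> F")
        case True
        then have "c \<in> dual" using F(2) by blast
        then obtain J where "finite J" "J \<subseteq> I" "depends_on J (ch c)"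
          by (rule ch_depends_on_finite) (rule that)
        then show ?thesis by (intro exI[of _ J] impI conjI)
      qed simp
    qed
    from choice[OF this] obtain j where j: "\<forall>c. c \<in> F \<longrightarrow> finite (j c) \<and> j c \<subseteq> I \<and> depends_on (j c) (ch c)" ..
    define J0 where "J0 = (\<Union>c\<in>F. j c)"
    have J0: "finite J0" "J0 \<subseteq> I" using F(1) j by (auto simp: J0_def)
    have y: "partial u F \<in> carrier ZA" using partial_norm_le[OF F(1,2)] by (simp only: norm_le_iff)
    have dep: "depends_on J0 (partial u F)"
      unfolding depends_on_def partial_def
    proof (intro ballI impI sum.cong refl)
      fix x y c assume xy: "x \<in> carrier P" "y \<in> carrier P" "agree J0 x y" and c: "c \<in> F"
      have "agree (j c) x y" using xy(3) by (rule agree_mono) (use c in \<open>auto simp: J0_def\<close>)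
      then have "ch c x = ch c y" using depends_onD[of "j c" "ch c"] j c xy by blast
      then show "coef u c * ch c x = coef u c * ch c y" by simp
    qed
    show "\<forall>\<^sub>F S in ?F. dist (proj_norm ZA (commutator u (?m S))) 0 < e"
      unfolding eventually_finite_subsets_at_top
    \<comment> \<open>Only abelian indices are added along the net; those of \<open>J0\<close> in
      the non-abelian part are present in every \<open>?m S\<close>.\<close>
    proof (intro exI[of _ "J0 - ?N"] conjI allI impI)
      fix S assume S: "finite S \<and> J0 - ?N \<subseteq> S \<and> S \<subseteq> I - ?N"
      have J: "finite (?N \<union> S)" "?N \<union> S \<subseteq> I" using S N by auto
      have "J0 \<subseteq> ?N \<union> S" using S by blast
      then have d: "depends_on (?N \<union> S) (partial u F)" by (rule depends_on_mono[OF dep])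
      let ?w = "\<lambda>x. u x - partial u F x"
      have w: "?w \<in> carrier ZA" "nrm ZA ?w \<le> \<epsilon>" using F(3) by (simp_all only: norm_le_iff)
      obtain a b where ab: "tensor_series ZA a b (?m S)" "suminf (\<lambda>n. nrm ZA (a n) * nrm ZA (b n)) \<le> K"
        using ser[of S] S by blast
      obtain a' b' where ab': "tensor_series ZA a' b' (commutator ?w (?m S))"
        "suminf (\<lambda>n. nrm ZA (a' n) * nrm ZA (b' n)) \<le> 2 * nrm ZA ?w * suminf (\<lambda>n. nrm ZA (a n) * nrm ZA (b n))"
        by (rule commutator_series[OF ab(1) w(1)])
      have eq: "commutator u (?m S) = commutator ?w (?m S)" by (rule commutator_class_diagonal[OF J u y d])
      have "proj_norm ZA (commutator u (?m S)) \<le> 2 * nrm ZA ?w * suminf (\<lambda>n. nrm ZA (a n) * nrm ZA (b n))"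
        unfolding eq by (rule order_trans[OF proj_norm_le(2)[OF ab'(1)] ab'(2)])
      also have "\<dots> \<le> 2 * nrm ZA ?w * K" using ab(2) nrm_nonneg[OF w(1)] by (intro mult_left_mono) auto
      also have "\<dots> \<le> 2 * \<epsilon> * K" using w(2) K0 by (intro mult_right_mono) auto
      also have "\<dots> < \<epsilon> * (2 * K + 1)" using \<epsilon> by (simp add: algebra_simps)
      also have "\<dots> = e" using K0 by (simp add: \<epsilon>_def)
      finally have "proj_norm ZA (commutator u (?m S)) < e" .
      moreover have "proj_norm ZA (commutator u (?m S)) \<ge> 0" unfolding eq by (rule proj_norm_le(1)[OF ab'(1)])
      ultimately show "dist (proj_norm ZA (commutator u (?m S))) 0 < e" by simp
    qed (use J0 in auto)
  qed
  have mult: "nrm ZA (u \<otimes>\<^bsub>ZA\<^esub> tensor_mult ZA (?m S) \<ominus>\<^bsub>ZA\<^esub> u) = 0"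
    if u: "u \<in> carrier ZA" and S: "finite S" "S \<subseteq> I - ?N" for u S
  proof -
    have J: "finite (?N \<union> S)" "?N \<union> S \<subseteq> I" using S N by auto
    note tm = tensor_mult_eq[OF pt[OF S]]
    have "tensor_mult ZA (?m S) = (\<lambda>x. if x \<in> carrier P then 1 else 0)"
      unfolding tm(2) class_diagonal_ev2[OF J] ..
    moreover have "(\<lambda>x. u x * (if x \<in> carrier P then 1 else 0)) = u"
      using class_funD(2)[OF norm_leD(1)[OF norm_le_nrm[OF u]]] by (intro ext) (simp only: split: if_split, auto)
    ultimately have "u \<otimes>\<^bsub>ZA\<^esub> tensor_mult ZA (?m S) = u" unfolding ZA_simps(2) by simp
    then have "u \<otimes>\<^bsub>ZA\<^esub> tensor_mult ZA (?m S) \<ominus>\<^bsub>ZA\<^esub> u = (\<lambda>x. 0)" using ZA_minus[OF u u] by simp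
    then show ?thesis using nrm_zero by simp
  qed
  have "bounded_approximate_diagonal ZA (filtermap ?m ?F)"
    unfolding bounded_approximate_diagonal_def
  proof (intro conjI ballI exI[of _ K])
    show "filtermap ?m ?F \<noteq> bot" by (simp add: filtermap_bot_iff)
    show "\<forall>\<^sub>F m in filtermap ?m ?F. m \<in> proj_tensor ZA \<and> proj_norm ZA m \<le> K"
      unfolding eventually_filtermap using pt pn by (intro eventually_finite_subsets_at_top_weakI) blast
    fix u assume u: "u \<in> carrier ZA"
    show "((\<lambda>m. proj_norm ZA (\<lambda>B. tensor_lact ZA u m B - tensor_ract ZA m u B)) \<longlongrightarrow> 0) (filtermap ?m ?F)"
      unfolding filterlim_filtermap commutator_def[symmetric] by (rule com[OF u])
    show "((\<lambda>m. nrm ZA (u \<otimes>\<^bsub>ZA\<^esub> tensor_mult ZA m \<ominus>\<^bsub>ZA\<^esub> u)) \<longlongrightarrow> 0) (filtermap ?m ?F)"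
      unfolding filterlim_filtermap
      by (rule tendsto_eventually) (intro eventually_finite_subsets_at_top_weakI mult[OF u])
  qed
  then show ?thesis unfolding amenable_def by blast
qed

end

theorem theorem4p5:
  fixes I :: "'i set" and G :: "'i \<Rightarrow> ('a, 'm) monoid_scheme"
  assumes "\<And>i. i \<in> I \<Longrightarrow> group (G i)"
    and "\<And>i. i \<in> I \<Longrightarrow> finite (carrier (G i))"
  shows "amenable (central_fourier_algebra (product_group I G) (product_group_topology I G))
           \<longleftrightarrow> finite {i \<in> I. \<not> comm_group (G i)}"
proof -
  interpret finite_product_grp I G by (rule finite_product_grp.intro) (fact assms)+
  show ?thesis using not_amenable amenable_ZA by blast
qed

end
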